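(* Let $\mu>0$, $\mu+\lambda\ge0$, $\gamma>1$. Assume that $(\rho,\vec u,P,\vec B)$ is a 2D radially symmetric strong solution of the free boundary problem consisting of $$\begin{cases}\rho_t+(\rho u)_r+\frac{\rho u}{r}=0,\\ \rho(u_t+uu_r)+P_r=(2\mu+\lambda)\left(u_r+\frac ur\right)_r-B\left(B_r+\frac Br\right),\\ P_t+uP_r+\gamma P\left(u_r+\frac ur\right)=0,\\ B_t+(uB)_r=0,\end{cases}\qquad 0\le r\le a(t),$$ with radially symmetric initial data $$\rho_0(\vec x)=\rho_0(r),\quad\vec u_0(\vec x)=\frac{\vec x}{r}u_0(r),\quad P_0(\vec x)=P_0(r),\quad\vec B_0(\vec x)=\frac{(-x_2,x_1)}{r}B_0(r),$$ $\rho_0,P_0\ge0$, and the boundary condition $$u(0,t)=B(0,t)=0,\qquad\left(\frac{B^2}{2}+P-(2\mu+\lambda)\left(u_r+\frac ur\right)\right)(a(t),t)=0,$$ where $a(t)$ satisfies $$a'(t)=u(a(t),t),\qquad a(0)=a_0>0,$$ corresponding to the free surface of $\Omega_t=\{x:0\le|x|\le a(t)\}$. If there exists a constant $r_0\in(0,a(0))$ such that $$\rho_0(r)=0,\ P_0(r)=0\quad\text{for }r\in[0,r_0],\qquad\text{and}\qquad\int_0^{r_0}B_0(r)\,dr\ne0,$$ then the strong solution $(\rho,\vec u,P,\vec B)$ will blow up in finite time. Moreover, for any constant $\alpha\in(1,2)$, the lifespan $T$ of the solution is bounded by $$T\le\exp\left(E_0\left(\frac{\left|\int_0^{r_0}B_0(r)\,dr\right|^2(2-\alpha)^2}{2\sqrt{2\mu+\lambda}\,C\left[\frac{\alpha}{\sqrt{2\alpha-2}}+\frac{\alpha+1}{\sqrt{2\alpha}}\right]}\right)^{-2}\right)-1,$$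 where $C$ is a positive constant depending on $a_0,E_0,\mu,\lambda$.
   Context: Radial symmetry means $\rho(\vec x,t)=\rho(r,t)$, $\vec u(\vec x,t)=\frac{\vec x}{r}u(r,t)$, $P(\vec x,t)=P(r,t)$, $\vec B(\vec x,t)=\frac{(-x_2,x_1)}{r}B(r,t)$, $r=|\vec x|$. A strong solution on $[0,T]$ satisfies the equations a.e. and has, for some constant $q>2$, the regularity (with spatial norms over the domain $\Omega_t$) $(\rho,P,\vec B)\in C([0,T];W^{1,q})$, $(\rho_t,P_t,\vec B_t)\in C([0,T];L^q)$, $\vec u\in C([0,T];H^2)\cap L^2(0,T;W^{2,q})$, $\vec u_t\in L^2(0,T;H^1)$, $\sqrt\rho\,\vec u_t\in L^\infty(0,T;L^2)$. The lifespan is the maximal time of existence of the strong solution; blow-up in finite time means it is finite. Existence of the local strong solution is assumed, not asserted. The initial energy (neglecting the factor $2\pi$) is $$E_0=\int_0^{a_0}\left(\frac12\rho_0u_0^2r+\frac1{\gamma-1}P_0r+\frac12B_0^2r\right)dr.$$ *)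

theory Defs
  imports "HOL-Analysis.Analysis"
begin

section \<open>Weak derivatives and Lebesgue norms\<close>

definition test_function :: "'a::euclidean_space set \<Rightarrow> ('a \<Rightarrow> real) \<Rightarrow> bool" where
  "test_function U \<phi> \<longleftrightarrow>
     (\<forall>x. \<phi> differentiable (at x)) \<and>
     (\<forall>v. continuous_on UNIV (\<lambda>x. frechet_derivative \<phi> (at x) v)) \<and>
     (\<exists>K. compact K \<and> K \<subseteq> U \<and> (\<forall>x. x \<notin> K \<longrightarrow> \<phi> x = 0))"

definition locally_integrable :: "'a::euclidean_space set \<Rightarrow> ('a \<Rightarrow> 'b::euclidean_space) \<Rightarrow> bool" where
  "locally_integrable U f \<longleftrightarrow> (\<forall>K. compact K \<longrightarrow> K \<subseteq> U \<longrightarrow> set_integrable lebesgue K f)"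

text \<open>\<open>g\<close> is a weak derivative of \<open>f\<close> in direction \<open>v\<close> on the open set \<open>U\<close>. First-order weak
  derivatives are tested with compactly supported \<open>C\<^sup>1\<close> functions (Gilbarg--Trudinger); higher ones
  are obtained by iteration.\<close>

definition weak_deriv ::
    "'a::euclidean_space set \<Rightarrow> 'a \<Rightarrow> ('a \<Rightarrow> 'b::euclidean_space) \<Rightarrow> ('a \<Rightarrow> 'b) \<Rightarrow> bool" where
  "weak_deriv U v f g \<longleftrightarrow>
     locally_integrable U f \<and> locally_integrable U g \<and>
     (\<forall>\<phi>. test_function U \<phi> \<longrightarrow>
        (LINT x:U|lebesgue. frechet_derivative \<phi> (at x) v *\<^sub>R f x) =
        - (LINT x:U|lebesgue. \<phi> x *\<^sub>R g x))"

definition in_Lp :: "real \<Rightarrow> 'a::euclidean_space set \<Rightarrow> ('a \<Rightarrow> 'b::euclidean_space) \<Rightarrow> bool" where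
  "in_Lp p U f \<longleftrightarrow>
     f \<in> borel_measurable (lebesgue_on U) \<and> integrable (lebesgue_on U) (\<lambda>x. norm (f x) powr p)"

text \<open>Only meaningful for functions satisfying \<open>in_Lp\<close>.\<close>

definition Lp_norm :: "real \<Rightarrow> 'a::euclidean_space set \<Rightarrow> ('a \<Rightarrow> 'b::euclidean_space) \<Rightarrow> real" where
  "Lp_norm p U f = (LINT x|lebesgue_on U. norm (f x) powr p) powr (1 / p)"

section \<open>Function spaces in time over a moving domain\<close>

text \<open>A field is a map \<open>f\<close> with \<open>f t x\<close> its value at time \<open>t\<close> and position \<open>x \<in> \<Omega> t\<close>. Space-time
  points are ordered as \<open>(x, t)\<close>.\<close>

definition space_time :: "real \<Rightarrow> (real \<Rightarrow> 'a set) \<Rightarrow> ('a \<times> real) set" where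
  "space_time T \<Omega> = {(x, t). 0 < t \<and> t < T \<and> x \<in> \<Omega> t}"

text \<open>\<open>C([0,T]; L\<^sup>p(\<Omega> t))\<close> and \<open>C([0,T]; W\<^bsup>k,p\<^esup>(\<Omega> t))\<close>. As the domain moves, \<open>f s\<close> and \<open>f t\<close> are
  compared in \<open>L\<^sup>p\<close> of the whole space after extending them, and each of their weak derivatives,
  by zero.\<close>

definition C_Lp :: "real \<Rightarrow> real \<Rightarrow> (real \<Rightarrow> 'a::euclidean_space set) \<Rightarrow>
    (real \<Rightarrow> 'a \<Rightarrow> 'b::euclidean_space) \<Rightarrow> bool" where
  "C_Lp p T \<Omega> f \<longleftrightarrow>
     (\<forall>t\<in>{0..T}. in_Lp p (\<Omega> t) (f t)) \<and>
     (\<forall>t\<in>{0..T}.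
        ((\<lambda>s. Lp_norm p UNIV
                (\<lambda>x. indicator (\<Omega> s) x *\<^sub>R f s x - indicator (\<Omega> t) x *\<^sub>R f t x)) \<longlongrightarrow> 0)
          (at t within {0..T}))"

primrec C_Sobolev :: "nat \<Rightarrow> real \<Rightarrow> real \<Rightarrow> (real \<Rightarrow> 'a::euclidean_space set) \<Rightarrow>
    (real \<Rightarrow> 'a \<Rightarrow> 'b::euclidean_space) \<Rightarrow> bool" where
  "C_Sobolev 0 p T \<Omega> f \<longleftrightarrow> C_Lp p T \<Omega> f"
| "C_Sobolev (Suc k) p T \<Omega> f \<longleftrightarrow>
     C_Lp p T \<Omega> f \<and>
     (\<forall>i\<in>Basis. \<exists>g. (\<forall>t\<in>{0..T}. weak_deriv (\<Omega> t) i (f t) (g t)) \<and> C_Sobolev k p T \<Omega> g)"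

definition space_time_measurable :: "real \<Rightarrow> (real \<Rightarrow> 'a::euclidean_space set) \<Rightarrow>
    (real \<Rightarrow> 'a \<Rightarrow> 'b::euclidean_space) \<Rightarrow> bool" where
  "space_time_measurable T \<Omega> f \<longleftrightarrow>
     (\<lambda>(x, t). f t x) \<in> borel_measurable (lebesgue_on (space_time T \<Omega>))"

text \<open>\<open>L\<^sup>s(0,T; L\<^sup>p(\<Omega> t))\<close> and \<open>L\<^sup>s(0,T; W\<^bsup>k,p\<^esup>(\<Omega> t))\<close> for finite \<open>s\<close>\<close>

definition L_Lp :: "real \<Rightarrow> real \<Rightarrow> real \<Rightarrow> (real \<Rightarrow> 'a::euclidean_space set) \<Rightarrow>
    (real \<Rightarrow> 'a \<Rightarrow> 'b::euclidean_space) \<Rightarrow> bool" where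
  "L_Lp s p T \<Omega> f \<longleftrightarrow>
     space_time_measurable T \<Omega> f \<and>
     (AE t in lebesgue_on {0..T}. in_Lp p (\<Omega> t) (f t)) \<and>
     in_Lp s {0..T} (\<lambda>t. Lp_norm p (\<Omega> t) (f t))"

primrec L_Sobolev :: "nat \<Rightarrow> real \<Rightarrow> real \<Rightarrow> real \<Rightarrow> (real \<Rightarrow> 'a::euclidean_space set) \<Rightarrow>
    (real \<Rightarrow> 'a \<Rightarrow> 'b::euclidean_space) \<Rightarrow> bool" where
  "L_Sobolev 0 s p T \<Omega> f \<longleftrightarrow> L_Lp s p T \<Omega> f"
| "L_Sobolev (Suc k) s p T \<Omega> f \<longleftrightarrow>
     L_Lp s p T \<Omega> f \<and>
     (\<forall>i\<in>Basis. \<exists>g. (AE t in lebesgue_on {0..T}. weak_deriv (\<Omega> t) i (f t) (g t)) \<and>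
        L_Sobolev k s p T \<Omega> g)"

text \<open>\<open>L\<^sup>\<infinity>(0,T; L\<^sup>p(\<Omega> t))\<close>\<close>

definition Linf_Lp :: "real \<Rightarrow> real \<Rightarrow> (real \<Rightarrow> 'a::euclidean_space set) \<Rightarrow>
    (real \<Rightarrow> 'a \<Rightarrow> 'b::euclidean_space) \<Rightarrow> bool" where
  "Linf_Lp p T \<Omega> f \<longleftrightarrow>
     space_time_measurable T \<Omega> f \<and>
     (AE t in lebesgue_on {0..T}. in_Lp p (\<Omega> t) (f t)) \<and>
     (\<exists>M. AE t in lebesgue_on {0..T}. Lp_norm p (\<Omega> t) (f t) \<le> M)"

section \<open>Radially symmetric fields\<close>

text \<open>Profiles are written \<open>f r t\<close>. The value of the two vector fields at \<open>x = 0\<close> is \<open>0\<close>.\<close>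

definition radial_scalar :: "(real \<Rightarrow> real \<Rightarrow> real) \<Rightarrow> real \<Rightarrow> real ^ 2 \<Rightarrow> real" where
  "radial_scalar f t x = f (norm x) t"

definition radial_vector :: "(real \<Rightarrow> real \<Rightarrow> real) \<Rightarrow> real \<Rightarrow> real ^ 2 \<Rightarrow> real ^ 2" where
  "radial_vector f t x = (f (norm x) t / norm x) *\<^sub>R x"

definition azimuthal_vector :: "(real \<Rightarrow> real \<Rightarrow> real) \<Rightarrow> real \<Rightarrow> real ^ 2 \<Rightarrow> real ^ 2" where
  "azimuthal_vector f t x = (f (norm x) t / norm x) *\<^sub>R vector [- x $ 2, x $ 1]"

text \<open>The interior of the fluid domain, and the space-time region of the radial variables.\<close>

definition fluid_domain :: "(real \<Rightarrow> real) \<Rightarrow> real \<Rightarrow> (real ^ 2) set" where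
  "fluid_domain a t = ball 0 (a t)"

definition radial_region :: "real \<Rightarrow> (real \<Rightarrow> real) \<Rightarrow> (real \<times> real) set" where
  "radial_region T a = space_time T (\<lambda>t. {0<..<a t})"

definition weak_dr :: "(real \<times> real) set \<Rightarrow> (real \<Rightarrow> real \<Rightarrow> real) \<Rightarrow> (real \<Rightarrow> real \<Rightarrow> real) \<Rightarrow> bool" where
  "weak_dr Q f g \<longleftrightarrow> weak_deriv Q (1, 0) (\<lambda>(r, t). f r t) (\<lambda>(r, t). g r t)"

definition weak_dt :: "(real \<times> real) set \<Rightarrow> (real \<Rightarrow> real \<Rightarrow> real) \<Rightarrow> (real \<Rightarrow> real \<Rightarrow> real) \<Rightarrow> bool" where
  "weak_dt Q f g \<longleftrightarrow> weak_deriv Q (0, 1) (\<lambda>(r, t). f r t) (\<lambda>(r, t). g r t)"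

section \<open>The free boundary problem\<close>

text \<open>The equations hold almost everywhere, subscripts being weak derivatives in \<open>(r, t)\<close>.
  Here \<open>\<rho>t, ut, Pt, Bt\<close> are time derivatives; \<open>\<rho>u_r\<close>, \<open>uB_r\<close> and \<open>div_r\<close> stand for
  \<open>(\<rho>u)\<^sub>r\<close>, \<open>(uB)\<^sub>r\<close> and \<open>(u\<^sub>r + u/r)\<^sub>r\<close>.\<close>

definition mhd_equations :: "real \<Rightarrow> real \<Rightarrow> real \<Rightarrow> real \<Rightarrow> (real \<Rightarrow> real) \<Rightarrow>
    (real \<Rightarrow> real \<Rightarrow> real) \<Rightarrow> (real \<Rightarrow> real \<Rightarrow> real) \<Rightarrow> (real \<Rightarrow> real \<Rightarrow> real) \<Rightarrow> (real \<Rightarrow> real \<Rightarrow> real) \<Rightarrow>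
    (real \<Rightarrow> real \<Rightarrow> real) \<Rightarrow> (real \<Rightarrow> real \<Rightarrow> real) \<Rightarrow> (real \<Rightarrow> real \<Rightarrow> real) \<Rightarrow> (real \<Rightarrow> real \<Rightarrow> real) \<Rightarrow> bool" where
  "mhd_equations \<mu> lam \<gamma> T a \<rho> u P B \<rho>t ut Pt Bt \<longleftrightarrow>
     (let Q = radial_region T a in
      weak_dt Q \<rho> \<rho>t \<and> weak_dt Q u ut \<and> weak_dt Q P Pt \<and> weak_dt Q B Bt \<and>
      (\<exists>\<rho>u_r u_r div_r P_r B_r uB_r.
         weak_dr Q (\<lambda>r t. \<rho> r t * u r t) \<rho>u_r \<and>
         weak_dr Q u u_r \<and>
         weak_dr Q (\<lambda>r t. u_r r t + u r t / r) div_r \<and>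
         weak_dr Q P P_r \<and>
         weak_dr Q B B_r \<and>
         weak_dr Q (\<lambda>r t. u r t * B r t) uB_r \<and>
         (AE (r, t) in lebesgue_on Q.
            \<rho>t r t + \<rho>u_r r t + \<rho> r t * u r t / r = 0 \<and>
            \<rho> r t * (ut r t + u r t * u_r r t) + P_r r t =
              (2 * \<mu> + lam) * div_r r t - B r t * (B_r r t + B r t / r) \<and>
            Pt r t + u r t * P_r r t + \<gamma> * P r t * (u_r r t + u r t / r) = 0 \<and>
            Bt r t + uB_r r t = 0)))"

text \<open>At the free surface \<open>u\<^sub>r\<close> is the one-sided derivative of \<open>u(\<cdot>, t)\<close> at \<open>r = a t\<close>; it exists
  since a radial \<open>H\<^sup>2\<close> profile is \<open>C\<^sup>1\<close> away from the origin, up to \<open>r = a t\<close>.\<close>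

definition boundary_conditions :: "real \<Rightarrow> real \<Rightarrow> real \<Rightarrow> (real \<Rightarrow> real) \<Rightarrow>
    (real \<Rightarrow> real \<Rightarrow> real) \<Rightarrow> (real \<Rightarrow> real \<Rightarrow> real) \<Rightarrow> (real \<Rightarrow> real \<Rightarrow> real) \<Rightarrow> bool" where
  "boundary_conditions \<mu> lam T a u P B \<longleftrightarrow>
     (\<forall>t\<in>{0..T}.
        u 0 t = 0 \<and> B 0 t = 0 \<and>
        (\<exists>u_r. ((\<lambda>r. u r t) has_real_derivative u_r) (at (a t) within {0..a t}) \<and>
           (B (a t) t)\<^sup>2 / 2 + P (a t) t - (2 * \<mu> + lam) * (u_r + u (a t) t / a t) = 0) \<and>
        (a has_real_derivative u (a t) t) (at t within {0..T}))"

definition strong_regularity :: "real \<Rightarrow> real \<Rightarrow> (real \<Rightarrow> real) \<Rightarrow>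
    (real \<Rightarrow> real \<Rightarrow> real) \<Rightarrow> (real \<Rightarrow> real \<Rightarrow> real) \<Rightarrow> (real \<Rightarrow> real \<Rightarrow> real) \<Rightarrow> (real \<Rightarrow> real \<Rightarrow> real) \<Rightarrow>
    (real \<Rightarrow> real \<Rightarrow> real) \<Rightarrow> (real \<Rightarrow> real \<Rightarrow> real) \<Rightarrow> (real \<Rightarrow> real \<Rightarrow> real) \<Rightarrow> (real \<Rightarrow> real \<Rightarrow> real) \<Rightarrow> bool" where
  "strong_regularity q T a \<rho> u P B \<rho>t ut Pt Bt \<longleftrightarrow>
     (let \<Omega> = fluid_domain a in
      C_Sobolev 1 q T \<Omega> (radial_scalar \<rho>) \<and>
      C_Sobolev 1 q T \<Omega> (radial_scalar P) \<and>
      C_Sobolev 1 q T \<Omega> (azimuthal_vector B) \<and>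
      C_Lp q T \<Omega> (radial_scalar \<rho>t) \<and>
      C_Lp q T \<Omega> (radial_scalar Pt) \<and>
      C_Lp q T \<Omega> (azimuthal_vector Bt) \<and>
      C_Sobolev 2 2 T \<Omega> (radial_vector u) \<and>
      L_Sobolev 2 2 q T \<Omega> (radial_vector u) \<and>
      L_Sobolev 1 2 2 T \<Omega> (radial_vector ut) \<and>
      Linf_Lp 2 T \<Omega> (\<lambda>t x. sqrt (radial_scalar \<rho> t x) *\<^sub>R radial_vector ut t x))"

text \<open>All fields are given by their continuous representatives on the closed region, which exist by
  the embeddings \<open>W\<^bsup>1,q\<^esup> \<subseteq> C\<close> (\<open>q > 2\<close>) and \<open>H\<^sup>2 \<subseteq> C\<close> in dimension two; this is what gives
  point values a meaning.\<close>

definition continuous_profile :: "real \<Rightarrow> (real \<Rightarrow> real) \<Rightarrow> (real \<Rightarrow> real \<Rightarrow> real) \<Rightarrow> bool" where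
  "continuous_profile T a f \<longleftrightarrow>
     continuous_on {(r, t). 0 \<le> t \<and> t \<le> T \<and> 0 \<le> r \<and> r \<le> a t} (\<lambda>(r, t). f r t)"

definition strong_solution :: "real \<Rightarrow> real \<Rightarrow> real \<Rightarrow> real \<Rightarrow> (real \<Rightarrow> real) \<Rightarrow>
    (real \<Rightarrow> real \<Rightarrow> real) \<Rightarrow> (real \<Rightarrow> real \<Rightarrow> real) \<Rightarrow> (real \<Rightarrow> real \<Rightarrow> real) \<Rightarrow> (real \<Rightarrow> real \<Rightarrow> real) \<Rightarrow> bool" where
  "strong_solution \<mu> lam \<gamma> T a \<rho> u P B \<longleftrightarrow>
     0 < T \<and> (\<forall>t\<in>{0..T}. 0 < a t) \<and>
     continuous_profile T a \<rho> \<and> continuous_profile T a u \<and>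
     continuous_profile T a P \<and> continuous_profile T a B \<and>
     boundary_conditions \<mu> lam T a u P B \<and>
     (\<exists>q>2. \<exists>\<rho>t ut Pt Bt.
        mhd_equations \<mu> lam \<gamma> T a \<rho> u P B \<rho>t ut Pt Bt \<and>
        strong_regularity q T a \<rho> u P B \<rho>t ut Pt Bt)"

definition initial_condition :: "real \<Rightarrow>
    (real \<Rightarrow> real) \<Rightarrow> (real \<Rightarrow> real) \<Rightarrow> (real \<Rightarrow> real) \<Rightarrow> (real \<Rightarrow> real) \<Rightarrow> (real \<Rightarrow> real) \<Rightarrow>
    (real \<Rightarrow> real \<Rightarrow> real) \<Rightarrow> (real \<Rightarrow> real \<Rightarrow> real) \<Rightarrow> (real \<Rightarrow> real \<Rightarrow> real) \<Rightarrow> (real \<Rightarrow> real \<Rightarrow> real) \<Rightarrow> bool" where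
  "initial_condition a0 \<rho>0 u0 P0 B0 a \<rho> u P B \<longleftrightarrow>
     a 0 = a0 \<and>
     (\<forall>r\<in>{0..a0}. \<rho> r 0 = \<rho>0 r \<and> u r 0 = u0 r \<and> P r 0 = P0 r \<and> B r 0 = B0 r)"

text \<open>The maximal time up to which a strong solution given on \<open>[0,T0]\<close> can be continued as a strong
  solution; blow-up in finite time means that it is finite.\<close>

definition lifespan :: "real \<Rightarrow> real \<Rightarrow> real \<Rightarrow> real \<Rightarrow> (real \<Rightarrow> real) \<Rightarrow>
    (real \<Rightarrow> real \<Rightarrow> real) \<Rightarrow> (real \<Rightarrow> real \<Rightarrow> real) \<Rightarrow> (real \<Rightarrow> real \<Rightarrow> real) \<Rightarrow> (real \<Rightarrow> real \<Rightarrow> real) \<Rightarrow> ereal" where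
  "lifespan \<mu> lam \<gamma> T0 a \<rho> u P B =
     Sup {ereal T | T. T0 \<le> T \<and>
       (\<exists>a' \<rho>' u' P' B'. strong_solution \<mu> lam \<gamma> T a' \<rho>' u' P' B' \<and>
          (\<forall>t\<in>{0..T0}. a' t = a t \<and>
             (\<forall>r\<in>{0..a t}. \<rho>' r t = \<rho> r t \<and> u' r t = u r t \<and> P' r t = P r t \<and> B' r t = B r t)))}"

definition initial_energy :: "real \<Rightarrow> real \<Rightarrow>
    (real \<Rightarrow> real) \<Rightarrow> (real \<Rightarrow> real) \<Rightarrow> (real \<Rightarrow> real) \<Rightarrow> (real \<Rightarrow> real) \<Rightarrow> real" where
  "initial_energy \<gamma> a0 \<rho>0 u0 P0 B0 =
     integral {0..a0} (\<lambda>r. 1 / 2 * \<rho>0 r * (u0 r)\<^sup>2 * r + 1 / (\<gamma> - 1) * P0 r * r + 1 / 2 * (B0 r)\<^sup>2 * r)"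

end

theory Submission
  imports Defs "HOL-Complex_Analysis.Great_Picard"
begin

text \<open>
  The argument concerns the vacuum core. Let \<open>R\<close> be the trajectory of the velocity that starts at \<open>r\<^sub>0\<close>. The
  induction equation \<open>B\<^sub>t + (uB)\<^sub>r = 0\<close> is a conservation law, so the flux \<open>I\<close>, the integral of \<open>B\<close> over
  \<open>[0, R(t)]\<close>, does not depend on time (\<open>flux_conserved\<close>); density and pressure remain zero there
  (\<open>sign_transported_vacuum\<close>). With \<open>D = u\<^sub>r + u/r\<close>, \<open>\<nu> = 2\<mu> + \<lambda>\<close> and the stress \<open>\<sigma> = P + B\<^sup>2/2 - \<nu> D\<close>, the
  momentum equation in the core reduces to \<open>\<sigma>\<^sub>r = - B\<^sup>2/r\<close>. Testing it with the weight
  \<open>r\<^sup>\<alpha> (q - r)\<close> bounds a weighted integral of \<open>B\<^sup>2\<close>, hence \<open>I\<^sup>2\<close>, by \<open>\<nu> R(t)\<close> times the square root of the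
  dissipation rate \<open>\<integral> r D\<^sup>2 dr\<close> (\<open>vacuum_inequality\<close>): a nonzero flux forces dissipation.

  The energy law bounds the total dissipation by the initial energy. As the velocity is bounded by
  the square root of the dissipation rate (\<open>velocity_le_diss\<close>), it also gives
  \<open>R(t)\<^sup>2 \<le> const (1 + t)\<close> (\<open>trajectory_growth\<close>). Together, the dissipation rate is at least a constant
  over \<open>1 + t\<close>, and integrating in time bounds \<open>ln (1 + T)\<close> (\<open>existence_time_bound\<close>).

  Most of the work makes these steps legitimate for solutions whose derivatives are only weak and
  whose equations hold almost everywhere. Three devices are used. On almost every line parallel to
  an axis, a function with a weak derivative is absolutely continuous (\<open>wdr_slices\<close>), which
  gives product and chain rules and allows one-dimensional arguments on almost every time slice.
  A cutoff to the region between two trajectories has, in the limit, no flux through its lateral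
  boundary (\<open>strip_limit\<close>), which turns every balance law into a statement on the masses at
  two times. For the energy law the cutoff produces boundary terms at the centre and at the free
  surface: at the centre half of the dissipation absorbs them (\<open>centre_layer_pointwise\<close>), and at the
  surface the boundary condition makes the stress small (\<open>stress_near_surface\<close>). The resulting
  inequality has \<open>\<nu>/2\<close> in place of \<open>\<nu>\<close>; the factor two enters only the constant \<open>C\<close>, for which
  \<open>C\<^sup>2 = 1 + 2 (a\<^sub>0\<^sup>2 + 2 E\<^sub>0/\<nu>)\<close> is taken.\<close>

section \<open>A \<open>C\<^sup>1\<close> cutoff\<close>

lemma DERIV_pos_part_sq:
  "((\<lambda>x::real. (max 0 x)\<^sup>2) has_real_derivative 2 * max 0 x) (at x)"
proof -
  consider "x < 0" | "x = 0" | "x > 0" by linarith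
  then show ?thesis
  proof cases
    case 1
    have "((\<lambda>x::real. 0) has_real_derivative 2 * max 0 x) (at x)"
      using 1 by (auto simp: max_def)
    then show ?thesis
      by (rule has_field_derivative_transform_within_open[where S="{..<0}"]) (use 1 in auto)
  next
    case 3
    have "((\<lambda>x::real. x\<^sup>2) has_real_derivative 2 * max 0 x) (at x)"
      using 3 by (auto intro!: derivative_eq_intros)
    then show ?thesis
      by (rule has_field_derivative_transform_within_open[where S="{0<..}"]) (use 3 in auto)
  next
    case 2
    have "((\<lambda>h::real. (max 0 h)\<^sup>2 / h) \<longlongrightarrow> 0) (at 0)"
    proof (rule Lim_null_comparison)
      show "\<forall>\<^sub>F h in at 0. norm ((max 0 h)\<^sup>2 / h) \<le> \<bar>h::real\<bar>"
        by (rule always_eventually) (auto simp: max_def power2_eq_square)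
      show "((\<lambda>h::real. \<bar>h\<bar>) \<longlongrightarrow> 0) (at 0)"
        using tendsto_rabs[OF tendsto_ident_at[of "0::real" UNIV]] by simp
    qed
    then show ?thesis using 2 by (simp add: DERIV_def)
  qed
qed

text \<open>A \<open>C\<^sup>1\<close> step from \<open>0\<close> to \<open>1\<close> on \<open>[1, 2]\<close>, the primitive of a tent function. All cutoffs are built from
  it.\<close>

definition ramp :: "real => real" where
  "ramp s = 2 * (max 0 (s - 1))\<^sup>2 - 4 * (max 0 (s - 3/2))\<^sup>2 + 2 * (max 0 (s - 2))\<^sup>2"

definition tent :: "real => real" where
  "tent s = 4 * max 0 (s - 1) - 8 * max 0 (s - 3/2) + 4 * max 0 (s - 2)"

lemma ramp_deriv: "(ramp has_real_derivative tent s) (at s)"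
proof -
  have *: "((\<lambda>s. (max 0 (s - c))\<^sup>2) has_real_derivative 2 * max 0 (s - c)) (at s)" for c :: real
    using DERIV_shift[THEN iffD1, of "\<lambda>x. (max 0 x)\<^sup>2" "2 * max 0 (s-c)" s "-c"] DERIV_pos_part_sq[of "s - c"]
    by simp
  show ?thesis unfolding ramp_def[abs_def] tent_def
    by (rule derivative_eq_intros * refl | simp)+
qed

lemma ramp_deriv_chain[derivative_intros]:
  "(f has_real_derivative d) (at x within S) ==>
   ((\<lambda>x. ramp (f x)) has_real_derivative tent (f x) * d) (at x within S)"
  using DERIV_chain2[OF ramp_deriv] by blast

lemma continuous_on_tent[continuous_intros]:
  "continuous_on S f ==> continuous_on S (\<lambda>x. tent (f x))"
  unfolding tent_def by (intro continuous_intros)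

lemma continuous_on_ramp[continuous_intros]:
  "continuous_on S f ==> continuous_on S (\<lambda>x. ramp (f x))"
  unfolding ramp_def by (intro continuous_intros)

lemma tent_eq_0: "s \<le> 1 \<or> 2 \<le> s ==> tent s = 0"
  unfolding tent_def by (auto simp: max_def)

lemma tent_nonneg: "0 \<le> tent s" and tent_le: "tent s \<le> 2"
  unfolding tent_def by (auto simp: max_def)

lemma ramp_eq_0: "s \<le> 1 ==> ramp s = 0"
  unfolding ramp_def by (auto simp: max_def)

lemma ramp_eq_1: "2 \<le> s ==> ramp s = 1"
  unfolding ramp_def by (auto simp: max_def power2_eq_square algebra_simps)

lemma ramp_mono: "s \<le> t ==> ramp s \<le> ramp t"
  by (rule DERIV_nonneg_imp_nondecreasing) (use ramp_deriv tent_nonneg in blast)+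

lemma ramp_nonneg: "0 \<le> ramp s"
  using ramp_mono[of "min s 0" s] ramp_eq_0[of "min s 0"] by simp

lemma ramp_le_1: "ramp s \<le> 1"
  using ramp_mono[of s "max s 2"] ramp_eq_1[of "max s 2"] by simp

text \<open>The step leaves \<open>0\<close> quadratically, so the square of its derivative is bounded by the step itself.
  This is what allows the dissipation to absorb the boundary term at the centre.\<close>

lemma tent_sq_le_ramp: "(tent s)\<^sup>2 \<le> 8 * ramp s"
proof -
  consider "s \<le> 1" | "1 \<le> s" "s < 3/2" | "3/2 \<le> s" "s \<le> 2" | "2 \<le> s" by linarith
  then show ?thesis
  proof cases
    case 3
    have "tent s = 4 * (2 - s)" using 3 by (auto simp: tent_def max_def)
    moreover have "(4 * (2 - s))\<^sup>2 \<le> 2\<^sup>2" by (rule power_mono) (use 3 in auto)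
    moreover have "ramp (3/2) \<le> ramp s" using 3 by (intro ramp_mono)
    moreover have "ramp (3/2) = 1/2" by (simp add: ramp_def power2_eq_square)
    ultimately show ?thesis by simp
  qed (auto simp: tent_def ramp_def max_def power2_eq_square algebra_simps)
qed

lemma integral_tent: "(LINT s|lborel. tent s) = 1" and integrable_tent: "integrable lborel tent"
proof -
  have *: "has_bochner_integral lborel (\<lambda>x. tent x * indicator {1..2} x) (ramp 2 - ramp 1)"
    by (rule has_bochner_integral_FTC_Icc_real)
       (use ramp_deriv continuous_on_tent[OF continuous_on_id, of UNIV] in
         \<open>auto simp: continuous_on_eq_continuous_at\<close>)
  moreover have "(\<lambda>x. tent x * indicator {1..2} x) = tent"
  proof
    fix x show "tent x * indicator {1..2} x = tent x"
      using tent_eq_0[of x] by (cases "x \<in> {1..2}") auto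
  qed
  ultimately have "has_bochner_integral lborel tent 1"
    using ramp_eq_0[of 1] ramp_eq_1[of 2] by simp
  then show "(LINT s|lborel. tent s) = 1" "integrable lborel tent"
    by (auto dest: has_bochner_integral_integral_eq intro: integrable.intros)
qed

section \<open>Absolutely continuous functions of one variable\<close>

text \<open>Absolute continuity with derivative \<open>g\<close> almost everywhere, in the form of the fundamental theorem.\<close>

definition ac :: "real => real => (real => real) => (real => real) => bool" where
  "ac p q f g \<longleftrightarrow> set_integrable lborel {p..q} g \<and>
     (\<forall>x y. p \<le> x --> x \<le> y --> y \<le> q --> f y - f x = (LBINT s:{x..y}. g s))"

lemma set_integral_Icc_combine:
  fixes g :: "real => real"
  assumes "set_integrable lborel {a..c} g" "a \<le> b" "b \<le> c"
  shows "(LBINT s:{a..b}. g s) + (LBINT s:{b..c}. g s) = (LBINT s:{a..c}. g s)"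
proof -
  have "set_integrable lborel {a..b} g" "set_integrable lborel {b..c} g"
    using assms by (auto intro: set_integrable_subset)
  then show ?thesis
    using assms Henstock_Kurzweil_Integration.integral_combine[of a b c g]
    by (simp add: set_borel_integral_eq_integral)
qed

lemma set_integrable_Icc_join:
  fixes g :: "real => real"
  assumes "set_integrable lborel {a..b} g" "set_integrable lborel {b..c} g" "a \<le> b" "b \<le> c"
  shows "set_integrable lborel {a..c} g"
  using set_integrable_Un[OF assms(1,2)] assms(3,4) by (simp add: ivl_disj_un_two_touch(4))

lemma set_integrable_mult_continuous:
  fixes h g :: "'a::euclidean_space => real"
  assumes "compact K" "continuous_on K h" "set_integrable lborel K g"
  shows "set_integrable lborel K (\<lambda>x. h x * g x)"
proof -
  obtain M where M: "\<And>x. x \<in> K ==> \<bar>h x\<bar> \<le> M"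
    using compact_imp_bounded[OF compact_continuous_image[OF assms(2,1)]]
    unfolding bounded_iff by auto
  have Kb: "K \<in> sets borel" using assms(1) by (rule borel_compact)
  have m1: "(\<lambda>x. indicator K x *\<^sub>R h x) \<in> borel_measurable lborel"
    using borel_measurable_continuous_on_indicator[OF Kb assms(2)] by simp
  have m2: "(\<lambda>x. indicator K x *\<^sub>R g x) \<in> borel_measurable lborel"
    using assms(3) unfolding set_integrable_def by auto
  have "integrable lborel (\<lambda>x. M * (indicator K x *\<^sub>R g x))"
    using assms(3) unfolding set_integrable_def by auto
  then show ?thesis unfolding set_integrable_def
  proof (rule Bochner_Integration.integrable_bound)
    have "(\<lambda>x. (indicator K x *\<^sub>R h x) * (indicator K x *\<^sub>R g x)) \<in> borel_measurable lborel"
      using m1 m2 by measurable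
    also have "(\<lambda>x. (indicator K x *\<^sub>R h x) * (indicator K x *\<^sub>R g x)) = (\<lambda>x. indicat_real K x *\<^sub>R (h x * g x))"
      by (auto simp: indicator_def)
    finally show "(\<lambda>x. indicat_real K x *\<^sub>R (h x * g x)) \<in> borel_measurable lborel" .
    show "AE x in lborel. norm (indicat_real K x *\<^sub>R (h x * g x)) \<le> norm (M * (indicat_real K x *\<^sub>R g x))"
    proof (intro always_eventually allI)
      fix x
      have "\<bar>h x\<bar> * \<bar>g x\<bar> \<le> \<bar>M\<bar> * \<bar>g x\<bar>" if "x \<in> K"
        using M[OF that] by (intro mult_right_mono) auto
      then show "norm (indicat_real K x *\<^sub>R (h x * g x)) \<le> norm (M * (indicat_real K x *\<^sub>R g x))"
        by (cases "x \<in> K") (auto simp: abs_mult)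
    qed
  qed
qed

lemma set_integrable_const_Icc: "set_integrable lborel {x..y::real} (\<lambda>_. c::real)"
  by (auto simp: set_integrable_def integrable_indicator_iff emeasure_lborel_Icc_eq)

lemma ac_integrable: "ac p q f g ==> set_integrable lborel {p..q} g"
  by (simp add: ac_def)

lemma ac_diff: "ac p q f g ==> p \<le> x ==> x \<le> y ==> y \<le> q ==> f y - f x = (LBINT s:{x..y}. g s)"
  by (simp add: ac_def)

lemma ac_subset: "ac p q f g ==> p \<le> p' ==> q' \<le> q ==> ac p' q' f g"
  unfolding ac_def by (auto intro: set_integrable_subset)

lemma ac_join:
  assumes "ac a b f g" "ac b c f g" "a \<le> b" "b \<le> c"
  shows "ac a c f g"
proof -
  have i: "set_integrable lborel {a..c} g"
    using assms by (auto simp: ac_def intro: set_integrable_Icc_join)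
  have "f y - f x = (LBINT s:{x..y}. g s)" if "a \<le> x" "x \<le> y" "y \<le> c" for x y
  proof -
    consider "y \<le> b" | "b \<le> x" | "x \<le> b" "b \<le> y" by linarith
    then show ?thesis
    proof cases
      case 3
      have "set_integrable lborel {x..y} g" using i that by (auto intro: set_integrable_subset)
      then have "(LBINT s:{x..b}. g s) + (LBINT s:{b..y}. g s) = (LBINT s:{x..y}. g s)"
        using 3 by (rule set_integral_Icc_combine)
      then show ?thesis using ac_diff[OF assms(1), of x b] ac_diff[OF assms(2), of b y] 3 that by simp
    qed (use that assms in \<open>auto simp: ac_def\<close>)
  qed
  then show ?thesis using i by (auto simp: ac_def)
qed

lemma ac_local:
  assumes "p \<le> q" and "\<And>x. p \<le> x ==> x \<le> q ==> \<exists>d>0. ac (x - d) (x + d) f g"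
  shows "ac p q f g"
  using assms(1)
proof (induction rule: Bolzano)
  case (trans a b c) then show ?case by (rule ac_join)
next
  case (local x)
  from assms(2)[OF this] obtain d where "d > 0" "ac (x - d) (x + d) f g" by blast
  then show ?case by (intro exI[of _ d]) (auto intro: ac_subset)
qed

lemma ac_continuous:
  assumes "ac p q f g" shows "continuous_on {p..q} f"
proof -
  have i: "set_integrable lborel {p..q} g" using assms by (simp add: ac_def)
  have "f x = f p + integral {p..x} g" if "x \<in> {p..q}" for x
    using ac_diff[OF assms, of p x] that set_integrable_subset[OF i, of "{p..x}"]
    by (simp add: set_borel_integral_eq_integral)
  moreover have "continuous_on {p..q} (\<lambda>x. f p + integral {p..x} g)"
    using i by (intro continuous_intros indefinite_integral_continuous_1)
      (simp add: set_borel_integral_eq_integral)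
  ultimately show ?thesis
    using continuous_on_cong[OF refl, of "{p..q}" f "\<lambda>x. f p + integral {p..x} g"] by blast
qed

lemma ac_cong:
  assumes "ac p q f g" "\<And>x. p \<le> x ==> x \<le> q ==> f x = f' x"
    "AE x in lborel. x \<in> {p..q} --> g x = g' x" "g' \<in> borel_measurable borel"
  shows "ac p q f' g'"
proof -
  have ae: "AE s in lborel. indicator A s *\<^sub>R g s = indicator A s *\<^sub>R g' s" if "A \<subseteq> {p..q}" for A
    using assms(3) by eventually_elim (use that in \<open>auto simp: indicator_def\<close>)
  have mg: "(\<lambda>s. indicator {p..q} s *\<^sub>R g s) \<in> borel_measurable lborel"
    using assms(1) unfolding ac_def set_integrable_def by auto
  have "set_integrable lborel {p..q} g'"
    using assms(1) integrable_cong_AE[OF mg _ ae[of "{p..q}"]] assms(4)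
    unfolding ac_def set_integrable_def by auto
  moreover have "(LBINT s:{x..y}. g s) = (LBINT s:{x..y}. g' s)" if "p \<le> x" "y \<le> q" for x y
  proof -
    have "set_integrable lborel {x..y} g"
      using assms(1) that unfolding ac_def by (auto intro: set_integrable_subset)
    then have "(\<lambda>s. indicator {x..y} s *\<^sub>R g s) \<in> borel_measurable lborel"
      unfolding set_integrable_def by auto
    then show ?thesis unfolding set_lebesgue_integral_def using ae[of "{x..y}"] assms(4) that
      by (intro integral_cong_AE) auto
  qed
  ultimately show ?thesis using assms(1,2) unfolding ac_def by (metis order_trans)
qed

lemma ac_add:
  assumes "ac p q f g" "ac p q f' g'"
  shows "ac p q (\<lambda>x. f x + f' x) (\<lambda>x. g x + g' x)"
proof -
  have "set_integrable lborel {x..y} g" "set_integrable lborel {x..y} g'" if "p \<le> x" "y \<le> q" for x y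
    using assms that unfolding ac_def by (auto intro: set_integrable_subset)
  then show ?thesis using assms unfolding ac_def
    by (auto simp: set_integral_add) (metis add_diff_add)
qed

lemma ac_cmult: "ac p q f g ==> ac p q (\<lambda>x. c * f x) (\<lambda>x. c * g x)"
  unfolding ac_def by (auto simp: right_diff_distrib[symmetric])

lemma ac_minus: "ac p q f g ==> ac p q f' g' ==> ac p q (\<lambda>x. f x - f' x) (\<lambda>x. g x - g' x)"
  using ac_add[OF _ ac_cmult[where c="-1"], of p q f g f' g'] by simp

lemma ac_C1:
  assumes "\<And>x. p \<le> x ==> x \<le> q ==> (f has_real_derivative f' x) (at x)" "continuous_on {p..q} f'"
  shows "ac p q f f'"
  unfolding ac_def
proof (intro conjI allI impI)
  show "set_integrable lborel {p..q} f'"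
    unfolding set_integrable_def using assms(2) by (intro borel_integrable_compact) auto
  fix x y assume xy: "p \<le> x" "x \<le> y" "y \<le> q"
  have "integral\<^sup>L lborel (\<lambda>s. indicator {x .. y} s *\<^sub>R f' s) = f y - f x"
    by (rule integral_FTC_Icc)
       (use xy assms in \<open>auto intro: continuous_on_subset has_field_derivative_at_within
         simp: has_real_derivative_iff_has_vector_derivative[symmetric]\<close>)
  then show "f y - f x = (LBINT s:{x..y}. f' s)" by (simp add: set_lebesgue_integral_def)
qed

text \<open>Both sides of the chain rule are additive in the interval, so it is enough to compare them on
  short intervals, where the mean value theorem gives an error of at most \<open>e\<close> times the integral of
  \<open>\<bar>g\<bar>\<close>.\<close>

lemma ac_chain:
  fixes \<beta> :: "real => real"
  assumes ac: "ac p q f g" and \<beta>: "\<And>x. (\<beta> has_real_derivative \<beta>' x) (at x)"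
    and c: "continuous_on UNIV \<beta>'"
  shows "ac p q (\<lambda>x. \<beta> (f x)) (\<lambda>x. \<beta>' (f x) * g x)"
proof -
  have fc: "continuous_on {p..q} f" by (rule ac_continuous[OF ac])
  have bc: "continuous_on {p..q} (\<lambda>x. \<beta>' (f x))"
    using continuous_on_compose2[OF c fc] by auto
  have int: "set_integrable lborel {p..q} (\<lambda>x. \<beta>' (f x) * g x)"
    using bc ac by (intro set_integrable_mult_continuous) (auto simp: ac_def)
  have ig: "set_integrable lborel {p..q} (\<lambda>x. \<bar>g x\<bar>)"
    using ac by (auto simp: ac_def intro: set_integrable_abs)
  have ints: "set_integrable lborel {a..b} (\<lambda>x. \<beta>' (f x) * g x)"
       "set_integrable lborel {a..b} (\<lambda>x. \<bar>g x\<bar>)" "set_integrable lborel {a..b} g" if "p \<le> a" "b \<le> q" for a b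
    using int ig ac that by (auto intro: set_integrable_subset simp: ac_def)
  have key: "\<bar>\<beta> (f y) - \<beta> (f x) - (LBINT s:{x..y}. \<beta>' (f s) * g s)\<bar> \<le> e * (LBINT s:{x..y}. \<bar>g s\<bar>)"
    if e: "e > 0" and xy: "p \<le> x" "x \<le> y" "y \<le> q" for e x y
  proof -
    (* a predicate on intervals in the form required by the bisection rule *)
    define Pr where "Pr a b \<longleftrightarrow> (p \<le> a --> a \<le> b --> b \<le> q -->
      \<bar>\<beta> (f b) - \<beta> (f a) - (LBINT s:{a..b}. \<beta>' (f s) * g s)\<bar> \<le> e * (LBINT s:{a..b}. \<bar>g s\<bar>))" for a b
    have "uniformly_continuous_on {p..q} (\<lambda>x. \<beta>' (f x))"
      by (rule compact_uniformly_continuous[OF bc]) simp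
    then obtain d where d: "d > 0" "\<And>s s'. s \<in> {p..q} ==> s' \<in> {p..q} ==> \<bar>s' - s\<bar> < d ==> \<bar>\<beta>' (f s') - \<beta>' (f s)\<bar> < e"
      using e unfolding uniformly_continuous_on_def dist_real_def by metis
    have small: "Pr a b" if "b - a < d" for a b
      unfolding Pr_def
    proof (intro impI)
      assume ab: "p \<le> a" "a \<le> b" "b \<le> q"
      have "\<exists>s\<in>{a..b}. \<beta> (f b) - \<beta> (f a) = \<beta>' (f s) * (f b - f a)"
      proof (cases "f a = f b")
        case True then show ?thesis using ab by auto
      next
        case False
        have "\<exists>z. min (f a) (f b) < z \<and> z < max (f a) (f b) \<and> \<beta> (f b) - \<beta> (f a) = \<beta>' z * (f b - f a)"
        proof (cases "f a < f b")
          case True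
          from MVT2[OF True, of \<beta> \<beta>'] \<beta> obtain z where "f a < z" "z < f b" "\<beta> (f b) - \<beta> (f a) = (f b - f a) * \<beta>' z" by blast
          then show ?thesis using True by (auto simp: mult.commute intro!: exI[of _ z])
        next
          case F: False
          then have "f b < f a" using False by simp
          from MVT2[OF this, of \<beta> \<beta>'] \<beta> obtain z where "f b < z" "z < f a" "\<beta> (f a) - \<beta> (f b) = (f a - f b) * \<beta>' z" by blast
          then show ?thesis using F by (auto simp: algebra_simps intro!: exI[of _ z])
        qed
        then obtain z where z: "min (f a) (f b) < z" "z < max (f a) (f b)" "\<beta> (f b) - \<beta> (f a) = \<beta>' z * (f b - f a)" by blast
        have "continuous_on {a..b} f" using fc ab by (auto intro: continuous_on_subset)
        then have "\<exists>s\<in>{a..b}. f s = z"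
          using IVT'[of f a z b] IVT2'[of f b z a] z(1,2) ab by (cases "f a \<le> f b") (force simp: min_def max_def)+
        then show ?thesis using z(3) by auto
      qed
      then obtain s0 where s0: "s0 \<in> {a..b}" "\<beta> (f b) - \<beta> (f a) = \<beta>' (f s0) * (f b - f a)" by blast
      have "\<beta> (f b) - \<beta> (f a) - (LBINT s:{a..b}. \<beta>' (f s) * g s)
          = (LBINT s:{a..b}. \<beta>' (f s0) * g s) - (LBINT s:{a..b}. \<beta>' (f s) * g s)"
        using s0(2) ac_diff[OF ac, of a b] ab by simp
      also have "\<dots> = (LBINT s:{a..b}. \<beta>' (f s0) * g s - \<beta>' (f s) * g s)"
        using ints[of a b] ab by (simp add: set_integral_diff)
      also have "\<bar>\<dots>\<bar> \<le> (LBINT s:{a..b}. \<bar>\<beta>' (f s0) * g s - \<beta>' (f s) * g s\<bar>)"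
        unfolding set_lebesgue_integral_def
        by (rule order_trans[OF integral_abs_bound]) (simp add: abs_mult)
      also have "\<dots> \<le> (LBINT s:{a..b}. e * \<bar>g s\<bar>)"
      proof (rule set_integral_mono)
        show "set_integrable lborel {a..b} (\<lambda>s. \<bar>\<beta>' (f s0) * g s - \<beta>' (f s) * g s\<bar>)"
          using ints[of a b] ab by (intro set_integrable_abs set_integral_diff(1)) auto
        show "set_integrable lborel {a..b} (\<lambda>s. e * \<bar>g s\<bar>)" using ints[of a b] ab by auto
        fix s assume s: "s \<in> {a..b}"
        have "\<bar>\<beta>' (f s0) - \<beta>' (f s)\<bar> \<le> e"
          using d(2)[of s s0] s s0(1) ab \<open>b - a < d\<close> by force
        then show "\<bar>\<beta>' (f s0) * g s - \<beta>' (f s) * g s\<bar> \<le> e * \<bar>g s\<bar>"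
          by (auto simp: abs_mult left_diff_distrib[symmetric] intro: mult_right_mono)
      qed
      finally show "\<bar>\<beta> (f b) - \<beta> (f a) - (LBINT s:{a..b}. \<beta>' (f s) * g s)\<bar> \<le> e * (LBINT s:{a..b}. \<bar>g s\<bar>)"
        by simp
    qed
    have "Pr x y" using xy(2)
    proof (induction rule: Bolzano)
      case (trans a b c)
      show ?case unfolding Pr_def
      proof (intro impI)
        assume h: "p \<le> a" "a \<le> c" "c \<le> q"
        have "\<bar>\<beta> (f b) - \<beta> (f a) - (LBINT s:{a..b}. \<beta>' (f s) * g s)\<bar> \<le> e * (LBINT s:{a..b}. \<bar>g s\<bar>)"
          "\<bar>\<beta> (f c) - \<beta> (f b) - (LBINT s:{b..c}. \<beta>' (f s) * g s)\<bar> \<le> e * (LBINT s:{b..c}. \<bar>g s\<bar>)"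
          using trans h unfolding Pr_def by auto
        moreover note set_integral_Icc_combine[OF ints(1) trans(3,4), OF h(1,3)]
          set_integral_Icc_combine[OF ints(2) trans(3,4), OF h(1,3)]
        ultimately show "\<bar>\<beta> (f c) - \<beta> (f a) - (LBINT s:{a..c}. \<beta>' (f s) * g s)\<bar> \<le> e * (LBINT s:{a..c}. \<bar>g s\<bar>)"
          by (smt (verit) distrib_left)
      qed
    next
      case (local z) then show ?case using small d(1) by blast
    qed
    then show ?thesis using xy by (simp add: Pr_def)
  qed
  have "\<beta> (f y) - \<beta> (f x) = (LBINT s:{x..y}. \<beta>' (f s) * g s)" if xy: "p \<le> x" "x \<le> y" "y \<le> q" for x y
  proof -
    define I where "I = (LBINT s:{x..y}. \<bar>g s\<bar>)"
    have "I \<ge> 0" unfolding I_def set_lebesgue_integral_def by (intro integral_nonneg_AE) auto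
    have "\<bar>\<beta> (f y) - \<beta> (f x) - (LBINT s:{x..y}. \<beta>' (f s) * g s)\<bar> \<le> 0 + e" if "e > 0" for e
    proof -
      have "\<bar>\<beta> (f y) - \<beta> (f x) - (LBINT s:{x..y}. \<beta>' (f s) * g s)\<bar> \<le> (e / (I + 1)) * I"
        using key[of "e / (I+1)" x y] that \<open>I \<ge> 0\<close> xy by (simp add: I_def)
      also have "\<dots> \<le> e" using that \<open>I \<ge> 0\<close> by (simp add: field_simps)
      finally show ?thesis by simp
    qed
    then have "\<bar>\<beta> (f y) - \<beta> (f x) - (LBINT s:{x..y}. \<beta>' (f s) * g s)\<bar> \<le> 0"
      by (rule field_le_epsilon)
    then show ?thesis by simp
  qed
  then show ?thesis using int by (simp add: ac_def)
qed

text \<open>By polarisation the product rule is a case of the chain rule for the square.\<close>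

lemma ac_mult:
  assumes "ac p q f g" "ac p q f' g'"
  shows "ac p q (\<lambda>x. f x * f' x) (\<lambda>x. g x * f' x + f x * g' x)"
proof -
  have sq: "ac p q (\<lambda>x. (h x)\<^sup>2) (\<lambda>x. (2 * h x) * k x)" if "ac p q h k" for h k
    by (rule ac_chain[OF that]) (auto intro!: derivative_eq_intros continuous_intros)
  have "ac p q (\<lambda>x. (1/2) * (((f x + f' x)\<^sup>2 - (f x)\<^sup>2) - (f' x)\<^sup>2))
     (\<lambda>x. (1/2) * (((2 * (f x + f' x)) * (g x + g' x) - (2 * f x) * g x) - (2 * f' x) * g' x))"
    by (intro ac_cmult ac_minus sq ac_add assms)
  then show ?thesis by (simp add: algebra_simps power2_eq_square add_divide_distrib diff_divide_distrib)
qed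

section \<open>Fubini in the plane\<close>

lemma plane_AE_slices:
  fixes P :: "real \<times> real => bool"
  assumes "AE z in lborel. P z"
  shows "AE t in lborel. AE r in lborel. P (r, t)"
proof -
  obtain N where N: "N \<in> sets lborel" "emeasure lborel N = 0" "{z. \<not> P z} \<subseteq> N"
    using assms by (elim AE_E) (simp add: subset_iff)
  have m: "{x \<in> space (lborel \<Otimes>\<^sub>M lborel). (fst x, snd x) \<notin> N} \<in> sets (lborel \<Otimes>\<^sub>M lborel)"
    using N(1) unfolding lborel_prod by (simp add: Compl_eq[symmetric])
  have "AE z in lborel \<Otimes>\<^sub>M lborel. (fst z, snd z) \<notin> N"
    unfolding lborel_prod using AE_not_in[of N lborel] N by (auto simp: null_sets_def)
  from lborel_pair.AE_pair[OF this] have "AE r in lborel. AE t in lborel. (r, t) \<notin> N" by simp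
  then have "AE t in lborel. AE r in lborel. (r, t) \<notin> N"
    using lborel_pair.AE_commute[of "\<lambda>r t. (r, t) \<notin> N"] m by simp
  then show ?thesis
    by (rule AE_mp) (rule always_eventually, use N(3) in \<open>auto elim!: eventually_mono\<close>)
qed

lemma plane_swap_measure: "distr lborel lborel prod.swap = (lborel :: (real \<times> real) measure)"
proof -
  have "prod.swap = (\<lambda>(x::real, y::real). (y, x))" by auto
  then show ?thesis
    using lborel_pair.distr_pair_swap[where 'a=real and 'b=real] unfolding lborel_prod by metis
qed

lemma measurable_prod_swap[measurable]: "prod.swap \<in> borel \<rightarrow>\<^sub>M (borel :: (real \<times> real) measure)"
  by (intro borel_measurable_continuous_onI continuous_intros)

lemma plane_integral_swap:
  fixes f :: "real \<times> real => real"
  assumes [measurable]: "f \<in> borel_measurable borel"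
  shows "(LBINT z. f (prod.swap z)) = (LBINT z. f z)"
proof -
  have "integral\<^sup>L (distr lborel lborel prod.swap) f = (LBINT z. f (prod.swap z))"
    by (rule integral_distr) (auto intro: measurable_prod_swap)
  then show ?thesis unfolding plane_swap_measure by (rule sym)
qed

lemma plane_integrable_swap:
  fixes f :: "real \<times> real => real"
  assumes "integrable lborel f"
  shows "integrable lborel (\<lambda>z. f (prod.swap z))"
proof -
  have "integrable (distr lborel lborel prod.swap) f" unfolding plane_swap_measure by fact
  then show ?thesis by (rule integrable_distr[rotated]) (use measurable_prod_swap in simp)
qed

lemma plane_Fubini:
  fixes f :: "real \<times> real => real"
  assumes "integrable lborel f"
  shows "AE t in lborel. integrable lborel (\<lambda>r. f (r, t))"
    and "integrable lborel (\<lambda>t. LBINT r. f (r, t))"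
    and "(LBINT z. f z) = (LBINT t. (LBINT r. f (r, t)))"
proof -
  have i: "integrable (lborel \<Otimes>\<^sub>M lborel) (\<lambda>z. f (prod.swap z))"
    using plane_integrable_swap[OF assms] by (simp add: lborel_prod)
  show "AE t in lborel. integrable lborel (\<lambda>r. f (r, t))"
    using lborel_pair.AE_integrable_fst'[OF i] by simp
  show "integrable lborel (\<lambda>t. LBINT r. f (r, t))"
    using lborel_pair.integrable_fst'[OF i] by simp
  have "(LBINT t. (LBINT r. f (r, t))) = (LBINT z. f (prod.swap z))"
    using lborel_pair.integral_fst'[OF i] by (simp add: lborel_prod)
  also have "\<dots> = (LBINT z. f z)"
    using assms by (intro plane_integral_swap) auto
  finally show "(LBINT z. f z) = (LBINT t. (LBINT r. f (r, t)))" ..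
qed

lemma plane_nn_Fubini:
  fixes f :: "real \<times> real => ennreal"
  assumes [measurable]: "f \<in> borel_measurable borel"
  shows "(\<integral>\<^sup>+z. f z \<partial>lborel) = (\<integral>\<^sup>+t. (\<integral>\<^sup>+r. f (r, t) \<partial>lborel) \<partial>lborel)"
proof -
  have "f \<in> borel_measurable (lborel \<Otimes>\<^sub>M lborel)" by (simp add: lborel_prod)
  from lborel_pair.nn_integral_snd[of f] this show ?thesis by (simp add: lborel_prod)
qed

lemma plane_integrableI:
  fixes f :: "real \<times> real => real"
  assumes [measurable]: "f \<in> borel_measurable borel"
    and "AE t in lborel. integrable lborel (\<lambda>r. f (r, t))"
    and i: "integrable lborel (\<lambda>t. LBINT r. \<bar>f (r, t)\<bar>)"
  shows "integrable lborel f"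
proof -
  have "integrable (lborel \<Otimes>\<^sub>M lborel) (\<lambda>z. f (prod.swap z))"
    by (rule lborel_pair.Fubini_integrable) (use assms in \<open>auto simp: lborel_prod\<close>)
  from plane_integrable_swap[OF this[unfolded lborel_prod]] show ?thesis by simp
qed

section \<open>Functions determined by their integrals\<close>

text \<open>Integrals over intervals determine those over all Borel sets.\<close>

lemma AE_zero_if_interval_integrals_zero:
  fixes f :: "real => real"
  assumes i: "set_integrable lborel {a..b} f"
    and z: "\<And>x y. a \<le> x ==> x \<le> y ==> y \<le> b ==> (LBINT s:{x..y}. f s) = 0"
  shows "AE s in lborel. s \<in> {a..b} --> f s = 0"
proof -
  define h where "h s = indicator {a..b} s *\<^sub>R f s" for s
  have hi: "integrable lborel h" using i unfolding set_integrable_def h_def .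
  have si: "set_integrable lborel A h" if "A \<in> sets borel" for A
    unfolding set_integrable_def using hi that by (intro integrable_mult_indicator) auto
  have tot: "(LBINT s:{x..y}. h s) = 0" for x y
  proof (cases "max x a \<le> min y b")
    case True
    have "(LBINT s:{x..y}. h s) = (LBINT s:{max x a..min y b}. f s)"
      unfolding set_lebesgue_integral_def h_def by (intro Bochner_Integration.integral_cong) (auto simp: indicator_def)
    then show ?thesis using z[of "max x a" "min y b"] True by simp
  next
    case False
    then have "(\<lambda>s. indicat_real {x..y} s *\<^sub>R h s) = (\<lambda>s. 0)" by (auto simp: h_def indicator_def fun_eq_iff)
    then show ?thesis unfolding set_lebesgue_integral_def by (simp only:) simp
  qed
  have "set_lebesgue_integral lborel A h = 0" if "A \<in> sets borel" for A
    using that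
  proof (induction rule: borel_set_induct)
    case empty then show ?case by (simp add: set_lebesgue_integral_def)
  next
    case (interval a b) then show ?case using tot by simp
  next
    case (compl A)
    have "(LBINT s:UNIV. h s) = (LBINT s:{a..b}. h s)"
      unfolding set_lebesgue_integral_def h_def by (intro Bochner_Integration.integral_cong) (auto simp: indicator_def)
    then have "(LBINT s:UNIV. h s) = 0" using tot by simp
    moreover have "(LBINT s:A \<union> - A. h s) = (LBINT s:A. h s) + (LBINT s:-A. h s)"
      by (rule set_integral_Un) (use compl si in auto)
    ultimately show ?case using compl by simp
  next
    case (union A)
    have "(LBINT s:(\<Union>i. A i). h s) = (\<Sum>i. (LBINT s:A i. h s))"
      by (rule lebesgue_integral_countable_add) (use union si in \<open>auto simp: disjoint_family_on_def\<close>)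
    then show ?case using union by simp
  qed
  then have "AE s in lborel. h s = 0"
    by (intro sigma_finite_measure.density_zero[OF sigma_finite_lborel hi]) auto
  then show ?thesis by (rule AE_mp) (auto simp: h_def)
qed

lemma continuous_AE_eq:
  fixes f g :: "real => real"
  assumes "p < q" "continuous_on {p..q} f" "continuous_on {p..q} g"
    and "AE x in lborel. x \<in> {p..q} --> f x = g x" and x: "x \<in> {p..q}"
  shows "f x = g x"
proof -
  define C where "C = {p..q} \<inter> (\<lambda>x. f x - g x) -` {0}"
  have C: "closed C" unfolding C_def
    by (rule continuous_closed_preimage) (use assms in \<open>auto intro!: continuous_intros\<close>)
  have "AE x \<in> {p<..<q} in lebesgue. x \<in> C"
    using AE_completion[OF assms(4)] by (rule AE_mp) (auto simp: C_def)
  then have "{p<..<q} \<subseteq> C"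
    by (intro subsetI mem_closed_if_AE_lebesgue_open[OF open_greaterThanLessThan C])
  then have "closure {p<..<q} \<subseteq> C" using C by (rule closure_minimal)
  then show ?thesis using x \<open>p < q\<close> by (auto simp: C_def)
qed

section \<open>Weak derivatives in the plane\<close>

text \<open>Test functions are kept together with their partial derivatives in \<open>r\<close> and \<open>t\<close>.\<close>

definition test_on :: "(real \<times> real) set => (real \<times> real => real) => (real \<times> real => real) =>
    (real \<times> real => real) => bool" where
  "test_on Q \<phi> \<phi>r \<phi>t \<longleftrightarrow>
     (\<forall>z. (\<phi> has_derivative (\<lambda>(x, y). \<phi>r z * x + \<phi>t z * y)) (at z)) \<and>
     continuous_on UNIV \<phi>r \<and> continuous_on UNIV \<phi>t \<and>
     (\<exists>K. compact K \<and> K \<subseteq> Q \<and> (\<forall>z. z \<notin> K --> \<phi> z = 0 \<and> \<phi>r z = 0 \<and> \<phi>t z = 0))"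

definition loc_int :: "(real \<times> real) set => (real \<times> real => real) => bool" where
  "loc_int Q f \<longleftrightarrow> f \<in> borel_measurable borel \<and>
     (\<forall>K. compact K --> K \<subseteq> Q --> set_integrable lborel K f)"

definition wdr :: "(real \<times> real) set => (real \<times> real => real) => (real \<times> real => real) => bool" where
  "wdr Q f g \<longleftrightarrow> loc_int Q f \<and> loc_int Q g \<and>
     (\<forall>\<phi> \<phi>r \<phi>t. test_on Q \<phi> \<phi>r \<phi>t -->
        (LBINT z. \<phi>r z * f z) = - (LBINT z. \<phi> z * g z))"

definition wdt :: "(real \<times> real) set => (real \<times> real => real) => (real \<times> real => real) => bool" where
  "wdt Q f g \<longleftrightarrow> loc_int Q f \<and> loc_int Q g \<and>
     (\<forall>\<phi> \<phi>r \<phi>t. test_on Q \<phi> \<phi>r \<phi>t -->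
        (LBINT z. \<phi>t z * f z) = - (LBINT z. \<phi> z * g z))"

lemma loc_int_continuous_mult:
  assumes "loc_int Q f" "continuous_on UNIV h"
  shows "loc_int Q (\<lambda>z. h z * f z)"
  unfolding loc_int_def
proof (intro conjI allI impI)
  have "h \<in> borel_measurable borel" using assms(2) by (rule borel_measurable_continuous_onI)
  then show "(\<lambda>z. h z * f z) \<in> borel_measurable borel"
    using assms(1) by (auto simp: loc_int_def)
  fix K assume "compact K" "K \<subseteq> Q"
  then show "set_integrable lborel K (\<lambda>z. h z * f z)"
    using assms by (intro set_integrable_mult_continuous) (auto simp: loc_int_def intro: continuous_on_subset)
qed

lemma loc_int_continuous: "continuous_on UNIV f ==> loc_int Q f"
  unfolding loc_int_def set_integrable_def
  using borel_integrable_compact[of _ f] borel_measurable_continuous_onI[of f]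
  by (blast intro: continuous_on_subset)

lemma loc_int_add: "loc_int Q f ==> loc_int Q g ==> loc_int Q (\<lambda>z. f z + g z)"
  unfolding loc_int_def by (auto intro!: set_integral_add(1))

lemma test_on_continuous:
  assumes "test_on Q \<phi> \<phi>r \<phi>t"
  shows "continuous_on UNIV \<phi>" "continuous_on UNIV \<phi>r" "continuous_on UNIV \<phi>t"
  using assms unfolding test_on_def
  by (auto intro!: has_derivative_continuous_on simp: has_derivative_at_withinI)

lemma test_on_slice:
  assumes "test_on Q \<phi> \<phi>r \<phi>t"
  shows "((\<lambda>r. \<phi> (r, t)) has_real_derivative \<phi>r (r, t)) (at r)"
proof -
  have "(\<phi> has_derivative (\<lambda>(x, y). \<phi>r (r, t) * x + \<phi>t (r, t) * y)) (at (r, t))"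
    using assms unfolding test_on_def by blast
  moreover have "((\<lambda>r. (r, t)) has_derivative (\<lambda>h. (h, 0))) (at r)"
    by (auto intro!: derivative_eq_intros)
  ultimately have "((\<lambda>r. \<phi> (r, t)) has_derivative (\<lambda>h. \<phi>r (r, t) * h)) (at r)"
    by (auto dest: has_derivative_compose)
  then show ?thesis by (simp add: has_field_derivative_def)
qed

lemma integrable_support:
  fixes \<phi> f :: "real \<times> real => real"
  assumes "loc_int Q f" "continuous_on UNIV \<phi>" "compact K" "K \<subseteq> Q" "\<And>z. z \<notin> K ==> \<phi> z = 0"
  shows "integrable lborel (\<lambda>z. \<phi> z * f z)"
proof -
  have "set_integrable lborel K (\<lambda>z. \<phi> z * f z)"
    using assms by (intro set_integrable_mult_continuous)
      (auto simp: loc_int_def intro: continuous_on_subset)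
  moreover have "(\<lambda>z. indicator K z *\<^sub>R (\<phi> z * f z)) = (\<lambda>z. \<phi> z * f z)"
    using assms(5) by (auto simp: indicator_def fun_eq_iff)
  ultimately show ?thesis by (simp add: set_integrable_def)
qed

lemma test_on_integrable:
  assumes "test_on Q \<phi> \<phi>r \<phi>t" "loc_int Q f"
  shows "integrable lborel (\<lambda>z. \<phi> z * f z)" "integrable lborel (\<lambda>z. \<phi>r z * f z)"
    "integrable lborel (\<lambda>z. \<phi>t z * f z)"
proof -
  obtain K where K: "compact K" "K \<subseteq> Q" "\<And>z. z \<notin> K ==> \<phi> z = 0 \<and> \<phi>r z = 0 \<and> \<phi>t z = 0"
    using assms(1) unfolding test_on_def by blast
  show "integrable lborel (\<lambda>z. \<phi> z * f z)" "integrable lborel (\<lambda>z. \<phi>r z * f z)"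
    "integrable lborel (\<lambda>z. \<phi>t z * f z)"
    using K test_on_continuous[OF assms(1)] by (auto intro!: integrable_support[OF assms(2)])
qed

lemma test_on_swap:
  assumes "test_on Q \<phi> \<phi>r \<phi>t"
  shows "test_on (prod.swap ` Q) (\<phi> \<circ> prod.swap) (\<phi>t \<circ> prod.swap) (\<phi>r \<circ> prod.swap)"
  unfolding test_on_def
proof (intro conjI allI)
  fix z :: "real \<times> real"
  have "(\<phi> has_derivative (\<lambda>(x, y). \<phi>r (prod.swap z) * x + \<phi>t (prod.swap z) * y)) (at (prod.swap z))"
    using assms unfolding test_on_def by blast
  moreover have "(prod.swap has_derivative (\<lambda>h::real\<times>real. prod.swap h)) (at z)"
    by (auto simp: prod.swap_def[abs_def] intro!: derivative_eq_intros)
  ultimately have "((\<lambda>z. \<phi> (prod.swap z)) has_derivative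
      (\<lambda>h. (\<lambda>(x, y). \<phi>r (prod.swap z) * x + \<phi>t (prod.swap z) * y) (prod.swap h))) (at z)"
    by (auto dest: has_derivative_compose)
  then show "((\<phi> \<circ> prod.swap) has_derivative
      (\<lambda>(x, y). (\<phi>t \<circ> prod.swap) z * x + (\<phi>r \<circ> prod.swap) z * y)) (at z)"
    by (simp add: o_def split_beta' add.commute)
next
  show "continuous_on UNIV (\<phi>t \<circ> prod.swap)" "continuous_on UNIV (\<phi>r \<circ> prod.swap)"
    using continuous_on_compose2[OF test_on_continuous(2)[OF assms] continuous_on_swap[of UNIV]]
      continuous_on_compose2[OF test_on_continuous(3)[OF assms] continuous_on_swap[of UNIV]]
    by (simp_all add: o_def)
  obtain K where K: "compact K" "K \<subseteq> Q" "\<And>z. z \<notin> K ==> \<phi> z = 0 \<and> \<phi>r z = 0 \<and> \<phi>t z = 0"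
    using assms unfolding test_on_def by blast
  have "compact (prod.swap ` K)"
    using K(1) by (intro compact_continuous_image) (auto simp: prod.swap_def[abs_def] intro!: continuous_intros)
  moreover have "prod.swap z \<notin> K" if "z \<notin> prod.swap ` K" for z
    using that by (metis image_eqI swap_swap)
  ultimately show "\<exists>K. compact K \<and> K \<subseteq> prod.swap ` Q \<and> (\<forall>z. z \<notin> K -->
      (\<phi> \<circ> prod.swap) z = 0 \<and> (\<phi>t \<circ> prod.swap) z = 0 \<and> (\<phi>r \<circ> prod.swap) z = 0)"
    using K by (intro exI[of _ "prod.swap ` K"]) (auto simp: image_mono)
qed

lemma swap_swap_image: "prod.swap ` prod.swap ` Q = Q"
  by (simp add: image_image)

lemma loc_int_swap:
  assumes "loc_int Q f" shows "loc_int (prod.swap ` Q) (f \<circ> prod.swap)"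
  unfolding loc_int_def
proof (intro conjI allI impI)
  show "f \<circ> prod.swap \<in> borel_measurable borel"
    using assms unfolding loc_int_def by (auto intro: measurable_comp measurable_prod_swap)
  fix K assume K: "compact K" "K \<subseteq> prod.swap ` Q"
  have "compact (prod.swap ` K)"
    using K(1) by (intro compact_continuous_image) (auto simp: prod.swap_def[abs_def] intro!: continuous_intros)
  moreover have "prod.swap ` K \<subseteq> Q" using image_mono[OF K(2), of prod.swap] by (simp add: swap_swap_image)
  ultimately have "integrable lborel (\<lambda>z. indicator (prod.swap ` K) z *\<^sub>R f z)"
    using assms unfolding loc_int_def set_integrable_def by auto
  from plane_integrable_swap[OF this]
  have "integrable lborel (\<lambda>z. indicator (prod.swap ` K) (prod.swap z) *\<^sub>R f (prod.swap z))" .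
  moreover have "prod.swap z \<in> prod.swap ` K \<longleftrightarrow> z \<in> K" for z by (metis image_iff swap_swap)
  then have "indicat_real (prod.swap ` K) (prod.swap z) = indicator K z" for z by (simp add: indicator_def)
  ultimately show "set_integrable lborel K (f \<circ> prod.swap)"
    unfolding set_integrable_def o_def by (simp only:)
qed

text \<open>Exchanging the coordinates transfers every fact on \<open>r\<close>-derivatives to \<open>t\<close>-derivatives.\<close>

lemma wdt_iff_wdr_swap: "wdt Q f g \<longleftrightarrow> wdr (prod.swap ` Q) (f \<circ> prod.swap) (g \<circ> prod.swap)"
proof
  assume L: "wdt Q f g"
  show "wdr (prod.swap ` Q) (f \<circ> prod.swap) (g \<circ> prod.swap)"
    unfolding wdr_def
  proof (intro conjI allI impI)
    show "loc_int (prod.swap ` Q) (f \<circ> prod.swap)" "loc_int (prod.swap ` Q) (g \<circ> prod.swap)"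
      using L by (auto simp: wdt_def loc_int_swap)
    fix \<phi> \<phi>r \<phi>t assume t: "test_on (prod.swap ` Q) \<phi> \<phi>r \<phi>t"
    from test_on_swap[OF this] have t': "test_on Q (\<phi> \<circ> prod.swap) (\<phi>t \<circ> prod.swap) (\<phi>r \<circ> prod.swap)"
      by (simp add: swap_swap_image)
    have [measurable]: "f \<in> borel_measurable borel" "g \<in> borel_measurable borel"
      using L by (auto simp: wdt_def loc_int_def)
    have [measurable]: "\<phi> \<in> borel_measurable borel" "\<phi>r \<in> borel_measurable borel"
      using test_on_continuous[OF t] by (auto intro: borel_measurable_continuous_onI)
    have "(LBINT z. \<phi>r z * (f \<circ> prod.swap) z) = (LBINT z. \<phi>r (prod.swap z) * (f \<circ> prod.swap) (prod.swap z))"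
      by (rule plane_integral_swap[symmetric]) (simp add: o_def)
    moreover have "(LBINT z. \<phi> z * (g \<circ> prod.swap) z) = (LBINT z. \<phi> (prod.swap z) * (g \<circ> prod.swap) (prod.swap z))"
      by (rule plane_integral_swap[symmetric]) (simp add: o_def)
    ultimately show "(LBINT z. \<phi>r z * (f \<circ> prod.swap) z) = - (LBINT z. \<phi> z * (g \<circ> prod.swap) z)"
      using L t' by (auto simp: wdt_def o_def)
  qed
next
  assume R: "wdr (prod.swap ` Q) (f \<circ> prod.swap) (g \<circ> prod.swap)"
  show "wdt Q f g" unfolding wdt_def
  proof (intro conjI allI impI)
    have "loc_int Q ((f \<circ> prod.swap) \<circ> prod.swap)" "loc_int Q ((g \<circ> prod.swap) \<circ> prod.swap)"
      using R loc_int_swap[of "prod.swap ` Q"] by (auto simp: wdr_def swap_swap_image)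
    then show li: "loc_int Q f" "loc_int Q g" by (auto simp: o_def)
    fix \<phi> \<phi>r \<phi>t assume t: "test_on Q \<phi> \<phi>r \<phi>t"
    note t' = test_on_swap[OF this]
    have [measurable]: "f \<in> borel_measurable borel" "g \<in> borel_measurable borel"
      using li by (auto simp: loc_int_def)
    have [measurable]: "\<phi> \<in> borel_measurable borel" "\<phi>t \<in> borel_measurable borel"
      using test_on_continuous[OF t] by (auto intro: borel_measurable_continuous_onI)
    have "(LBINT z. \<phi>t z * f z) = (LBINT z. \<phi>t (prod.swap z) * f (prod.swap z))"
      by (rule plane_integral_swap[symmetric]) simp
    moreover have "(LBINT z. \<phi> z * g z) = (LBINT z. \<phi> (prod.swap z) * g (prod.swap z))"
      by (rule plane_integral_swap[symmetric]) simp
    ultimately show "(LBINT z. \<phi>t z * f z) = - (LBINT z. \<phi> z * g z)"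
      using R t' unfolding wdr_def o_def by simp
  qed
qed

section \<open>Weak derivatives along slices\<close>

text \<open>Smooth approximations of the indicator of \<open>[x, y]\<close> from inside, with layers of width \<open>1/n\<close>.\<close>

definition plateau :: "nat => real => real => real => real" where
  "plateau n x y s = ramp (real n * (s - x)) * ramp (real n * (y - s))"

definition plateau' :: "nat => real => real => real => real" where
  "plateau' n x y s = tent (real n * (s - x)) * real n * ramp (real n * (y - s))
     - ramp (real n * (s - x)) * (tent (real n * (y - s)) * real n)"

lemma plateau_deriv: "(plateau n x y has_real_derivative plateau' n x y s) (at s)"
  unfolding plateau_def[abs_def] plateau'_def by (auto intro!: derivative_eq_intros)

lemma continuous_plateau: "continuous_on S (plateau n x y)" "continuous_on S (plateau' n x y)"
  unfolding plateau_def[abs_def] plateau'_def[abs_def] by (intro continuous_intros)+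

lemma plateau_outside: "s \<notin> {x..y} ==> plateau n x y s = 0 \<and> plateau' n x y s = 0"
proof -
  assume "s \<notin> {x..y}"
  then have "real n * (s - x) \<le> 0 \<or> real n * (y - s) \<le> 0"
    by (auto simp: mult_le_0_iff)
  then show ?thesis
    by (auto simp: plateau_def plateau'_def ramp_eq_0 tent_eq_0)
qed

lemma plateau_bounds: "0 \<le> plateau n x y s" "plateau n x y s \<le> 1"
  unfolding plateau_def by (auto intro!: mult_nonneg_nonneg mult_le_one ramp_nonneg ramp_le_1)

lemma plateau_tendsto: "(\<lambda>n. plateau n x y s) \<longlonglongrightarrow> indicator {x<..<y} s"
proof (cases "x < s \<and> s < y")
  case True
  obtain N :: nat where N: "real N > 2 / (s - x)" "real N > 2 / (y - s)"
    using reals_Archimedean2[of "max (2 / (s - x)) (2 / (y - s))"] by auto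
  have "plateau n x y s = 1" if "n \<ge> N" for n
  proof -
    have "real n > 2 / (s - x)" "real n > 2 / (y - s)" using N that by auto
    then have "real n * (s - x) \<ge> 2" "real n * (y - s) \<ge> 2"
      using True by (auto simp: field_simps)
    then show ?thesis by (simp add: plateau_def ramp_eq_1)
  qed
  then have "eventually (\<lambda>n. plateau n x y s = indicator {x<..<y} s) sequentially"
    using True by (auto simp: eventually_sequentially)
  then show ?thesis by (rule tendsto_eventually)
next
  case False
  then have neg: "real n * (s - x) \<le> 0 \<or> real n * (y - s) \<le> 0" for n
    by (auto simp: mult_le_0_iff)
  have "plateau n x y s = 0" for n
    using neg[of n] ramp_eq_0[of "real n * (s - x)"] ramp_eq_0[of "real n * (y - s)"]
    by (auto simp: plateau_def)
  then show ?thesis using False by simp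
qed

lemma plateau_integral_tendsto:
  assumes "integrable lborel w"
  shows "(\<lambda>n. LBINT s. plateau n x y s * w s) \<longlonglongrightarrow> (LBINT s:{x..y}. w s)"
proof -
  have "(\<lambda>n. LBINT s. plateau n x y s * w s) \<longlonglongrightarrow> (LBINT s. indicator {x<..<y} s * w s)"
  proof (rule integral_dominated_convergence[where w="\<lambda>s. \<bar>w s\<bar>"])
    have "plateau n x y \<in> borel_measurable borel" for n
      by (intro borel_measurable_continuous_onI continuous_plateau)
    then show "(\<lambda>s. plateau n x y s * w s) \<in> borel_measurable lborel" for n
      using assms by auto
    show "(\<lambda>s. indicator {x<..<y} s * w s) \<in> borel_measurable lborel" using assms by auto
    show "integrable lborel (\<lambda>s. \<bar>w s\<bar>)" using assms by auto
    show "AE s in lborel. (\<lambda>n. plateau n x y s * w s) \<longlonglongrightarrow> indicator {x<..<y} s * w s"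
      by (intro always_eventually allI tendsto_mult plateau_tendsto tendsto_const)
    show "AE s in lborel. norm (plateau n x y s * w s) \<le> \<bar>w s\<bar>" for n
      using plateau_bounds[of n x y]
      by (intro always_eventually allI) (auto simp: abs_mult intro!: mult_left_le_one_le)
  qed
  also have "(LBINT s. indicator {x<..<y} s * w s) = (LBINT s:{x..y}. w s)"
    unfolding set_lebesgue_integral_def
  proof (rule integral_cong_AE)
    show "AE s in lborel. indicator {x<..<y} s * w s = indicator {x..y} s *\<^sub>R w s"
      using AE_lborel_singleton[of x] AE_lborel_singleton[of y]
      by eventually_elim (auto simp: indicator_def)
  qed (use assms in auto)
  finally show ?thesis .
qed

lemma primitive_bump:
  fixes k :: "real => real"
  assumes k: "continuous_on UNIV k" and z: "\<And>s. s \<notin> {p..q} ==> k s = 0" and pq: "p \<le> q"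
    and int: "integral {p..q} k = 0"
  shows "((\<lambda>r. integral {p..r} k) has_real_derivative k r) (at r)"
    and "r \<notin> {p..q} ==> integral {p..r} k = 0"
proof -
  define m where "m = min p r - 1"
  have ii: "k integrable_on {a..b}" for a b
    by (rule integrable_continuous_real) (use k in \<open>auto intro: continuous_on_subset\<close>)
  have zero: "integral {a..b} k = 0" if "\<And>s. s \<in> {a..b} ==> s < p \<or> s > q" for a b
  proof -
    have "integral {a..b} k = integral {a..b} (\<lambda>_. 0)"
      using that z by (intro Henstock_Kurzweil_Integration.integral_cong) force
    then show ?thesis by simp
  qed
  have eq: "integral {m..s} k = integral {p..s} k" if "s > m" for s
  proof (cases "s < p")
    case True then show ?thesis using zero[of m s] by auto
  next
    case False
    have "integral {m..p} k = 0"
    proof -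
      have "continuous_on UNIV k" by fact
      have kp: "k s = 0" if "s < p" for s using z that by auto
      have "integral {m..p} k = integral {m..p} (\<lambda>_. 0)"
        by (rule integral_spike[of "{p}"]) (use kp in auto)
      then show ?thesis by simp
    qed
    then show ?thesis
      using Henstock_Kurzweil_Integration.integral_combine[of m p s k] ii False by (simp add: m_def)
  qed
  have "((\<lambda>x. integral {m..x} k) has_real_derivative k r) (at r within {m..r+1})"
    by (rule integral_has_real_derivative) (use k in \<open>auto simp: m_def intro: continuous_on_subset\<close>)
  then have "((\<lambda>x. integral {m..x} k) has_real_derivative k r) (at r)"
    by (subst (asm) at_within_interior) (auto simp: m_def)
  then show "((\<lambda>r. integral {p..r} k) has_real_derivative k r) (at r)"
    by (rule has_field_derivative_transform_within_open[of _ _ _ "{m<..}"]) (use eq in \<open>auto simp: m_def\<close>)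
  assume r: "r \<notin> {p..q}"
  show "integral {p..r} k = 0"
  proof (cases "r < p")
    case False
    then have "r > q" using r by auto
    have "integral {q..r} k = integral {q..r} (\<lambda>_. 0)"
      by (rule integral_spike[of "{q}"]) (use z in auto)
    then show ?thesis using Henstock_Kurzweil_Integration.integral_combine[of p q r k] ii int \<open>r > q\<close> pq by simp
  qed simp
qed

definition plateau_mass :: "nat => real => real => real" where
  "plateau_mass n x y = integral {x..y} (plateau n x y)"

lemma plateau_integral: "p \<le> x ==> y \<le> q ==> integral {p..q} (plateau n x y) = plateau_mass n x y"
proof -
  assume "p \<le> x" "y \<le> q"
  have "integral {p..q} (plateau n x y) = integral {p..q} (\<lambda>s. if s \<in> {x..y} then plateau n x y s else 0)"
    using plateau_outside[of _ x y n] by (intro Henstock_Kurzweil_Integration.integral_cong) presburger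
  also have "\<dots> = integral {x..y} (plateau n x y)"
    unfolding integral_restrict_Int using \<open>p \<le> x\<close> \<open>y \<le> q\<close> by (simp add: Int_absorb1)
  finally show ?thesis by (simp add: plateau_mass_def)
qed

lemma plateau_mass_tendsto:
  assumes "x \<le> y" shows "(\<lambda>n. plateau_mass n x y) \<longlonglongrightarrow> y - x"
proof -
  have i: "integrable lborel (indicat_real {x..y})" by (simp add: integrable_indicator_iff emeasure_lborel_Icc_eq)
  have "(\<lambda>n. LBINT s. plateau n x y s * indicator {x..y} s) \<longlonglongrightarrow> (LBINT s:{x..y}. indicator {x..y} s)"
    by (rule plateau_integral_tendsto[OF i])
  also have "(LBINT s:{x..y}. indicat_real {x..y} s) = y - x"
    using assms unfolding set_lebesgue_integral_def by (simp add: indicator_inter_arith[symmetric])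
  also have "(\<lambda>n. LBINT s. plateau n x y s * indicator {x..y} s) = (\<lambda>n. plateau_mass n x y)"
  proof
    fix n
    have "set_integrable lborel {x..y} (plateau n x y)"
      unfolding set_integrable_def by (intro borel_integrable_compact continuous_plateau) auto
    from set_borel_integral_eq_integral(2)[OF this]
    show "(LBINT s. plateau n x y s * indicator {x..y} s) = plateau_mass n x y"
      by (simp add: plateau_mass_def set_lebesgue_integral_def mult.commute)
  qed
  finally show ?thesis .
qed

text \<open>The weights make the total integral vanish, so the primitive \<open>hat\<close> has compact support.\<close>

definition hat' :: "nat => real => real => real => real => real => real" where
  "hat' n p q x y s = plateau_mass n p q * plateau n x y s - plateau_mass n x y * plateau n p q s"

definition hat :: "nat => real => real => real => real => real => real" where
  "hat n p q x y r = integral {p..r} (hat' n p q x y)"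

lemma continuous_hat': "continuous_on S (hat' n p q x y)"
  unfolding hat'_def[abs_def] by (intro continuous_intros continuous_plateau)

lemma hat:
  assumes "p \<le> x" "x \<le> y" "y \<le> q"
  shows "(hat n p q x y has_real_derivative hat' n p q x y r) (at r)"
    and "r \<notin> {p..q} ==> hat n p q x y r = 0 \<and> hat' n p q x y r = 0"
    and "hat n p q x y p = 0" "hat n p q x y q = 0"
proof -
  have z: "hat' n p q x y s = 0" if "s \<notin> {p..q}" for s
    using that plateau_outside[of s x y n] plateau_outside[of s p q n] assms by (auto simp: hat'_def)
  have pi: "plateau n a b integrable_on {p..q}" for a b
    by (intro integrable_continuous_real continuous_plateau)
  have i: "integral {p..q} (hat' n p q x y) = 0"
    unfolding hat'_def[abs_def] using assms plateau_integral[of p x y q n] plateau_integral[of p p q q n]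
    by (subst Henstock_Kurzweil_Integration.integral_diff) (auto intro: pi integrable_cmul[where 'b=real, simplified])
  have pq: "p \<le> q" using assms by simp
  note b = primitive_bump[OF continuous_hat' z pq i]
  show "(hat n p q x y has_real_derivative hat' n p q x y r) (at r)"
    unfolding hat_def[abs_def] by (rule b(1))
  show "r \<notin> {p..q} ==> hat n p q x y r = 0 \<and> hat' n p q x y r = 0"
    using b(2)[of r] z by (simp add: hat_def)
  show "hat n p q x y p = 0" "hat n p q x y q = 0" using i by (auto simp: hat_def)
qed

lemma ac_primitive:
  assumes "set_integrable lborel {p..q} g"
  shows "ac p q (\<lambda>r. c + (LBINT s:{p..r}. g s)) g"
  unfolding ac_def
proof (intro conjI allI impI)
  fix x y assume "p \<le> x" "x \<le> y" "y \<le> q"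
  then show "c + (LBINT s:{p..y}. g s) - (c + (LBINT s:{p..x}. g s)) = (LBINT s:{x..y}. g s)"
    using set_integral_Icc_combine[of p y g x] set_integrable_subset[OF assms, of "{p..y}"] by simp
qed fact

text \<open>The test functions \<open>hat\<close> have a derivative with two plateaux of opposite sign and equal
  mass. Against \<open>f\<close> minus a primitive of \<open>g\<close> they say that this difference has the same
  mean value over all intervals.\<close>

lemma ac_if_weak_derivative:
  fixes f g :: "real => real"
  assumes pq: "p < q" "p \<in> \<rat>" and f: "set_integrable lborel {p..q} f" and g: "set_integrable lborel {p..q} g"
    and w: "\<And>n x y. x \<in> \<rat> ==> y \<in> \<rat> ==> p \<le> x ==> x < y ==> y \<le> q ==>
      (LBINT r:{p..q}. hat' n p q x y r * f r + hat n p q x y r * g r) = 0"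
  shows "\<exists>F. ac p q F g \<and> (AE r in lborel. r \<in> {p..q} --> f r = F r)"
proof -
  define G where "G r = 0 + (LBINT s:{p..r}. g s)" for r
  have G: "ac p q G g" unfolding G_def by (rule ac_primitive[OF g])
  have Gi: "set_integrable lborel {p..q} G"
    unfolding set_integrable_def by (intro borel_integrable_compact ac_continuous[OF G]) auto
  define h where "h r = f r - G r" for r
  have hi: "set_integrable lborel {p..q} h" unfolding h_def using f Gi by (intro set_integral_diff(1))
  define h0 where "h0 r = indicator {p..q} r * h r" for r
  have h0: "integrable lborel h0" using hi unfolding set_integrable_def h0_def by simp
  have pl: "(LBINT s. plateau n x y s * h0 s) = (LBINT r:{p..q}. plateau n x y r * h r)" for n x y
    unfolding h0_def set_lebesgue_integral_def by (intro Bochner_Integration.integral_cong) (auto simp: indicator_def)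
  have h0x: "(LBINT s:{x..y}. h0 s) = (LBINT s:{x..y}. h s)" if "p \<le> x" "y \<le> q" for x y
    unfolding h0_def set_lebesgue_integral_def using that
    by (intro Bochner_Integration.integral_cong) (auto simp: indicator_def)
  (* the derivative of hat tends to (q - p) times the indicator of [x, y] minus (y - x) times that of [p, q] *)
  have mean: "(q - p) * (LBINT s:{x..y}. h s) = (y - x) * (LBINT s:{p..q}. h s)"
    if xy: "x \<in> \<rat>" "y \<in> \<rat>" "p \<le> x" "x < y" "y \<le> q" for x y
  proof -
    have eq: "plateau_mass n p q * (LBINT r:{p..q}. plateau n x y r * h r)
        = plateau_mass n x y * (LBINT r:{p..q}. plateau n p q r * h r)" for n
    proof -
      have hac: "ac p q (hat n p q x y) (hat' n p q x y)"
        by (rule ac_C1) (use hat(1)[of p x y q] xy continuous_hat' in auto)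
      have "(LBINT r:{p..q}. hat' n p q x y r * G r + hat n p q x y r * g r) = 0"
        using ac_diff[OF ac_mult[OF hac G], of p q] pq hat(3,4)[of p x y q n] xy by simp
      moreover note w[OF xy, of n]
      moreover have i1: "set_integrable lborel {p..q} (\<lambda>r. hat' n p q x y r * f r)"
          "set_integrable lborel {p..q} (\<lambda>r. hat' n p q x y r * G r)"
          "set_integrable lborel {p..q} (\<lambda>r. hat n p q x y r * g r)"
        using f g Gi by (auto intro!: set_integrable_mult_continuous continuous_hat' ac_continuous[OF hac])
      ultimately have "(LBINT r:{p..q}. hat' n p q x y r * f r) - (LBINT r:{p..q}. hat' n p q x y r * G r) = 0"
        by (simp add: set_integral_add)
      then have "(LBINT r:{p..q}. hat' n p q x y r * f r - hat' n p q x y r * G r) = 0"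
        using i1 by (subst set_integral_diff(2)) auto
      then have "(LBINT r:{p..q}. plateau_mass n p q * (plateau n x y r * h r) - plateau_mass n x y * (plateau n p q r * h r)) = 0"
        by (simp add: hat'_def h_def algebra_simps)
      moreover have "set_integrable lborel {p..q} (\<lambda>r. plateau n a b r * h r)" for a b
        by (intro set_integrable_mult_continuous continuous_plateau hi compact_Icc)
      ultimately show ?thesis
        by (subst (asm) set_integral_diff(2)) auto
    qed
    have L1: "(\<lambda>n. (LBINT r:{p..q}. plateau n x y r * h r)) \<longlonglongrightarrow> (LBINT s:{x..y}. h s)" if "p \<le> x" "y \<le> q" for x y
      using plateau_integral_tendsto[OF h0, of x y] h0x[OF that] unfolding pl by simp
    have "(\<lambda>n. plateau_mass n p q * (LBINT r:{p..q}. plateau n x y r * h r)) \<longlonglongrightarrow> (q - p) * (LBINT s:{x..y}. h s)"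
      using pq xy by (intro tendsto_mult plateau_mass_tendsto L1) auto
    moreover have "(\<lambda>n. plateau_mass n p q * (LBINT r:{p..q}. plateau n x y r * h r)) \<longlonglongrightarrow> (y - x) * (LBINT s:{p..q}. h s)"
      unfolding eq using pq xy by (intro tendsto_mult plateau_mass_tendsto L1) auto
    ultimately show ?thesis by (rule LIMSEQ_unique)
  qed
  define c where "c = (LBINT s:{p..q}. h s) / (q - p)"
  define J where "J y = (0 + (LBINT s:{p..y}. h s)) - c * (y - p)" for y
  have hc: "set_integrable lborel {p..q} (\<lambda>s. h s - c)"
    using hi by (intro set_integral_diff(1)) (auto simp: set_integrable_def integrable_indicator_iff emeasure_lborel_Icc_eq)
  have "ac p q (\<lambda>y. c * (y - p)) (\<lambda>_. c)" by (rule ac_C1) (auto intro!: derivative_eq_intros)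
  from ac_minus[OF ac_primitive[OF hi, of 0] this] have Jac: "ac p q J (\<lambda>s. h s - c)" unfolding J_def .
  have Jc: "continuous_on {p..q} J" by (rule ac_continuous[OF Jac])
  have Jrat: "J y = 0" if "y \<in> \<rat>" "p < y" "y \<le> q" for y
    using mean[of p y] pq that by (simp add: J_def c_def field_simps)
  have J0: "J y = 0" if y: "p \<le> y" "y \<le> q" for y
  proof (cases "y = p")
    case True
    have "(LBINT s:{p..p}. h s) = 0"
      using ac_diff[OF ac_primitive[OF hi, of 0], of p p] pq by simp
    then show ?thesis using True by (simp add: J_def)
  next
    case False
    show ?thesis
    proof (rule ccontr)
      assume "J y \<noteq> 0"
      then obtain d where d: "d > 0" "\<And>x. x \<in> {p..q} ==> \<bar>x - y\<bar> < d ==> \<bar>J x - J y\<bar> < \<bar>J y\<bar>"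
        using Jc y unfolding continuous_on_iff dist_real_def by (metis atLeastAtMost_iff zero_less_abs_iff)
      have "max p (y - d) < y" using False y d by auto
      then obtain x where x: "x \<in> \<rat>" "max p (y - d) < x" "x < y" using Rats_dense_in_real by blast
      then show False using d(2)[of x] Jrat[of x] y by auto
    qed
  qed
  have "AE s in lborel. s \<in> {p..q} --> h s - c = 0"
  proof (rule AE_zero_if_interval_integrals_zero[OF hc])
    fix x y assume "p \<le> x" "x \<le> y" "y \<le> q"
    then show "(LBINT s:{x..y}. h s - c) = 0" using ac_diff[OF Jac, of x y] J0[of x] J0[of y] by simp
  qed
  then have "AE r in lborel. r \<in> {p..q} --> f r = c + (LBINT s:{p..r}. g s)"
    by (rule AE_mp) (auto simp: h_def G_def)
  then show ?thesis using ac_primitive[OF g, of c] by blast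
qed

lemma test_on_product:
  assumes "\<And>s. (\<zeta> has_real_derivative \<zeta>' s) (at s)" "continuous_on UNIV \<zeta>'"
    and "\<And>s. s \<notin> {p..q} ==> \<zeta> s = 0 \<and> \<zeta>' s = 0"
    and "\<And>s. (\<psi> has_real_derivative \<psi>' s) (at s)" "continuous_on UNIV \<psi>'"
    and "\<And>s. s \<notin> {t1..t2} ==> \<psi> s = 0 \<and> \<psi>' s = 0"
    and Q: "{p..q} \<times> {t1..t2} \<subseteq> Q"
  shows "test_on Q (\<lambda>z. \<zeta> (fst z) * \<psi> (snd z)) (\<lambda>z. \<zeta>' (fst z) * \<psi> (snd z)) (\<lambda>z. \<zeta> (fst z) * \<psi>' (snd z))"
  unfolding test_on_def
proof (intro conjI allI)
  fix z :: "real \<times> real"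
  have 1: "((\<lambda>z. \<zeta> (fst z)) has_derivative (\<lambda>h. \<zeta>' (fst z) * fst h)) (at z)"
    using has_derivative_compose[OF has_derivative_fst[OF has_derivative_ident] assms(1)[unfolded has_field_derivative_def], of z UNIV]
    by simp
  have 2: "((\<lambda>z. \<psi> (snd z)) has_derivative (\<lambda>h. \<psi>' (snd z) * snd h)) (at z)"
    using has_derivative_compose[OF has_derivative_snd[OF has_derivative_ident] assms(4)[unfolded has_field_derivative_def], of z UNIV]
    by simp
  show "((\<lambda>z. \<zeta> (fst z) * \<psi> (snd z)) has_derivative
         (\<lambda>(x, y). \<zeta>' (fst z) * \<psi> (snd z) * x + \<zeta> (fst z) * \<psi>' (snd z) * y)) (at z)"
    using has_derivative_mult[OF 1 2] by (simp add: split_beta' algebra_simps)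
next
  have c: "continuous_on UNIV \<zeta>" "continuous_on UNIV \<psi>"
    using assms(1,4) by (auto intro!: DERIV_continuous_on[of UNIV] simp: has_field_derivative_at_within)
  have c1: "continuous_on UNIV (\<lambda>z::real\<times>real. f (fst z))" and c2: "continuous_on UNIV (\<lambda>z::real\<times>real. f (snd z))"
    if "continuous_on UNIV f" for f :: "real => real"
    using continuous_on_compose2[OF that continuous_on_fst[OF continuous_on_id]]
      continuous_on_compose2[OF that continuous_on_snd[OF continuous_on_id]] by auto
  show "continuous_on UNIV (\<lambda>z. \<zeta>' (fst z) * \<psi> (snd z))"
    by (intro continuous_on_mult c1 c2 c assms)
  show "continuous_on UNIV (\<lambda>z. \<zeta> (fst z) * \<psi>' (snd z))"
    by (intro continuous_on_mult c1 c2 c assms)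
  have "compact ({p..q} \<times> {t1..t2})" by (intro compact_Times compact_Icc)
  moreover have "\<zeta> (fst z) * \<psi> (snd z) = 0 \<and> \<zeta>' (fst z) * \<psi> (snd z) = 0 \<and> \<zeta> (fst z) * \<psi>' (snd z) = 0"
    if "z \<notin> {p..q} \<times> {t1..t2}" for z
  proof -
    have "fst z \<notin> {p..q} \<or> snd z \<notin> {t1..t2}" using that by (metis mem_Times_iff)
    then show ?thesis using assms(3,6) by auto
  qed
  ultimately show "\<exists>K. compact K \<and> K \<subseteq> Q \<and> (\<forall>z. z \<notin> K -->
      \<zeta> (fst z) * \<psi> (snd z) = 0 \<and> \<zeta>' (fst z) * \<psi> (snd z) = 0 \<and> \<zeta> (fst z) * \<psi>' (snd z) = 0)"
    using Q by blast
qed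

lemma loc_int_slices:
  assumes "loc_int Q f" "{p..q} \<times> {t1..t2} \<subseteq> Q"
  shows "AE t in lborel. t \<in> {t1..t2} --> set_integrable lborel {p..q} (\<lambda>r. f (r, t))"
proof -
  have "integrable lborel (\<lambda>z. indicator ({p..q} \<times> {t1..t2}) z *\<^sub>R f z)"
    using assms compact_Times[OF compact_Icc[of p q] compact_Icc[of t1 t2]]
    unfolding loc_int_def set_integrable_def by blast
  from plane_Fubini(1)[OF this] show ?thesis
  proof (rule AE_mp, intro always_eventually allI impI)
    fix t assume i: "integrable lborel (\<lambda>r. indicator ({p..q} \<times> {t1..t2}) (r, t) *\<^sub>R f (r, t))" and t: "t \<in> {t1..t2}"
    have "(\<lambda>r. indicat_real ({p..q} \<times> {t1..t2}) (r, t) *\<^sub>R f (r, t)) = (\<lambda>r. indicat_real {p..q} r *\<^sub>R f (r, t))"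
      using t by (auto simp: indicator_def fun_eq_iff)
    then show "set_integrable lborel {p..q} (\<lambda>r. f (r, t))"
      using i unfolding set_integrable_def by simp
  qed
qed

text \<open>Testing with products of a function of \<open>r\<close> and plateaux in \<open>t\<close>, which exhaust all time intervals,
  yields the one-dimensional weak formulation on almost every slice.\<close>

lemma wdr_slice_test:
  assumes w: "wdr Q f g" and Q: "{p..q} \<times> {t1..t2} \<subseteq> Q"
    and \<zeta>: "\<And>s. (\<zeta> has_real_derivative \<zeta>' s) (at s)" "continuous_on UNIV \<zeta>'"
      "\<And>s. s \<notin> {p..q} ==> \<zeta> s = 0 \<and> \<zeta>' s = 0"
  shows "AE t in lborel. t \<in> {t1..t2} --> (LBINT r:{p..q}. \<zeta>' r * f (r, t) + \<zeta> r * g (r, t)) = 0"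
proof -
  define B where "B = {p..q} \<times> {t1..t2}"
  have B: "compact B" "B \<subseteq> Q" unfolding B_def using Q by (auto intro: compact_Times)
  have \<zeta>c: "continuous_on UNIV \<zeta>"
    using \<zeta>(1) by (auto intro!: DERIV_continuous_on[of UNIV] simp: has_field_derivative_at_within)
  have c1: "continuous_on UNIV (\<lambda>z::real\<times>real. k (fst z))" and c2: "continuous_on UNIV (\<lambda>z::real\<times>real. k (snd z))"
    if "continuous_on UNIV k" for k :: "real => real"
    using continuous_on_compose2[OF that continuous_on_fst[OF continuous_on_id]]
      continuous_on_compose2[OF that continuous_on_snd[OF continuous_on_id]] by auto
  define H where "H z = indicator B z *\<^sub>R (\<zeta>' (fst z) * f z + \<zeta> (fst z) * g z)" for z
  have li: "loc_int Q (\<lambda>z. \<zeta>' (fst z) * f z + \<zeta> (fst z) * g z)"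
    using w by (intro loc_int_add loc_int_continuous_mult c1 \<zeta> \<zeta>c) (auto simp: wdr_def)
  have H: "integrable lborel H"
    using li B unfolding loc_int_def set_integrable_def H_def by blast
  define A where "A t = (LBINT r. H (r, t))" for t
  have A: "integrable lborel A" unfolding A_def by (rule plane_Fubini(2)[OF H])
  have Aeq: "A t = (LBINT r:{p..q}. \<zeta>' r * f (r, t) + \<zeta> r * g (r, t))" if "t \<in> {t1..t2}" for t
    unfolding A_def set_lebesgue_integral_def H_def B_def using that
    by (intro Bochner_Integration.integral_cong) (auto simp: indicator_def)
  have "AE t in lborel. t \<in> {t1..t2} --> A t = 0"
  proof (rule AE_zero_if_interval_integrals_zero)
    show "set_integrable lborel {t1..t2} A"
      unfolding set_integrable_def using A by (intro integrable_mult_indicator) auto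
    fix s1 s2 assume s: "t1 \<le> s1" "s1 \<le> s2" "s2 \<le> t2"
    have "(LBINT t. plateau n s1 s2 t * A t) = 0" for n
    proof -
      have t: "test_on Q (\<lambda>z. \<zeta> (fst z) * plateau n s1 s2 (snd z)) (\<lambda>z. \<zeta>' (fst z) * plateau n s1 s2 (snd z))
          (\<lambda>z. \<zeta> (fst z) * plateau' n s1 s2 (snd z))"
        using plateau_outside[of _ s1 s2 n] s
        by (intro test_on_product[OF \<zeta> plateau_deriv continuous_plateau(2) _ Q]) auto
      have "(LBINT z. \<zeta>' (fst z) * plateau n s1 s2 (snd z) * f z)
         = - (LBINT z. \<zeta> (fst z) * plateau n s1 s2 (snd z) * g z)"
        using w t unfolding wdr_def by blast
      then have "(LBINT z. \<zeta>' (fst z) * plateau n s1 s2 (snd z) * f z + \<zeta> (fst z) * plateau n s1 s2 (snd z) * g z) = 0"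
        using test_on_integrable[OF t] w by (subst Bochner_Integration.integral_add) (auto simp: wdr_def)
      also have "(\<lambda>z. \<zeta>' (fst z) * plateau n s1 s2 (snd z) * f z + \<zeta> (fst z) * plateau n s1 s2 (snd z) * g z)
          = (\<lambda>z. plateau n s1 s2 (snd z) * H z)"
      proof
        fix z :: "real \<times> real"
        have "z \<in> B \<or> fst z \<notin> {p..q} \<or> snd z \<notin> {s1..s2}" using s by (auto simp: B_def mem_Times_iff)
        then show "\<zeta>' (fst z) * plateau n s1 s2 (snd z) * f z + \<zeta> (fst z) * plateau n s1 s2 (snd z) * g z
            = plateau n s1 s2 (snd z) * H z"
          using \<zeta>(3)[of "fst z"] plateau_outside[of "snd z" s1 s2 n]
          by (auto simp: H_def indicator_def algebra_simps)
      qed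
      finally have 0: "(LBINT z. plateau n s1 s2 (snd z) * H z) = 0" .
      have "integrable lborel (\<lambda>z. plateau n s1 s2 (snd z) * H z)"
      proof (rule Bochner_Integration.integrable_bound[OF H])
        have "(\<lambda>z::real\<times>real. plateau n s1 s2 (snd z)) \<in> borel_measurable borel"
          by (intro borel_measurable_continuous_onI c2 continuous_plateau)
        then show "(\<lambda>z. plateau n s1 s2 (snd z) * H z) \<in> borel_measurable lborel" using H by auto
        show "AE z in lborel. norm (plateau n s1 s2 (snd z) * H z) \<le> norm (H z)"
          using plateau_bounds by (intro always_eventually allI) (auto simp: abs_mult intro!: mult_left_le_one_le)
      qed
      from plane_Fubini(3)[OF this] 0 show ?thesis by (simp add: A_def)
    qed
    with plateau_integral_tendsto[OF A, of s1 s2] show "(LBINT t:{s1..s2}. A t) = 0"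
      using LIMSEQ_unique[OF tendsto_const] by fastforce
  qed
  then show ?thesis by (rule AE_mp) (use Aeq in auto)
qed

text \<open>Countably many boxes suffice to reach every segment, so that the exceptional null sets of times
  can be united.\<close>

lemma rational_box:
  fixes Q :: "(real \<times> real) set"
  assumes "open Q" "{p..q} \<times> {t} \<subseteq> Q"
  obtains p' q' t1 t2 where "p' \<in> \<rat>" "q' \<in> \<rat>" "t1 \<in> \<rat>" "t2 \<in> \<rat>" "p' < p" "q < q'" "t1 < t" "t < t2"
    "{p'..q'} \<times> {t1..t2} \<subseteq> Q"
proof -
  have "compact ({p..q} \<times> {t})" by (intro compact_Times) auto
  then obtain e where e: "e > 0" "(\<Union>x\<in>{p..q} \<times> {t}. ball x e) \<subseteq> Q"
    using compact_subset_open_imp_ball_epsilon_subset assms by metis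
  show ?thesis
  proof (cases "p \<le> q")
    case True
    obtain p' where p': "p' \<in> \<rat>" "p - e/2 < p'" "p' < p" using Rats_dense_in_real[of "p - e/2" p] e by auto
    obtain q' where q': "q' \<in> \<rat>" "q < q'" "q' < q + e/2" using Rats_dense_in_real[of q "q + e/2"] e by auto
    obtain t1 where t1: "t1 \<in> \<rat>" "t - e/2 < t1" "t1 < t" using Rats_dense_in_real[of "t - e/2" t] e by auto
    obtain t2 where t2: "t2 \<in> \<rat>" "t < t2" "t2 < t + e/2" using Rats_dense_in_real[of t "t + e/2"] e by auto
    have "{p'..q'} \<times> {t1..t2} \<subseteq> Q"
    proof
      fix z assume z: "z \<in> {p'..q'} \<times> {t1..t2}"
      define x where "x = max p (min q (fst z))"
      have "dist (x, t) z \<le> \<bar>x - fst z\<bar> + \<bar>t - snd z\<bar>"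
        using sqrt_sum_squares_le_sum_abs by (auto simp: dist_prod_def dist_real_def split_beta)
      also have "\<dots> < e" using z p' q' t1 t2 True unfolding x_def by (auto simp: mem_Times_iff)
      finally have "z \<in> ball (x, t) e" by simp
      moreover have "(x, t) \<in> {p..q} \<times> {t}" using True by (auto simp: x_def)
      ultimately show "z \<in> Q" using e(2) by blast
    qed
    with that p' q' t1 t2 show ?thesis by blast
  next
    case False
    define m where "m = (p + q) / 2"
    obtain p' where p': "p' \<in> \<rat>" "m < p'" "p' < p" using Rats_dense_in_real[of m p] False by (auto simp: m_def)
    obtain q' where q': "q' \<in> \<rat>" "q < q'" "q' < m" using Rats_dense_in_real[of q m] False by (auto simp: m_def)
    obtain t1 where t1: "t1 \<in> \<rat>" "t - 1 < t1" "t1 < t" using Rats_dense_in_real[of "t - 1" t] by auto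
    obtain t2 where t2: "t2 \<in> \<rat>" "t < t2" "t2 < t + 1" using Rats_dense_in_real[of t "t + 1"] by auto
    have "{p'..q'} = {}" using p' q' by auto
    with that p' q' t1 t2 show ?thesis by blast
  qed
qed

theorem wdr_slices:
  assumes Q: "open Q" and w: "wdr Q f g"
  shows "AE t in lborel. \<forall>p q. p < q --> {p..q} \<times> {t} \<subseteq> Q -->
    (\<exists>F. ac p q F (\<lambda>r. g (r, t)) \<and> (AE r in lborel. r \<in> {p..q} --> f (r, t) = F r))"
proof -
  define I where "I = {(p, q, t1, t2). (p::real) \<in> \<rat> \<and> (q::real) \<in> \<rat> \<and> (t1::real) \<in> \<rat> \<and> (t2::real) \<in> \<rat> \<and>
     p < q \<and> {p..q} \<times> {t1..t2} \<subseteq> Q}"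
  have "I \<subseteq> \<rat> \<times> \<rat> \<times> \<rat> \<times> \<rat>" by (auto simp: I_def)
  then have I: "countable I" by (rule countable_subset) (intro countable_SIGMA countable_rat)
  have fg: "loc_int Q f" "loc_int Q g" using w by (auto simp: wdr_def)
  have key: "AE t in lborel. t \<in> {t1..t2} -->
     (\<exists>F. ac p q F (\<lambda>r. g (r, t)) \<and> (AE r in lborel. r \<in> {p..q} --> f (r, t) = F r))"
    if pq: "p \<in> \<rat>" "p < q" "{p..q} \<times> {t1..t2} \<subseteq> Q" for p q t1 t2
  proof -
    define X where "X = {(n::nat, x, y). (x::real) \<in> \<rat> \<and> (y::real) \<in> \<rat> \<and> p \<le> x \<and> x < y \<and> y \<le> q}"
    have "X \<subseteq> UNIV \<times> \<rat> \<times> \<rat>" by (auto simp: X_def)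
    then have X: "countable X" by (rule countable_subset) (intro countable_SIGMA countable_rat, auto)
    have "AE t in lborel. \<forall>(n, x, y)\<in>X. t \<in> {t1..t2} -->
        (LBINT r:{p..q}. hat' n p q x y r * f (r, t) + hat n p q x y r * g (r, t)) = 0"
      unfolding split_beta'
    proof (subst AE_ball_countable[OF X], intro ballI)
      fix i assume i: "i \<in> X"
      obtain n x y where [simp]: "i = (n, x, y)" by (cases i)
      show "AE t in lborel. t \<in> {t1..t2} -->
        (LBINT r:{p..q}. hat' (fst i) p q (fst (snd i)) (snd (snd i)) r * f (r, t) +
           hat (fst i) p q (fst (snd i)) (snd (snd i)) r * g (r, t)) = 0"
      proof -
        have xy: "p \<le> x" "x \<le> y" "y \<le> q" using i by (auto simp: X_def)
        have "AE t in lborel. t \<in> {t1..t2} -->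
          (LBINT r:{p..q}. hat' n p q x y r * f (r, t) + hat n p q x y r * g (r, t)) = 0"
          by (rule wdr_slice_test[OF w pq(3)]) (use hat(1,2)[OF xy] continuous_hat' in blast)+
        then show ?thesis by simp
      qed
    qed
    with loc_int_slices[OF fg(1) pq(3)] loc_int_slices[OF fg(2) pq(3)] show ?thesis
    proof eventually_elim
      case (elim t)
      show ?case
      proof
        assume t: "t \<in> {t1..t2}"
        show "\<exists>F. ac p q F (\<lambda>r. g (r, t)) \<and> (AE r in lborel. r \<in> {p..q} --> f (r, t) = F r)"
        proof (rule ac_if_weak_derivative[OF pq(2,1)])
          show "set_integrable lborel {p..q} (\<lambda>r. f (r, t))" "set_integrable lborel {p..q} (\<lambda>r. g (r, t))"
            using elim t by auto
          fix n x y assume "x \<in> \<rat>" "y \<in> \<rat>" "p \<le> x" "x < y" "y \<le> q"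
          then have "(n, x, y) \<in> X" by (simp add: X_def)
          then show "(LBINT r:{p..q}. hat' n p q x y r * f (r, t) + hat n p q x y r * g (r, t)) = 0"
            using elim(3) t by fast
        qed
      qed
    qed
  qed
  have "AE t in lborel. \<forall>i\<in>I. t \<in> {fst (snd (snd i))..snd (snd (snd i))} -->
     (\<exists>F. ac (fst i) (fst (snd i)) F (\<lambda>r. g (r, t)) \<and> (AE r in lborel. r \<in> {fst i..fst (snd i)} --> f (r, t) = F r))"
    by (subst AE_ball_countable[OF I]) (use key in \<open>auto simp: I_def\<close>)
  then show ?thesis
  proof (rule AE_mp, intro always_eventually allI impI)
    fix t p q
    assume all: "\<forall>i\<in>I. t \<in> {fst (snd (snd i))..snd (snd (snd i))} -->
     (\<exists>F. ac (fst i) (fst (snd i)) F (\<lambda>r. g (r, t)) \<and> (AE r in lborel. r \<in> {fst i..fst (snd i)} --> f (r, t) = F r))"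
      and pq: "p < q" "{p..q} \<times> {t} \<subseteq> Q"
    obtain p' q' t1 t2 where b: "p' \<in> \<rat>" "q' \<in> \<rat>" "t1 \<in> \<rat>" "t2 \<in> \<rat>" "p' < p" "q < q'" "t1 < t" "t < t2"
      "{p'..q'} \<times> {t1..t2} \<subseteq> Q" using rational_box[OF Q pq(2)] .
    then have "(p', q', t1, t2) \<in> I" using pq by (auto simp: I_def)
    from all[rule_format, OF this] b obtain F where F: "ac p' q' F (\<lambda>r. g (r, t))"
      "AE r in lborel. r \<in> {p'..q'} --> f (r, t) = F r" by auto
    have "AE r in lborel. r \<in> {p..q} --> f (r, t) = F r"
      using F(2) by (rule AE_mp) (use b in auto)
    moreover have "ac p q F (\<lambda>r. g (r, t))" using F(1) b by (auto intro: ac_subset)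
    ultimately show "\<exists>F. ac p q F (\<lambda>r. g (r, t)) \<and> (AE r in lborel. r \<in> {p..q} --> f (r, t) = F r)" by blast
  qed
qed

lemma continuous_on_slice: "continuous_on UNIV f ==> continuous_on S (\<lambda>r. f (r, t))"
  for f :: "real \<times> real => real"
  by (rule continuous_on_compose2[of UNIV f]) (auto intro!: continuous_intros)

theorem wdr_slices_continuous:
  assumes Q: "open Q" and w: "wdr Q f g" and c: "continuous_on UNIV f"
  shows "AE t in lborel. \<forall>p q. p < q --> {p..q} \<times> {t} \<subseteq> Q --> ac p q (\<lambda>r. f (r, t)) (\<lambda>r. g (r, t))"
  using wdr_slices[OF Q w]
proof (rule AE_mp, intro always_eventually allI impI)
  fix t p q
  assume all: "\<forall>p q. p < q --> {p..q} \<times> {t} \<subseteq> Q -->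
      (\<exists>F. ac p q F (\<lambda>r. g (r, t)) \<and> (AE r in lborel. r \<in> {p..q} --> f (r, t) = F r))"
    and pq: "p < q" "{p..q} \<times> {t} \<subseteq> Q"
  then obtain F where F: "ac p q F (\<lambda>r. g (r, t))" "AE r in lborel. r \<in> {p..q} --> f (r, t) = F r"
    by blast
  have "f (r, t) = F r" if "r \<in> {p..q}" for r
    by (rule continuous_AE_eq[OF pq(1) continuous_on_slice[OF c] ac_continuous[OF F(1)] F(2) that])
  then show "ac p q (\<lambda>r. f (r, t)) (\<lambda>r. g (r, t))"
    using F(1) by (auto simp: ac_def)
qed

text \<open>On a slice the product of a test function and an absolutely continuous function integrates its
  derivative to zero; Fubini assembles the slices.\<close>

theorem wdrI_slices:
  assumes Q: "open Q" and fg: "loc_int Q f" "loc_int Q g"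
    and ae: "AE t in lborel. \<forall>p q. p < q --> {p..q} \<times> {t} \<subseteq> Q --> ac p q (\<lambda>r. f (r, t)) (\<lambda>r. g (r, t))"
  shows "wdr Q f g"
  unfolding wdr_def
proof (intro conjI fg allI impI)
  fix \<phi> \<phi>r \<phi>t assume t: "test_on Q \<phi> \<phi>r \<phi>t"
  note i = test_on_integrable[OF t]
  obtain K where K: "compact K" "K \<subseteq> Q" "\<And>z. z \<notin> K ==> \<phi> z = 0 \<and> \<phi>r z = 0 \<and> \<phi>t z = 0"
    using t unfolding test_on_def by blast
  obtain N where N: "N > 0" "\<And>z. z \<in> K ==> norm z < N"
    using compact_imp_bounded[OF K(1)] bounded_pos_less by metis
  have out: "\<phi> (r, s) = 0 \<and> \<phi>r (r, s) = 0" if "\<bar>r\<bar> \<ge> N" for r s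
    using K(3)[of "(r, s)"] N(2)[of "(r, s)"] norm_fst_le[of r s] that by fastforce
  have sum: "integrable lborel (\<lambda>z. \<phi>r z * f z + \<phi> z * g z)"
    by (intro Bochner_Integration.integrable_add i fg)
  have "AE t in lborel. (LBINT r. \<phi>r (r, t) * f (r, t) + \<phi> (r, t) * g (r, t)) = 0"
    using ae
  proof (rule AE_mp, intro always_eventually allI impI)
    fix s assume ac: "\<forall>p q. p < q --> {p..q} \<times> {s} \<subseteq> Q --> ac p q (\<lambda>r. f (r, s)) (\<lambda>r. g (r, s))"
    define k where "k r = \<phi>r (r, s) * f (r, s) + \<phi> (r, s) * g (r, s)" for r
    have "ac (-N) N (\<lambda>r. \<phi> (r, s) * f (r, s)) k"
    proof (rule ac_local)
      show "- N \<le> N" using N by simp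
      fix x
      show "\<exists>d>0. ac (x - d) (x + d) (\<lambda>r. \<phi> (r, s) * f (r, s)) k"
      proof (cases "(x, s) \<in> Q")
        case True
        then obtain e where e: "e > 0" "ball (x, s) e \<subseteq> Q" using Q openE by blast
        have "{x - e/2..x + e/2} \<times> {s} \<subseteq> Q"
          using e by (intro subset_trans[OF _ e(2)]) (auto simp: dist_prod_def dist_real_def)
        then have "ac (x - e/2) (x + e/2) (\<lambda>r. f (r, s)) (\<lambda>r. g (r, s))" using ac e(1) by auto
        moreover have "ac (x - e/2) (x + e/2) (\<lambda>r. \<phi> (r, s)) (\<lambda>r. \<phi>r (r, s))"
          by (rule ac_C1) (use test_on_slice[OF t] continuous_on_slice[OF test_on_continuous(2)[OF t]] in auto)
        ultimately have "ac (x - e/2) (x + e/2) (\<lambda>r. \<phi> (r, s) * f (r, s)) k"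
          unfolding k_def by (rule ac_mult[rotated])
        then show ?thesis using e(1) by (intro exI[of _ "e/2"]) auto
      next
        case False
        then have "(x, s) \<in> - K" using K(2) by auto
        moreover have "open (- K)" using K(1) by (simp add: compact_imp_closed open_Compl)
        ultimately obtain e where e: "e > 0" "ball (x, s) e \<subseteq> - K" using openE by blast
        have sub: "{x - e/2..x + e/2} \<times> {s} \<subseteq> - K"
          using e by (intro subset_trans[OF _ e(2)]) (auto simp: dist_prod_def dist_real_def)
        have z: "\<phi> (r, s) = 0" "k r = 0" if "r \<in> {x - e/2..x + e/2}" for r
        proof -
          have "(r, s) \<in> {x - e/2..x + e/2} \<times> {s}" using that by simp
          then have "(r, s) \<notin> K" using sub by blast
          then show "\<phi> (r, s) = 0" "k r = 0" using K(3)[of "(r, s)"] by (auto simp: k_def)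
        qed
        have "(\<lambda>u. indicator A u *\<^sub>R k u) = (\<lambda>u. 0)" if "A \<subseteq> {x - e/2..x + e/2}" for A
          using z that by (auto simp: indicator_def fun_eq_iff)
        then have "ac (x - e/2) (x + e/2) (\<lambda>r. \<phi> (r, s) * f (r, s)) k"
          unfolding ac_def set_integrable_def set_lebesgue_integral_def using z by (simp del: scaleR_conv_of_real real_scaleR_def)
        then show ?thesis using e(1) by (intro exI[of _ "e/2"]) auto
      qed
    qed
    from ac_diff[OF this, of "-N" N] have "(LBINT r:{-N..N}. k r) = 0"
      using out[of N s] out[of "-N" s] N by simp
    moreover have "(LBINT r:{-N..N}. k r) = (LBINT r. k r)"
      unfolding set_lebesgue_integral_def
    proof (intro Bochner_Integration.integral_cong refl)
      fix r show "indicator {-N..N} r *\<^sub>R k r = k r"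
        using out[of r s] by (cases "r \<in> {-N..N}") (auto simp: k_def)
    qed
    ultimately show "(LBINT r. \<phi>r (r, s) * f (r, s) + \<phi> (r, s) * g (r, s)) = 0"
      by (simp add: k_def)
  qed
  then have "(LBINT t. (LBINT r. \<phi>r (r, t) * f (r, t) + \<phi> (r, t) * g (r, t))) = 0"
    by (rule integral_eq_zero_AE)
  with plane_Fubini(3)[OF sum] have "(LBINT z. \<phi>r z * f z + \<phi> z * g z) = 0" by simp
  then show "(LBINT z. \<phi>r z * f z) = - (LBINT z. \<phi> z * g z)"
    using i fg by (subst (asm) Bochner_Integration.integral_add) auto
qed

lemma wdr_chain:
  assumes Q: "open Q" and w: "wdr Q f g" and c: "continuous_on UNIV f"
    and \<beta>: "\<And>x. (\<beta> has_real_derivative \<beta>' x) (at x)" "continuous_on UNIV \<beta>'"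
  shows "wdr Q (\<lambda>z. \<beta> (f z)) (\<lambda>z. \<beta>' (f z) * g z)"
proof (rule wdrI_slices[OF Q])
  have "continuous_on UNIV \<beta>" using \<beta>(1) by (auto intro!: DERIV_continuous_on[of UNIV] simp: has_field_derivative_at_within)
  from continuous_on_compose2[OF this c] show "loc_int Q (\<lambda>z. \<beta> (f z))" by (intro loc_int_continuous) auto
  from continuous_on_compose2[OF \<beta>(2) c] show "loc_int Q (\<lambda>z. \<beta>' (f z) * g z)"
    using w by (intro loc_int_continuous_mult) (auto simp: wdr_def)
  show "AE t in lborel. \<forall>p q. p < q --> {p..q} \<times> {t} \<subseteq> Q -->
      ac p q (\<lambda>r. \<beta> (f (r, t))) (\<lambda>r. \<beta>' (f (r, t)) * g (r, t))"
    using wdr_slices_continuous[OF Q w c] by (rule AE_mp) (use ac_chain[OF _ \<beta>] in auto)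
qed

lemma wdr_mult:
  assumes Q: "open Q" and w: "wdr Q f g" "wdr Q f' g'" and c: "continuous_on UNIV f" "continuous_on UNIV f'"
  shows "wdr Q (\<lambda>z. f z * f' z) (\<lambda>z. f' z * g z + f z * g' z)"
proof (rule wdrI_slices[OF Q])
  show "loc_int Q (\<lambda>z. f z * f' z)" by (intro loc_int_continuous continuous_intros c)
  show "loc_int Q (\<lambda>z. f' z * g z + f z * g' z)"
    using w by (intro loc_int_add loc_int_continuous_mult c) (auto simp: wdr_def)
  show "AE t in lborel. \<forall>p q. p < q --> {p..q} \<times> {t} \<subseteq> Q -->
      ac p q (\<lambda>r. f (r, t) * f' (r, t)) (\<lambda>r. f' (r, t) * g (r, t) + f (r, t) * g' (r, t))"
    using wdr_slices_continuous[OF Q w(1) c(1)] wdr_slices_continuous[OF Q w(2) c(2)]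
    by eventually_elim (use ac_mult in \<open>fastforce simp: mult.commute\<close>)
qed

lemma wdr_add: "wdr Q f g ==> wdr Q f' g' ==> wdr Q (\<lambda>z. f z + f' z) (\<lambda>z. g z + g' z)"
  unfolding wdr_def using test_on_integrable
  by (auto simp: distrib_left Bochner_Integration.integral_add intro!: loc_int_add)

lemma wdr_cmult: "wdr Q f g ==> wdr Q (\<lambda>z. c * f z) (\<lambda>z. c * g z)"
proof -
  assume w: "wdr Q f g"
  have "(LBINT z. h z * (c * k z)) = c * (LBINT z. h z * k z)" for h k :: "real \<times> real => real"
    by (simp add: mult.left_commute)
  with w show ?thesis unfolding wdr_def by (simp add: loc_int_continuous_mult)
qed

lemma wdr_fst:
  assumes "open Q" shows "wdr Q fst (\<lambda>z. 1)"
  by (rule wdrI_slices[OF assms])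
     (auto intro!: loc_int_continuous continuous_intros ac_C1 derivative_eq_intros)

lemma wdr_snd:
  assumes "open Q" shows "wdr Q snd (\<lambda>z. 0)"
  by (rule wdrI_slices[OF assms])
     (auto intro!: loc_int_continuous continuous_intros ac_C1 derivative_eq_intros)

section \<open>The time derivative\<close>

lemma open_swap: "open Q ==> open (prod.swap ` Q)" for Q :: "(real \<times> real) set"
proof -
  assume "open Q"
  moreover have "prod.swap ` Q = prod.swap -` Q" by (auto simp: image_iff prod_eq_iff) (metis fst_conv snd_conv swap_simp)
  ultimately show ?thesis by (simp add: open_vimage continuous_on_swap)
qed

lemma continuous_swap: "continuous_on UNIV f ==> continuous_on UNIV (f \<circ> prod.swap)"
  for f :: "real \<times> real => real"
  using continuous_on_compose2[OF _ continuous_on_swap[of UNIV], of UNIV f] by (simp add: o_def)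

lemma wdt_chain:
  assumes Q: "open Q" and w: "wdt Q f g" and c: "continuous_on UNIV f"
    and \<beta>: "\<And>x. (\<beta> has_real_derivative \<beta>' x) (at x)" "continuous_on UNIV \<beta>'"
  shows "wdt Q (\<lambda>z. \<beta> (f z)) (\<lambda>z. \<beta>' (f z) * g z)"
  using wdr_chain[OF open_swap[OF Q] w[unfolded wdt_iff_wdr_swap] continuous_swap[OF c] \<beta>]
  unfolding wdt_iff_wdr_swap by (simp add: o_def)

lemma wdt_mult:
  assumes Q: "open Q" and w: "wdt Q f g" "wdt Q f' g'" and c: "continuous_on UNIV f" "continuous_on UNIV f'"
  shows "wdt Q (\<lambda>z. f z * f' z) (\<lambda>z. f' z * g z + f z * g' z)"
  using wdr_mult[OF open_swap[OF Q] w[unfolded wdt_iff_wdr_swap] c[THEN continuous_swap]]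
  unfolding wdt_iff_wdr_swap by (simp add: o_def)

lemma wdt_add: "wdt Q f g ==> wdt Q f' g' ==> wdt Q (\<lambda>z. f z + f' z) (\<lambda>z. g z + g' z)"
  using wdr_add unfolding wdt_iff_wdr_swap by (fastforce simp: o_def)

lemma wdt_cmult: "wdt Q f g ==> wdt Q (\<lambda>z. c * f z) (\<lambda>z. c * g z)"
  using wdr_cmult unfolding wdt_iff_wdr_swap by (fastforce simp: o_def)

lemma wdt_fst:
  assumes "open Q" shows "wdt Q fst (\<lambda>z. 0)"
  using wdr_snd[OF open_swap[OF assms]] unfolding wdt_iff_wdr_swap by (simp add: o_def)

section \<open>Trajectories of a continuous velocity field\<close>

lemma continuous_on_graph:
  fixes U :: "real \<times> real => real" and y :: "real => real"
  assumes "continuous_on UNIV U" "continuous_on S y"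
  shows "continuous_on S (\<lambda>t. U (y t, t))"
  by (rule continuous_on_compose2[OF assms(1)]) (auto intro!: continuous_intros assms)

text \<open>Tonelli's approximate solutions, whose velocity is evaluated at the position a time \<open>h\<close> earlier, as
  an iteration that becomes stationary up to time \<open>k h\<close> after \<open>k\<close> steps.\<close>

primrec delayed :: "(real \<times> real => real) => real => real => nat => real => real" where
  "delayed U y0 h 0 = (\<lambda>t. y0)"
| "delayed U y0 h (Suc k) = (\<lambda>t. y0 + integral {0..t} (\<lambda>s. U (delayed U y0 h k (s - h), s)))"

lemma Lipschitz_integral:
  fixes f :: "real => real"
  assumes c: "continuous_on UNIV f" and b: "\<And>s. \<bar>f s\<bar> \<le> M" and "s \<le> t"
  shows "\<bar>integral {0..t} f - integral {0..s} f\<bar> \<le> M * (t - s)"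
proof -
  have M: "0 \<le> M" using b[of 0] by simp
  have ii: "f integrable_on {p..q}" for p q
    by (rule integrable_continuous_real) (use c in \<open>auto intro: continuous_on_subset\<close>)
  have bd: "\<bar>integral {p..q} f\<bar> \<le> M * (q - p)" if "p \<le> q" for p q
    using integral_bound[of p q f M] that b c by (auto intro: continuous_on_subset)
  consider "t < 0" | "s < 0" "0 \<le> t" | "0 \<le> s" by linarith
  then show ?thesis
  proof cases
    case 1 then show ?thesis using M \<open>s \<le> t\<close> by simp
  next
    case 2
    have "M * t \<le> M * (t - s)" using M 2 by (intro mult_left_mono) auto
    then show ?thesis using bd[of 0 t] 2 by simp
  next
    case 3
    then have "integral {0..s} f + integral {s..t} f = integral {0..t} f"
      using ii \<open>s \<le> t\<close> by (intro Henstock_Kurzweil_Integration.integral_combine) auto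
    then show ?thesis using bd[of s t] \<open>s \<le> t\<close> by simp
  qed
qed

lemma delayed_Lipschitz:
  assumes U: "continuous_on UNIV U" "\<And>z. \<bar>U z\<bar> \<le> M"
  shows "\<bar>delayed U y0 h k t - delayed U y0 h k s\<bar> \<le> M * \<bar>t - s\<bar>"
proof -
  have M: "0 \<le> M" using U(2)[of 0] by simp
  have "\<forall>s t. s \<le> t --> \<bar>delayed U y0 h k t - delayed U y0 h k s\<bar> \<le> M * (t - s)"
  proof (induction k)
    case 0 then show ?case using M by simp
  next
    case (Suc k)
    have L: "\<bar>delayed U y0 h k t - delayed U y0 h k s\<bar> \<le> M * \<bar>t - s\<bar>" for s t
      using Suc[rule_format, of s t] Suc[rule_format, of t s] by (cases "s \<le> t") (auto simp: abs_minus_commute)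
    have "continuous_on UNIV (delayed U y0 h k)"
    proof (rule lipschitz_on_continuous_on)
      show "M-lipschitz_on UNIV (delayed U y0 h k)"
        using L M by (intro lipschitz_onI) (auto simp: dist_real_def)
    qed
    then have "continuous_on UNIV (\<lambda>s. delayed U y0 h k (s - h))"
      by (rule continuous_on_compose2) (auto intro!: continuous_intros)
    from continuous_on_graph[OF U(1) this] show ?case
      using U(2) by (auto intro!: Lipschitz_integral)
  qed
  from this[rule_format, of s t] this[rule_format, of t s] show ?thesis
    by (cases "s \<le> t") (auto simp: abs_minus_commute)
qed

lemma delayed_stable: "0 < h ==> t \<le> real k * h ==> delayed U y0 h (Suc k) t = delayed U y0 h k t"
proof (induction k arbitrary: t)
  case 0 then show ?case by (cases "t = 0") auto
next
  case (Suc k)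
  have "integral {0..t} (\<lambda>s. U (delayed U y0 h (Suc k) (s - h), s)) = integral {0..t} (\<lambda>s. U (delayed U y0 h k (s - h), s))"
    using Suc by (intro Henstock_Kurzweil_Integration.integral_cong) (auto simp: algebra_simps simp del: delayed.simps)
  then show ?case by simp
qed

text \<open>The delayed solutions have a common Lipschitz constant; a uniform limit of a subsequence solves the
  equation without delay.\<close>

theorem peano_existence:
  fixes U :: "real \<times> real => real"
  assumes U: "continuous_on UNIV U" "\<And>z. \<bar>U z\<bar> \<le> M" and \<tau>: "0 \<le> \<tau>"
  shows "\<exists>y. continuous_on {0..\<tau>} y \<and> (\<forall>t\<in>{0..\<tau>}. y t = y0 + integral {0..t} (\<lambda>s. U (y s, s)))"
proof -
  have M: "0 \<le> M" using U(2)[of 0] by simp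
  (* delays 1/(n+1), and enough iterations to be stationary on the whole interval *)
  define h where "h n = 1 / real (Suc n)" for n
  define K where "K n = nat \<lceil>\<tau> * real (Suc n)\<rceil>" for n
  define F where "F n = delayed U y0 (h n) (K n)" for n
  have hp: "h n > 0" for n by (simp add: h_def)
  have L: "\<bar>F n t - F n s\<bar> \<le> M * \<bar>t - s\<bar>" for n s t
    unfolding F_def by (rule delayed_Lipschitz[OF U])
  have eq: "F n t = y0 + integral {0..t} (\<lambda>s. U (F n (s - h n), s))" if "t \<le> \<tau>" for n t
  proof -
    have "\<tau> * real (Suc n) \<le> real (K n)" unfolding K_def using real_nat_ceiling_ge by blast
    then have "\<tau> \<le> real (K n) * h n" by (simp add: h_def field_simps)
    then have "delayed U y0 (h n) (Suc (K n)) t = F n t"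
      using delayed_stable[OF hp[of n], of t "K n" U y0] that by (simp add: F_def del: delayed.simps)
    then show ?thesis by (simp add: F_def)
  qed
  have F0: "F n 0 = y0" for n using eq[of 0 n] \<tau> by simp
  have bd: "norm (F n t) \<le> \<bar>y0\<bar> + M * \<tau>" if "t \<in> {0..\<tau>}" for n t
  proof -
    have "M * \<bar>t\<bar> \<le> M * \<tau>" using that M by (intro mult_left_mono) auto
    then show ?thesis using L[of n t 0] F0[of n] by auto
  qed
  obtain g k where g: "continuous_on {0..\<tau>} g" "strict_mono (k :: nat => nat)"
    "\<And>e. 0 < e ==> \<exists>N. \<forall>n x. n \<ge> N \<and> x \<in> {0..\<tau>} --> norm (F (k n) x - g x) < e"
  proof (rule Arzela_Ascoli[of "{0..\<tau>}" F "\<bar>y0\<bar> + M * \<tau>"])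
    fix x e :: real assume "e > 0"
    have "norm (F n x - F n y) < e" if "norm (x - y) < e / (M + 1)" for n y
    proof -
      have "M * \<bar>x - y\<bar> \<le> (M + 1) * \<bar>x - y\<bar>" by (intro mult_right_mono) auto
      also have "\<dots> < e" using that M by (simp add: field_simps)
      finally show ?thesis using L[of n x y] by simp
    qed
    then show "\<exists>d>0. \<forall>n y. y \<in> {0..\<tau>} \<and> norm (x - y) < d --> norm (F n x - F n y) < e"
      using \<open>e > 0\<close> M by (intro exI[of _ "e / (M + 1)"]) auto
  qed (use bd in auto)
  have lim: "(\<lambda>n. F (k n) x) \<longlonglongrightarrow> g x" if "x \<in> {0..\<tau>}" for x
    using g(3) that unfolding LIMSEQ_def dist_norm by blast
  have h0: "(\<lambda>n. h (k n)) \<longlonglongrightarrow> 0"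
    using LIMSEQ_subseq_LIMSEQ[OF LIMSEQ_inverse_real_of_nat g(2)]
    by (simp add: h_def o_def inverse_eq_divide)
  have lim': "(\<lambda>n. F (k n) (x - h (k n))) \<longlonglongrightarrow> g x" if "x \<in> {0..\<tau>}" for x
  proof -
    have "(\<lambda>n. F (k n) (x - h (k n)) - F (k n) x) \<longlonglongrightarrow> 0"
    proof (rule Lim_null_comparison)
      show "\<forall>\<^sub>F n in sequentially. norm (F (k n) (x - h (k n)) - F (k n) x) \<le> M * h (k n)"
        using L[of _ "x - h _" x] hp by (intro always_eventually) (metis abs_minus_cancel abs_of_pos minus_diff_eq diff_diff_eq2 add_diff_cancel_left' real_norm_def)
      show "(\<lambda>n. M * h (k n)) \<longlonglongrightarrow> 0" using tendsto_mult_right_zero[OF h0] .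
    qed
    from tendsto_add[OF this lim[OF that]] show ?thesis by simp
  qed
  have "g t = y0 + integral {0..t} (\<lambda>s. U (g s, s))" if t: "t \<in> {0..\<tau>}" for t
  proof -
    have "continuous_on UNIV (F n)" for n
      using L M by (intro lipschitz_on_continuous_on lipschitz_onI) (auto simp: dist_real_def)
    then have "continuous_on UNIV (\<lambda>s. F n (s - h n))" for n
      by (rule continuous_on_compose2) (auto intro!: continuous_intros)
    from continuous_on_graph[OF U(1) this]
    have i: "(\<lambda>s. U (F n (s - h n), s)) integrable_on {0..t}" for n
      by (intro integrable_continuous_real) (auto intro: continuous_on_subset)
    have "(\<lambda>n. integral {0..t} (\<lambda>s. U (F (k n) (s - h (k n)), s))) \<longlonglongrightarrow> integral {0..t} (\<lambda>s. U (g s, s))"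
    proof (rule dominated_convergence(2)[where h="\<lambda>_. M"])
      show "(\<lambda>n. U (F (k n) (s - h (k n)), s)) \<longlonglongrightarrow> U (g s, s)" if "s \<in> {0..t}" for s
      proof -
        have "(\<lambda>n. (F (k n) (s - h (k n)), s)) \<longlonglongrightarrow> (g s, s)"
          using lim'[of s] that t by (intro tendsto_intros) auto
        moreover have "isCont U (g s, s)" using U(1) by (simp add: continuous_on_eq_continuous_at)
        ultimately show ?thesis by (rule isCont_tendsto_compose[rotated])
      qed
    qed (use i U(2) in auto)
    then have "(\<lambda>n. F (k n) t) \<longlonglongrightarrow> y0 + integral {0..t} (\<lambda>s. U (g s, s))"
      using t by (subst eq) (auto intro!: tendsto_intros)
    with lim[OF t] show ?thesis by (rule LIMSEQ_unique)
  qed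
  then show ?thesis using g(1) by blast
qed

text \<open>After the last time at which it is nonnegative the function would be constant.\<close>

lemma invariant_nonneg:
  fixes f :: "real => real"
  assumes c: "continuous_on {0..\<tau>} f" and 0: "f 0 \<ge> 0"
    and d: "\<And>t. 0 < t ==> t < \<tau> ==> f t < 0 ==> (f has_real_derivative 0) (at t)"
    and t: "t \<in> {0..\<tau>}"
  shows "f t \<ge> 0"
proof (rule ccontr)
  assume neg: "\<not> f t \<ge> 0"
  define S where "S = {0..t} \<inter> f -` {0..}"
  have "closed S" unfolding S_def
    by (rule continuous_closed_preimage) (use c t in \<open>auto intro: continuous_on_subset\<close>)
  moreover have "S \<noteq> {}" using 0 t by (auto simp: S_def)
  moreover have bS: "bdd_above S" by (auto simp: S_def bdd_above_def)
  ultimately have "Sup S \<in> S" by (intro closed_contains_Sup)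
  define s where "s = Sup S"
  have s: "s \<in> S" using \<open>Sup S \<in> S\<close> by (simp add: s_def)
  have st: "s < t" "0 \<le> s" "f s \<ge> 0" using s neg by (auto simp: S_def less_le)
  have neg': "f x < 0" if "s < x" "x \<le> t" for x
  proof (rule ccontr)
    assume "\<not> f x < 0"
    then have "x \<in> S" using that st by (auto simp: S_def)
    then show False using cSup_upper[OF _ bS, of x] that by (simp add: s_def)
  qed
  have "\<exists>z>s. z < t \<and> f t - f s = (t - s) * 0"
  proof -
    have "\<exists>l z. s < z \<and> z < t \<and> (f has_real_derivative l) (at z) \<and> f t - f s = (t - s) * l"
    proof (rule MVT)
      show "continuous_on {s..t} f" using c st t by (auto intro: continuous_on_subset)
      fix x assume "s < x" "x < t"
      then have "(f has_real_derivative 0) (at x)" using d[of x] neg'[of x] st t by auto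
      then show "f differentiable (at x)" by (auto simp: real_differentiable_def)
    qed (use st in auto)
    then obtain l z where z: "s < z" "z < t" "(f has_real_derivative l) (at z)" "f t - f s = (t - s) * l" by blast
    have "l = 0" using d[of z] neg'[of z] z st t DERIV_unique by auto
    then show ?thesis using z by auto
  qed
  then show False using neg st by auto
qed

lemma antiderivative_exists:
  fixes w :: "real => real"
  assumes "continuous_on UNIV w"
  shows "\<exists>Y. Y 0 = y0 \<and> (\<forall>t. (Y has_real_derivative w t) (at t))"
proof -
  obtain F where F: "\<And>x. (F has_vector_derivative w x) (at x)"
    using einterval_antiderivative[of "-\<infinity>" "\<infinity>" w] assms by (auto simp: continuous_on_eq_continuous_at)
  show ?thesis
    by (rule exI[of _ "\<lambda>t. y0 + (F t - F 0)"])
       (use F in \<open>auto simp: has_real_derivative_iff_has_vector_derivative[symmetric] intro!: derivative_eq_intros\<close>)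
qed

text \<open>Clamping the field outside the region \<open>0 \<le> r \<le> a t\<close> makes both boundary curves
  impassable.\<close>

theorem trajectory_exists:
  fixes U :: "real \<times> real => real"
  assumes U: "continuous_on UNIV U" "\<And>z. \<bar>U z\<bar> \<le> M" and \<tau>: "0 \<le> \<tau>"
    and a: "\<And>t. t \<in> {0..\<tau>} ==> (a has_real_derivative U (a t, t)) (at t within {0..\<tau>})"
    and a0: "\<And>t. t \<in> {0..\<tau>} ==> 0 \<le> a t" and U0: "\<And>t. t \<in> {0..\<tau>} ==> U (0, t) = 0"
    and y0: "0 \<le> y0" "y0 \<le> a 0"
  shows "\<exists>y y'. y 0 = y0 \<and> (\<forall>t. (y has_real_derivative y' t) (at t)) \<and> continuous_on UNIV y' \<and>
    (\<forall>t\<in>{0..\<tau>}. 0 \<le> y t \<and> y t \<le> a t \<and> y' t = U (y t, t))"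
proof -
  define c where "c t = max 0 (min \<tau> t)" for t
  have c: "c t \<in> {0..\<tau>}" "t \<in> {0..\<tau>} ==> c t = t" for t using \<tau> by (auto simp: c_def)
  have cc: "continuous_on S c" for S unfolding c_def by (intro continuous_intros)
  have ac: "continuous_on {0..\<tau>} a" by (rule DERIV_continuous_on[OF a])
  have acc: "continuous_on UNIV (\<lambda>t. a (c t))"
    by (rule continuous_on_compose2[OF ac cc]) (use c in auto)
  have acs: "continuous_on UNIV (\<lambda>z::real\<times>real. a (c (snd z)))"
    by (rule continuous_on_compose2[OF acc]) (auto intro!: continuous_intros)
  (* the position is clamped to the region, the time to the interval *)
  define V where "V z = U (max 0 (min (fst z) (a (c (snd z)))), c (snd z))" for z
  have V: "continuous_on UNIV V" "\<And>z. \<bar>V z\<bar> \<le> M"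
    unfolding V_def using U(2)
    by (auto intro!: continuous_on_compose2[OF U(1)] continuous_on_Pair continuous_on_max continuous_on_min
        continuous_on_const continuous_on_fst continuous_on_id acs continuous_on_compose2[OF cc] continuous_on_snd)
  obtain x where x: "continuous_on {0..\<tau>} x"
    "\<And>t. t \<in> {0..\<tau>} ==> x t = y0 + integral {0..t} (\<lambda>s. V (x s, s))"
    using peano_existence[OF V \<tau>, of y0] by blast
  define w where "w t = V (x (c t), c t)" for t
  have "continuous_on UNIV (\<lambda>t. x (c t))" by (rule continuous_on_compose2[OF x(1) cc]) (use c in auto)
  then have wc: "continuous_on UNIV w" unfolding w_def
    by (intro continuous_on_compose2[OF V(1)] continuous_on_Pair cc) auto
  obtain Y where Y: "Y 0 = y0" "\<And>t. (Y has_real_derivative w t) (at t)"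
    using antiderivative_exists[OF wc] by blast
  have Yx: "Y t = x t" if t: "t \<in> {0..\<tau>}" for t
  proof -
    have "(w has_integral (Y t - Y 0)) {0..t}"
      by (rule fundamental_theorem_of_calculus)
        (use t Y(2) in \<open>auto simp: has_real_derivative_iff_has_vector_derivative[symmetric] intro: has_field_derivative_at_within\<close>)
    then have "Y t = y0 + integral {0..t} w" using Y(1) by (simp add: has_integral_iff)
    also have "integral {0..t} w = integral {0..t} (\<lambda>s. V (x s, s))"
      using t c by (intro Henstock_Kurzweil_Integration.integral_cong) (auto simp: w_def)
    finally show ?thesis using x(2)[OF t] by simp
  qed
  have wV: "w t = U (max 0 (min (Y t) (a t)), t)" if "t \<in> {0..\<tau>}" for t
    using Yx[OF that] c(2)[OF that] by (simp add: w_def V_def)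
  have Yc: "continuous_on {0..\<tau>} Y" by (rule DERIV_continuous_on[OF has_field_derivative_at_within[OF Y(2)]])
  have nonneg: "0 \<le> Y t" if "t \<in> {0..\<tau>}" for t
  proof (rule invariant_nonneg[OF Yc _ _ that])
    show "0 \<le> Y 0" using Y y0 by simp
    fix t assume t: "0 < t" "t < \<tau>" "Y t < 0"
    then have "w t = 0" using wV[of t] U0[of t] a0[of t] by (auto simp: max_def min_def split: if_splits)
    then show "(Y has_real_derivative 0) (at t)" using Y(2)[of t] by simp
  qed
  have le: "0 \<le> a t - Y t" if "t \<in> {0..\<tau>}" for t
  proof (rule invariant_nonneg[where f="\<lambda>t. a t - Y t", OF _ _ _ that])
    show "continuous_on {0..\<tau>} (\<lambda>t. a t - Y t)" by (intro continuous_intros ac Yc)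
    show "0 \<le> a 0 - Y 0" using Y y0 by simp
    fix t assume t: "0 < t" "t < \<tau>" "a t - Y t < 0"
    then have "w t = U (a t, t)" using wV[of t] a0[of t] by (auto simp: max_def min_def)
    moreover have "(a has_real_derivative U (a t, t)) (at t)"
      using a[of t] t by (simp add: at_within_Icc_at)
    ultimately show "((\<lambda>t. a t - Y t) has_real_derivative 0) (at t)"
      using Y(2)[of t] by (auto intro!: derivative_eq_intros)
  qed
  have "w t = U (Y t, t)" if "t \<in> {0..\<tau>}" for t
    using wV[OF that] nonneg[OF that] le[OF that] by (simp add: max_def min_def)
  then show ?thesis using Y wc nonneg le by (intro exI[of _ Y] exI[of _ w]) auto
qed

corollary backward_trajectory_exists:
  fixes U :: "real \<times> real => real"
  assumes U: "continuous_on UNIV U" "\<And>z. \<bar>U z\<bar> \<le> M" and \<tau>: "0 \<le> \<tau>"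
    and a: "\<And>t. t \<in> {0..\<tau>} ==> (a has_real_derivative U (a t, t)) (at t within {0..\<tau>})"
    and a0: "\<And>t. t \<in> {0..\<tau>} ==> 0 \<le> a t" and U0: "\<And>t. t \<in> {0..\<tau>} ==> U (0, t) = 0"
    and y0: "0 \<le> y0" "y0 \<le> a \<tau>"
  shows "\<exists>y y'. y \<tau> = y0 \<and> (\<forall>t. (y has_real_derivative y' t) (at t)) \<and> continuous_on UNIV y' \<and>
    (\<forall>t\<in>{0..\<tau>}. 0 \<le> y t \<and> y t \<le> a t \<and> y' t = U (y t, t))"
proof -
  define V where "V z = - U (fst z, \<tau> - snd z)" for z
  define b where "b t = a (\<tau> - t)" for t
  have "\<exists>y y'. y 0 = y0 \<and> (\<forall>t. (y has_real_derivative y' t) (at t)) \<and> continuous_on UNIV y' \<and>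
    (\<forall>t\<in>{0..\<tau>}. 0 \<le> y t \<and> y t \<le> b t \<and> y' t = V (y t, t))"
  proof (rule trajectory_exists)
    show "continuous_on UNIV V" unfolding V_def[abs_def]
      by (intro continuous_on_minus continuous_on_compose2[OF U(1)] continuous_intros) auto
    fix t assume t: "t \<in> {0..\<tau>}"
    have im: "(\<lambda>t. \<tau> - t) ` {0..\<tau>} = {0..\<tau>}" by (auto simp: image_def intro!: bexI[of _ "\<tau> - _"])
    have "(a has_real_derivative U (a (\<tau> - t), \<tau> - t)) (at (\<tau> - t) within (\<lambda>t. \<tau> - t) ` {0..\<tau>})"
      unfolding im using a[of "\<tau> - t"] t by simp
    moreover have "((\<lambda>t. \<tau> - t) has_real_derivative -1) (at t within {0..\<tau>})"
      by (auto intro!: derivative_eq_intros)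
    ultimately show "(b has_real_derivative V (b t, t)) (at t within {0..\<tau>})"
      using DERIV_image_chain[of a _ "\<lambda>t. \<tau> - t" t "{0..\<tau>}"] by (fastforce simp: b_def[abs_def] V_def o_def)
    show "0 \<le> b t" "V (0, t) = 0" using a0[of "\<tau> - t"] U0[of "\<tau> - t"] t by (auto simp: b_def V_def)
  qed (use U(2) \<tau> y0 in \<open>auto simp: V_def b_def\<close>)
  then obtain y y' where y: "y 0 = y0" "\<And>t. (y has_real_derivative y' t) (at t)" "continuous_on UNIV y'"
    "\<And>t. t \<in> {0..\<tau>} ==> 0 \<le> y t \<and> y t \<le> a (\<tau> - t) \<and> y' t = - U (y t, \<tau> - t)"
    unfolding V_def b_def fst_conv snd_conv by blast
  have "((\<lambda>t. y (\<tau> - t)) has_real_derivative - y' (\<tau> - t)) (at t)" for t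
  proof -
    have "((\<lambda>t. \<tau> - t) has_real_derivative - 1) (at t)" by (auto intro!: derivative_eq_intros)
    from DERIV_chain2[where f=y and g="\<lambda>t. \<tau> - t", OF y(2) this] show ?thesis by simp
  qed
  moreover have "continuous_on UNIV (\<lambda>t. - y' (\<tau> - t))"
    by (intro continuous_on_minus continuous_on_compose2[OF y(3)] continuous_intros) auto
  moreover have "0 \<le> y (\<tau> - t) \<and> y (\<tau> - t) \<le> a t \<and> - y' (\<tau> - t) = U (y (\<tau> - t), t)" if "t \<in> {0..\<tau>}" for t
    using y(4)[of "\<tau> - t"] that by auto
  ultimately show ?thesis using y(1)
    by (intro exI[of _ "\<lambda>t. y (\<tau> - t)"] exI[of _ "\<lambda>t. - y' (\<tau> - t)"]) auto
qed

section \<open>Balance laws between two trajectories\<close>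

text \<open>An approximation of the unit mass at \<open>0\<close>, supported in \<open>[1/n, 2/n]\<close>.\<close>

definition layer :: "nat => real => real" where
  "layer n s = real n * tent (real n * s)"

lemma layer_nonneg: "0 \<le> layer n s"
  by (simp add: layer_def tent_nonneg)

lemma layer_eq_0: "0 < n ==> s \<notin> {1 / real n..2 / real n} ==> layer n s = 0"
  unfolding layer_def by (auto intro!: tent_eq_0 simp: field_simps)

lemma continuous_on_layer[continuous_intros]:
  "continuous_on S f ==> continuous_on S (\<lambda>x. layer n (f x))"
  unfolding layer_def by (intro continuous_intros)

lemma layer_integral:
  assumes "0 < n" "\<bar>c\<bar> = 1"
  shows "has_bochner_integral lborel (\<lambda>r. layer n (b + c * r)) 1"
proof -
  have c0: "real n * c \<noteq> 0" using assms by auto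
  have eq: "layer n (b + c * r) = real n * tent (real n * b + (real n * c) * r)" for r
    by (simp add: layer_def algebra_simps)
  have "integrable lborel (\<lambda>r. tent (real n * b + (real n * c) * r))"
    by (rule lborel_integrable_real_affine[OF integrable_tent c0])
  moreover have "1 = \<bar>real n * c\<bar> *\<^sub>R (LBINT r. tent (real n * b + (real n * c) * r))"
    using lborel_integral_real_affine[OF c0, of tent "real n * b"] integral_tent by simp
  ultimately show ?thesis unfolding eq has_bochner_integral_iff
    using assms by (auto simp: abs_mult)
qed

lemma plateau'_layer:
  "plateau' n x y s = layer n (s - x) * ramp (real n * (y - s)) - ramp (real n * (s - x)) * layer n (y - s)"
  by (simp add: plateau'_def layer_def)

text \<open>Cutoffs to the region between the curves \<open>R1\<close> and \<open>R2\<close> during the time interval \<open>[0, \<tau>]\<close>, with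
  their partial derivatives.\<close>

definition strip :: "nat => real => (real => real) => (real => real) => real \<times> real => real" where
  "strip n \<tau> R1 R2 z = plateau n 0 \<tau> (snd z) * plateau n (R1 (snd z)) (R2 (snd z)) (fst z)"

definition strip_r :: "nat => real => (real => real) => (real => real) => real \<times> real => real" where
  "strip_r n \<tau> R1 R2 z = plateau n 0 \<tau> (snd z) * plateau' n (R1 (snd z)) (R2 (snd z)) (fst z)"

definition strip_t :: "nat => real => (real => real) => (real => real) => (real => real) => (real => real) => real \<times> real => real" where
  "strip_t n \<tau> R1 R2 R1' R2' z =
     plateau' n 0 \<tau> (snd z) * plateau n (R1 (snd z)) (R2 (snd z)) (fst z) +
     plateau n 0 \<tau> (snd z) *
       (ramp (real n * (fst z - R1 (snd z))) * layer n (R2 (snd z) - fst z) * R2' (snd z)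
        - layer n (fst z - R1 (snd z)) * ramp (real n * (R2 (snd z) - fst z)) * R1' (snd z))"

lemma strip_bounds: "0 \<le> strip n \<tau> R1 R2 z" "strip n \<tau> R1 R2 z \<le> 1"
  unfolding strip_def using plateau_bounds by (auto intro!: mult_nonneg_nonneg mult_le_one)

lemma plateau_support: "0 < n ==> plateau n x y s \<noteq> 0 \<or> plateau' n x y s \<noteq> 0 ==> x + 1 / real n \<le> s \<and> s \<le> y - 1 / real n"
proof (rule ccontr)
  assume n: "0 < n" and a: "plateau n x y s \<noteq> 0 \<or> plateau' n x y s \<noteq> 0" and "\<not> (x + 1 / real n \<le> s \<and> s \<le> y - 1 / real n)"
  then have "real n * (s - x) \<le> 1 \<or> real n * (y - s) \<le> 1" by (auto simp: field_simps)
  with a show False by (auto simp: plateau_def plateau'_def ramp_eq_0 tent_eq_0)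
qed

lemma continuous_snd_comp: "continuous_on UNIV f ==> continuous_on S (\<lambda>z::real\<times>real. f (snd z))"
  for f :: "real => real"
  by (rule continuous_on_compose2[of UNIV f]) (auto intro!: continuous_intros)

lemma bounded_on_interval:
  fixes f :: "real => real"
  assumes "continuous_on UNIV f"
  obtains b where "b > 0" "\<And>t. t \<in> {0..\<tau>} ==> \<bar>f t\<bar> \<le> b"
proof -
  have "bounded (f ` {0..\<tau>})"
    using assms by (intro compact_imp_bounded compact_continuous_image) (auto intro: continuous_on_subset)
  then show ?thesis using that unfolding bounded_pos by auto
qed

lemma strip_test_on:
  assumes n: "0 < n" and R1: "\<And>t. (R1 has_real_derivative R1' t) (at t)" "continuous_on UNIV R1'"
    and R2: "\<And>t. (R2 has_real_derivative R2' t) (at t)" "continuous_on UNIV R2'"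
    and Q: "\<And>r t. 0 < t ==> t < \<tau> ==> R1 t < r ==> r < R2 t ==> (r, t) \<in> Q"
  shows "test_on Q (strip n \<tau> R1 R2) (strip_r n \<tau> R1 R2) (strip_t n \<tau> R1 R2 R1' R2')"
  unfolding test_on_def
proof (intro conjI allI)
  have Rc: "continuous_on UNIV R1" "continuous_on UNIV R2"
    using DERIV_continuous_on[OF has_field_derivative_at_within[OF R1(1)]]
      DERIV_continuous_on[OF has_field_derivative_at_within[OF R2(1)]] by auto
  note cs = continuous_snd_comp[OF Rc(1)] continuous_snd_comp[OF Rc(2)] continuous_snd_comp[OF R1(2)] continuous_snd_comp[OF R2(2)]
  show "continuous_on UNIV (strip_r n \<tau> R1 R2)"
    unfolding strip_r_def[abs_def] plateau_def plateau'_layer by (intro continuous_intros cs)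
  show "continuous_on UNIV (strip_t n \<tau> R1 R2 R1' R2')"
    unfolding strip_t_def[abs_def] plateau_def plateau'_layer by (intro continuous_intros cs)
  fix z :: "real \<times> real"
  obtain r t where z: "z = (r, t)" by (cases z)
  have f: "(fst has_derivative fst) (at z)" and s: "(snd has_derivative snd) (at z)"
    by (auto intro!: derivative_eq_intros)
  have d1: "((\<lambda>z. R1 (snd z)) has_derivative (\<lambda>h. R1' t * snd h)) (at z)"
    using has_derivative_compose[OF s, of R1 "(*) (R1' t)"] R1(1)[of t] by (simp add: has_field_derivative_def z)
  have d2: "((\<lambda>z. R2 (snd z)) has_derivative (\<lambda>h. R2' t * snd h)) (at z)"
    using has_derivative_compose[OF s, of R2 "(*) (R2' t)"] R2(1)[of t] by (simp add: has_field_derivative_def z)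
  have p: "((\<lambda>z. plateau n 0 \<tau> (snd z)) has_derivative (\<lambda>h. plateau' n 0 \<tau> t * snd h)) (at z)"
    using has_derivative_compose[OF s, of "plateau n 0 \<tau>" "(*) (plateau' n 0 \<tau> t)"] plateau_deriv[of n 0 \<tau> t]
    by (simp add: has_field_derivative_def z)
  have ra: "((\<lambda>z. ramp (real n * g z)) has_derivative (\<lambda>h. tent (real n * g z) * (real n * g' h))) (at z)"
    if "(g has_derivative g') (at z)" for g g'
  proof -
    have "((\<lambda>z. real n * g z) has_derivative (\<lambda>h. real n * g' h)) (at z)"
      using that by (auto intro!: derivative_eq_intros)
    from has_derivative_compose[OF this, of ramp "(*) (tent (real n * g z))"] ramp_deriv[of "real n * g z"]
    show ?thesis by (simp add: has_field_derivative_def)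
  qed
  have r1: "((\<lambda>z. ramp (real n * (fst z - R1 (snd z)))) has_derivative
      (\<lambda>h. tent (real n * (fst z - R1 (snd z))) * (real n * (fst h - R1' t * snd h)))) (at z)"
    by (rule ra[OF has_derivative_diff[OF f d1]])
  have r2: "((\<lambda>z. ramp (real n * (R2 (snd z) - fst z))) has_derivative
      (\<lambda>h. tent (real n * (R2 (snd z) - fst z)) * (real n * (R2' t * snd h - fst h)))) (at z)"
    by (rule ra[OF has_derivative_diff[OF d2 f]])
  have "((\<lambda>z. plateau n 0 \<tau> (snd z) * (ramp (real n * (fst z - R1 (snd z))) * ramp (real n * (R2 (snd z) - fst z))))
      has_derivative (\<lambda>(x, y). strip_r n \<tau> R1 R2 z * x + strip_t n \<tau> R1 R2 R1' R2' z * y)) (at z)"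
    by (rule has_derivative_eq_rhs[OF has_derivative_mult[OF p has_derivative_mult[OF r1 r2]]])
       (auto simp: fun_eq_iff z strip_r_def strip_t_def plateau_def plateau'_layer layer_def algebra_simps)
  then show "(strip n \<tau> R1 R2 has_derivative (\<lambda>(x, y). strip_r n \<tau> R1 R2 z * x + strip_t n \<tau> R1 R2 R1' R2' z * y)) (at z)"
    by (simp add: strip_def[abs_def] plateau_def)
next
  have Rc: "continuous_on UNIV R1" "continuous_on UNIV R2"
    using DERIV_continuous_on[OF has_field_derivative_at_within[OF R1(1)]]
      DERIV_continuous_on[OF has_field_derivative_at_within[OF R2(1)]] by auto
  note cs = continuous_snd_comp[OF Rc(1)] continuous_snd_comp[OF Rc(2)]
  define e where "e = 1 / real n"
  have e: "e > 0" using n by (simp add: e_def)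
  define K where "K = {z. e \<le> snd z} \<inter> {z. snd z \<le> \<tau> - e} \<inter> {z. R1 (snd z) + e \<le> fst z} \<inter> {z. fst z \<le> R2 (snd z) - e}"
  have "closed K" unfolding K_def
    by (intro closed_Int closed_Collect_le continuous_intros cs)
  moreover have "bounded K"
  proof -
    obtain b1 b2 where b: "\<And>t. t \<in> {0..\<tau>} ==> \<bar>R1 t\<bar> \<le> b1" "\<And>t. t \<in> {0..\<tau>} ==> \<bar>R2 t\<bar> \<le> b2"
      using bounded_on_interval[OF Rc(1), of \<tau>] bounded_on_interval[OF Rc(2), of \<tau>] by metis
    have "K \<subseteq> {- b1..b2} \<times> {0..\<tau>}"
    proof
      fix z assume z: "z \<in> K"
      then have "snd z \<in> {0..\<tau>}" using e by (auto simp: K_def)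
      then show "z \<in> {- b1..b2} \<times> {0..\<tau>}"
        using b(1)[of "snd z"] b(2)[of "snd z"] z e by (auto simp: K_def mem_Times_iff)
    qed
    then show ?thesis by (rule bounded_subset[rotated]) (intro bounded_Times bounded_closed_interval)
  qed
  ultimately have "compact K" by (simp add: compact_eq_bounded_closed)
  moreover have "K \<subseteq> Q" using Q e by (auto simp: K_def)
  moreover have "strip n \<tau> R1 R2 z = 0 \<and> strip_r n \<tau> R1 R2 z = 0 \<and> strip_t n \<tau> R1 R2 R1' R2' z = 0" if "z \<notin> K" for z
  proof -
    consider "snd z < e" | "\<tau> - e < snd z" | "fst z < R1 (snd z) + e" | "R2 (snd z) - e < fst z"
      using \<open>z \<notin> K\<close> unfolding K_def by fastforce
    then have "real n * snd z \<le> 1 \<or> real n * (\<tau> - snd z) \<le> 1 \<or> real n * (fst z - R1 (snd z)) \<le> 1 \<or> real n * (R2 (snd z) - fst z) \<le> 1"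
      using n by cases (auto simp: e_def field_simps)
    then show ?thesis
      by (elim disjE) (simp_all add: strip_def strip_r_def strip_t_def plateau_def plateau'_def layer_def ramp_eq_0 tent_eq_0)
  qed
  ultimately show "\<exists>K. compact K \<and> K \<subseteq> Q \<and> (\<forall>z. z \<notin> K -->
      strip n \<tau> R1 R2 z = 0 \<and> strip_r n \<tau> R1 R2 z = 0 \<and> strip_t n \<tau> R1 R2 R1' R2' z = 0)" by blast
qed

lemma plateau_moving_tendsto:
  assumes x: "x \<longlonglongrightarrow> x0" and y: "y \<longlonglongrightarrow> y0" and "s \<noteq> x0" "s \<noteq> y0"
  shows "(\<lambda>n. plateau n (x n) (y n) s) \<longlonglongrightarrow> indicator {x0..y0} s"
proof -
  have up: "eventually (\<lambda>n. 2 \<le> real n * v n) sequentially" if "v \<longlonglongrightarrow> v0" "0 < v0" for v v0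
  proof -
    have "filterlim (\<lambda>n. v n * real n) at_top sequentially"
      by (rule filterlim_tendsto_pos_mult_at_top[OF that filterlim_real_sequentially])
    then show ?thesis unfolding filterlim_at_top by (simp add: mult.commute)
  qed
  have dn: "eventually (\<lambda>n. real n * v n \<le> 1) sequentially" if "v \<longlonglongrightarrow> v0" "v0 < 0" for v v0
  proof -
    have "eventually (\<lambda>n. v n < 0) sequentially" using that by (rule order_tendstoD)
    then show ?thesis by eventually_elim (smt (verit) mult_nonneg_nonpos of_nat_0_le_iff)
  qed
  have lx: "(\<lambda>n. s - x n) \<longlonglongrightarrow> s - x0" and ly: "(\<lambda>n. y n - s) \<longlonglongrightarrow> y0 - s"
    by (intro tendsto_intros x y)+
  consider "x0 < s" "s < y0" | "s < x0" | "y0 < s" using assms(3,4) by linarith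
  then have "eventually (\<lambda>n. plateau n (x n) (y n) s = indicator {x0..y0} s) sequentially"
  proof cases
    case 1
    then have "eventually (\<lambda>n. 2 \<le> real n * (s - x n)) sequentially" "eventually (\<lambda>n. 2 \<le> real n * (y n - s)) sequentially"
      using up[OF lx] up[OF ly] by auto
    then show ?thesis by eventually_elim (use 1 in \<open>simp add: plateau_def ramp_eq_1\<close>)
  next
    case 2
    from dn[OF lx] 2 have "eventually (\<lambda>n. real n * (s - x n) \<le> 1) sequentially" by simp
    then show ?thesis by eventually_elim (use 2 in \<open>simp add: plateau_def ramp_eq_0\<close>)
  next
    case 3
    from dn[OF ly] 3 have "eventually (\<lambda>n. real n * (y n - s) \<le> 1) sequentially" by simp
    then show ?thesis by eventually_elim (use 3 in \<open>simp add: plateau_def ramp_eq_0\<close>)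
  qed
  then show ?thesis by (rule tendsto_eventually)
qed

context
  fixes \<tau> C :: real and R1 R2 R1' R2' :: "real => real" and u F :: "real \<times> real => real"
  assumes \<tau>: "0 < \<tau>"
    and R1: "\<And>t. (R1 has_real_derivative R1' t) (at t)" "continuous_on UNIV R1'"
    and R2: "\<And>t. (R2 has_real_derivative R2' t) (at t)" "continuous_on UNIV R2'"
    and u: "continuous_on UNIV u" and F: "continuous_on UNIV F" "\<And>z. \<bar>F z\<bar> \<le> C"
    and tr: "\<And>t. t \<in> {0..\<tau>} ==> R1' t = u (R1 t, t)" "\<And>t. t \<in> {0..\<tau>} ==> R2' t = u (R2 t, t)"
begin

lemma R_continuous: "continuous_on UNIV R1" "continuous_on UNIV R2"
  using DERIV_continuous_on[OF has_field_derivative_at_within[OF R1(1)]]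
    DERIV_continuous_on[OF has_field_derivative_at_within[OF R2(1)]] by auto

text \<open>The smoothed mass between the two curves at one time.\<close>

definition slab :: "nat => real => real" where
  "slab n t = (LBINT r. plateau n (R1 t) (R2 t) r * F (r, t))"

lemma slab_bound: "\<exists>D>0. \<forall>n. \<forall>t\<in>{0..\<tau>}. \<bar>slab n t\<bar> \<le> D"
  and slab_tendsto: "t0 \<in> {0..\<tau>} ==> (\<And>n. ts n \<in> {0..\<tau>}) ==> ts \<longlonglongrightarrow> t0 ==>
      (\<lambda>n. slab n (ts n)) \<longlonglongrightarrow> (LBINT r:{R1 t0..R2 t0}. F (r, t0))"
proof -
  have C: "0 \<le> C" using F(2)[of 0] by simp
  obtain b1 b2 where b: "b1 > 0" "\<And>t. t \<in> {0..\<tau>} ==> \<bar>R1 t\<bar> \<le> b1" "b2 > 0" "\<And>t. t \<in> {0..\<tau>} ==> \<bar>R2 t\<bar> \<le> b2"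
    using bounded_on_interval[OF R_continuous(1), of \<tau>] bounded_on_interval[OF R_continuous(2), of \<tau>] by metis
  have wi: "integrable lborel (\<lambda>r. C * indicat_real {-b1..b2} r)" by (simp add: integrable_indicator_iff emeasure_lborel_Icc_eq)
  have dom: "norm (plateau n (R1 t) (R2 t) r * F (r, t)) \<le> C * indicator {-b1..b2} r" if "t \<in> {0..\<tau>}" for n t r
  proof (cases "r \<in> {-b1..b2}")
    case True
    have "\<bar>plateau n (R1 t) (R2 t) r\<bar> * \<bar>F (r, t)\<bar> \<le> 1 * C"
      using plateau_bounds[of n "R1 t" "R2 t" r] F(2)[of "(r, t)"] by (intro mult_mono) auto
    then show ?thesis using True by (simp add: abs_mult)
  next
    case False
    then have "r \<notin> {R1 t..R2 t}" using b(2)[OF that] b(4)[OF that] by auto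
    then show ?thesis using plateau_outside[of r] False by simp
  qed
  have Fs: "continuous_on UNIV (\<lambda>r. F (r, t))" for t by (rule continuous_on_slice[OF F(1)])
  have meas: "(\<lambda>r. plateau n (R1 t) (R2 t) r * F (r, t)) \<in> borel_measurable lborel" for n t
    unfolding measurable_lborel2 by (intro borel_measurable_continuous_onI continuous_intros continuous_plateau Fs)
  have bd: "\<bar>slab n t\<bar> \<le> C * (b1 + b2) + 1" if t: "t \<in> {0..\<tau>}" for n t
  proof -
    have i: "integrable lborel (\<lambda>r. plateau n (R1 t) (R2 t) r * F (r, t))"
    proof (rule Bochner_Integration.integrable_bound[OF wi meas], intro always_eventually allI)
      fix r show "norm (plateau n (R1 t) (R2 t) r * F (r, t)) \<le> norm (C * indicat_real {-b1..b2} r)"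
        using order_trans[OF dom[OF t] abs_ge_self] unfolding real_norm_def .
    qed
    have "\<bar>slab n t\<bar> \<le> (LBINT r. \<bar>plateau n (R1 t) (R2 t) r * F (r, t)\<bar>)"
      unfolding slab_def by (rule integral_abs_bound)
    also have "\<dots> \<le> (LBINT r. C * indicat_real {-b1..b2} r)"
      using dom[OF t] i wi by (intro integral_mono) auto
    also have "\<dots> = C * (b1 + b2)" using b(1,3) by simp
    finally show ?thesis by simp
  qed
  have "0 < C * (b1 + b2) + 1" using C b by (smt (verit) mult_nonneg_nonneg)
  then show "\<exists>D>0. \<forall>n. \<forall>t\<in>{0..\<tau>}. \<bar>slab n t\<bar> \<le> D" using bd by blast
  show "(\<lambda>n. slab n (t n)) \<longlonglongrightarrow> (LBINT r:{R1 t0..R2 t0}. F (r, t0))"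
    if t0: "t0 \<in> {0..\<tau>}" and t: "\<And>n. t n \<in> {0..\<tau>}" "t \<longlonglongrightarrow> t0" for t0 t
  proof -
    have tl: "(\<lambda>n. f (t n)) \<longlonglongrightarrow> f t0" if "continuous_on UNIV f" for f :: "real => real"
      using isCont_tendsto_compose[OF _ t(2), of f] that by (simp add: continuous_on_eq_continuous_at)
    have "(\<lambda>n. slab n (t n)) \<longlonglongrightarrow> (LBINT r. indicator {R1 t0..R2 t0} r *\<^sub>R F (r, t0))"
      unfolding slab_def
    proof (rule integral_dominated_convergence[OF _ meas wi])
      show "(\<lambda>r. indicat_real {R1 t0..R2 t0} r *\<^sub>R F (r, t0)) \<in> borel_measurable lborel"
        using borel_measurable_continuous_onI[OF Fs] by measurable
      show "AE r in lborel. (\<lambda>n. plateau n (R1 (t n)) (R2 (t n)) r * F (r, t n)) \<longlonglongrightarrow> indicat_real {R1 t0..R2 t0} r *\<^sub>R F (r, t0)"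
        using AE_lborel_singleton[of "R1 t0"] AE_lborel_singleton[of "R2 t0"]
      proof eventually_elim
        case (elim r)
        have "(\<lambda>n. plateau n (R1 (t n)) (R2 (t n)) r) \<longlonglongrightarrow> indicator {R1 t0..R2 t0} r"
          by (rule plateau_moving_tendsto[OF tl[OF R_continuous(1)] tl[OF R_continuous(2)] elim])
        moreover have "continuous_on UNIV (\<lambda>s. F (r, s))"
          by (rule continuous_on_compose2[OF F(1)]) (auto intro!: continuous_intros)
        from tl[OF this] have "(\<lambda>n. F (r, t n)) \<longlonglongrightarrow> F (r, t0)" .
        ultimately show ?case unfolding real_scaleR_def by (rule tendsto_mult)
      qed
      show "AE r in lborel. norm (plateau n (R1 (t n)) (R2 (t n)) r * F (r, t n)) \<le> C * indicat_real {-b1..b2} r" for n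
        using dom[OF t(1)] by (intro always_eventually allI)
    qed
    then show "(\<lambda>n. slab n (t n)) \<longlonglongrightarrow> (LBINT r:{R1 t0..R2 t0}. F (r, t0))"
      by (simp add: set_lebesgue_integral_def)
  qed
qed

lemma slab_measurable: "slab n \<in> borel_measurable borel"
proof -
  have "continuous_on UNIV (\<lambda>z::real\<times>real. F (snd z, fst z))"
    by (rule continuous_on_compose2[OF F(1)]) (auto intro!: continuous_intros)
  moreover have "continuous_on UNIV (\<lambda>z::real\<times>real. plateau n (R1 (fst z)) (R2 (fst z)) (snd z))"
    unfolding plateau_def
    by (intro continuous_intros continuous_on_compose2[OF R_continuous(1)] continuous_on_compose2[OF R_continuous(2)]) auto
  ultimately have "(\<lambda>z::real\<times>real. plateau n (R1 (fst z)) (R2 (fst z)) (snd z) * F (snd z, fst z)) \<in> borel_measurable borel"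
    by (intro borel_measurable_continuous_onI continuous_on_mult)
  then have "(\<lambda>(t, r). plateau n (R1 t) (R2 t) r * F (r, t)) \<in> borel_measurable (borel \<Otimes>\<^sub>M lborel)"
    by (simp add: split_beta' borel_prod[symmetric] cong: measurable_cong_sets)
  from lborel.borel_measurable_lebesgue_integral[OF this] show ?thesis by (simp add: slab_def[abs_def])
qed

text \<open>The case \<open>c = 1\<close> is the layer after time \<open>0\<close>, the case \<open>c = -1\<close> the one before time \<open>\<tau>\<close>.\<close>

lemma time_layer_tendsto:
  assumes c: "\<bar>c\<bar> = 1" and t0: "t0 = (if c = 1 then 0 else \<tau>)"
  shows "(\<lambda>n. LBINT t. layer n (c * (t - t0)) * slab n t) \<longlonglongrightarrow> (LBINT r:{R1 t0..R2 t0}. F (r, t0))"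
proof -
  obtain D where D: "D > 0" "\<And>n t. t \<in> {0..\<tau>} ==> \<bar>slab n t\<bar> \<le> D"
    using slab_bound by blast
  define M where "M = (LBINT r:{R1 t0..R2 t0}. F (r, t0))"
  define cl where "cl t = max 0 (min \<tau> t)" for t
  have cl: "cl t \<in> {0..\<tau>}" "t \<in> {0..\<tau>} ==> cl t = t" for t using \<tau> by (auto simp: cl_def)
  have t0i: "t0 \<in> {0..\<tau>}" using t0 \<tau> by auto
  have cc: "c * c = 1" using abs_mult_self_eq[of c] c by simp
  have "(\<lambda>n. LBINT s. tent s * slab n (cl (t0 + c * s / real n))) \<longlonglongrightarrow> (LBINT s. tent s * M)"
  proof (rule integral_dominated_convergence)
    show "integrable lborel (\<lambda>s. tent s * D)" using integrable_tent by simp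
    have [measurable]: "slab n \<in> borel_measurable borel" for n by (rule slab_measurable)
    have [measurable]: "tent \<in> borel_measurable borel"
      by (intro borel_measurable_continuous_onI continuous_on_tent continuous_on_id)
    show "(\<lambda>s. tent s * M) \<in> borel_measurable lborel" by simp
    show "(\<lambda>s. tent s * slab n (cl (t0 + c * s / real n))) \<in> borel_measurable lborel" for n
      unfolding cl_def by measurable
    show "AE s in lborel. (\<lambda>n. tent s * slab n (cl (t0 + c * s / real n))) \<longlonglongrightarrow> tent s * M"
    proof (intro always_eventually allI tendsto_mult tendsto_const)
      fix s
      have "(\<lambda>n. t0 + c * s / real n) \<longlonglongrightarrow> t0 + 0"
        by (intro tendsto_add tendsto_const lim_const_over_n)
      then have "(\<lambda>n. cl (t0 + c * s / real n)) \<longlonglongrightarrow> max 0 (min \<tau> t0)"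
        unfolding cl_def by (intro tendsto_max tendsto_min tendsto_const) simp
      then have "(\<lambda>n. cl (t0 + c * s / real n)) \<longlonglongrightarrow> t0" using t0i by simp
      from slab_tendsto[OF t0i cl(1) this] show "(\<lambda>n. slab n (cl (t0 + c * s / real n))) \<longlonglongrightarrow> M" by (simp add: M_def)
    qed
    show "AE s in lborel. norm (tent s * slab n (cl (t0 + c * s / real n))) \<le> tent s * D" for n
      using D(2)[OF cl(1)] tent_nonneg
      by (intro always_eventually allI) (auto simp: abs_mult intro!: mult_left_mono)
  qed
  also have "(LBINT s. tent s * M) = M" using integral_tent by simp
  finally have lim: "(\<lambda>n. LBINT s. tent s * slab n (cl (t0 + c * s / real n))) \<longlonglongrightarrow> M" .
  obtain N where N: "real N > 2 / \<tau>" using reals_Archimedean2 by blast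
  have eqn: "(LBINT t. layer n (c * (t - t0)) * slab n t) = (LBINT s. tent s * slab n (cl (t0 + c * s / real n)))"
    if n: "n \<ge> max N 1" for n
  proof -
    have n0: "real n > 0" "real n > 2 / \<tau>" using n N by auto
    have c0: "c / real n \<noteq> 0" using c n0 by auto
    have "(LBINT t. layer n (c * (t - t0)) * slab n t)
        = \<bar>c / real n\<bar> *\<^sub>R (LBINT s. layer n (c * ((t0 + c / real n * s) - t0)) * slab n (t0 + c / real n * s))"
      by (rule lborel_integral_real_affine[OF c0])
    also have "\<dots> = (LBINT s. \<bar>c / real n\<bar> * (layer n (c * ((t0 + c / real n * s) - t0)) * slab n (t0 + c / real n * s)))"
      by simp
    also have "\<dots> = (LBINT s. tent s * slab n (cl (t0 + c * s / real n)))"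
    proof (rule Bochner_Integration.integral_cong[OF refl])
      fix s
      have e1: "c * ((t0 + c / real n * s) - t0) = s / real n" using cc by (simp add: field_simps)
      have e2: "\<bar>c / real n\<bar> * layer n (s / real n) = tent s" using c n0 by (simp add: layer_def)
      show "\<bar>c / real n\<bar> * (layer n (c * ((t0 + c / real n * s) - t0)) * slab n (t0 + c / real n * s))
          = tent s * slab n (cl (t0 + c * s / real n))"
      proof (cases "s \<in> {1..2}")
        case True
        have "2 / real n < \<tau>" using n0 \<tau> by (simp add: field_simps)
        then have "s / real n \<le> \<tau>" "0 \<le> s / real n" using True n0 by (auto simp: field_simps)
        moreover have "c = 1 \<or> c = -1" using c by auto
        ultimately have "t0 + c * s / real n \<in> {0..\<tau>}" using t0 by auto
        then show ?thesis unfolding e1 using cl(2) e2 by (simp add: mult.assoc[symmetric])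
      next
        case False
        then have "tent s = 0" by (auto intro: tent_eq_0)
        then show ?thesis unfolding e1 using e2 by (simp add: layer_def)
      qed
    qed
    finally show ?thesis .
  qed
  have "eventually (\<lambda>n. (LBINT s. tent s * slab n (cl (t0 + c * s / real n))) = (LBINT t. layer n (c * (t - t0)) * slab n t)) sequentially"
    unfolding eventually_sequentially by (intro exI[of _ "max N 1"] allI impI) (rule eqn[symmetric])
  from Lim_transform_eventually[OF lim this] show ?thesis by (simp add: M_def)
qed

lemma slab_layer_integrable:
  assumes "\<bar>c\<bar> = 1" and t0: "t0 = (if c = 1 then 0 else \<tau>)" and n: "0 < n" "2 / real n \<le> \<tau>"
  shows "integrable lborel (\<lambda>t. layer n (c * (t - t0)) * slab n t)"
proof -
  obtain D where D: "D > 0" "\<And>n t. t \<in> {0..\<tau>} ==> \<bar>slab n t\<bar> \<le> D"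
    using slab_bound by blast
  have eq: "c * (t - t0) = - c * t0 + c * t" for t by (simp add: algebra_simps)
  have i: "integrable lborel (\<lambda>t. layer n (c * (t - t0)))"
    using layer_integral[OF n(1) assms(1), of "- c * t0"] unfolding eq by (auto intro: integrable.intros)
  show ?thesis
  proof (rule Bochner_Integration.integrable_bound)
    show "integrable lborel (\<lambda>t. layer n (c * (t - t0)) * D)" using i by simp
    show "(\<lambda>t. layer n (c * (t - t0)) * slab n t) \<in> borel_measurable lborel"
      using slab_measurable[of n] borel_measurable_integrable[OF i] by simp
    show "AE t in lborel. norm (layer n (c * (t - t0)) * slab n t) \<le> norm (layer n (c * (t - t0)) * D)"
    proof (intro always_eventually allI)
      fix t
      show "norm (layer n (c * (t - t0)) * slab n t) \<le> norm (layer n (c * (t - t0)) * D)"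
      proof (cases "t \<in> {0..\<tau>}")
        case True
        then show ?thesis using D by (auto simp: abs_mult intro!: mult_left_mono)
      next
        case False
        have "c = 1 \<or> c = -1" using assms(1) by auto
        then have "c * (t - t0) \<notin> {1 / real n..2 / real n}"
          using False t0 n by (auto simp: not_le) 
        then show ?thesis using layer_eq_0[OF n(1)] by simp
      qed
    qed
  qed
qed

text \<open>For each time the layer along a curve has unit mass.\<close>

lemma curve_layer:
  fixes R w :: "real => real"
  assumes R: "continuous_on UNIV R" and n: "0 < n" and c: "\<bar>c\<bar> = 1" and w: "integrable lborel w"
  shows "integrable lborel (\<lambda>z. w (snd z) * layer n (c * (fst z - R (snd z))))"
    and "(LBINT z. w (snd z) * layer n (c * (fst z - R (snd z)))) = (LBINT t. w t)"
proof -
  have hb: "has_bochner_integral lborel (\<lambda>r. layer n (c * (r - R t))) 1" for t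
    using layer_integral[OF n c, of "- c * R t"] by (simp add: algebra_simps)
  then have i1: "integrable lborel (\<lambda>r. layer n (c * (r - R t)))" and i2: "(LBINT r. layer n (c * (r - R t))) = 1" for t
    by (auto simp: has_bochner_integral_iff)
  have sm: "(snd :: real \<times> real => real) \<in> borel_measurable borel"
    by (intro borel_measurable_continuous_onI continuous_intros)
  have "w \<in> borel_measurable borel" using borel_measurable_integrable[OF w] by simp
  from measurable_compose[OF sm this] have m1: "(\<lambda>z::real\<times>real. w (snd z)) \<in> borel_measurable borel" .
  have m2: "(\<lambda>z::real\<times>real. layer n (c * (fst z - R (snd z)))) \<in> borel_measurable borel"
    by (intro borel_measurable_continuous_onI continuous_intros continuous_snd_comp R)
  show I: "integrable lborel (\<lambda>z. w (snd z) * layer n (c * (fst z - R (snd z))))"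
  proof (rule plane_integrableI)
    show "(\<lambda>z. w (snd z) * layer n (c * (fst z - R (snd z)))) \<in> borel_measurable borel" using m1 m2 by simp
    show "AE t in lborel. integrable lborel (\<lambda>r. w (snd (r, t)) * layer n (c * (fst (r, t) - R (snd (r, t)))))"
      using i1 by simp
    have "(LBINT r. \<bar>w (snd (r, t)) * layer n (c * (fst (r, t) - R (snd (r, t))))\<bar>) = \<bar>w t\<bar>" for t
      using i2[of t] by (simp add: abs_mult layer_nonneg)
    then show "integrable lborel (\<lambda>t. LBINT r. \<bar>w (snd (r, t)) * layer n (c * (fst (r, t) - R (snd (r, t))))\<bar>)"
      using w by simp
  qed
  show "(LBINT z. w (snd z) * layer n (c * (fst z - R (snd z)))) = (LBINT t. w t)"
    using plane_Fubini(3)[OF I] i2 by simp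
qed

text \<open>The part of \<open>(\<partial>\<^sub>t + u \<partial>\<^sub>r) strip\<close> carried by the two lateral layers. Its factors \<open>u - R'\<close> vanish on the
  curves.\<close>

definition edge :: "nat => real \<times> real => real" where
  "edge n z = plateau n 0 \<tau> (snd z) *
     (layer n (fst z - R1 (snd z)) * ramp (real n * (R2 (snd z) - fst z)) * (u z - R1' (snd z)) +
      ramp (real n * (fst z - R1 (snd z))) * layer n (R2 (snd z) - fst z) * (R2' (snd z) - u z)) * F z"

lemma near_curve:
  assumes "continuous_on UNIV R" "e > 0"
  shows "\<exists>N. \<forall>n\<ge>N. \<forall>t\<in>{0..\<tau>}. \<forall>r. \<bar>r - R t\<bar> \<le> 2 / real n --> \<bar>u (r, t) - u (R t, t)\<bar> < e"
proof -
  obtain b where b: "b > 0" "\<And>t. t \<in> {0..\<tau>} ==> \<bar>R t\<bar> \<le> b" using bounded_on_interval[OF assms(1)] by metis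
  have "uniformly_continuous_on ({-b-2..b+2} \<times> {0..\<tau>}) u"
    by (intro compact_uniformly_continuous compact_Times compact_Icc continuous_on_subset[OF u]) auto
  then obtain d where d: "d > 0" "\<And>z z'. z \<in> {-b-2..b+2} \<times> {0..\<tau>} ==> z' \<in> {-b-2..b+2} \<times> {0..\<tau>} ==> dist z' z < d ==> dist (u z') (u z) < e"
    using assms(2) unfolding uniformly_continuous_on_def by metis
  obtain N where N: "real N > 2 / d" using reals_Archimedean2 by blast
  show ?thesis
  proof (intro exI[of _ "max N 1"] allI impI ballI)
    fix n t r assume n: "max N 1 \<le> n" and t: "t \<in> {0..\<tau>}" and r: "\<bar>r - R t\<bar> \<le> 2 / real n"
    have n1: "real n \<ge> 1" "real n > 2 / d" using n N by auto
    have A1: "2 / real n \<le> 2" using n1 by (simp add: field_simps)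
    have "2 / real n < d" using n1 d(1) by (simp add: field_simps)
    moreover have "dist (r, t) (R t, t) = \<bar>r - R t\<bar>" by (simp add: dist_prod_def dist_real_def)
    moreover have "- b - 2 \<le> r" "r \<le> b + 2" "- b - 2 \<le> R t" "R t \<le> b + 2"
      using b(2)[OF t] r A1 by linarith+
    ultimately show "\<bar>u (r, t) - u (R t, t)\<bar> < e"
      using d(2)[of "(R t, t)" "(r, t)"] t r by (simp add: dist_real_def)
  qed
qed

lemma edge_tendsto: "(\<lambda>n. LBINT z. edge n z) \<longlonglongrightarrow> 0"
  and edge_integrable: "0 < n ==> integrable lborel (edge n)"
proof -
  have C: "0 \<le> C" using F(2)[of 0] by simp
  have Rc: "continuous_on UNIV R1" "continuous_on UNIV R2" by (rule R_continuous)+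
  note cs = continuous_snd_comp[OF Rc(1)] continuous_snd_comp[OF Rc(2)] continuous_snd_comp[OF R1(2)] continuous_snd_comp[OF R2(2)]
  have em: "edge n \<in> borel_measurable borel" for n
    unfolding edge_def[abs_def] plateau_def
    by (intro borel_measurable_continuous_onI continuous_intros cs u F)
  have wi: "integrable lborel (indicat_real {0..\<tau>})" by (simp add: integrable_indicator_iff emeasure_lborel_Icc_eq)
  define L where "L n z = indicat_real {0..\<tau>} (snd z) * layer n (1 * (fst z - R1 (snd z)))
      + indicat_real {0..\<tau>} (snd z) * layer n (-1 * (fst z - R2 (snd z)))" for n z
  have Li: "integrable lborel (L n)" "(LBINT z. L n z) = 2 * \<tau>" if "0 < n" for n
    unfolding L_def using curve_layer[OF Rc(1) that _ wi, of 1] curve_layer[OF Rc(2) that _ wi, of "-1"] \<tau>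
    by simp_all
  have Lnn: "0 \<le> L n z" for n z unfolding L_def by (intro add_nonneg_nonneg mult_nonneg_nonneg layer_nonneg) auto
  have bound: "\<bar>edge n z\<bar> \<le> e * C * L n z"
    if n: "0 < n" and near: "\<forall>t\<in>{0..\<tau>}. \<forall>r. \<bar>r - R1 t\<bar> \<le> 2 / real n --> \<bar>u (r, t) - u (R1 t, t)\<bar> \<le> e"
      "\<forall>t\<in>{0..\<tau>}. \<forall>r. \<bar>r - R2 t\<bar> \<le> 2 / real n --> \<bar>u (r, t) - u (R2 t, t)\<bar> \<le> e" for n z e
  proof -
    obtain r t where z: "z = (r, t)" by (cases z)
    show ?thesis
    proof (cases "t \<in> {0..\<tau>}")
      case False
      then show ?thesis using plateau_outside[OF False] by (simp add: edge_def L_def z)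
    next
      case True
      have e: "0 \<le> e" using near(1)[rule_format, OF True, of "R1 t"] by simp
      have 1: "\<bar>layer n (r - R1 t) * ramp (real n * (R2 t - r)) * (u z - R1' t)\<bar> \<le> layer n (r - R1 t) * e"
      proof (cases "r - R1 t \<in> {1 / real n..2 / real n}")
        case F: True
        have "0 \<le> 1 / real n" by simp
        then have "\<bar>r - R1 t\<bar> \<le> 2 / real n" using F by auto
        then have "\<bar>u z - R1' t\<bar> \<le> e" using near(1) True tr(1)[OF True] by (simp add: z)
        then have "ramp (real n * (R2 t - r)) * \<bar>u z - R1' t\<bar> \<le> 1 * e"
          by (intro mult_mono ramp_le_1) auto
        then show ?thesis using layer_nonneg[of n] ramp_nonneg
          by (auto simp: abs_mult mult.assoc intro!: mult_left_mono)
      qed (simp add: layer_eq_0[OF n])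
      have 2: "\<bar>ramp (real n * (r - R1 t)) * layer n (R2 t - r) * (R2' t - u z)\<bar> \<le> layer n (R2 t - r) * e"
      proof (cases "R2 t - r \<in> {1 / real n..2 / real n}")
        case F: True
        have "0 \<le> 1 / real n" by simp
        then have "\<bar>r - R2 t\<bar> \<le> 2 / real n" using F by auto
        then have "\<bar>R2' t - u z\<bar> \<le> e" using near(2) True tr(2)[OF True] by (simp add: z abs_minus_commute)
        then have "ramp (real n * (r - R1 t)) * \<bar>R2' t - u z\<bar> \<le> 1 * e"
          by (intro mult_mono ramp_le_1) auto
        then have "layer n (R2 t - r) * (ramp (real n * (r - R1 t)) * \<bar>R2' t - u z\<bar>) \<le> layer n (R2 t - r) * e"
          using layer_nonneg[of n] by (intro mult_left_mono) auto
        then show ?thesis using layer_nonneg[of n "R2 t - r"] ramp_nonneg[of "real n * (r - R1 t)"]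
          by (simp add: abs_mult mult_ac)
      qed (simp add: layer_eq_0[OF n])
      have "\<bar>edge n z\<bar> \<le> 1 * (layer n (r - R1 t) * e + layer n (R2 t - r) * e) * C"
        unfolding edge_def abs_mult z snd_conv fst_conv
        using plateau_bounds[of n 0 \<tau> t] F(2)[of "(r, t)"] 1 2 layer_nonneg[of n] e
        by (intro mult_mono) (auto simp: z intro!: add_nonneg_nonneg mult_nonneg_nonneg)
      then show ?thesis using True by (simp add: L_def z algebra_simps)
    qed
  qed
  have near_ev: "\<exists>N. \<forall>n\<ge>N. (\<forall>t\<in>{0..\<tau>}. \<forall>r. \<bar>r - R1 t\<bar> \<le> 2 / real n --> \<bar>u (r, t) - u (R1 t, t)\<bar> \<le> e) \<and>
      (\<forall>t\<in>{0..\<tau>}. \<forall>r. \<bar>r - R2 t\<bar> \<le> 2 / real n --> \<bar>u (r, t) - u (R2 t, t)\<bar> \<le> e)" if e0: "e > 0" for e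
  proof -
    obtain N1 N2 where "\<forall>n\<ge>N1. \<forall>t\<in>{0..\<tau>}. \<forall>r. \<bar>r - R1 t\<bar> \<le> 2 / real n --> \<bar>u (r, t) - u (R1 t, t)\<bar> < e"
      "\<forall>n\<ge>N2. \<forall>t\<in>{0..\<tau>}. \<forall>r. \<bar>r - R2 t\<bar> \<le> 2 / real n --> \<bar>u (r, t) - u (R2 t, t)\<bar> < e"
      using near_curve[OF Rc(1) e0] near_curve[OF Rc(2) e0] by blast
    then show ?thesis by (intro exI[of _ "max N1 N2"]) (auto intro: less_imp_le)
  qed
  have int_gen: "integrable lborel (edge n)" "\<bar>LBINT z. edge n z\<bar> \<le> e * C * (2 * \<tau>)"
    if n: "0 < n" and near: "\<forall>t\<in>{0..\<tau>}. \<forall>r. \<bar>r - R1 t\<bar> \<le> 2 / real n --> \<bar>u (r, t) - u (R1 t, t)\<bar> \<le> e"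
      "\<forall>t\<in>{0..\<tau>}. \<forall>r. \<bar>r - R2 t\<bar> \<le> 2 / real n --> \<bar>u (r, t) - u (R2 t, t)\<bar> \<le> e" for n e
  proof -
    have Ji: "integrable lborel (\<lambda>z. e * C * L n z)" using Li[OF n] by simp
    show i: "integrable lborel (edge n)"
    proof (rule Bochner_Integration.integrable_bound[OF Ji])
      show "edge n \<in> borel_measurable lborel" using em by simp
      show "AE z in lborel. norm (edge n z) \<le> norm (e * C * L n z)"
        using order_trans[OF bound[OF n near] abs_ge_self] by (intro always_eventually allI) simp
    qed
    have "\<bar>LBINT z. edge n z\<bar> \<le> (LBINT z. \<bar>edge n z\<bar>)" by (rule integral_abs_bound)
    also have "\<dots> \<le> (LBINT z. e * C * L n z)"
      using i Ji bound[OF n near] by (intro integral_mono) auto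
    finally show "\<bar>LBINT z. edge n z\<bar> \<le> e * C * (2 * \<tau>)" using Li[OF n] by simp
  qed
  show "(\<lambda>n. LBINT z. edge n z) \<longlonglongrightarrow> 0"
  proof (rule LIMSEQ_I)
    fix d :: real assume d: "0 < d"
    define e where "e = d / (2 * (C * (2 * \<tau>) + 1))"
    have pos: "C * (2 * \<tau>) + 1 > 0" using C \<tau> by (smt (verit) mult_nonneg_nonneg)
    have e: "e > 0" using d pos by (simp add: e_def)
    obtain N where N: "\<forall>n\<ge>N. (\<forall>t\<in>{0..\<tau>}. \<forall>r. \<bar>r - R1 t\<bar> \<le> 2 / real n --> \<bar>u (r, t) - u (R1 t, t)\<bar> \<le> e) \<and>
      (\<forall>t\<in>{0..\<tau>}. \<forall>r. \<bar>r - R2 t\<bar> \<le> 2 / real n --> \<bar>u (r, t) - u (R2 t, t)\<bar> \<le> e)"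
      using near_ev[OF e] by blast
    have "e * (C * (2 * \<tau>)) \<le> e * (C * (2 * \<tau>) + 1)" using e by simp
    also have "\<dots> = d / 2"
    proof -
      have "d / (2 * X) * X = d / 2" if "X > 0" for X :: real using that by simp
      from this[OF pos] show ?thesis unfolding e_def .
    qed
    finally have "e * C * (2 * \<tau>) < d" using d by (simp add: mult.assoc)
    moreover have "\<bar>LBINT z. edge n z\<bar> \<le> e * C * (2 * \<tau>)" if n: "max N 1 \<le> n" for n
    proof -
      have n0: "0 < n" "N \<le> n" using n by auto
      note Nn = N[rule_format, OF n0(2)]
      show ?thesis by (rule int_gen(2)[OF n0(1) Nn[THEN conjunct1] Nn[THEN conjunct2]])
    qed
    ultimately have "norm ((LBINT z. edge n z) - 0) < d" if "max N 1 \<le> n" for n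
      using that by fastforce
    then show "\<exists>no. \<forall>n\<ge>no. norm ((LBINT z. edge n z) - 0) < d" by blast
  qed
  assume n: "0 < n"
  have comp: "bounded (u ` ({- b..b} \<times> {0..\<tau>}))" for b
    by (intro compact_imp_bounded compact_continuous_image continuous_on_subset[OF u] compact_Times compact_Icc) auto
  obtain b1 b2 where b: "\<And>t. t \<in> {0..\<tau>} ==> \<bar>R1 t\<bar> \<le> b1" "\<And>t. t \<in> {0..\<tau>} ==> \<bar>R2 t\<bar> \<le> b2"
    using bounded_on_interval[OF Rc(1)] bounded_on_interval[OF Rc(2)] by metis
  define b where "b = max b1 b2 + 2 / real n"
  obtain M where M: "\<And>z. z \<in> {- b..b} \<times> {0..\<tau>} ==> \<bar>u z\<bar> \<le> M"
    using comp[of b] unfolding bounded_iff by auto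
  have nn: "0 \<le> 2 / real n" by simp
  have M2: "\<bar>u (r, t) - u (R t, t)\<bar> \<le> 2 * M" if "t \<in> {0..\<tau>}" "\<bar>r - R t\<bar> \<le> 2 / real n" "\<bar>R t\<bar> \<le> max b1 b2" for r t R
  proof -
    have "(r, t) \<in> {- b..b} \<times> {0..\<tau>}" "(R t, t) \<in> {- b..b} \<times> {0..\<tau>}"
      using that nn unfolding b_def mem_Times_iff by auto
    from M[OF this(1)] M[OF this(2)] show ?thesis by linarith
  qed
  show "integrable lborel (edge n)"
  proof (rule int_gen(1)[OF n, of "2 * M"]; intro ballI allI impI)
    fix t r assume t: "t \<in> {0..\<tau>}"
    show "\<bar>u (r, t) - u (R1 t, t)\<bar> \<le> 2 * M" if "\<bar>r - R1 t\<bar> \<le> 2 / real n"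
      by (rule M2[where R=R1, OF t that]) (use b(1)[OF t] in simp)
    show "\<bar>u (r, t) - u (R2 t, t)\<bar> \<le> 2 * M" if "\<bar>r - R2 t\<bar> \<le> 2 / real n"
      by (rule M2[where R=R2, OF t that]) (use b(2)[OF t] in simp)
  qed
qed

text \<open>The time layers of the cutoff leave the masses at the two ends, and the lateral layers contribute
  nothing since the curves move with the velocity.\<close>

theorem strip_limit:
  "(\<lambda>n. LBINT z. (strip_t n \<tau> R1 R2 R1' R2' z + u z * strip_r n \<tau> R1 R2 z) * F z) \<longlonglongrightarrow>
     (LBINT r:{R1 0..R2 0}. F (r, 0)) - (LBINT r:{R1 \<tau>..R2 \<tau>}. F (r, \<tau>))"
proof -
  obtain N where N: "real N > 4 / \<tau>" using reals_Archimedean2 by blast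
  define S where "S n z = plateau' n 0 \<tau> (snd z) * (plateau n (R1 (snd z)) (R2 (snd z)) (fst z) * F z)" for n z
  have split: "(strip_t n \<tau> R1 R2 R1' R2' z + u z * strip_r n \<tau> R1 R2 z) * F z = S n z + edge n z" for n z
    unfolding strip_t_def strip_r_def S_def edge_def plateau'_layer[of n "R1 _"] by (simp add: algebra_simps)
  have Rc: "continuous_on UNIV R1" "continuous_on UNIV R2" by (rule R_continuous)+
  note cs = continuous_snd_comp[OF Rc(1)] continuous_snd_comp[OF Rc(2)]
  obtain b1 b2 where b: "\<And>t. t \<in> {0..\<tau>} ==> \<bar>R1 t\<bar> \<le> b1" "\<And>t. t \<in> {0..\<tau>} ==> \<bar>R2 t\<bar> \<le> b2"
    using bounded_on_interval[OF Rc(1)] bounded_on_interval[OF Rc(2)] by metis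
  have Sc: "continuous_on UNIV (S n)" for n
    unfolding S_def[abs_def] plateau_def plateau'_layer by (intro continuous_intros cs F)
  have Si: "integrable lborel (S n)" for n
  proof -
    have "set_integrable lborel ({- b1..b2} \<times> {0..\<tau>}) (S n)"
      unfolding set_integrable_def
      by (intro borel_integrable_compact compact_Times compact_Icc continuous_on_subset[OF Sc]) auto
    moreover have "indicat_real ({- b1..b2} \<times> {0..\<tau>}) z *\<^sub>R S n z = S n z" for z
    proof (cases "z \<in> {- b1..b2} \<times> {0..\<tau>}")
      case False
      then have "snd z \<notin> {0..\<tau>} \<or> (snd z \<in> {0..\<tau>} \<and> fst z \<notin> {R1 (snd z)..R2 (snd z)})"
        using b[of "snd z"] by (auto simp: mem_Times_iff)
      then have "S n z = 0" using plateau_outside by (auto simp: S_def)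
      then show ?thesis by simp
    qed simp
    ultimately show ?thesis unfolding set_integrable_def by (simp only:)
  qed
  have eq: "(LBINT z. (strip_t n \<tau> R1 R2 R1' R2' z + u z * strip_r n \<tau> R1 R2 z) * F z) =
      (LBINT t. layer n (1 * (t - 0)) * slab n t) - (LBINT t. layer n (-1 * (t - \<tau>)) * slab n t)
        + (LBINT z. edge n z)" if n: "n \<ge> max N 1" for n
  proof -
    have n0: "0 < n" "real n > 4 / \<tau>" using n N by auto
    then have n\<tau>: "real n * \<tau> > 4" using \<tau> by (simp add: field_simps)
    then have n2: "2 / real n \<le> \<tau>" using n0 by (simp add: field_simps)
    have p: "plateau' n 0 \<tau> t = layer n (1 * (t - 0)) - layer n (-1 * (t - \<tau>))" for t
    proof -
      have l1: "layer n t * ramp (real n * (\<tau> - t)) = layer n t"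
      proof (cases "real n * t \<le> 2")
        case True
        then have "2 \<le> real n * (\<tau> - t)" using n\<tau> by (simp add: algebra_simps)
        then show ?thesis by (simp add: ramp_eq_1)
      next
        case False
        then show ?thesis by (simp add: layer_def tent_eq_0)
      qed
      have l2: "ramp (real n * t) * layer n (\<tau> - t) = layer n (\<tau> - t)"
      proof (cases "real n * (\<tau> - t) \<le> 2")
        case True
        then have "2 \<le> real n * t" using n\<tau> by (simp add: algebra_simps)
        then show ?thesis by (simp add: ramp_eq_1)
      next
        case False
        then show ?thesis by (simp add: layer_def tent_eq_0)
      qed
      have "plateau' n 0 \<tau> t = layer n t - layer n (\<tau> - t)"
        by (simp only: plateau'_layer diff_0_right l1 l2)
      then show ?thesis by simp
    qed
    have i1: "integrable lborel (\<lambda>t. layer n (1 * (t - 0)) * slab n t)"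
      by (rule slab_layer_integrable) (use n0 n2 in auto)
    have i2: "integrable lborel (\<lambda>t. layer n (-1 * (t - \<tau>)) * slab n t)"
      by (rule slab_layer_integrable) (use n0 n2 in auto)
    have "(LBINT z. S n z) = (LBINT t. plateau' n 0 \<tau> t * slab n t)"
      using plane_Fubini(3)[OF Si[of n]] by (simp add: S_def slab_def)
    also have "\<dots> = (LBINT t. layer n (1 * (t - 0)) * slab n t - layer n (-1 * (t - \<tau>)) * slab n t)"
      unfolding p by (simp add: left_diff_distrib)
    also have "\<dots> = (LBINT t. layer n (1 * (t - 0)) * slab n t) - (LBINT t. layer n (-1 * (t - \<tau>)) * slab n t)"
      by (rule Bochner_Integration.integral_diff[OF i1 i2])
    finally show ?thesis unfolding split using Si edge_integrable[OF n0(1)] by simp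
  qed
  have "(\<lambda>n. (LBINT t. layer n (1 * (t - 0)) * slab n t) - (LBINT t. layer n (-1 * (t - \<tau>)) * slab n t)
        + (LBINT z. edge n z)) \<longlonglongrightarrow> (LBINT r:{R1 0..R2 0}. F (r, 0)) - (LBINT r:{R1 \<tau>..R2 \<tau>}. F (r, \<tau>)) + 0"
    by (intro tendsto_add tendsto_diff time_layer_tendsto edge_tendsto) auto
  then have lim: "(\<lambda>n. (LBINT t. layer n (1 * (t - 0)) * slab n t) - (LBINT t. layer n (-1 * (t - \<tau>)) * slab n t)
        + (LBINT z. edge n z)) \<longlonglongrightarrow> (LBINT r:{R1 0..R2 0}. F (r, 0)) - (LBINT r:{R1 \<tau>..R2 \<tau>}. F (r, \<tau>))" by simp
  have ev: "eventually (\<lambda>n. (LBINT t. layer n (1 * (t - 0)) * slab n t) - (LBINT t. layer n (-1 * (t - \<tau>)) * slab n t)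
        + (LBINT z. edge n z) =
      (LBINT z. (strip_t n \<tau> R1 R2 R1' R2' z + u z * strip_r n \<tau> R1 R2 z) * F z)) sequentially"
    unfolding eventually_sequentially by (intro exI[of _ "max N 1"] allI impI) (rule eq[symmetric])
  show ?thesis by (rule Lim_transform_eventually[OF lim ev])
qed

end

lemma strip_outside:
  assumes "fst z \<notin> {R1 (snd z)..R2 (snd z)} \<or> snd z \<notin> {0..\<tau>}"
  shows "strip n \<tau> R1 R2 z = 0" "strip_r n \<tau> R1 R2 z = 0" "strip_t n \<tau> R1 R2 R1' R2' z = 0"
proof -
  have "real n * snd z \<le> 0 \<or> real n * (\<tau> - snd z) \<le> 0 \<or> real n * (fst z - R1 (snd z)) \<le> 0 \<or> real n * (R2 (snd z) - fst z) \<le> 0"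
    using assms by (auto simp: mult_le_0_iff)
  then show "strip n \<tau> R1 R2 z = 0" "strip_r n \<tau> R1 R2 z = 0" "strip_t n \<tau> R1 R2 R1' R2' z = 0"
    by (auto simp: strip_def strip_r_def strip_t_def plateau_def plateau'_def layer_def ramp_eq_0 tent_eq_0)
qed

text \<open>Only the values of \<open>F\<close> between the two curves matter, and these are bounded.\<close>

lemma strip_limit_continuous:
  fixes u F :: "real \<times> real => real"
  assumes \<tau>: "0 < \<tau>"
    and R1: "\<And>t. (R1 has_real_derivative R1' t) (at t)" "continuous_on UNIV R1'"
    and R2: "\<And>t. (R2 has_real_derivative R2' t) (at t)" "continuous_on UNIV R2'"
    and u: "continuous_on UNIV u" and F: "continuous_on UNIV F"
    and tr: "\<And>t. t \<in> {0..\<tau>} ==> R1' t = u (R1 t, t)" "\<And>t. t \<in> {0..\<tau>} ==> R2' t = u (R2 t, t)"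
  shows "(\<lambda>n. LBINT z. (strip_t n \<tau> R1 R2 R1' R2' z + u z * strip_r n \<tau> R1 R2 z) * F z) \<longlonglongrightarrow>
     (LBINT r:{R1 0..R2 0}. F (r, 0)) - (LBINT r:{R1 \<tau>..R2 \<tau>}. F (r, \<tau>))"
proof -
  have Rc: "continuous_on UNIV R1" "continuous_on UNIV R2"
    using DERIV_continuous_on[OF has_field_derivative_at_within[OF R1(1)]]
      DERIV_continuous_on[OF has_field_derivative_at_within[OF R2(1)]] by auto
  obtain b1 b2 where b: "\<And>t. t \<in> {0..\<tau>} ==> \<bar>R1 t\<bar> \<le> b1" "\<And>t. t \<in> {0..\<tau>} ==> \<bar>R2 t\<bar> \<le> b2"
    using bounded_on_interval[OF Rc(1)] bounded_on_interval[OF Rc(2)] by metis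
  have "bounded (F ` ({- b1..b2} \<times> {0..\<tau>}))"
    by (intro compact_imp_bounded compact_continuous_image continuous_on_subset[OF F] compact_Times compact_Icc) auto
  then obtain C where C: "\<And>z. z \<in> {- b1..b2} \<times> {0..\<tau>} ==> \<bar>F z\<bar> \<le> C" unfolding bounded_iff by auto
  (* F truncated at its bound on a rectangle that contains the region *)
  define G where "G z = max (- \<bar>C\<bar>) (min \<bar>C\<bar> (F z))" for z
  have Gc: "continuous_on UNIV G" unfolding G_def[abs_def] by (intro continuous_intros F)
  have Gb: "\<bar>G z\<bar> \<le> \<bar>C\<bar>" for z unfolding G_def by auto
  have GF: "G (r, t) = F (r, t)" if "t \<in> {0..\<tau>}" "r \<in> {R1 t..R2 t}" for r t
  proof -
    have "(r, t) \<in> {- b1..b2} \<times> {0..\<tau>}" using b[OF that(1)] that by auto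
    then show ?thesis using C[of "(r, t)"] by (auto simp: G_def)
  qed
  have e1: "(strip_t n \<tau> R1 R2 R1' R2' z + u z * strip_r n \<tau> R1 R2 z) * G z
      = (strip_t n \<tau> R1 R2 R1' R2' z + u z * strip_r n \<tau> R1 R2 z) * F z" for n z
  proof (cases "fst z \<notin> {R1 (snd z)..R2 (snd z)} \<or> snd z \<notin> {0..\<tau>}")
    case True then show ?thesis by (simp only: strip_outside[where z=z and ?R1.0=R1 and ?R2.0=R2 and \<tau>=\<tau>, OF True]) simp
  next
    case False then show ?thesis using GF[of "snd z" "fst z"] by simp
  qed
  have e2: "(LBINT r:{R1 t..R2 t}. G (r, t)) = (LBINT r:{R1 t..R2 t}. F (r, t))" if "t \<in> {0..\<tau>}" for t
    using GF[OF that] by (intro set_lebesgue_integral_cong) auto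
  show ?thesis
    using strip_limit[OF \<tau> R1 R2 u Gc Gb tr] e2[of 0] e2[of \<tau>] \<tau> unfolding e1 by simp
qed

text \<open>No mass crosses a trajectory, so the mass between two of them changes only through the
  source.\<close>

theorem transport_between_trajectories:
  fixes u F :: "real \<times> real => real"
  assumes \<tau>: "0 < \<tau>"
    and R1: "\<And>t. (R1 has_real_derivative R1' t) (at t)" "continuous_on UNIV R1'"
    and R2: "\<And>t. (R2 has_real_derivative R2' t) (at t)" "continuous_on UNIV R2'"
    and u: "continuous_on UNIV u" and F: "continuous_on UNIV F"
    and tr: "\<And>t. t \<in> {0..\<tau>} ==> R1' t = u (R1 t, t)" "\<And>t. t \<in> {0..\<tau>} ==> R2' t = u (R2 t, t)"
    and Q: "\<And>r t. 0 < t ==> t < \<tau> ==> R1 t < r ==> r < R2 t ==> (r, t) \<in> Q"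
    and wt: "wdt Q F Ft" and wr: "wdr Q (\<lambda>z. u z * F z) G"
    and src: "AE z in lborel. z \<in> Q --> \<bar>Ft z + G z\<bar> \<le> h z" and h: "integrable lborel (\<lambda>z. indicator Q z * h z)"
  shows "\<bar>(LBINT r:{R1 \<tau>..R2 \<tau>}. F (r, \<tau>)) - (LBINT r:{R1 0..R2 0}. F (r, 0))\<bar> \<le> (LBINT z. indicator Q z * h z)"
proof -
  have bd: "\<bar>LBINT z. (strip_t n \<tau> R1 R2 R1' R2' z + u z * strip_r n \<tau> R1 R2 z) * F z\<bar> \<le> (LBINT z. indicator Q z * h z)"
    if n: "n \<ge> 1" for n
  proof -
    have t: "test_on Q (strip n \<tau> R1 R2) (strip_r n \<tau> R1 R2) (strip_t n \<tau> R1 R2 R1' R2')"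
      using n by (intro strip_test_on R1 R2 Q) auto
    note ti = test_on_integrable[OF t]
    have li: "loc_int Q F" "loc_int Q Ft" "loc_int Q (\<lambda>z. u z * F z)" "loc_int Q G" using wt wr by (auto simp: wdt_def wdr_def)
    have e1: "(LBINT z. strip_t n \<tau> R1 R2 R1' R2' z * F z) = - (LBINT z. strip n \<tau> R1 R2 z * Ft z)"
      using wt t unfolding wdt_def by blast
    have e2: "(LBINT z. strip_r n \<tau> R1 R2 z * (u z * F z)) = - (LBINT z. strip n \<tau> R1 R2 z * G z)"
      using wr t unfolding wdr_def by blast
    have "(LBINT z. (strip_t n \<tau> R1 R2 R1' R2' z + u z * strip_r n \<tau> R1 R2 z) * F z)
        = (LBINT z. strip_t n \<tau> R1 R2 R1' R2' z * F z + strip_r n \<tau> R1 R2 z * (u z * F z))"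
      by (simp add: algebra_simps)
    also have "\<dots> = - (LBINT z. strip n \<tau> R1 R2 z * Ft z + strip n \<tau> R1 R2 z * G z)"
      using e1 e2 ti li by simp
    finally have "\<bar>LBINT z. (strip_t n \<tau> R1 R2 R1' R2' z + u z * strip_r n \<tau> R1 R2 z) * F z\<bar> =
        \<bar>LBINT z. strip n \<tau> R1 R2 z * Ft z + strip n \<tau> R1 R2 z * G z\<bar>" by (simp only: abs_minus_cancel)
    also have "\<dots> \<le> (LBINT z. \<bar>strip n \<tau> R1 R2 z * Ft z + strip n \<tau> R1 R2 z * G z\<bar>)"
      by (simp add: integral_abs_bound)
    also have "\<dots> \<le> (LBINT z. indicator Q z * h z)"
    proof (rule integral_mono_AE)
      show "integrable lborel (\<lambda>z. \<bar>strip n \<tau> R1 R2 z * Ft z + strip n \<tau> R1 R2 z * G z\<bar>)"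
        by (rule Bochner_Integration.integrable_abs[OF Bochner_Integration.integrable_add[OF ti(1)[OF li(2)] ti(1)[OF li(4)]]])
      show "AE z in lborel. \<bar>strip n \<tau> R1 R2 z * Ft z + strip n \<tau> R1 R2 z * G z\<bar> \<le> indicator Q z * h z"
      proof (rule AE_mp[OF src], intro always_eventually allI impI)
        fix z assume elim: "z \<in> Q --> \<bar>Ft z + G z\<bar> \<le> h z"
        show "\<bar>strip n \<tau> R1 R2 z * Ft z + strip n \<tau> R1 R2 z * G z\<bar> \<le> indicator Q z * h z"
        proof (cases "z \<in> Q")
          case True
          have "\<bar>strip n \<tau> R1 R2 z * Ft z + strip n \<tau> R1 R2 z * G z\<bar> = strip n \<tau> R1 R2 z * \<bar>Ft z + G z\<bar>"
            using strip_bounds(1) by (simp add: abs_mult distrib_left[symmetric])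
          also have "\<dots> \<le> 1 * h z"
          proof (rule mult_mono)
            show le: "\<bar>Ft z + G z\<bar> \<le> h z" using elim True by blast
          qed (use strip_bounds in auto)
          finally show ?thesis using True by simp
        next
          case False
          obtain K where "K \<subseteq> Q" "\<And>z. z \<notin> K ==> strip n \<tau> R1 R2 z = 0" using t unfolding test_on_def by blast
          then have "strip n \<tau> R1 R2 z = 0" using False by blast
          then show ?thesis using False by simp
        qed
      qed
    qed (rule h)
    finally show ?thesis .
  qed
  have "\<bar>(LBINT r:{R1 0..R2 0}. F (r, 0)) - (LBINT r:{R1 \<tau>..R2 \<tau>}. F (r, \<tau>))\<bar> \<le> (LBINT z. indicator Q z * h z)"
  proof (rule LIMSEQ_le_const2)
    show "(\<lambda>n. \<bar>LBINT z. (strip_t n \<tau> R1 R2 R1' R2' z + u z * strip_r n \<tau> R1 R2 z) * F z\<bar>) \<longlonglongrightarrow>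
        \<bar>(LBINT r:{R1 0..R2 0}. F (r, 0)) - (LBINT r:{R1 \<tau>..R2 \<tau>}. F (r, \<tau>))\<bar>"
      by (rule tendsto_rabs[OF strip_limit_continuous[OF \<tau> R1 R2 u F tr]])
    show "\<exists>N. \<forall>n\<ge>N. \<bar>LBINT z. (strip_t n \<tau> R1 R2 R1' R2' z + u z * strip_r n \<tau> R1 R2 z) * F z\<bar>
        \<le> (LBINT z. indicator Q z * h z)"
      using bd by (intro exI[of _ 1] allI impI)
  qed
  then show ?thesis by (simp add: abs_minus_commute)
qed

section \<open>The flow and its time slices\<close>

text \<open>A radial flow in the form in which it is analysed: fields in the variable \<open>z = (r, t)\<close>, continuous and
  bounded on the whole plane, with Borel representatives of the weak derivatives on the region \<open>Q\<close>
  below the free surface. The weights in \<open>ut_L2\<close> are those of polar coordinates.\<close>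

locale mhd_flow =
  fixes \<nu> \<gamma> T M :: real and a a' :: "real => real"
    and \<rho> u P B \<rho>t ut Pt Bt \<rho>ur ur divr Pr Br uBr :: "real \<times> real => real"
    and Q :: "(real \<times> real) set"
  assumes \<nu>: "0 < \<nu>" and \<gamma>: "1 < \<gamma>" and T: "0 < T"
    and Q_def: "Q = {(r, t). 0 < t \<and> t < T \<and> 0 < r \<and> r < a t}"
    and a: "\<And>t. (a has_real_derivative a' t) (at t)" "continuous_on UNIV a'"
    and a_pos: "\<And>t. t \<in> {0..T} ==> 0 < a t"
    and a_traj: "\<And>t. t \<in> {0..T} ==> a' t = u (a t, t)"
    and cont: "continuous_on UNIV \<rho>" "continuous_on UNIV u" "continuous_on UNIV P" "continuous_on UNIV B"
    and bounded: "\<And>z. \<bar>\<rho> z\<bar> \<le> M" "\<And>z. \<bar>u z\<bar> \<le> M" "\<And>z. \<bar>P z\<bar> \<le> M" "\<And>z. \<bar>B z\<bar> \<le> M"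
    and u0: "\<And>t. t \<in> {0..T} ==> u (0, t) = 0" and B0: "\<And>t. t \<in> {0..T} ==> B (0, t) = 0"
    and wt: "wdt Q \<rho> \<rho>t" "wdt Q u ut" "wdt Q P Pt" "wdt Q B Bt"
    and wr: "wdr Q (\<lambda>z. \<rho> z * u z) \<rho>ur" "wdr Q u ur" "wdr Q (\<lambda>z. ur z + u z / fst z) divr"
      "wdr Q P Pr" "wdr Q B Br" "wdr Q (\<lambda>z. u z * B z) uBr"
    and eqs: "AE z in lborel. z \<in> Q -->
        \<rho>t z + \<rho>ur z + \<rho> z * u z / fst z = 0 \<and>
        \<rho> z * (ut z + u z * ur z) + Pr z = \<nu> * divr z - B z * (Br z + B z / fst z) \<and>
        Pt z + u z * Pr z + \<gamma> * P z * (ur z + u z / fst z) = 0 \<and>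
        Bt z + uBr z = 0"
    and bc: "\<And>t. t \<in> {0..T} ==> \<exists>d. ((\<lambda>r. u (r, t)) has_real_derivative d) (at (a t) within {0..a t}) \<and>
        (B (a t, t))\<^sup>2 / 2 + P (a t, t) - \<nu> * (d + u (a t, t) / a t) = 0"
    and ut_L2: "integrable lborel (\<lambda>z. indicator Q z * ((ut z)\<^sup>2 * fst z))"
    and init: "\<And>r. r \<in> {0..a 0} ==> 0 \<le> \<rho> (r, 0) \<and> 0 \<le> P (r, 0)"
begin

lemma a_cont: "continuous_on UNIV a"
  using DERIV_continuous_on[OF has_field_derivative_at_within[OF a(1)]] by auto

lemma M_nonneg: "0 \<le> M"
  using bounded(1)[of 0] by simp

lemma B_square_le: "(B z)\<^sup>2 \<le> M\<^sup>2"
  using bounded(4)[of z] by (rule abs_le_square_iff[THEN iffD1, OF order_trans[OF _ abs_ge_self]])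

lemma a_min: obtains am where "0 < am" "\<And>t. t \<in> {0..T} ==> am \<le> a t"
proof -
  have "\<exists>t0\<in>{0..T}. \<forall>t\<in>{0..T}. a t0 \<le> a t"
    by (rule continuous_attains_inf) (use T a_cont in \<open>auto intro: continuous_on_subset\<close>)
  then show ?thesis using that a_pos by blast
qed

lemma open_Q: "open Q"
proof -
  have "Q = {z. 0 < snd z} \<inter> {z. snd z < T} \<inter> {z. 0 < fst z} \<inter> {z. fst z < a (snd z)}"
    by (auto simp: Q_def)
  moreover have "open \<dots>"
    by (intro open_Int open_Collect_less continuous_intros continuous_snd_comp[OF a_cont])
  ultimately show ?thesis by simp
qed

lemma segment_in_Q: "t \<in> {0<..<T} ==> 0 < p ==> q < a t ==> {p..q} \<times> {t} \<subseteq> Q"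
  by (auto simp: Q_def)

definition D :: "real \<times> real => real" where "D z = ur z + u z / fst z"

definition stress :: "real \<times> real => real" where "stress z = P z + (B z)\<^sup>2 / 2 - \<nu> * D z"

definition force :: "real \<times> real => real" where
  "force z = \<rho> z * (ut z + u z * ur z) + (B z)\<^sup>2 / fst z"

lemma measurable_fields[measurable]:
  "\<rho> \<in> borel_measurable borel" "u \<in> borel_measurable borel" "P \<in> borel_measurable borel"
  "B \<in> borel_measurable borel" "ut \<in> borel_measurable borel" "ur \<in> borel_measurable borel"
  "divr \<in> borel_measurable borel" "Pr \<in> borel_measurable borel" "Br \<in> borel_measurable borel"
  using cont wt wr unfolding wdt_def wdr_def loc_int_def by (auto intro: borel_measurable_continuous_onI)

lemma measurable_fst_plane[measurable]: "(fst :: real \<times> real => real) \<in> borel_measurable borel"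
  and measurable_snd_plane[measurable]: "(snd :: real \<times> real => real) \<in> borel_measurable borel"
  by (intro borel_measurable_continuous_onI continuous_intros)+

lemma measurable_D[measurable]: "D \<in> borel_measurable borel"
  unfolding D_def[abs_def] by measurable

lemma measurable_force: "force \<in> borel_measurable borel"
  unfolding force_def[abs_def] by measurable

lemma measurable_slice: "f \<in> borel_measurable borel ==> (\<lambda>r. f (r, t)) \<in> borel_measurable borel"
  for f :: "real \<times> real => real"
proof -
  assume f: "f \<in> borel_measurable borel"
  have "(\<lambda>r::real. (r, t)) \<in> borel \<rightarrow>\<^sub>M borel" by (intro borel_measurable_continuous_onI continuous_intros)
  from measurable_compose[OF this f] show ?thesis .
qed

text \<open>Times at which all regularity needed in one dimension is available. The representative of \<open>D\<close> is
  asserted on one segment at a time.\<close>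

definition good :: "real => bool" where
  "good t \<longleftrightarrow> t \<in> {0<..<T} \<and>
     (\<forall>p q. 0 < p --> p < q --> q < a t -->
        ac p q (\<lambda>r. u (r, t)) (\<lambda>r. ur (r, t)) \<and>
        ac p q (\<lambda>r. P (r, t)) (\<lambda>r. Pr (r, t)) \<and>
        ac p q (\<lambda>r. B (r, t)) (\<lambda>r. Br (r, t)) \<and>
        (\<exists>F. ac p q F (\<lambda>r. divr (r, t)) \<and> (AE r in lborel. r \<in> {p..q} --> D (r, t) = F r))) \<and>
     (AE r in lborel. r \<in> {0<..<a t} -->
        \<rho> (r, t) * (ut (r, t) + u (r, t) * ur (r, t)) + Pr (r, t) =
        \<nu> * divr (r, t) - B (r, t) * (Br (r, t) + B (r, t) / r)) \<and>
     integrable lborel (\<lambda>r. indicator {0<..<a t} r * ((ut (r, t))\<^sup>2 * r))"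

lemma AE_good: "AE t in lborel. t \<in> {0<..<T} --> good t"
proof -
  note s = wdr_slices_continuous[OF open_Q wr(2) cont(2)] wdr_slices_continuous[OF open_Q wr(4) cont(3)]
    wdr_slices_continuous[OF open_Q wr(5) cont(4)] wdr_slices[OF open_Q wr(3)]
    plane_AE_slices[OF eqs] plane_Fubini(1)[OF ut_L2]
  show ?thesis using s
  proof eventually_elim
    case (elim t)
    show ?case
    proof
      assume t: "t \<in> {0<..<T}"
      have Qi: "(r, t) \<in> Q \<longleftrightarrow> r \<in> {0<..<a t}" for r using t by (auto simp: Q_def)
      have "indicat_real Q (r, t) = indicator {0<..<a t} r" for r using Qi[of r] by (simp add: indicator_def)
      then have "integrable lborel (\<lambda>r. indicator {0<..<a t} r * ((ut (r, t))\<^sup>2 * r))" using elim(6) by simp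
      moreover have "AE r in lborel. r \<in> {0<..<a t} -->
        \<rho> (r, t) * (ut (r, t) + u (r, t) * ur (r, t)) + Pr (r, t) =
        \<nu> * divr (r, t) - B (r, t) * (Br (r, t) + B (r, t) / r)"
        using elim(5) by (rule AE_mp) (simp add: Qi)
      moreover note segment_in_Q[OF t]
      ultimately show "good t" unfolding good_def D_def using elim(1-4) t by simp
    qed
  qed
qed

lemma goodD:
  assumes "good t"
  shows "t \<in> {0<..<T}" "t \<in> {0..T}" "0 < a t"
    and "0 < p ==> p < q ==> q < a t ==> ac p q (\<lambda>r. u (r, t)) (\<lambda>r. ur (r, t))"
    and "0 < p ==> p < q ==> q < a t ==> ac p q (\<lambda>r. P (r, t)) (\<lambda>r. Pr (r, t))"
    and "0 < p ==> p < q ==> q < a t ==> ac p q (\<lambda>r. B (r, t)) (\<lambda>r. Br (r, t))"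
    and "AE r in lborel. r \<in> {0<..<a t} -->
        \<rho> (r, t) * (ut (r, t) + u (r, t) * ur (r, t)) + Pr (r, t) =
        \<nu> * divr (r, t) - B (r, t) * (Br (r, t) + B (r, t) / r)"
    and "integrable lborel (\<lambda>r. indicator {0<..<a t} r * ((ut (r, t))\<^sup>2 * r))"
proof -
  note c = assms[unfolded good_def]
  note c2 = c[THEN conjunct2, THEN conjunct1, rule_format]
  show t: "t \<in> {0<..<T}" by (rule c[THEN conjunct1])
  then show "t \<in> {0..T}" by simp
  then show "0 < a t" by (rule a_pos)
  show "0 < p ==> p < q ==> q < a t ==> ac p q (\<lambda>r. u (r, t)) (\<lambda>r. ur (r, t))"
    by (rule c2[THEN conjunct1])
  show "0 < p ==> p < q ==> q < a t ==> ac p q (\<lambda>r. P (r, t)) (\<lambda>r. Pr (r, t))"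
    by (rule c2[THEN conjunct2, THEN conjunct1])
  show "0 < p ==> p < q ==> q < a t ==> ac p q (\<lambda>r. B (r, t)) (\<lambda>r. Br (r, t))"
    by (rule c2[THEN conjunct2, THEN conjunct2, THEN conjunct1])
  show "AE r in lborel. r \<in> {0<..<a t} -->
        \<rho> (r, t) * (ut (r, t) + u (r, t) * ur (r, t)) + Pr (r, t) =
        \<nu> * divr (r, t) - B (r, t) * (Br (r, t) + B (r, t) / r)"
    by (rule c[THEN conjunct2, THEN conjunct2, THEN conjunct1])
  show "integrable lborel (\<lambda>r. indicator {0<..<a t} r * ((ut (r, t))\<^sup>2 * r))"
    by (rule c[THEN conjunct2, THEN conjunct2, THEN conjunct2])
qed

lemma good_D:
  assumes "good t" "0 < p" "p < q" "q < a t"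
  shows "\<exists>F. ac p q F (\<lambda>r. divr (r, t)) \<and> (AE r in lborel. r \<in> {p..q} --> D (r, t) = F r)"
  using assms(1)[unfolded good_def, THEN conjunct2, THEN conjunct1, rule_format, OF assms(2-4)]
  by (elim conjE)

text \<open>On a good slice the representatives of \<open>D\<close> on larger and larger intervals agree where both are
  defined, so they glue to one function.\<close>

lemma D_representative:
  assumes g: "good t"
  shows "\<exists>F. (\<forall>p q. 0 < p --> p < q --> q < a t --> ac p q F (\<lambda>r. divr (r, t))) \<and>
    (AE r in lborel. r \<in> {0<..<a t} --> D (r, t) = F r)"
proof -
  define p where "p n = a t / (real n + 3)" for n
  define q where "q n = a t - a t / (real n + 3)" for n
  have at: "0 < a t" using goodD(3)[OF g] .
  have pos: "0 < p n" "p n < q n" "q n < a t" for n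
  proof -
    have "a t / (real n + 3) \<le> a t / 3" using at by (intro divide_left_mono) auto
    moreover have "0 < a t / (real n + 3)" using at by simp
    ultimately show "0 < p n" "p n < q n" "q n < a t" unfolding p_def q_def using at by linarith+
  qed
  have mono: "p m \<le> p n" "q n \<le> q m" if "n \<le> m" for n m
  proof -
    have "a t / (real m + 3) \<le> a t / (real n + 3)" using at that by (intro divide_left_mono) auto
    then show "p m \<le> p n" "q n \<le> q m" unfolding p_def q_def by auto
  qed
  have ex: "\<exists>n. p n \<le> x \<and> y \<le> q n" if "0 < x" "y < a t" for x y
  proof -
    obtain n :: nat where n: "real n > a t / x + a t / (a t - y)" using reals_Archimedean2 by blast
    have d: "0 < a t / x" "0 < a t / (a t - y)" using at that by auto
    then have "a t / x < real n + 3" "a t / (a t - y) < real n + 3" using n by linarith+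
    then have "a t / (real n + 3) < x" "a t / (real n + 3) < a t - y" using that at by (auto simp: field_simps)
    then show ?thesis unfolding p_def q_def by (intro exI[of _ n]) auto
  qed
  have "\<forall>n. \<exists>F. ac (p n) (q n) F (\<lambda>r. divr (r, t)) \<and> (AE r in lborel. r \<in> {p n..q n} --> D (r, t) = F r)"
    by (intro allI good_D[OF g] pos)
  from choice[OF this] obtain G where GG: "\<forall>n. ac (p n) (q n) (G n) (\<lambda>r. divr (r, t)) \<and>
      (AE r in lborel. r \<in> {p n..q n} --> D (r, t) = G n r)" ..
  have G: "ac (p n) (q n) (G n) (\<lambda>r. divr (r, t))" "AE r in lborel. r \<in> {p n..q n} --> D (r, t) = G n r" for n
    by (rule GG[rule_format, THEN conjunct1], rule GG[rule_format, THEN conjunct2])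
  have agree: "G m r = G n r" if "n \<le> m" "r \<in> {p n..q n}" for n m r
  proof (rule continuous_AE_eq[OF pos(2)[of n] _ _ _ that(2)])
    show "continuous_on {p n..q n} (G m)"
      using ac_continuous[OF G(1)[of m]] mono[OF that(1)] by (auto intro: continuous_on_subset)
    show "continuous_on {p n..q n} (G n)" by (rule ac_continuous[OF G(1)])
    show "AE x in lborel. x \<in> {p n..q n} --> G m x = G n x"
      using G(2)[of n] G(2)[of m] by eventually_elim (use mono[OF that(1)] in auto)
  qed
  define F where "F r = G (SOME n. p n \<le> r \<and> r \<le> q n) r" for r
  have FG: "F r = G n r" if "r \<in> {p n..q n}" for n r
  proof -
    define k where "k = (SOME n. p n \<le> r \<and> r \<le> q n)"
    have "p n \<le> r \<and> r \<le> q n" using that by simp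
    then have "p k \<le> r \<and> r \<le> q k" unfolding k_def by (rule someI)
    then show ?thesis using agree[of k n r] agree[of n k r] that
      unfolding F_def k_def[symmetric] by (cases "k \<le> n") auto
  qed
  have "ac x y F (\<lambda>r. divr (r, t))" if xy: "0 < x" "x < y" "y < a t" for x y
  proof -
    obtain n where n: "p n \<le> x" "y \<le> q n" using ex[OF xy(1,3)] by blast
    have "ac x y (G n) (\<lambda>r. divr (r, t))" using ac_subset[OF G(1) n] .
    moreover have "G n r = F r" if "r \<in> {x..y}" for r using FG[of r n] n that by auto
    ultimately show ?thesis by (auto simp: ac_def)
  qed
  moreover have "AE r in lborel. \<forall>n. r \<in> {p n..q n} --> D (r, t) = G n r"
    unfolding AE_all_countable by (intro allI G(2))
  then have "AE r in lborel. r \<in> {0<..<a t} --> D (r, t) = F r"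
  proof (rule AE_mp, intro always_eventually allI impI)
    fix r assume e: "\<forall>n. r \<in> {p n..q n} --> D (r, t) = G n r" and r: "r \<in> {0<..<a t}"
    obtain n where "p n \<le> r" "r \<le> q n" using ex[of r r] r by auto
    then show "D (r, t) = F r" using e FG[of r n] by simp
  qed
  ultimately show ?thesis by blast
qed

text \<open>The stress is only given almost everywhere; \<open>s\<close> is its absolutely continuous representative on the
  slice. The second clause recovers the one of \<open>D\<close> from it.\<close>

definition stress_rep :: "real => (real => real) => bool" where
  "stress_rep t s \<longleftrightarrow> (\<forall>p q. 0 < p --> p < q --> q < a t -->
       ac p q s (\<lambda>r. - force (r, t)) \<and>
       ac p q (\<lambda>r. (P (r, t) + (B (r, t))\<^sup>2 / 2 - s r) / \<nu>) (\<lambda>r. divr (r, t))) \<and>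
     (AE r in lborel. r \<in> {0<..<a t} --> stress (r, t) = s r)"

lemma stress_rep_exists:
  assumes g: "good t" shows "\<exists>s. stress_rep t s"
proof -
  obtain F where F: "\<And>p q. 0 < p ==> p < q ==> q < a t ==> ac p q F (\<lambda>r. divr (r, t))"
    "AE r in lborel. r \<in> {0<..<a t} --> D (r, t) = F r" using D_representative[OF g] by blast
  define s where "s r = P (r, t) + (B (r, t))\<^sup>2 / 2 - \<nu> * F r" for r
  have "ac p q s (\<lambda>r. - force (r, t))" if pq: "0 < p" "p < q" "q < a t" for p q
  proof -
    have B2: "ac p q (\<lambda>r. (1/2) * (B (r, t) * B (r, t))) (\<lambda>r. (1/2) * (Br (r, t) * B (r, t) + B (r, t) * Br (r, t)))"
      by (intro ac_cmult ac_mult goodD(6)[OF g] pq)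
    have "ac p q (\<lambda>r. (P (r, t) + (1/2) * (B (r, t) * B (r, t))) - \<nu> * F r)
       (\<lambda>r. (Pr (r, t) + (1/2) * (Br (r, t) * B (r, t) + B (r, t) * Br (r, t))) - \<nu> * divr (r, t))"
      by (intro ac_minus ac_add ac_cmult goodD(5)[OF g] B2 F pq)
    then show ?thesis
    proof (rule ac_cong)
      show "(\<lambda>r. - force (r, t)) \<in> borel_measurable borel"
        using measurable_slice[OF measurable_force] by simp
      show "AE x in lborel. x \<in> {p..q} -->
         Pr (x, t) + 1 / 2 * (Br (x, t) * B (x, t) + B (x, t) * Br (x, t)) - \<nu> * divr (x, t) = - force (x, t)"
        using goodD(7)[OF g]
        by (rule AE_mp) (intro always_eventually allI impI, use pq in \<open>auto simp: force_def power2_eq_square algebra_simps\<close>)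
    qed (simp add: s_def power2_eq_square)
  qed
  moreover have "(\<lambda>r. (P (r, t) + (B (r, t))\<^sup>2 / 2 - s r) / \<nu>) = F" using \<nu> by (simp add: s_def fun_eq_iff)
  moreover have "AE r in lborel. r \<in> {0<..<a t} --> stress (r, t) = s r"
    using F(2) by (rule AE_mp) (auto simp: stress_def s_def)
  ultimately show ?thesis using F(1) unfolding stress_rep_def
    by (intro exI[of _ s] conjI allI impI) (simp_all only:)
qed

lemma stress_rep_bound:
  assumes g: "good t" and s: "stress_rep t s" and S: "S \<ge> 0"
    and xy: "0 < x" "x \<le> y" "y < a t" and le: "\<And>r. r \<in> {x..y} ==> \<bar>s r\<bar> \<le> S"
    and k: "0 \<le> k" "AE r in lborel. r \<in> {x..y} --> \<bar>force (r, t)\<bar> \<le> k * (w r + \<bar>s r\<bar>)"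
    and w: "set_integrable lborel {x..y} w"
  shows "\<bar>s y - s x\<bar> \<le> k * (LBINT r:{x..y}. w r) + k * (y - x) * S"
proof (cases "x = y")
  case True
  have "AE r in lborel. indicator {y..y} r *\<^sub>R w r = 0"
    using AE_lborel_singleton[of y] by eventually_elim (auto simp: indicator_def)
  then have "(LBINT r:{y..y}. w r) = 0" unfolding set_lebesgue_integral_def by (rule integral_eq_zero_AE)
  then show ?thesis using True by simp
next
  case False
  then have lt: "x < y" using xy by simp
  have ac: "ac x y s (\<lambda>r. - force (r, t))" using s xy lt unfolding stress_rep_def by blast
  have f: "set_integrable lborel {x..y} (\<lambda>r. - force (r, t))" by (rule ac_integrable[OF ac])
  have ci: "set_integrable lborel {x..y} (\<lambda>r. k * (w r + S))"
    using w by (intro set_integrable_mult_right set_integral_add(1) set_integrable_const_Icc)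
  have "\<bar>s y - s x\<bar> = \<bar>LBINT r:{x..y}. - force (r, t)\<bar>" using ac_diff[OF ac, of x y] xy by simp
  also have "\<dots> \<le> (LBINT r:{x..y}. \<bar>- force (r, t)\<bar>)"
    unfolding set_lebesgue_integral_def by (rule order_trans[OF integral_abs_bound]) (simp add: abs_mult)
  also have "\<dots> \<le> (LBINT r:{x..y}. k * (w r + S))"
  proof (rule set_integral_mono_AE[OF set_integrable_abs[OF f] ci])
    show "AE r \<in> {x..y} in lborel. \<bar>- force (r, t)\<bar> \<le> k * (w r + S)"
      using k(2)
    proof (rule AE_mp, intro always_eventually allI impI)
      fix r assume h: "r \<in> {x..y} --> \<bar>force (r, t)\<bar> \<le> k * (w r + \<bar>s r\<bar>)" and r: "r \<in> {x..y}"
      have "k * (w r + \<bar>s r\<bar>) \<le> k * (w r + S)" using le[OF r] k(1) by (intro mult_left_mono) auto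
      then show "\<bar>- force (r, t)\<bar> \<le> k * (w r + S)" using h r by simp
    qed
  qed
  also have "\<dots> = k * ((LBINT r:{x..y}. w r) + (LBINT r:{x..y}. S))"
    using w by (subst set_integral_mult_right, subst set_integral_add(2)) (auto simp: set_integrable_def integrable_indicator_iff emeasure_lborel_Icc_eq)
  also have "(LBINT r:{x..y}. S) = (y - x) * S" using xy by (simp add: set_integral_const measure_lborel_Icc)
  finally show ?thesis by (simp add: algebra_simps)
qed

end

section \<open>The stress near the free surface\<close>

lemma absorb_half:
  fixes x v e p q p' :: real
  assumes "x \<le> v + e" "v \<le> p + q" "p \<le> p'" "q \<le> (1 / 2) * x"
  shows "x \<le> 2 * (e + p')"
proof -
  have "x \<le> p' + (1 / 2) * x + e" using assms by (meson add_mono order_refl order_trans)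
  then show ?thesis by simp
qed

context mhd_flow
begin

text \<open>Away from the centre the weight \<open>r\<close> is bounded below.\<close>

lemma ut_slice_integrable:
  assumes g: "good t" and c: "0 < c"
  shows "set_integrable lborel {c..a t} (\<lambda>r. \<bar>ut (r, t)\<bar> + 1)"
  unfolding set_integrable_def
proof (rule Bochner_Integration.integrable_bound)
  show "integrable lborel (\<lambda>r. 2 * indicat_real {c..a t} r + (1 / c) * (indicator {0<..<a t} r * ((ut (r, t))\<^sup>2 * r)))"
    by (intro Bochner_Integration.integrable_add integrable_mult_right goodD(8)[OF g])
       (simp add: integrable_indicator_iff emeasure_lborel_Icc_eq)
  have [measurable]: "(\<lambda>r. ut (r, t)) \<in> borel_measurable borel" by (rule measurable_slice) measurable
  show "(\<lambda>r. indicat_real {c..a t} r *\<^sub>R (\<bar>ut (r, t)\<bar> + 1)) \<in> borel_measurable lborel" by measurable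
  show "AE r in lborel. norm (indicat_real {c..a t} r *\<^sub>R (\<bar>ut (r, t)\<bar> + 1))
      \<le> norm (2 * indicat_real {c..a t} r + (1 / c) * (indicator {0<..<a t} r * ((ut (r, t))\<^sup>2 * r)))"
    using AE_lborel_singleton[of "a t"]
  proof (rule AE_mp, intro always_eventually allI impI)
    fix r assume ne: "r \<noteq> a t"
    show "norm (indicat_real {c..a t} r *\<^sub>R (\<bar>ut (r, t)\<bar> + 1))
      \<le> norm (2 * indicat_real {c..a t} r + (1 / c) * (indicator {0<..<a t} r * ((ut (r, t))\<^sup>2 * r)))"
    proof (cases "r \<in> {c..a t}")
      case True
      then have r: "r \<in> {0<..<a t}" "c \<le> r" using ne c by auto
      have "0 \<le> (\<bar>ut (r, t)\<bar> - 1)\<^sup>2" by simp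
      then have sq: "\<bar>ut (r, t)\<bar> \<le> 1 + (ut (r, t))\<^sup>2" by (simp add: power2_diff)
      have "(ut (r, t))\<^sup>2 * c \<le> (ut (r, t))\<^sup>2 * r" using r(2) by (intro mult_left_mono) auto
      then have "(ut (r, t))\<^sup>2 \<le> (1 / c) * ((ut (r, t))\<^sup>2 * r)" using c by (simp add: field_simps)
      with sq show ?thesis using True r by simp
    qed simp
  qed
qed

text \<open>Away from the centre the derivative \<open>u\<^sub>r\<close> in the force is expressed by the stress and bounded terms.\<close>

lemma force_bound:
  assumes b: "0 < b"
  shows "\<exists>K\<ge>1. \<forall>t s. good t --> stress_rep t s -->
    (AE r in lborel. r \<in> {b..<a t} --> \<bar>force (r, t)\<bar> \<le> K * (\<bar>ut (r, t)\<bar> + 1 + \<bar>s r\<bar>))"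
proof -
  define k2 where "k2 = M * M * ((M + M\<^sup>2) / \<nu> + M / b) + M\<^sup>2 / b"
  define k3 where "k3 = M * M / \<nu>"
  define K where "K = 1 + M + k2 + k3"
  have Mn: "0 \<le> M" by (rule M_nonneg)
  have kn: "0 \<le> k2" "0 \<le> k3" using Mn b \<nu> by (auto simp: k2_def k3_def)
  have "AE r in lborel. r \<in> {b..<a t} --> \<bar>force (r, t)\<bar> \<le> K * (\<bar>ut (r, t)\<bar> + 1 + \<bar>s r\<bar>)"
    if g: "good t" and s: "stress_rep t s" for t s
  proof -
    have "AE r in lborel. r \<in> {0<..<a t} --> stress (r, t) = s r" using s unfolding stress_rep_def by (rule conjunct2)
    then show ?thesis
    proof (rule AE_mp, intro always_eventually allI impI)
      fix r assume e: "r \<in> {0<..<a t} --> stress (r, t) = s r" and r: "r \<in> {b..<a t}"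
      have r0: "0 < r" "b \<le> r" using r b by auto
      have st: "stress (r, t) = s r" using e r b by auto
      note B2 = B_square_le[of "(r, t)"]
      have "\<nu> * D (r, t) = P (r, t) + (B (r, t))\<^sup>2 / 2 - s r" using st by (simp add: stress_def)
      then have "\<nu> * \<bar>D (r, t)\<bar> = \<bar>P (r, t) + (B (r, t))\<^sup>2 / 2 - s r\<bar>" using \<nu> by (metis abs_mult abs_of_pos)
      also have "\<dots> \<le> M + M\<^sup>2 + \<bar>s r\<bar>"
        using bounded(3)[of "(r, t)"] B2 zero_le_power2[of "B (r, t)"] by linarith
      finally have Db: "\<bar>D (r, t)\<bar> \<le> (M + M\<^sup>2 + \<bar>s r\<bar>) / \<nu>" using \<nu> by (simp add: field_simps)
      have "\<bar>u (r, t) / r\<bar> \<le> M / b"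
        using bounded(2)[of "(r, t)"] r0 b by (auto simp: abs_divide intro!: frac_le)
      then have urb: "\<bar>ur (r, t)\<bar> \<le> (M + M\<^sup>2 + \<bar>s r\<bar>) / \<nu> + M / b"
        using Db unfolding D_def fst_conv by linarith
      have "\<bar>\<rho> (r, t) * (ut (r, t) + u (r, t) * ur (r, t))\<bar> \<le> M * (\<bar>ut (r, t)\<bar> + M * ((M + M\<^sup>2 + \<bar>s r\<bar>) / \<nu> + M / b))"
        unfolding abs_mult
      proof (rule mult_mono[OF bounded(1)])
        have "\<bar>u (r, t)\<bar> * \<bar>ur (r, t)\<bar> \<le> M * ((M + M\<^sup>2 + \<bar>s r\<bar>) / \<nu> + M / b)"
          by (rule mult_mono[OF bounded(2) urb]) (use Mn in auto)
        then show "\<bar>ut (r, t) + u (r, t) * ur (r, t)\<bar> \<le> \<bar>ut (r, t)\<bar> + M * ((M + M\<^sup>2 + \<bar>s r\<bar>) / \<nu> + M / b)"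
          by (intro order_trans[OF abs_triangle_ineq]) (simp add: abs_mult)
      qed (use Mn in auto)
      moreover have "\<bar>(B (r, t))\<^sup>2 / r\<bar> \<le> M\<^sup>2 / b"
        using B2 r0 b by (auto simp: abs_divide intro!: frac_le)
      ultimately have "\<bar>force (r, t)\<bar> \<le> M * (\<bar>ut (r, t)\<bar> + M * ((M + M\<^sup>2 + \<bar>s r\<bar>) / \<nu> + M / b)) + M\<^sup>2 / b"
        unfolding force_def fst_conv by linarith
      also have "\<dots> = M * \<bar>ut (r, t)\<bar> + k2 + k3 * \<bar>s r\<bar>"
        by (simp add: k2_def k3_def algebra_simps add_divide_distrib)
      also have "\<dots> \<le> K * \<bar>ut (r, t)\<bar> + K * 1 + K * \<bar>s r\<bar>"
        using kn Mn by (intro add_mono mult_right_mono) (auto simp: K_def)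
      finally show "\<bar>force (r, t)\<bar> \<le> K * (\<bar>ut (r, t)\<bar> + 1 + \<bar>s r\<bar>)" by (simp add: algebra_simps)
    qed
  qed
  moreover have "1 \<le> K" using kn Mn by (simp add: K_def)
  ultimately show ?thesis by (intro exI[of _ K] conjI allI impI)
qed

lemma one_sided_derivative_unique:
  fixes f :: "real => real"
  assumes "(f has_real_derivative d) (at x within {y..x})" "(f has_real_derivative d') (at x within {y..x})" "y < x"
  shows "d = d'"
proof -
  have "at x within {y..x} = at_left x" using assms(3) by (simp add: at_within_Icc_at_left)
  then have "at x within {y..x} \<noteq> bot" by simp
  with assms(1,2) show ?thesis
    unfolding has_field_derivative_iff by (auto intro: tendsto_unique)
qed

text \<open>Near the free surface \<open>\<bar>force\<bar>\<close> is at most a multiple of \<open>\<bar>u\<^sub>t\<bar> + 1 + \<bar>stress\<bar>\<close>, and over a short enough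
  interval the last term can be absorbed. Hence the stress extends continuously to the surface,
  where the boundary condition makes it vanish, and integrating back from there bounds it by the
  integral of \<open>\<bar>u\<^sub>t\<bar> + 1\<close> alone.\<close>

theorem stress_near_surface:
  shows "\<exists>K>0. \<exists>l>0. (\<forall>t\<in>{0..T}. l < a t) \<and>
    (\<forall>t s r. good t --> stress_rep t s --> a t - l \<le> r --> r < a t -->
       \<bar>s r\<bar> \<le> K * (LBINT x:{r..a t}. \<bar>ut (x, t)\<bar> + 1))"
proof -
  have "\<exists>am>0. \<forall>t\<in>{0..T}. am \<le> a t" by (rule a_min) blast
  then obtain am where am: "0 < am" "\<forall>t\<in>{0..T}. am \<le> a t" by blast
  have "0 < am / 2" using am by simp
  from force_bound[OF this] obtain K where K: "1 \<le> K" and KK: "\<forall>t s. good t --> stress_rep t s -->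
    (AE r in lborel. r \<in> {am/2..<a t} --> \<bar>force (r, t)\<bar> \<le> K * (\<bar>ut (r, t)\<bar> + 1 + \<bar>s r\<bar>))"
    by (elim exE conjE)
  (* short enough for K l to absorb half of the supremum of the stress *)
  define l where "l = min (am / 2) (1 / (2 * K))"
  have l: "0 < l" "l \<le> am / 2" "K * l \<le> 1 / 2" using am K by (auto simp: l_def min_def field_simps)
  have main: "\<bar>s r\<bar> \<le> 2 * K * (LBINT x:{r..a t}. \<bar>ut (x, t)\<bar> + 1)"
    if g: "good t" and s: "stress_rep t s" and r: "a t - l \<le> r" "r < a t" for t s r
  proof -
    define c where "c = a t - l"
    have amt: "am \<le> a t" using am(2) goodD(2)[OF g] by simp
    have c: "0 < c" "am / 2 \<le> c" "c < a t" "c \<le> r" "a t - c = l" using l am amt r by (auto simp: c_def)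
    define w where "w x = \<bar>ut (x, t)\<bar> + 1" for x
    have w: "set_integrable lborel {c..a t} w" unfolding w_def by (rule ut_slice_integrable[OF g c(1)])
    have wxy: "set_integrable lborel {x..y} w" if "c \<le> x" "y \<le> a t" for x y
      using w that by (auto intro: set_integrable_subset)
    have wn: "0 \<le> w x" for x by (simp add: w_def)
    have Wmono: "(LBINT x:{x..y}. w x) \<le> (LBINT x:{x'..y'}. w x)" if "c \<le> x'" "x' \<le> x" "y \<le> y'" "y' \<le> a t" for x y x' y'
      unfolding set_lebesgue_integral_def
      using wxy[of x y] wxy[of x' y'] that wn unfolding set_integrable_def
      by (intro integral_mono) (auto simp: indicator_def)
    define W where "W = (LBINT x:{c..a t}. w x)"
    have Wn: "0 \<le> (LBINT x:{x..y}. w x)" for x y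
      unfolding set_lebesgue_integral_def using wn by (intro integral_nonneg_AE) (auto intro!: always_eventually)
    have fb: "AE x in lborel. x \<in> {c..<a t} --> \<bar>force (x, t)\<bar> \<le> K * (w x + \<bar>s x\<bar>)"
      using KK[rule_format, OF g s] by (rule AE_mp) (use c in \<open>auto simp: w_def\<close>)
    have fb': "AE z in lborel. z \<in> {x..y} --> \<bar>force (z, t)\<bar> \<le> K * (w z + \<bar>s z\<bar>)" if "c \<le> x" "y < a t" for x y
      using fb by (rule AE_mp) (use that in auto)
    have sc: "continuous_on {c..y} s" if "y < a t" for y
    proof (cases "c < y")
      case True
      then have "ac c y s (\<lambda>r. - force (r, t))" using s c that unfolding stress_rep_def by blast
      then show ?thesis by (rule ac_continuous)
    next
      case False
      then have "{c..y} \<subseteq> {c}" by auto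
      then show ?thesis using continuous_on_finite[of "{c..y}" s] finite_subset by blast
    qed
    define S where "S = 2 * (\<bar>s c\<bar> + K * W)"
    have Sb: "\<bar>s x\<bar> \<le> S" if x: "c \<le> x" "x < a t" for x
    proof -
      have "\<exists>y\<in>{c..x}. \<forall>z\<in>{c..x}. \<bar>s z\<bar> \<le> \<bar>s y\<bar>"
        by (rule continuous_attains_sup) (use x sc[of x] in \<open>auto intro!: continuous_intros\<close>)
      then obtain y where y: "y \<in> {c..x}" "\<And>z. z \<in> {c..x} ==> \<bar>s z\<bar> \<le> \<bar>s y\<bar>" by blast
      have t1: "\<bar>s y - s c\<bar> \<le> K * (LBINT r:{c..y}. w r) + K * (y - c) * \<bar>s y\<bar>"
        by (rule stress_rep_bound[OF g s _ c(1)]) (use y x K wxy fb' in \<open>auto\<close>)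
      have t2: "K * (LBINT r:{c..y}. w r) \<le> K * W" unfolding W_def
        using K y x by (intro mult_left_mono Wmono) auto
      have t3: "K * (y - c) * \<bar>s y\<bar> \<le> (1 / 2) * \<bar>s y\<bar>"
      proof (rule mult_right_mono)
        have "K * (y - c) \<le> K * l" using K y x c by (intro mult_left_mono) auto
        then show "K * (y - c) \<le> 1 / 2" using l by linarith
      qed simp
      have "\<bar>s y\<bar> \<le> \<bar>s y - s c\<bar> + \<bar>s c\<bar>" by linarith
      from absorb_half[OF this t1 t2 t3] have "\<bar>s y\<bar> \<le> S" unfolding S_def .
      then show ?thesis using y(2)[of x] x by force
    qed
    have Sn: "0 \<le> S" using Sb[of c] c by auto
    have fi: "set_integrable lborel {c..a t} (\<lambda>x. - force (x, t))"
      unfolding set_integrable_def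
    proof (rule Bochner_Integration.integrable_bound)
      show "integrable lborel (\<lambda>x. K * (indicator {c..a t} x *\<^sub>R w x + S * indicator {c..a t} x))"
        using w unfolding set_integrable_def
        by (intro integrable_mult_right Bochner_Integration.integrable_add) (auto simp: integrable_indicator_iff emeasure_lborel_Icc_eq)
      have [measurable]: "(\<lambda>r. force (r, t)) \<in> borel_measurable borel" by (rule measurable_slice[OF measurable_force])
      show "(\<lambda>x. indicat_real {c..a t} x *\<^sub>R - force (x, t)) \<in> borel_measurable lborel" by measurable
      show "AE x in lborel. norm (indicat_real {c..a t} x *\<^sub>R - force (x, t))
          \<le> norm (K * (indicator {c..a t} x *\<^sub>R w x + S * indicator {c..a t} x))"
        using fb AE_lborel_singleton[of "a t"]
      proof eventually_elim
        case (elim x)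
        show ?case
        proof (cases "x \<in> {c..a t}")
          case True
          then have "\<bar>force (x, t)\<bar> \<le> K * (w x + \<bar>s x\<bar>)" "\<bar>s x\<bar> \<le> S" using elim Sb[of x] by auto
          moreover have "K * (w x + \<bar>s x\<bar>) \<le> K * (w x + S)" using calculation(2) K by (intro mult_left_mono) auto
          ultimately have "\<bar>force (x, t)\<bar> \<le> K * (w x + S)" by linarith
          also have "\<dots> \<le> \<bar>K * (w x + S)\<bar>" by (rule abs_ge_self)
          finally show ?thesis using True by simp
        qed simp
      qed
    qed
    (* the extension of the stress up to the surface *)
    define sb where "sb x = s c + (LBINT r:{c..x}. - force (r, t))" for x
    have sbac: "ac c (a t) sb (\<lambda>x. - force (x, t))" unfolding sb_def by (rule ac_primitive[OF fi])
    have sbs: "sb x = s x" if "c \<le> x" "x < a t" for x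
    proof (cases "c < x")
      case True
      then have "ac c x s (\<lambda>r. - force (r, t))" using s c that unfolding stress_rep_def by blast
      from ac_diff[OF this, of c x] show ?thesis using that by (simp add: sb_def)
    next
      case False
      then have "x = c" using that by simp
      moreover have "sb c - sb c = (LBINT r:{c..c}. - force (r, t))" using ac_diff[OF sbac, of c c] c by simp
      ultimately show ?thesis by (simp add: sb_def)
    qed
    have sbc: "continuous_on {c..a t} sb" by (rule ac_continuous[OF sbac])
    (* the value of the derivative of u that the stress prescribes, up to the surface *)
    define g' where "g' x = (P (x, t) + (B (x, t))\<^sup>2 / 2 - sb x) / \<nu> - u (x, t) / x" for x
    have cs: "continuous_on S (\<lambda>r. f (r, t))" if "continuous_on UNIV f" for S and f :: "real \<times> real => real"
      by (rule continuous_on_slice[OF that])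
    have g'c: "continuous_on {c..a t} g'"
      unfolding g'_def using c \<nu> by (intro continuous_intros cs cont sbc) auto
    have ur: "AE x in lborel. x \<in> {c..<a t} --> ur (x, t) = g' x"
    proof -
      have "AE r in lborel. r \<in> {0<..<a t} --> stress (r, t) = s r" using s unfolding stress_rep_def by (rule conjunct2)
      then show ?thesis
        by (rule AE_mp) (intro always_eventually allI impI, use c sbs \<nu> in \<open>auto simp: g'_def stress_def D_def field_simps\<close>)
    qed
    have uint: "u (y, t) - u (c, t) = integral {c..y} g'" if y: "c < y" "y < a t" for y
    proof -
      have "ac c y (\<lambda>r. u (r, t)) (\<lambda>r. ur (r, t))" using goodD(4)[OF g c(1) y] .
      then have "ac c y (\<lambda>r. u (r, t)) (\<lambda>x. if x \<in> {c..y} then g' x else 0)"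
      proof (rule ac_cong)
        show "AE x in lborel. x \<in> {c..y} --> ur (x, t) = (if x \<in> {c..y} then g' x else 0)"
          using ur by (rule AE_mp) (use y in auto)
        have "(\<lambda>x. if x \<in> {c..y} then g' x else 0) = (\<lambda>x. indicator {c..y} x *\<^sub>R g' x)" by (auto simp: fun_eq_iff)
        moreover have "(\<lambda>x. indicator {c..y} x *\<^sub>R g' x) \<in> borel_measurable borel"
          by (rule borel_measurable_continuous_on_indicator) (use g'c y in \<open>auto intro: continuous_on_subset\<close>)
        ultimately show "(\<lambda>x. if x \<in> {c..y} then g' x else 0) \<in> borel_measurable borel" by simp
      qed simp
      from ac_diff[OF this, of c y] have "u (y, t) - u (c, t) = (LBINT x:{c..y}. if x \<in> {c..y} then g' x else 0)" using y by simp
      also have "\<dots> = (LBINT x:{c..y}. g' x)" by (rule set_lebesgue_integral_cong) auto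
      also have "\<dots> = integral {c..y} g'"
      proof (rule set_borel_integral_eq_integral)
        have "continuous_on {c..y} g'" by (rule continuous_on_subset[OF g'c]) (use y in auto)
        then show "set_integrable lborel {c..y} g'"
          unfolding set_integrable_def by (intro borel_integrable_compact compact_Icc)
      qed
      finally show ?thesis .
    qed
    define V where "V x = u (c, t) + integral {c..x} g'" for x
    have Vd: "(V has_real_derivative g' (a t)) (at (a t) within {c..a t})"
      unfolding V_def using integral_has_real_derivative[OF g'c, of "a t"] c by (auto intro!: derivative_eq_intros)
    have uV: "u (x, t) = V x" if "x \<in> {c..a t}" for x
    proof -
      have Vc: "continuous_on {c..a t} V" unfolding V_def
        by (intro continuous_intros indefinite_integral_continuous_1 integrable_continuous_real g'c)
      have "AE x in lborel. x \<in> {c..a t} --> u (x, t) = V x"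
        using AE_lborel_singleton[of "a t"] AE_lborel_singleton[of c]
        by eventually_elim (use uint in \<open>auto simp: V_def algebra_simps\<close>)
      from continuous_AE_eq[OF c(3) cs[OF cont(2)] Vc this that] show ?thesis .
    qed
    obtain d where d: "((\<lambda>r. u (r, t)) has_real_derivative d) (at (a t) within {0..a t})"
        "(B (a t, t))\<^sup>2 / 2 + P (a t, t) - \<nu> * (d + u (a t, t) / a t) = 0"
      using bc[OF goodD(2)[OF g]] by blast
    have "((\<lambda>r. u (r, t)) has_real_derivative d) (at (a t) within {c..a t})"
      using d(1) by (rule has_field_derivative_subset) (use c in auto)
    then have "(V has_real_derivative d) (at (a t) within {c..a t})"
      by (rule has_field_derivative_transform_within[OF _ zero_less_one]) (use uV c in auto)
    from one_sided_derivative_unique[OF this Vd c(3)] have "d = g' (a t)" .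
    then have sb0: "sb (a t) = 0" using d(2) \<nu> by (simp add: g'_def field_simps)
    have "\<exists>y\<in>{r..a t}. \<forall>z\<in>{r..a t}. \<bar>sb z\<bar> \<le> \<bar>sb y\<bar>"
      by (rule continuous_attains_sup) (use r c sbc in \<open>auto intro!: continuous_intros intro: continuous_on_subset\<close>)
    then obtain y where y: "y \<in> {r..a t}" "\<And>z. z \<in> {r..a t} ==> \<bar>sb z\<bar> \<le> \<bar>sb y\<bar>" by blast
    define m where "m = \<bar>sb y\<bar>"
    have yi: "c \<le> y" "y \<le> a t" using y c by auto
    have "\<bar>sb y\<bar> = \<bar>LBINT x:{y..a t}. - force (x, t)\<bar>"
      using ac_diff[OF sbac, of y "a t"] yi sb0 by simp
    also have "\<dots> \<le> (LBINT x:{y..a t}. \<bar>- force (x, t)\<bar>)"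
      unfolding set_lebesgue_integral_def by (rule order_trans[OF integral_abs_bound]) (simp add: abs_mult)
    also have "\<dots> \<le> (LBINT x:{y..a t}. K * (w x + m))"
    proof (rule set_integral_mono_AE)
      show "set_integrable lborel {y..a t} (\<lambda>x. \<bar>- force (x, t)\<bar>)"
        using fi yi by (intro set_integrable_abs) (auto intro: set_integrable_subset)
      show "set_integrable lborel {y..a t} (\<lambda>x. K * (w x + m))"
        using wxy[of y "a t"] yi by (intro set_integrable_mult_right set_integral_add(1) set_integrable_const_Icc) simp
      show "AE x \<in> {y..a t} in lborel. \<bar>- force (x, t)\<bar> \<le> K * (w x + m)"
        using fb AE_lborel_singleton[of "a t"]
      proof eventually_elim
        case (elim x)
        show ?case
        proof
          assume x: "x \<in> {y..a t}"
          then have xi: "x \<in> {c..<a t}" "x \<in> {r..a t}" using elim yi y by auto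
          then have "\<bar>s x\<bar> \<le> m" using y(2)[of x] sbs[of x] by (simp add: m_def)
          then have "K * (w x + \<bar>s x\<bar>) \<le> K * (w x + m)" using K by (intro mult_left_mono) auto
          then show "\<bar>- force (x, t)\<bar> \<le> K * (w x + m)" using elim(1) xi by simp
        qed
      qed
    qed
    also have "\<dots> = K * ((LBINT r:{y..a t}. w r) + (LBINT r:{y..a t}. m))"
      using wxy[of y "a t"] yi by (subst set_integral_mult_right, subst set_integral_add(2)) (auto simp: set_integrable_def integrable_indicator_iff emeasure_lborel_Icc_eq)
    also have "(LBINT r:{y..a t}. m) = (a t - y) * m" using yi by (simp add: set_integral_const measure_lborel_Icc)
    finally have m1: "m \<le> K * (LBINT r:{y..a t}. w r) + (K * (a t - y)) * m" by (simp add: m_def algebra_simps)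
    have "K * (LBINT r:{y..a t}. w r) \<le> K * (LBINT r:{r..a t}. w r)"
      using K y c by (intro mult_left_mono Wmono) auto
    moreover have "(K * (a t - y)) * m \<le> (1 / 2) * m"
    proof (rule mult_right_mono)
      have "K * (a t - y) \<le> K * l" using K yi c by (intro mult_left_mono) auto
      then show "K * (a t - y) \<le> 1 / 2" using l by linarith
    qed (simp add: m_def)
    ultimately have "m \<le> 2 * (K * (LBINT r:{r..a t}. w r))" using m1 by linarith
    moreover have "\<bar>s r\<bar> \<le> m" using y(2)[of r] sbs[of r] r c by (simp add: m_def)
    ultimately show ?thesis unfolding w_def by linarith
  qed
  have "\<forall>t\<in>{0..T}. l < a t"
  proof
    fix t assume "t \<in> {0..T}"
    then have "am \<le> a t" using am(2) by blast
    then show "l < a t" using am(1) l by linarith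
  qed
  then show ?thesis using main K l by (intro exI[of _ "2 * K"] exI[of _ l] conjI allI impI) auto
qed

end

section \<open>The energy identity under a cutoff\<close>

context mhd_flow
begin

definition energy_density :: "real \<times> real => real" where
  "energy_density z = fst z * (\<rho> z * (u z)\<^sup>2 / 2 + P z / (\<gamma> - 1) + (B z)\<^sup>2 / 2)"

definition energy :: "real => real" where
  "energy t = (LBINT r:{0..a t}. energy_density (r, t))"

lemma energy_density_continuous: "continuous_on UNIV energy_density"
  unfolding energy_density_def[abs_def] using \<gamma> by (intro continuous_intros cont) auto

definition energy_flux :: "real \<times> real => real" where
  "energy_flux z = u z * energy_density z + (P z + (B z)\<^sup>2 / 2) * (u z * fst z)"

lemma fst_continuous: "continuous_on UNIV (fst :: real \<times> real => real)"
  by (intro continuous_intros)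

text \<open>The equations multiplied by \<open>u\<^sup>2/2\<close>, \<open>u\<close>, \<open>1/(\<gamma> - 1)\<close> and \<open>B\<close> add up to the local energy law.\<close>

lemma energy_balance:
  obtains Et Xr where "wdt Q energy_density Et" "wdr Q energy_flux Xr"
    "AE z in lborel. z \<in> Q --> Et z + Xr z = \<nu> * divr z * (u z * fst z)"
proof -
  define k where "k = 1 / (\<gamma> - 1)"
  have k: "\<gamma> * k = 1 + k" using \<gamma> by (simp add: k_def field_simps)
  note c = cont fst_continuous
  note mt = wdt_mult[OF open_Q] and mr = wdr_mult[OF open_Q]
  define m where "m z = \<rho> z * u z" for z
  define w where "w z = u z * B z" for z
  have mc: "continuous_on UNIV m" and wc: "continuous_on UNIV w"
    unfolding m_def[abs_def] w_def[abs_def] by (intro continuous_intros cont)+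
  have m_t: "wdt Q m (\<lambda>z. u z * \<rho>t z + \<rho> z * ut z)" unfolding m_def[abs_def] by (rule mt[OF wt(1,2) c(1,2)])
  have mu_t: "wdt Q (\<lambda>z. m z * u z) (\<lambda>z. u z * (u z * \<rho>t z + \<rho> z * ut z) + m z * ut z)" by (rule mt[OF m_t wt(2) mc c(2)])
  have BB_t: "wdt Q (\<lambda>z. B z * B z) (\<lambda>z. B z * Bt z + B z * Bt z)" by (rule mt[OF wt(4,4) c(4,4)])
  have s_t: "wdt Q (\<lambda>z. (1/2) * (m z * u z) + (k * P z + (1/2) * (B z * B z)))
      (\<lambda>z. (1/2) * (u z * (u z * \<rho>t z + \<rho> z * ut z) + m z * ut z) + (k * Pt z + (1/2) * (B z * Bt z + B z * Bt z)))"
    by (intro wdt_add wdt_cmult mu_t wt BB_t)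
  define Et where "Et z = ((1/2) * (m z * u z) + (k * P z + (1/2) * (B z * B z))) * 0 + fst z *
      ((1/2) * (u z * (u z * \<rho>t z + \<rho> z * ut z) + m z * ut z) + (k * Pt z + (1/2) * (B z * Bt z + B z * Bt z)))" for z
  have "wdt Q (\<lambda>z. fst z * ((1/2) * (m z * u z) + (k * P z + (1/2) * (B z * B z)))) Et"
    unfolding Et_def[abs_def] by (rule mt[OF wdt_fst[OF open_Q] s_t fst_continuous]) (intro continuous_intros mc c)
  moreover have "(\<lambda>z. fst z * ((1/2) * (m z * u z) + (k * P z + (1/2) * (B z * B z)))) = energy_density"
    by (simp add: fun_eq_iff energy_density_def m_def k_def power2_eq_square)
  ultimately have Et: "wdt Q energy_density Et" by simp
  have wm: "wdr Q m \<rho>ur" and ww: "wdr Q w uBr" unfolding m_def[abs_def] w_def[abs_def] by (rule wr)+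
  have mu: "wdr Q (\<lambda>z. m z * u z) (\<lambda>z. u z * \<rho>ur z + m z * ur z)" by (rule mr[OF wm wr(2) mc c(2)])
  have muu: "wdr Q (\<lambda>z. (m z * u z) * u z) (\<lambda>z. u z * (u z * \<rho>ur z + m z * ur z) + (m z * u z) * ur z)"
    by (rule mr[OF mu wr(2)]) (intro continuous_intros mc c)+
  have Pu: "wdr Q (\<lambda>z. P z * u z) (\<lambda>z. u z * Pr z + P z * ur z)" by (rule mr[OF wr(4,2) c(3,2)])
  have Bw: "wdr Q (\<lambda>z. B z * w z) (\<lambda>z. w z * Br z + B z * uBr z)" by (rule mr[OF wr(5) ww c(4) wc])
  have s_r: "wdr Q (\<lambda>z. (1/2) * (m z * u z * u z) + ((1 + k) * (P z * u z) + B z * w z))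
      (\<lambda>z. (1/2) * (u z * (u z * \<rho>ur z + m z * ur z) + (m z * u z) * ur z) + ((1 + k) * (u z * Pr z + P z * ur z) + (w z * Br z + B z * uBr z)))"
    by (intro wdr_add wdr_cmult muu Pu Bw)
  define Xr where "Xr z = ((1/2) * (m z * u z * u z) + ((1 + k) * (P z * u z) + B z * w z)) * 1 + fst z *
      ((1/2) * (u z * (u z * \<rho>ur z + m z * ur z) + (m z * u z) * ur z) + ((1 + k) * (u z * Pr z + P z * ur z) + (w z * Br z + B z * uBr z)))" for z
  have "wdr Q (\<lambda>z. fst z * ((1/2) * (m z * u z * u z) + ((1 + k) * (P z * u z) + B z * w z))) Xr"
    unfolding Xr_def[abs_def] by (rule mr[OF wdr_fst[OF open_Q] s_r fst_continuous]) (intro continuous_intros mc wc c)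
  moreover have "(\<lambda>z. fst z * ((1/2) * (m z * u z * u z) + ((1 + k) * (P z * u z) + B z * w z))) = energy_flux"
    by (simp add: fun_eq_iff energy_flux_def energy_density_def m_def w_def k_def power2_eq_square algebra_simps)
  ultimately have Xr: "wdr Q energy_flux Xr" by simp
  have "AE z in lborel. z \<in> Q --> Et z + Xr z = \<nu> * divr z * (u z * fst z)"
    using eqs
  proof (rule AE_mp, intro always_eventually allI impI)
    fix z assume e: "z \<in> Q -->
        \<rho>t z + \<rho>ur z + \<rho> z * u z / fst z = 0 \<and>
        \<rho> z * (ut z + u z * ur z) + Pr z = \<nu> * divr z - B z * (Br z + B z / fst z) \<and>
        Pt z + u z * Pr z + \<gamma> * P z * (ur z + u z / fst z) = 0 \<and>
        Bt z + uBr z = 0" and z: "z \<in> Q"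
    have r: "fst z \<noteq> 0" using z by (auto simp: Q_def)
    have e1: "\<rho>t z * fst z = - \<rho>ur z * fst z - \<rho> z * u z"
    proof -
      have "\<rho>t z = - \<rho>ur z - \<rho> z * u z / fst z" using e z by linarith
      then show ?thesis using r by (simp add: field_simps)
    qed
    have e2: "\<nu> * divr z * fst z = (\<rho> z * (ut z + u z * ur z) + Pr z + B z * Br z) * fst z + B z * B z"
    proof -
      have "\<nu> * divr z = \<rho> z * (ut z + u z * ur z) + Pr z + B z * (Br z + B z / fst z)" using e z by linarith
      then show ?thesis using r by (simp add: field_simps)
    qed
    have e3: "k * Pt z * fst z = - k * u z * Pr z * fst z - (1 + k) * P z * (ur z * fst z + u z)"
    proof -
      have "Pt z = - (u z * Pr z) - \<gamma> * P z * (ur z + u z / fst z)" using e z by linarith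
      then have p: "Pt z * fst z = - (u z * Pr z * fst z) - \<gamma> * P z * (ur z * fst z + u z)"
        using r by (simp add: field_simps)
      have "k * Pt z * fst z = k * (Pt z * fst z)" by simp
      also have "\<dots> = - k * u z * Pr z * fst z - (\<gamma> * k) * P z * (ur z * fst z + u z)"
        unfolding p by (simp add: algebra_simps)
      finally have "k * Pt z * fst z = - k * u z * Pr z * fst z - (\<gamma> * k) * P z * (ur z * fst z + u z)" .
      then show ?thesis unfolding k .
    qed
    have e4: "Bt z = - uBr z" using e z by linarith
    have "Et z + Xr z = (1/2) * (u z)\<^sup>2 * (\<rho>t z * fst z + \<rho>ur z * fst z + \<rho> z * u z)
        + u z * \<rho> z * (ut z + u z * ur z) * fst z + k * Pt z * fst z
        + (1 + k) * (P z * u z + fst z * (u z * Pr z + P z * ur z)) + u z * B z * B z + fst z * u z * B z * Br z"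
      unfolding Et_def Xr_def e4 m_def w_def by (simp add: algebra_simps power2_eq_square)
    also have "\<dots> = u z * (\<nu> * divr z * fst z)"
      unfolding e1 e2 e3 by (simp add: algebra_simps power2_eq_square)
    finally show "Et z + Xr z = \<nu> * divr z * (u z * fst z)" by simp
  qed
  with Et Xr show ?thesis by (rule that)
qed

text \<open>The cutoff to the fluid region: its lateral curves are the centre and the free surface.\<close>

abbreviation cut :: "nat => real \<times> real => real" where "cut n \<equiv> strip n T (\<lambda>_. 0) a"
abbreviation cut_r :: "nat => real \<times> real => real" where "cut_r n \<equiv> strip_r n T (\<lambda>_. 0) a"
abbreviation cut_t :: "nat => real \<times> real => real" where "cut_t n \<equiv> strip_t n T (\<lambda>_. 0) a (\<lambda>_. 0) a'"

lemma cut_test_on: "0 < n ==> test_on Q (cut n) (cut_r n) (cut_t n)"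
  by (rule strip_test_on) (use a in \<open>auto simp: Q_def\<close>)

lemma cut_support:
  assumes "0 < n" "cut n (r, t) \<noteq> 0 \<or> cut_r n (r, t) \<noteq> 0"
  shows "1 / real n \<le> r" "r \<le> a t - 1 / real n" "t \<in> {0<..<T}"
proof -
  have "plateau n 0 (a t) r \<noteq> 0 \<or> plateau' n 0 (a t) r \<noteq> 0" and p: "plateau n 0 T t \<noteq> 0"
    using assms(2) by (auto simp: strip_def strip_r_def)
  from plateau_support[OF assms(1) this(1)] show "1 / real n \<le> r" "r \<le> a t - 1 / real n" by auto
  have "0 < 1 / real n" using assms(1) by simp
  moreover have "0 + 1 / real n \<le> t" "t \<le> T - 1 / real n" using plateau_support[OF assms(1), of 0 T t] p by auto
  ultimately have "0 < t" "t < T" by linarith+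
  then show "t \<in> {0<..<T}" by simp
qed

text \<open>On the support of the cutoff the slice stays away from the centre and the surface, so integration by
  parts of \<open>divr = D\<^sub>r\<close> against \<open>cut u r\<close> is justified.\<close>

lemma energy_slice:
  assumes g: "good t" and n: "0 < n"
  shows "integrable lborel (\<lambda>r. cut n (r, t) * (r * (D (r, t))\<^sup>2))"
    and "integrable lborel (\<lambda>r. cut n (r, t) * (divr (r, t) * (u (r, t) * r))) ==>
      integrable lborel (\<lambda>r. cut_r n (r, t) * (D (r, t) * (u (r, t) * r))) ==>
      (LBINT r. cut n (r, t) * (r * (D (r, t))\<^sup>2)) =
       - (LBINT r. cut n (r, t) * (divr (r, t) * (u (r, t) * r)))
       - (LBINT r. cut_r n (r, t) * (D (r, t) * (u (r, t) * r)))"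
proof -
  (* outside [e, a t - e] the cutoff vanishes, since its support starts at distance 1/n *)
  define e where "e = min (1 / (2 * real n)) (a t / 4)"
  have at: "0 < a t" using goodD(3)[OF g] .
  have "1 / (2 * real n) < 1 / real n" "0 < 1 / (2 * real n)" using n by (auto simp: field_simps)
  moreover have "e \<le> 1 / (2 * real n)" "e \<le> a t / 4" "0 < e" using at n by (auto simp: e_def)
  ultimately have e: "0 < e" "e < 1 / real n" "e \<le> a t / 4" by linarith+
  define p where "p = e" define q where "q = a t - e"
  have pq: "0 < p" "p < q" "q < a t" using e at by (auto simp: p_def q_def)
  have out: "cut n (r, t) = 0 \<and> cut_r n (r, t) = 0" if "r \<le> p \<or> q \<le> r" for r
    using cut_support[OF n, of r t] that e unfolding p_def q_def by linarith
  obtain F where F: "\<And>p q. 0 < p ==> p < q ==> q < a t ==> ac p q F (\<lambda>r. divr (r, t))"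
    and FD: "AE r in lborel. r \<in> {0<..<a t} --> D (r, t) = F r" using D_representative[OF g] by blast
  note F = F[OF pq]
  note t = cut_test_on[OF n]
  have c1: "continuous_on S (\<lambda>r. cut n (r, t))" "continuous_on S (\<lambda>r. cut_r n (r, t))" for S
    using continuous_on_slice[OF test_on_continuous(1)[OF t]] continuous_on_slice[OF test_on_continuous(2)[OF t]] by auto
  have Fc: "continuous_on {p..q} F" by (rule ac_continuous[OF F])
  have ind: "indicator {p..q} r *\<^sub>R (cut n (r, t) * x) = cut n (r, t) * x"
    "indicator {p..q} r *\<^sub>R (cut_r n (r, t) * x) = cut_r n (r, t) * x" for r x
    using out[of r] by (cases "r \<in> {p..q}"; auto)+
  have mD: "(\<lambda>r. D (r, t)) \<in> borel_measurable borel" "(\<lambda>r. u (r, t)) \<in> borel_measurable borel" "(\<lambda>r. divr (r, t)) \<in> borel_measurable borel"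
    by (rule measurable_slice, measurable)+
  have mc: "(\<lambda>r. cut n (r, t)) \<in> borel_measurable borel" "(\<lambda>r. cut_r n (r, t)) \<in> borel_measurable borel"
    using c1[of UNIV] by (auto intro: borel_measurable_continuous_onI)
  have FDpq: "AE r in lborel. r \<in> {p..q} --> D (r, t) = F r"
    using FD by (rule AE_mp) (use pq in auto)
  have mF: "(\<lambda>r. indicator {p..q} r *\<^sub>R F r) \<in> borel_measurable borel"
    by (rule borel_measurable_continuous_on_indicator[OF _ Fc]) simp
  have "set_integrable lborel {p..q} (\<lambda>r. cut n (r, t) * (r * (F r)\<^sup>2))"
    unfolding set_integrable_def by (intro borel_integrable_compact compact_Icc continuous_intros Fc c1)
  then have iF: "integrable lborel (\<lambda>r. indicator {p..q} r *\<^sub>R (cut n (r, t) * (r * (F r)\<^sup>2)))" unfolding set_integrable_def .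
  have eqAE: "AE r in lborel. indicator {p..q} r *\<^sub>R (cut n (r, t) * (r * (F r)\<^sup>2)) = cut n (r, t) * (r * (D (r, t))\<^sup>2)"
    using FDpq
  proof (rule AE_mp, intro always_eventually allI impI)
    fix r assume h: "r \<in> {p..q} --> D (r, t) = F r"
    show "indicator {p..q} r *\<^sub>R (cut n (r, t) * (r * (F r)\<^sup>2)) = cut n (r, t) * (r * (D (r, t))\<^sup>2)"
      using h out[of r] by (cases "r \<in> {p..q}") auto
  qed
  show i1: "integrable lborel (\<lambda>r. cut n (r, t) * (r * (D (r, t))\<^sup>2))"
    using integrable_cong_AE[OF borel_measurable_integrable[OF iF] _ eqAE] iF mD mc by simp
  assume i2: "integrable lborel (\<lambda>r. cut n (r, t) * (divr (r, t) * (u (r, t) * r)))"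
    and i3: "integrable lborel (\<lambda>r. cut_r n (r, t) * (D (r, t) * (u (r, t) * r)))"
  have k: "ac p q (\<lambda>r. cut n (r, t) * (u (r, t) * r))
      (\<lambda>r. cut_r n (r, t) * (u (r, t) * r) + cut n (r, t) * (ur (r, t) * r + u (r, t) * 1))"
    by (intro ac_mult goodD(4)[OF g] pq ac_C1 test_on_slice[OF t] c1) (auto intro!: derivative_eq_intros)
  let ?L = "\<lambda>r. (cut_r n (r, t) * (u (r, t) * r) + cut n (r, t) * (ur (r, t) * r + u (r, t) * 1)) * F r
      + cut n (r, t) * (u (r, t) * r) * divr (r, t)"
  from ac_diff[OF ac_mult[OF k F], of p q] pq
  have "(LBINT r:{p..q}. ?L r) = 0" using out[of p] out[of q] by simp
  moreover have "(LBINT r:{p..q}. ?L r) =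
      (LBINT r. cut_r n (r, t) * (D (r, t) * (u (r, t) * r)) + (cut n (r, t) * (r * (D (r, t))\<^sup>2) + cut n (r, t) * (divr (r, t) * (u (r, t) * r))))"
    unfolding set_lebesgue_integral_def
  proof (rule integral_cong_AE)
    show "(\<lambda>r. cut_r n (r, t) * (D (r, t) * (u (r, t) * r)) + (cut n (r, t) * (r * (D (r, t))\<^sup>2) + cut n (r, t) * (divr (r, t) * (u (r, t) * r)))) \<in> borel_measurable lborel"
      using mD mc by simp
    show "(\<lambda>r. indicator {p..q} r *\<^sub>R ?L r) \<in> borel_measurable lborel"
      using ac_integrable[OF ac_mult[OF k F]] unfolding set_integrable_def by (rule borel_measurable_integrable)
    show "AE r in lborel. indicator {p..q} r *\<^sub>R ?L r =
       cut_r n (r, t) * (D (r, t) * (u (r, t) * r)) + (cut n (r, t) * (r * (D (r, t))\<^sup>2) + cut n (r, t) * (divr (r, t) * (u (r, t) * r)))"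
      using FDpq
    proof (rule AE_mp, intro always_eventually allI impI)
      fix r assume h: "r \<in> {p..q} --> D (r, t) = F r"
      show "indicator {p..q} r *\<^sub>R ?L r =
       cut_r n (r, t) * (D (r, t) * (u (r, t) * r)) + (cut n (r, t) * (r * (D (r, t))\<^sup>2) + cut n (r, t) * (divr (r, t) * (u (r, t) * r)))"
      proof (cases "r \<in> {p..q}")
        case True
        then have "F r = D (r, t)" using h by simp
        moreover have "ur (r, t) * r + u (r, t) * 1 = r * D (r, t)" using True pq by (simp add: D_def field_simps)
        ultimately show ?thesis using True by (simp add: algebra_simps power2_eq_square)
      next
        case False then show ?thesis using out[of r] by auto
      qed
    qed
  qed
  ultimately show "(LBINT r. cut n (r, t) * (r * (D (r, t))\<^sup>2)) =
       - (LBINT r. cut n (r, t) * (divr (r, t) * (u (r, t) * r)))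
       - (LBINT r. cut_r n (r, t) * (D (r, t) * (u (r, t) * r)))"
    using i1 i2 i3 by simp
qed

text \<open>The integrability of the dissipation density under the cutoff comes from the identity on slices:
  its integrals over slices equal an integrable function of time.\<close>

lemma energy_identity:
  assumes n: "0 < n"
  shows "integrable lborel (\<lambda>z. cut n z * (fst z * (D z)\<^sup>2))"
    and "integrable lborel (\<lambda>z. cut_r n z * (stress z * (u z * fst z)))"
    and "\<nu> * (LBINT z. cut n z * (fst z * (D z)\<^sup>2)) =
      (LBINT z. (cut_t n z + u z * cut_r n z) * energy_density z)
      + (LBINT z. cut_r n z * (stress z * (u z * fst z)))"
proof -
  note t = cut_test_on[OF n]
  obtain Et Xr where E: "wdt Q energy_density Et" "wdr Q energy_flux Xr"
    "AE z in lborel. z \<in> Q --> Et z + Xr z = \<nu> * divr z * (u z * fst z)" by (rule energy_balance)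
  have urc: "continuous_on UNIV (\<lambda>z. u z * fst z)" by (intro continuous_intros cont)
  have D: "loc_int Q D" using wr(3) unfolding wdr_def D_def[abs_def] by (rule conjunct1)
  have li: "loc_int Q (\<lambda>z. (u z * fst z) * divr z)" "loc_int Q (\<lambda>z. (u z * fst z) * D z)"
    using wr(3) D by (auto intro!: loc_int_continuous_mult urc simp: wdr_def)
  have iV: "integrable lborel (\<lambda>z. cut n z * (divr z * (u z * fst z)))"
    using test_on_integrable(1)[OF t li(1)] by (simp add: mult.commute)
  have iD: "integrable lborel (\<lambda>z. cut_r n z * (D z * (u z * fst z)))"
    using test_on_integrable(2)[OF t li(2)] by (simp add: mult.commute)
  have cm: "cut n \<in> borel_measurable borel" using test_on_continuous(1)[OF t] by (rule borel_measurable_continuous_onI)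
  have cn: "0 \<le> cut n z" for z by (rule strip_bounds)
  have nonneg: "0 \<le> cut n (r, t) * (r * (D (r, t))\<^sup>2)" for r t
  proof (cases "cut n (r, t) = 0")
    case False
    then have "1 / real n \<le> r" using cut_support(1)[OF n, of r t] by blast
    moreover have "0 < 1 / real n" using n by simp
    ultimately have "0 < r" by linarith
    then show ?thesis using cn by simp
  qed simp
  have ze: "cut n (r, t) = 0" "cut_r n (r, t) = 0" if "t \<notin> {0<..<T}" for r t
    using cut_support(3)[OF n, of r t] that by auto
  have sl: "AE t in lborel. integrable lborel (\<lambda>r. cut n (r, t) * (r * (D (r, t))\<^sup>2)) \<and>
      (LBINT r. cut n (r, t) * (r * (D (r, t))\<^sup>2)) =
       - (LBINT r. cut n (r, t) * (divr (r, t) * (u (r, t) * r)))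
       - (LBINT r. cut_r n (r, t) * (D (r, t) * (u (r, t) * r)))"
    using AE_good plane_Fubini(1)[OF iV] plane_Fubini(1)[OF iD]
  proof eventually_elim
    case (elim t)
    show ?case
    proof (cases "t \<in> {0<..<T}")
      case True
      then have g: "good t" using elim(1) by simp
      show ?thesis using energy_slice[OF g n] elim(2,3) by simp
    next
      case False then show ?thesis by (simp add: ze)
    qed
  qed
  have sl1: "AE t in lborel. integrable lborel (\<lambda>r. cut n (r, t) * (r * (D (r, t))\<^sup>2))"
    using sl by (rule AE_mp) (intro always_eventually allI impI, elim conjE)
  have sl2: "AE t in lborel. (LBINT r. cut n (r, t) * (r * (D (r, t))\<^sup>2)) =
       - (LBINT r. cut n (r, t) * (divr (r, t) * (u (r, t) * r)))
       - (LBINT r. cut_r n (r, t) * (D (r, t) * (u (r, t) * r)))"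
    using sl by (rule AE_mp) (intro always_eventually allI impI, elim conjE)
  have iR: "integrable lborel (\<lambda>t. - (LBINT r. cut n (r, t) * (divr (r, t) * (u (r, t) * r)))
       - (LBINT r. cut_r n (r, t) * (D (r, t) * (u (r, t) * r))))"
    using plane_Fubini(2)[OF iV] plane_Fubini(2)[OF iD] by simp
  have mD2: "(\<lambda>z. cut n z * (fst z * (D z)\<^sup>2)) \<in> borel_measurable borel" using cm by measurable
  have mI: "(\<lambda>t. LBINT r. cut n (r, t) * (r * (D (r, t))\<^sup>2)) \<in> borel_measurable lborel"
  proof -
    have "(\<lambda>z. cut n (prod.swap z) * (fst (prod.swap z) * (D (prod.swap z))\<^sup>2)) \<in> borel_measurable borel"
      using measurable_compose[OF measurable_prod_swap mD2] .
    then have "(\<lambda>(t, r). cut n (r, t) * (r * (D (r, t))\<^sup>2)) \<in> borel_measurable (borel \<Otimes>\<^sub>M lborel)"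
      by (simp add: split_beta' borel_prod[symmetric] prod.swap_def cong: measurable_cong_sets)
    from lborel.borel_measurable_lebesgue_integral[OF this] show ?thesis by simp
  qed
  have iI: "integrable lborel (\<lambda>t. LBINT r. cut n (r, t) * (r * (D (r, t))\<^sup>2))"
    using integrable_cong_AE[OF mI borel_measurable_integrable[OF iR] sl2] iR by simp
  show i1: "integrable lborel (\<lambda>z. cut n z * (fst z * (D z)\<^sup>2))"
  proof (rule plane_integrableI[OF mD2])
    show "AE t in lborel. integrable lborel (\<lambda>r. cut n (r, t) * (fst (r, t) * (D (r, t))\<^sup>2))" using sl1 by simp
    show "integrable lborel (\<lambda>t. LBINT r. \<bar>cut n (r, t) * (fst (r, t) * (D (r, t))\<^sup>2)\<bar>)"
      using iI nonneg by simp
  qed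
  have e1: "(LBINT z. cut n z * (fst z * (D z)\<^sup>2)) =
     - (LBINT z. cut n z * (divr z * (u z * fst z))) - (LBINT z. cut_r n z * (D z * (u z * fst z)))"
  proof -
    have "(LBINT z. cut n z * (fst z * (D z)\<^sup>2)) = (LBINT t. (LBINT r. cut n (r, t) * (r * (D (r, t))\<^sup>2)))"
      using plane_Fubini(3)[OF i1] by simp
    also have "\<dots> = (LBINT t. - (LBINT r. cut n (r, t) * (divr (r, t) * (u (r, t) * r)))
       - (LBINT r. cut_r n (r, t) * (D (r, t) * (u (r, t) * r))))"
      by (rule integral_cong_AE[OF mI borel_measurable_integrable[OF iR] sl2])
    also have "\<dots> = - (LBINT z. cut n z * (divr z * (u z * fst z))) - (LBINT z. cut_r n z * (D z * (u z * fst z)))"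
      using plane_Fubini(2,3)[OF iV] plane_Fubini(2,3)[OF iD] by simp
    finally show ?thesis .
  qed
  have lE: "loc_int Q energy_density" "loc_int Q Et" "loc_int Q energy_flux" "loc_int Q Xr" using E by (auto simp: wdt_def wdr_def)
  have b1: "(LBINT z. cut_t n z * energy_density z) = - (LBINT z. cut n z * Et z)"
    using E(1) t unfolding wdt_def by blast
  have b2: "(LBINT z. cut_r n z * energy_flux z) = - (LBINT z. cut n z * Xr z)"
    using E(2) t unfolding wdr_def by blast
  have "(LBINT z. cut n z * Et z + cut n z * Xr z) = (LBINT z. \<nu> * (cut n z * (divr z * (u z * fst z))))"
  proof (rule integral_cong_AE)
    have m: "Et \<in> borel_measurable borel" "Xr \<in> borel_measurable borel" using lE by (auto simp: loc_int_def)
    show "(\<lambda>z. cut n z * Et z + cut n z * Xr z) \<in> borel_measurable lborel" using cm m by simp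
    show "(\<lambda>z. \<nu> * (cut n z * (divr z * (u z * fst z)))) \<in> borel_measurable lborel" using borel_measurable_integrable[OF iV] by simp
    show "AE z in lborel. cut n z * Et z + cut n z * Xr z = \<nu> * (cut n z * (divr z * (u z * fst z)))"
      using E(3)
    proof (rule AE_mp, intro always_eventually allI impI)
      fix z assume h: "z \<in> Q --> Et z + Xr z = \<nu> * divr z * (u z * fst z)"
      show "cut n z * Et z + cut n z * Xr z = \<nu> * (cut n z * (divr z * (u z * fst z)))"
      proof (cases "cut n z = 0")
        case False
        obtain r t where z: "z = (r, t)" by (cases z)
        have "0 < 1 / real n" using n by simp
        moreover have "1 / real n \<le> r" "r \<le> a t - 1 / real n" "t \<in> {0<..<T}" using cut_support[OF n, of r t] False z by auto
        ultimately have "0 < r" "r < a t" "0 < t" "t < T" unfolding greaterThanLessThan_iff by linarith+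
        then have "z \<in> Q" unfolding z Q_def by simp
        then have "Et z + Xr z = \<nu> * divr z * (u z * fst z)" using h by simp
        then show ?thesis by (simp add: distrib_left[symmetric])
      qed simp
    qed
  qed
  then have b3: "(LBINT z. cut n z * Et z) + (LBINT z. cut n z * Xr z) = \<nu> * (LBINT z. cut n z * (divr z * (u z * fst z)))"
    using test_on_integrable(1)[OF t] lE by simp
  define pf where "pf z = (P z + (B z)\<^sup>2 / 2) * (u z * fst z)" for z
  have pfc: "continuous_on UNIV pf" unfolding pf_def[abs_def] by (intro continuous_intros cont) auto
  have ipf: "integrable lborel (\<lambda>z. cut_r n z * pf z)"
    by (rule test_on_integrable(2)[OF t loc_int_continuous[OF pfc]])
  have st: "cut_r n z * (stress z * (u z * fst z)) = cut_r n z * pf z - \<nu> * (cut_r n z * (D z * (u z * fst z)))" for z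
    by (simp add: stress_def pf_def algebra_simps)
  show i2: "integrable lborel (\<lambda>z. cut_r n z * (stress z * (u z * fst z)))"
    unfolding st using ipf iD by simp
  have s1: "(LBINT z. cut_r n z * (stress z * (u z * fst z))) = (LBINT z. cut_r n z * pf z) - \<nu> * (LBINT z. cut_r n z * (D z * (u z * fst z)))"
    unfolding st using ipf iD by simp
  have iF: "integrable lborel (\<lambda>z. cut_t n z * energy_density z)" "integrable lborel (\<lambda>z. cut_r n z * (u z * energy_density z))"
    using test_on_integrable(3)[OF t lE(1)] test_on_integrable(2)[OF t loc_int_continuous_mult[OF lE(1) cont(2)]] by auto
  have "(LBINT z. (cut_t n z + u z * cut_r n z) * energy_density z) = (LBINT z. cut_t n z * energy_density z + cut_r n z * (u z * energy_density z))"
    by (simp add: algebra_simps)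
  then have s2: "(LBINT z. (cut_t n z + u z * cut_r n z) * energy_density z)
      = (LBINT z. cut_t n z * energy_density z) + (LBINT z. cut_r n z * (u z * energy_density z))"
    using iF by simp
  have "(LBINT z. cut_r n z * energy_flux z) = (LBINT z. cut_r n z * (u z * energy_density z) + cut_r n z * pf z)"
    by (simp add: energy_flux_def pf_def distrib_left)
  then have s3: "(LBINT z. cut_r n z * energy_flux z) = (LBINT z. cut_r n z * (u z * energy_density z)) + (LBINT z. cut_r n z * pf z)"
    using iF ipf by simp
  show "\<nu> * (LBINT z. cut n z * (fst z * (D z)\<^sup>2)) =
      (LBINT z. (cut_t n z + u z * cut_r n z) * energy_density z)
      + (LBINT z. cut_r n z * (stress z * (u z * fst z)))"
    unfolding e1 s1 s2 right_diff_distrib using b1 b2 b3 s3 by simp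
qed

end

section \<open>The total dissipation\<close>

lemma two_divide_less:
  fixes d x :: real
  assumes "0 < d" "2 / d < x" shows "2 / x < d" "0 < x"
proof -
  have "0 < 2 / d" using assms(1) by simp
  then show "0 < x" using assms(2) by linarith
  then show "2 / x < d" using assms by (simp add: field_simps)
qed

context mhd_flow
begin

lemma a_max: "\<exists>A>0. \<forall>t\<in>{0..T}. a t \<le> A"
proof -
  obtain A where "A > 0" "\<And>t. t \<in> {0..T} ==> \<bar>a t\<bar> \<le> A" using bounded_on_interval[OF a_cont] by metis
  then show ?thesis by force
qed

lemma measurable_Q[measurable]: "Q \<in> sets borel"
  using open_Q by simp

lemma Q_finite: "integrable lborel (indicat_real Q)"
proof -
  obtain A where A: "A > 0" "\<forall>t\<in>{0..T}. a t \<le> A" using a_max by blast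
  have "Q \<subseteq> {0..A} \<times> {0..T}"
  proof
    fix z assume "z \<in> Q"
    then have "0 < snd z" "snd z < T" "0 < fst z" "fst z < a (snd z)" by (auto simp: Q_def)
    moreover have "a (snd z) \<le> A" using A(2) calculation by simp
    ultimately show "z \<in> {0..A} \<times> {0..T}" by (simp add: mem_Times_iff)
  qed
  then have "bounded Q" using bounded_subset[OF bounded_Times[OF bounded_closed_interval bounded_closed_interval]] by blast
  then have "emeasure lborel Q < \<infinity>" by (rule emeasure_bounded_finite)
  then show ?thesis by (simp add: integrable_indicator_iff)
qed

text \<open>The part of the fluid region that contains the cutoff layer at the free surface.\<close>

definition rim :: "nat => (real \<times> real) set" where
  "rim n = {z \<in> Q. a (snd z) - 2 / real n \<le> fst z}"

lemma measurable_rim[measurable]: "rim n \<in> sets borel"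
proof -
  have "rim n = Q \<inter> {z. a (snd z) - 2 / real n \<le> fst z}" by (auto simp: rim_def)
  moreover have "closed {z::real\<times>real. a (snd z) - 2 / real n \<le> fst z}"
    by (intro closed_Collect_le continuous_intros continuous_snd_comp[OF a_cont])
  ultimately show ?thesis by simp
qed

text \<open>Near the surface \<open>r\<close> is bounded below, so the weighted square of \<open>u\<^sub>t\<close> controls its integral; the rims shrink
  to the empty set.\<close>

lemma rim_integral:
  assumes l: "0 < l" "\<forall>t\<in>{0..T}. l < a t"
  shows "2 / real n \<le> l ==> integrable lborel (\<lambda>z. indicator (rim n) z * (\<bar>ut z\<bar> + 1))"
    and "(\<lambda>n. LBINT z. indicator (rim n) z * (\<bar>ut z\<bar> + 1)) \<longlonglongrightarrow> 0"
proof -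
  have "\<exists>t0\<in>{0..T}. \<forall>t\<in>{0..T}. a t0 - l \<le> a t - l"
    by (rule continuous_attains_inf) (use T a_cont in \<open>auto intro!: continuous_intros intro: continuous_on_subset\<close>)
  then obtain t0 where t0: "t0 \<in> {0..T}" "\<forall>t\<in>{0..T}. a t0 - l \<le> a t - l" by blast
  define c where "c = a t0 - l"
  have c: "0 < c" using l(2) t0(1) by (simp add: c_def)
  define w where "w z = 2 * indicat_real Q z + (1 / c) * (indicator Q z * ((ut z)\<^sup>2 * fst z))" for z
  have wi: "integrable lborel w" unfolding w_def
    by (intro Bochner_Integration.integrable_add integrable_mult_right Q_finite ut_L2)
  have bd: "norm (indicator (rim n) z * (\<bar>ut z\<bar> + 1)) \<le> w z" if n: "2 / real n \<le> l" for n z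
  proof (cases "z \<in> rim n")
    case True
    then have z: "z \<in> Q" "a (snd z) - 2 / real n \<le> fst z" by (auto simp: rim_def)
    then have "snd z \<in> {0..T}" by (auto simp: Q_def)
    then have "c \<le> a (snd z) - l" using t0(2) by (simp add: c_def)
    then have r: "c \<le> fst z" using z(2) n by linarith
    have "0 \<le> (\<bar>ut z\<bar> - 1)\<^sup>2" by simp
    then have sq: "\<bar>ut z\<bar> \<le> 1 + (ut z)\<^sup>2" by (simp add: power2_diff)
    have "(ut z)\<^sup>2 * c \<le> (ut z)\<^sup>2 * fst z" using r by (intro mult_left_mono) auto
    then have "(ut z)\<^sup>2 \<le> (1 / c) * ((ut z)\<^sup>2 * fst z)" using c by (simp add: field_simps)
    with sq show ?thesis using True z(1) by (simp add: w_def)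
  next
    case False
    have "0 \<le> w z" using c by (cases "z \<in> Q") (auto simp: w_def Q_def)
    then show ?thesis using False by simp
  qed
  show "2 / real n \<le> l ==> integrable lborel (\<lambda>z. indicator (rim n) z * (\<bar>ut z\<bar> + 1))" for n
    by (rule Bochner_Integration.integrable_bound[OF wi])
       (measurable, intro always_eventually allI order_trans[OF bd], simp_all)
  obtain N where N: "real N > 2 / l" using reals_Archimedean2 by blast
  have nl: "2 / real n \<le> l" if "n \<ge> N" for n
  proof -
    have "2 / l < real n" using N that by linarith
    then show ?thesis using l(1) by (cases "n = 0") (auto simp: field_simps)
  qed
  have "(\<lambda>n. LBINT z. indicator (rim (n + N)) z * (\<bar>ut z\<bar> + 1)) \<longlonglongrightarrow> (\<integral>z. 0 \<partial>(lborel :: (real \<times> real) measure))"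
  proof (rule integral_dominated_convergence[OF _ _ wi])
    show "AE z in lborel. norm (indicator (rim (n + N)) z * (\<bar>ut z\<bar> + 1)) \<le> w z" for n
      by (intro always_eventually allI bd nl) simp
    show "AE z in lborel. (\<lambda>n. indicator (rim (n + N)) z * (\<bar>ut z\<bar> + 1)) \<longlonglongrightarrow> 0"
    proof (intro always_eventually allI)
      fix z
      show "(\<lambda>n. indicator (rim (n + N)) z * (\<bar>ut z\<bar> + 1)) \<longlonglongrightarrow> 0"
      proof (cases "z \<in> Q")
        case True
        then have d: "0 < a (snd z) - fst z" by (auto simp: Q_def)
        obtain k where k: "real k > 2 / (a (snd z) - fst z)" using reals_Archimedean2 by blast
        have "z \<notin> rim (n + N)" if "n \<ge> k" for n
        proof -
          have "real (n + N) > 2 / (a (snd z) - fst z)" using k that by simp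
          from two_divide_less(1)[OF d this] have "fst z < a (snd z) - 2 / real (n + N)" by linarith
          then show ?thesis unfolding rim_def by simp
        qed
        then have "eventually (\<lambda>n. indicator (rim (n + N)) z * (\<bar>ut z\<bar> + 1) = 0) sequentially"
          unfolding eventually_sequentially by (intro exI[of _ k]) auto
        then show ?thesis by (rule tendsto_eventually)
      next
        case False
        then have "z \<notin> rim n" for n by (simp add: rim_def)
        then show ?thesis by simp
      qed
    qed
  qed measurable
  then have "(\<lambda>n. LBINT z. indicator (rim (n + N)) z * (\<bar>ut z\<bar> + 1)) \<longlonglongrightarrow> 0" by simp
  then show "(\<lambda>n. LBINT z. indicator (rim n) z * (\<bar>ut z\<bar> + 1)) \<longlonglongrightarrow> 0"
    by (rule LIMSEQ_offset)
qed

lemma cut_r_split: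
  assumes n: "0 < n" and b: "2 / real n \<le> b" "b < a t - 2 / real n"
  shows "r \<le> b ==> cut_r n (r, t) = plateau n 0 T t * (layer n r * ramp (real n * (a t - r)))"
    and "b < r ==> cut_r n (r, t) = - (plateau n 0 T t * (ramp (real n * r) * layer n (a t - r)))"
proof -
  have e: "cut_r n (r, t) = plateau n 0 T t * (layer n (r - 0) * ramp (real n * (a t - r)) - ramp (real n * (r - 0)) * layer n (a t - r))"
    by (simp only: strip_r_def plateau'_layer fst_conv snd_conv)
  show "cut_r n (r, t) = plateau n 0 T t * (layer n r * ramp (real n * (a t - r)))" if "r \<le> b"
  proof -
    have "a t - r \<notin> {1 / real n..2 / real n}" using that b by auto
    then show ?thesis unfolding e using layer_eq_0[OF n, of "a t - r"] by simp
  qed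
  show "cut_r n (r, t) = - (plateau n 0 T t * (ramp (real n * r) * layer n (a t - r)))" if "b < r"
  proof -
    have "r \<notin> {1 / real n..2 / real n}" using that b by auto
    then show ?thesis unfolding e using layer_eq_0[OF n, of r] by simp
  qed
qed

text \<open>The rectangle that contains the cutoff layer at the centre.\<close>

abbreviation core :: "nat => (real \<times> real) set" where "core n \<equiv> {1 / real n..2 / real n} \<times> {0..T}"

text \<open>At the centre the term \<open>D u r\<close> is split by \<open>2 x y \<le> x\<^sup>2 + y\<^sup>2\<close>: half of the dissipation absorbs
  the part with \<open>D\<close> because the cutoff satisfies \<open>tent\<^sup>2 \<le> 8 ramp\<close>, and \<open>u\<close> is small there.\<close>

lemma centre_layer_pointwise:
  assumes n: "0 < n" and b: "2 / real n \<le> b" "b < a t - 2 / real n" and t: "t \<in> {0..T}" and r: "r \<le> b"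
    and w: "\<And>r. r \<in> {0..2 / real n} ==> \<bar>u (r, t)\<bar> \<le> w"
  shows "cut_r n (r, t) * (stress (r, t) * (u (r, t) * r)) \<le> \<nu> / 2 * (cut n (r, t) * (r * (D (r, t))\<^sup>2))
     + indicator (core n) (r, t) * (4 * M * (M + M\<^sup>2) + 8 * \<nu> * real n * w\<^sup>2)"
proof (cases "r \<in> {1 / real n..2 / real n}")
  case False
  have "0 < 1 / real n" using n by simp
  have nn: "0 \<le> cut n (r, t) * (r * (D (r, t))\<^sup>2)"
  proof (cases "cut n (r, t) = 0")
    case F: False
    then have "1 / real n \<le> r" using cut_support(1)[OF n, of r t] by blast
    then have "0 \<le> r" using \<open>0 < 1 / real n\<close> by linarith
    then show ?thesis using strip_bounds(1) by simp
  qed simp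
  have "cut_r n (r, t) = 0" using cut_r_split(1)[OF n b r] layer_eq_0[OF n False] by simp
  moreover have "0 \<le> \<nu> / 2 * (cut n (r, t) * (r * (D (r, t))\<^sup>2))" using nn \<nu> by simp
  moreover have "(r, t) \<notin> core n" using False by blast
  ultimately show ?thesis by simp
next
  case True
  define p where "p = plateau n 0 T t * ramp (real n * (a t - r))"
  have p: "0 \<le> p" "p \<le> 1" unfolding p_def using plateau_bounds ramp_nonneg ramp_le_1
    by (auto intro!: mult_nonneg_nonneg mult_le_one)
  have np: "0 < real n" using n by simp
  have r0: "0 \<le> r" "real n * r \<le> 2" using True np by (auto simp: field_simps order_trans[OF _ True[simplified, THEN conjunct1]])
  have cr: "cut_r n (r, t) = p * (real n * tent (real n * r))"
    using cut_r_split(1)[OF n b r] by (simp add: p_def layer_def mult_ac)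
  have ct: "cut n (r, t) = p * ramp (real n * r)" by (simp add: strip_def plateau_def p_def mult_ac)
  have uw: "\<bar>u (r, t)\<bar> \<le> w" using w[of r] True r0 by simp
  have u2: "(u (r, t))\<^sup>2 \<le> w\<^sup>2" by (rule abs_le_square_iff[THEN iffD1, OF order_trans[OF uw abs_ge_self]])
  define x where "x = tent (real n * r) * D (r, t)"
  define y where "y = real n * u (r, t)"
  (* the constants leave exactly half of the dissipation: x^2/16 is at most ramp D^2/2 *)
  have "0 \<le> (x / 4 + 2 * y)\<^sup>2" by simp
  then have xy: "- (x * y) \<le> x\<^sup>2 / 16 + 4 * y\<^sup>2" by (simp add: power2_eq_square algebra_simps)
  have "x\<^sup>2 \<le> (8 * ramp (real n * r)) * (D (r, t))\<^sup>2"
    unfolding x_def power_mult_distrib by (rule mult_right_mono[OF tent_sq_le_ramp]) simp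
  then have x2: "x\<^sup>2 / 16 \<le> ramp (real n * r) * (D (r, t))\<^sup>2 / 2" by simp
  note B2 = B_square_le[of "(r, t)"]
  have q: "\<bar>P (r, t) + (B (r, t))\<^sup>2 / 2\<bar> \<le> M + M\<^sup>2"
    using bounded(3)[of "(r, t)"] B2 zero_le_power2[of "B (r, t)"] by linarith
  define pf where "pf = (P (r, t) + (B (r, t))\<^sup>2 / 2) * u (r, t)"
  have pf: "\<bar>pf\<bar> \<le> (M + M\<^sup>2) * M" unfolding pf_def abs_mult
    using q bounded(2)[of "(r, t)"] M_nonneg by (intro mult_mono) auto
  have "real n * r * tent (real n * r) * pf \<le> 2 * 2 * ((M + M\<^sup>2) * M)"
  proof -
    have "real n * r * tent (real n * r) * pf \<le> \<bar>real n * r * tent (real n * r)\<bar> * \<bar>pf\<bar>" by (simp add: abs_mult[symmetric])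
    also have "\<dots> \<le> (2 * 2) * ((M + M\<^sup>2) * M)"
    proof (rule mult_mono[OF _ pf])
      have "real n * r * tent (real n * r) \<le> 2 * 2" using r0 tent_nonneg tent_le np by (intro mult_mono) auto
      then show "\<bar>real n * r * tent (real n * r)\<bar> \<le> 2 * 2" using r0 tent_nonneg[of "real n * r"] np by simp
    qed simp_all
    finally show ?thesis .
  qed
  moreover have "\<nu> * r * - (x * y) \<le> \<nu> * r * (ramp (real n * r) * (D (r, t))\<^sup>2 / 2 + 4 * y\<^sup>2)"
    using xy x2 \<nu> r0 by (intro mult_left_mono) auto
  moreover have "\<nu> * r * (4 * y\<^sup>2) \<le> 8 * \<nu> * real n * w\<^sup>2"
  proof -
    have "\<nu> * r * (4 * y\<^sup>2) = (4 * \<nu> * real n) * ((real n * r) * (u (r, t))\<^sup>2)" by (simp add: y_def power2_eq_square)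
    also have "\<dots> \<le> (4 * \<nu> * real n) * (2 * w\<^sup>2)" using \<nu> r0 u2 np by (intro mult_left_mono mult_mono) auto
    finally show ?thesis by simp
  qed
  ultimately have "real n * r * tent (real n * r) * pf + \<nu> * r * - (x * y)
      \<le> \<nu> / 2 * (ramp (real n * r) * (r * (D (r, t))\<^sup>2)) + (4 * M * (M + M\<^sup>2) + 8 * \<nu> * real n * w\<^sup>2)"
    by (simp add: algebra_simps)
  from mult_left_mono[OF this p(1)]
  have "p * (real n * r * tent (real n * r) * pf + \<nu> * r * - (x * y))
      \<le> \<nu> / 2 * (cut n (r, t) * (r * (D (r, t))\<^sup>2)) + p * (4 * M * (M + M\<^sup>2) + 8 * \<nu> * real n * w\<^sup>2)"
    unfolding ct by (simp add: algebra_simps)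
  moreover have "p * (4 * M * (M + M\<^sup>2) + 8 * \<nu> * real n * w\<^sup>2) \<le> 1 * (4 * M * (M + M\<^sup>2) + 8 * \<nu> * real n * w\<^sup>2)"
    using p(2) M_nonneg \<nu> by (intro mult_right_mono) auto
  moreover have "cut_r n (r, t) * (stress (r, t) * (u (r, t) * r)) = p * (real n * r * tent (real n * r) * pf + \<nu> * r * - (x * y))"
    unfolding cr stress_def pf_def x_def y_def by (simp add: algebra_simps)
  ultimately show ?thesis using True t by simp
qed

text \<open>The cutoff is split at \<open>r = b\<close>. The centre part costs half of the dissipation and a term \<open>J\<close>; in the
  surface part the layer has unit mass on each slice and the stress is at most a multiple of the
  integral of \<open>\<bar>u\<^sub>t\<bar> + 1\<close> over the rim. Both error terms vanish in the limit, and Fatou's lemma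
  removes the cutoff from the dissipation.\<close>

theorem dissipation_bound:
  shows "integrable lborel (\<lambda>z. indicator Q z * (fst z * (D z)\<^sup>2))"
    and "\<nu> / 2 * (LBINT z. indicator Q z * (fst z * (D z)\<^sup>2)) \<le> energy 0 - energy T"
proof -
  obtain K l where K: "0 < K" "0 < l" "\<forall>t\<in>{0..T}. l < a t"
    and st: "\<forall>t s r. good t --> stress_rep t s --> a t - l \<le> r --> r < a t -->
       \<bar>s r\<bar> \<le> K * (LBINT x:{r..a t}. \<bar>ut (x, t)\<bar> + 1)"
    using stress_near_surface by (elim exE conjE)
  obtain A where A: "A > 0" "\<forall>t\<in>{0..T}. a t \<le> A" using a_max by blast
  define b where "b = l / 2"
  define W where "W n z = cut_r n z * (stress z * (u z * fst z))" for n z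
  define Y where "Y n = (LBINT z. cut n z * (fst z * (D z)\<^sup>2))" for n
  define S where "S n = (LBINT z. (cut_t n z + u z * cut_r n z) * energy_density z)" for n
  define Z where "Z n = (LBINT z. indicator (rim n) z * (\<bar>ut z\<bar> + 1))" for n
  have Slim: "S \<longlonglongrightarrow> energy 0 - energy T"
    unfolding S_def energy_def
    using strip_limit_continuous[OF T _ _ a cont(2) energy_density_continuous, of "\<lambda>_. 0" "\<lambda>_. 0"] u0 a_traj by simp
  have ex_w: "\<exists>w. w \<longlonglongrightarrow> (0::real) \<and> (\<forall>n>0. \<forall>t\<in>{0..T}. \<forall>r\<in>{0..2 / real n}. \<bar>u (r, t)\<bar> \<le> w n)"
  proof -
    define w where "w n = (SUP z\<in>{0..2 / real n} \<times> {0..T}. \<bar>u z\<bar>)" for n :: nat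
    have bdd: "bdd_above ((\<lambda>z. \<bar>u z\<bar>) ` X)" for X by (rule bdd_aboveI2[of _ _ M]) (rule bounded(2))
    have ne: "(0, 0) \<in> {0..2 / real n} \<times> {0..T}" for n :: nat using T by simp
    have le: "\<bar>u (r, t)\<bar> \<le> w n" if "t \<in> {0..T}" "r \<in> {0..2 / real n}" for n r t
      unfolding w_def by (rule cSUP_upper[OF _ bdd]) (use that in auto)
    have w0: "0 \<le> w n" for n using le[of 0 0 n] T by (auto intro: order_trans[OF abs_ge_zero])
    have "w \<longlonglongrightarrow> 0"
    proof (rule LIMSEQ_I)
      fix e :: real assume e: "0 < e"
      have "uniformly_continuous_on ({0..2} \<times> {0..T}) u"
        by (intro compact_uniformly_continuous compact_Times compact_Icc continuous_on_subset[OF cont(2)]) auto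
      then obtain d where d: "d > 0" "\<And>z z'. z \<in> {0..2} \<times> {0..T} ==> z' \<in> {0..2} \<times> {0..T} ==> dist z' z < d ==> dist (u z') (u z) < e / 2"
        unfolding uniformly_continuous_on_def using e half_gt_zero by meson
      obtain N where N: "real N > 2 / d" using reals_Archimedean2 by blast
      have "norm (w n - 0) < e" if n: "n \<ge> max N 1" for n
      proof -
        have n1: "real n \<ge> 1" "real n > 2 / d" using n N by auto
        have A1: "2 / real n \<le> 2" "2 / real n < d" using n1 d(1) by (auto simp: field_simps)
        have "w n \<le> e / 2" unfolding w_def
        proof (rule cSUP_least)
          fix z assume z: "z \<in> {0..2 / real n} \<times> {0..T}"
          obtain r t where zz: "z = (r, t)" by (cases z)
          have rt: "0 \<le> r" "r \<le> 2 / real n" "t \<in> {0..T}" using z zz by auto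
          then have "dist (r, t) (0, t) < d" using A1 by (simp add: dist_prod_def dist_real_def)
          then have "dist (u (r, t)) (u (0, t)) < e / 2" using d(2)[of "(0, t)" "(r, t)"] rt A1 by simp
          then show "\<bar>u z\<bar> \<le> e / 2" using u0[OF rt(3)] by (simp add: zz dist_real_def)
        qed (use ne in blast)
        then show ?thesis using w0[of n] e by simp
      qed
      then show "\<exists>no. \<forall>n\<ge>no. norm (w n - 0) < e" by blast
    qed
    then show ?thesis using le by (intro exI[of _ w] conjI allI impI ballI) auto
  qed
  then obtain w where w: "w \<longlonglongrightarrow> 0" "\<And>n t r. 0 < n ==> t \<in> {0..T} ==> r \<in> {0..2 / real n} ==> \<bar>u (r, t)\<bar> \<le> w n" by blast
  (* the area T/n of the central rectangle times the pointwise error; w bounds the velocity there *)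
  define J where "J n = T * (4 * M * (M + M\<^sup>2) * (1 / real n) + 8 * \<nu> * (w n)\<^sup>2)" for n :: nat
  obtain N where N: "real N > 8 / l" using reals_Archimedean2 by blast
  have main: "\<nu> / 2 * Y n \<le> S n + J n + A * M * K * Z n" if nN: "n \<ge> max N 1" for n
  proof -
    have n: "0 < n" "real n > 8 / l" using nN N by auto
    then have "8 / real n < l" using K(2) by (simp add: field_simps)
    moreover have "8 / real n = 4 * (2 / real n)" "0 < 2 / real n" using n(1) by auto
    ultimately have nl: "2 / real n \<le> b" "2 / real n \<le> l" and nl4: "4 * (2 / real n) < l" unfolding b_def by linarith+
    have ba: "b < a t - 2 / real n" if "t \<in> {0..T}" for t
    proof -
      have "l < a t" using K(3) that by blast
      then show ?thesis using nl4 K(2) unfolding b_def by linarith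
    qed
    note I = energy_identity[OF n(1)]
    have Wi: "integrable lborel (W n)" unfolding W_def by (rule I(2))
    define Lp where "Lp z = indicator {z. fst z \<le> b} z * W n z" for z
    define Rp where "Rp z = indicator {z. b < fst z} z * W n z" for z
    have sb: "{z::real\<times>real. fst z \<le> b} \<in> sets lborel" "{z::real\<times>real. b < fst z} \<in> sets lborel"
      by (simp_all add: closed_Collect_le open_Collect_less continuous_on_fst borel_closed borel_open)
    have Li: "integrable lborel Lp" "integrable lborel Rp"
      unfolding Lp_def Rp_def using integrable_mult_indicator[OF sb(1) Wi] integrable_mult_indicator[OF sb(2) Wi] by simp_all
    have "W n z = Lp z + Rp z" for z unfolding Lp_def Rp_def by (auto simp: indicator_def)
    then have WLR: "(LBINT z. W n z) = (LBINT z. Lp z) + (LBINT z. Rp z)" using Li by simp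
    have rect: "has_bochner_integral lborel (indicat_real (core n)) ((1 / real n) * T)"
    proof -
      have "emeasure lborel (core n) = ennreal (1 / real n) * ennreal T"
        using lborel.emeasure_pair_measure_Times[of "{1 / real n..2 / real n}" lborel "{0..T}"] T n(1)
          divide_right_mono[of 1 2 "real n"]
        by (simp add: lborel_prod emeasure_lborel_Icc_eq diff_divide_distrib[symmetric])
      then show ?thesis using T
        by (intro has_bochner_integral_real_indicator[THEN has_bochner_integral_cong[THEN iffD1, rotated -1]])
           (auto simp: measure_def ennreal_mult[symmetric] enn2real_mult intro!: borel_closed closed_Times)
    qed
    define j where "j = 4 * M * (M + M\<^sup>2) + 8 * \<nu> * real n * (w n)\<^sup>2"
    have Lbound: "(LBINT z. Lp z) \<le> \<nu> / 2 * Y n + J n"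
    proof -
      have "(LBINT z. Lp z) \<le> (LBINT z. \<nu> / 2 * (cut n z * (fst z * (D z)\<^sup>2)) + indicator (core n) z * j)"
      proof (rule integral_mono[OF Li(1)])
        show "integrable lborel (\<lambda>z. \<nu> / 2 * (cut n z * (fst z * (D z)\<^sup>2)) + indicator (core n) z * j)"
          using I(1) rect by (auto simp: has_bochner_integral_iff)
        fix z :: "real \<times> real"
        obtain r t where z: "z = (r, t)" by (cases z)
        have nn: "0 \<le> \<nu> / 2 * (cut n z * (fst z * (D z)\<^sup>2)) + indicator (core n) z * j"
        proof (cases "cut n z = 0")
          case True then show ?thesis using M_nonneg \<nu> by (simp add: j_def)
        next
          case False
          then have "1 / real n \<le> r" using cut_support(1)[OF n(1), of r t] z by blast
          moreover have "0 < 1 / real n" using n by simp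
          ultimately have "0 \<le> r" by linarith
          then show ?thesis using M_nonneg \<nu> strip_bounds(1)[of n T "\<lambda>_. 0" a z] by (simp add: j_def z)
        qed
        show "Lp z \<le> \<nu> / 2 * (cut n z * (fst z * (D z)\<^sup>2)) + indicator (core n) z * j"
        proof (cases "r \<le> b \<and> t \<in> {0..T}")
          case True
          then show ?thesis
            using centre_layer_pointwise[OF n(1) nl(1) ba, of t r "w n"] w(2)[OF n(1)] by (simp add: Lp_def W_def z j_def)
        next
          case False
          then have "Lp z = 0"
          proof (cases "t \<in> {0..T}")
            case F: False
            have "cut_r n z = 0"
            proof (rule ccontr)
              assume "cut_r n z \<noteq> 0"
              then have "t \<in> {0<..<T}" using cut_support(3)[OF n(1), of r t] z by blast
              then show False using F by auto
            qed
            then show ?thesis by (simp add: Lp_def W_def)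
          qed (use False in \<open>simp add: Lp_def z\<close>)
          then show ?thesis using nn by simp
        qed
      qed
      also have "\<dots> = \<nu> / 2 * Y n + (1 / real n) * T * j"
        using I(1) rect by (simp add: Y_def has_bochner_integral_iff)
      also have "(1 / real n) * T * j = J n" using n by (simp add: j_def J_def field_simps)
      finally show ?thesis .
    qed
    note Gi = rim_integral(1)[OF K(2,3) nl(2)]
    define zt where "zt t = (LBINT r. indicator (rim n) (r, t) * (\<bar>ut (r, t)\<bar> + 1))" for t
    have zt0: "0 \<le> zt t" for t unfolding zt_def by (intro integral_nonneg_AE always_eventually allI) simp
    have zti: "integrable lborel zt" "(LBINT t. zt t) = Z n"
      using plane_Fubini(2,3)[OF Gi] by (simp_all add: zt_def[abs_def] Z_def)
    have hb: "has_bochner_integral lborel (\<lambda>r. layer n (a t - r)) 1" for t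
      using layer_integral[OF n(1), of "-1" "a t"] by simp
    have sl: "AE t in lborel. \<bar>LBINT r. Rp (r, t)\<bar> \<le> A * M * K * zt t"
      using AE_good plane_Fubini(1)[OF Li(2)]
    proof eventually_elim
      case (elim t)
      have zn: "0 \<le> A * M * K * zt t" using A M_nonneg K zt0 by simp
      show ?case
      proof (cases "t \<in> {0<..<T}")
        case False
        then have "Rp (r, t) = 0" for r using cut_support(3)[OF n(1), of r t] by (auto simp: Rp_def W_def)
        then show ?thesis using zn by simp
      next
        case True
        then have g: "good t" using elim by simp
        obtain s where s: "stress_rep t s" using stress_rep_exists[OF g] ..
        have ss: "AE r in lborel. r \<in> {0<..<a t} --> stress (r, t) = s r" using s unfolding stress_rep_def by (rule conjunct2)
        have tt: "t \<in> {0..T}" using True by simp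
        have at: "l < a t" "a t \<le> A" using K(3) A(2) tt by auto
        have sr: "\<bar>s r\<bar> \<le> K * zt t" if r: "a t - 2 / real n \<le> r" "r < a t" for r
        proof -
          have "\<bar>s r\<bar> \<le> K * (LBINT x:{r..a t}. \<bar>ut (x, t)\<bar> + 1)"
            using st[rule_format, OF g s, of r] r nl by linarith
          also have "(LBINT x:{r..a t}. \<bar>ut (x, t)\<bar> + 1) \<le> zt t"
          proof -
            have rp: "0 < a t - 2 / real n" using at nl by linarith
            have "(LBINT x:{r..a t}. \<bar>ut (x, t)\<bar> + 1) \<le> (LBINT x:{a t - 2 / real n..a t}. \<bar>ut (x, t)\<bar> + 1)"
              unfolding set_lebesgue_integral_def
            proof (rule integral_mono)
              show "integrable lborel (\<lambda>x. indicat_real {r..a t} x *\<^sub>R (\<bar>ut (x, t)\<bar> + 1))"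
                using ut_slice_integrable[OF g, of r] rp r unfolding set_integrable_def by linarith
              show "integrable lborel (\<lambda>x. indicat_real {a t - 2 / real n..a t} x *\<^sub>R (\<bar>ut (x, t)\<bar> + 1))"
                using ut_slice_integrable[OF g rp] unfolding set_integrable_def .
              show "indicat_real {r..a t} x *\<^sub>R (\<bar>ut (x, t)\<bar> + 1) \<le> indicat_real {a t - 2 / real n..a t} x *\<^sub>R (\<bar>ut (x, t)\<bar> + 1)" for x
                using r by (auto simp: indicator_def)
            qed
            also have "\<dots> = zt t" unfolding set_lebesgue_integral_def zt_def
            proof (rule integral_cong_AE)
              have [measurable]: "(\<lambda>x. ut (x, t)) \<in> borel_measurable borel" by (rule measurable_slice) measurable
              have [measurable]: "(\<lambda>x. indicat_real (rim n) (x, t)) \<in> borel_measurable borel"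
                by (rule measurable_slice) measurable
              show "(\<lambda>x. indicat_real {a t - 2 / real n..a t} x *\<^sub>R (\<bar>ut (x, t)\<bar> + 1)) \<in> borel_measurable lborel" by measurable
              show "(\<lambda>x. indicat_real (rim n) (x, t) * (\<bar>ut (x, t)\<bar> + 1)) \<in> borel_measurable lborel" by measurable
              show "AE x in lborel. indicat_real {a t - 2 / real n..a t} x *\<^sub>R (\<bar>ut (x, t)\<bar> + 1) = indicat_real (rim n) (x, t) * (\<bar>ut (x, t)\<bar> + 1)"
                using AE_lborel_singleton[of "a t"]
              proof (rule AE_mp, intro always_eventually allI impI)
                fix x assume "x \<noteq> a t"
                have "(x, t) \<in> rim n \<longleftrightarrow> (x, t) \<in> Q \<and> a t - 2 / real n \<le> x" by (simp add: rim_def)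
                moreover have "(x, t) \<in> Q \<longleftrightarrow> 0 < x \<and> x < a t" using True by (simp add: Q_def)
                ultimately have "x \<in> {a t - 2 / real n..a t} \<longleftrightarrow> (x, t) \<in> rim n" using \<open>x \<noteq> a t\<close> rp by auto
                then show "indicat_real {a t - 2 / real n..a t} x *\<^sub>R (\<bar>ut (x, t)\<bar> + 1) = indicat_real (rim n) (x, t) * (\<bar>ut (x, t)\<bar> + 1)"
                  by (simp add: indicator_def)
              qed
            qed
            finally show ?thesis .
          qed
          finally show ?thesis using K(1) by (simp add: mult_left_mono)
        qed
        have Rb: "AE r in lborel. \<bar>Rp (r, t)\<bar> \<le> layer n (a t - r) * (A * M * K * zt t)"
          using ss
        proof (rule AE_mp, intro always_eventually allI impI)
          fix r assume h: "r \<in> {0<..<a t} --> stress (r, t) = s r"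
          have rhs: "0 \<le> layer n (a t - r) * (A * M * K * zt t)" using layer_nonneg zn by simp
          show "\<bar>Rp (r, t)\<bar> \<le> layer n (a t - r) * (A * M * K * zt t)"
          proof (cases "b < r \<and> a t - r \<in> {1 / real n..2 / real n}")
            case True
            have "0 < 1 / real n" using n by simp
            moreover have "b < r" "1 / real n \<le> a t - r" "a t - r \<le> 2 / real n" "0 < b" using True K(2) by (auto simp: b_def)
            ultimately have r: "a t - 2 / real n \<le> r" "r < a t" "0 < r" "r \<le> A" using at by linarith+
            have S1: "\<bar>stress (r, t)\<bar> \<le> K * zt t" using h r sr[OF r(1,2)] by auto
            have "Rp (r, t) = - (plateau n 0 T t * (ramp (real n * r) * layer n (a t - r))) * (stress (r, t) * (u (r, t) * r))"
              using True cut_r_split(2)[OF n(1) nl(1) ba[OF tt], of r] by (simp add: Rp_def W_def)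
            then have "\<bar>Rp (r, t)\<bar> = (plateau n 0 T t * ramp (real n * r)) * (layer n (a t - r) * (\<bar>stress (r, t)\<bar> * (\<bar>u (r, t)\<bar> * r)))"
              using plateau_bounds(1) ramp_nonneg layer_nonneg r by (simp add: abs_mult)
            also have "\<dots> \<le> 1 * (layer n (a t - r) * ((K * zt t) * (M * A)))"
              using plateau_bounds ramp_nonneg ramp_le_1 layer_nonneg S1 bounded(2)[of "(r, t)"] r K zt0[of t] M_nonneg A
              by (intro mult_mono mult_le_one mult_nonneg_nonneg) auto
            finally show ?thesis by (simp add: mult_ac)
          next
            case False
            then have "Rp (r, t) = 0"
              using layer_eq_0[OF n(1), of "a t - r"] cut_r_split(2)[OF n(1) nl(1) ba[OF tt], of r]
              by (cases "b < r") (auto simp: Rp_def W_def)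
            then show ?thesis using rhs by simp
          qed
        qed
        have "\<bar>LBINT r. Rp (r, t)\<bar> \<le> (LBINT r. \<bar>Rp (r, t)\<bar>)" by (rule integral_abs_bound)
        also have "\<dots> \<le> (LBINT r. layer n (a t - r) * (A * M * K * zt t))"
        proof (rule integral_mono_AE[OF _ _ Rb])
          show "integrable lborel (\<lambda>r. \<bar>Rp (r, t)\<bar>)" using elim(2) by (rule Bochner_Integration.integrable_abs)
          show "integrable lborel (\<lambda>r. layer n (a t - r) * (A * M * K * zt t))"
            using hb[of t] by (auto simp: has_bochner_integral_iff)
        qed
        also have "\<dots> = A * M * K * zt t" using hb[of t] by (simp add: has_bochner_integral_iff)
        finally show ?thesis .
      qed
    qed
    have Rbound: "(LBINT z. Rp z) \<le> A * M * K * Z n"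
    proof -
      have "(LBINT z. Rp z) = (LBINT t. (LBINT r. Rp (r, t)))" by (rule plane_Fubini(3)[OF Li(2)])
      also have "\<dots> \<le> (LBINT t. A * M * K * zt t)"
      proof (rule integral_mono_AE)
        show "AE t in lborel. (LBINT r. Rp (r, t)) \<le> A * M * K * zt t"
          using sl by (rule AE_mp) (intro always_eventually allI impI, linarith)
      qed (use plane_Fubini(2)[OF Li(2)] zti in auto)
      finally show ?thesis using zti by simp
    qed
    have "\<nu> * Y n = S n + (LBINT z. W n z)" using I(3) by (simp add: Y_def S_def W_def)
    then show ?thesis using WLR Lbound Rbound by (simp add: field_simps)
  qed
  (* an upper bound for the dissipation under the cutoff, with limit V *)
  define U where "U n = 2 / \<nu> * (S n + J n + A * M * K * Z n)" for n
  have Jlim: "J \<longlonglongrightarrow> 0"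
  proof -
    have "J \<longlonglongrightarrow> T * (4 * M * (M + M\<^sup>2) * 0 + 8 * \<nu> * 0\<^sup>2)" unfolding J_def
      by (intro tendsto_intros w(1) lim_inverse_n'[unfolded inverse_eq_divide])
    then show ?thesis by simp
  qed
  have Zlim: "Z \<longlonglongrightarrow> 0" unfolding Z_def by (rule rim_integral(2)[OF K(2,3)])
  define V where "V = 2 / \<nu> * (energy 0 - energy T)"
  have "U \<longlonglongrightarrow> 2 / \<nu> * (energy 0 - energy T + 0 + A * M * K * 0)"
    unfolding U_def by (intro tendsto_intros Slim Jlim Zlim)
  then have Ulim: "U \<longlonglongrightarrow> V" by (simp add: V_def)
  have YU: "Y n \<le> U n" if "n \<ge> max N 1" for n using main[OF that] \<nu> by (simp add: U_def field_simps)
  have cnn: "0 \<le> cut n z * (fst z * (D z)\<^sup>2)" if "0 < n" for n z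
  proof (cases "cut n z = 0")
    case False
    obtain r t where z: "z = (r, t)" by (cases z)
    then have "1 / real n \<le> r" using cut_support(1)[OF that, of r t] False by blast
    moreover have "0 < 1 / real n" using that by simp
    ultimately have "0 \<le> r" by linarith
    then show ?thesis using strip_bounds(1)[of n T "\<lambda>_. 0" a z] by (simp add: z)
  qed simp
  have Y0: "0 \<le> Y n" if "0 < n" for n unfolding Y_def by (intro integral_nonneg_AE always_eventually allI cnn that)
  have V0: "0 \<le> V"
    by (rule LIMSEQ_le_const[OF Ulim]) (intro exI[of _ "max N 1"] allI impI order_trans[OF Y0 YU], auto)
  have lim1: "(\<lambda>n. ennreal (cut (n + max N 1) z * (fst z * (D z)\<^sup>2))) \<longlonglongrightarrow> ennreal (indicator Q z * (fst z * (D z)\<^sup>2))" for z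
  proof -
    have "(\<lambda>n. cut n z) \<longlonglongrightarrow> indicator {0<..<T} (snd z) * indicator {0<..<a (snd z)} (fst z)"
      unfolding strip_def by (intro tendsto_mult plateau_tendsto)
    moreover have "indicator {0<..<T} (snd z) * indicator {0<..<a (snd z)} (fst z) = indicat_real Q z"
      by (cases z) (auto simp: Q_def indicator_def)
    ultimately have "(\<lambda>n. cut n z) \<longlonglongrightarrow> indicator Q z" by simp
    then show ?thesis by (intro tendsto_ennrealI tendsto_mult tendsto_const LIMSEQ_ignore_initial_segment)
  qed
  have cm: "(\<lambda>z. cut n z * (fst z * (D z)\<^sup>2)) \<in> borel_measurable lborel" if "0 < n" for n
    using energy_identity(1)[OF that] by (rule borel_measurable_integrable)
  have "(\<integral>\<^sup>+z. ennreal (indicator Q z * (fst z * (D z)\<^sup>2)) \<partial>lborel)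
      = (\<integral>\<^sup>+z. liminf (\<lambda>n. ennreal (cut (n + max N 1) z * (fst z * (D z)\<^sup>2))) \<partial>lborel)"
    using lim_imp_Liminf[OF _ lim1] by simp
  also have "\<dots> \<le> liminf (\<lambda>n. \<integral>\<^sup>+z. ennreal (cut (n + max N 1) z * (fst z * (D z)\<^sup>2)) \<partial>lborel)"
  proof (rule nn_integral_liminf)
    fix n
    have "1 \<le> max N 1" by simp
    then have "0 < n + max N 1" by linarith
    from measurable_compose[OF cm[OF this] measurable_ennreal]
    show "(\<lambda>z. ennreal (cut (n + max N 1) z * (fst z * (D z)\<^sup>2))) \<in> borel_measurable lborel" .
  qed
  also have "\<dots> \<le> liminf (\<lambda>n. ennreal (U (n + max N 1)))"
  proof (intro Liminf_mono always_eventually allI)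
    fix n
    have "1 \<le> max N 1" by simp
    then have n0: "0 < n + max N 1" by linarith
    have "(\<integral>\<^sup>+z. ennreal (cut (n + max N 1) z * (fst z * (D z)\<^sup>2)) \<partial>lborel) = ennreal (Y (n + max N 1))"
      unfolding Y_def by (rule nn_integral_eq_integral[OF energy_identity(1)[OF n0]]) (intro always_eventually allI cnn n0)
    also have "\<dots> \<le> ennreal (U (n + max N 1))" by (intro ennreal_leI YU) simp
    finally show "(\<integral>\<^sup>+z. ennreal (cut (n + max N 1) z * (fst z * (D z)\<^sup>2)) \<partial>lborel) \<le> ennreal (U (n + max N 1))" .
  qed
  also have "\<dots> = ennreal V"
    by (rule lim_imp_Liminf) (auto intro!: tendsto_ennrealI LIMSEQ_ignore_initial_segment Ulim)
  finally have nn: "(\<integral>\<^sup>+z. ennreal (indicator Q z * (fst z * (D z)\<^sup>2)) \<partial>lborel) \<le> ennreal V" .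
  have qn: "0 \<le> indicator Q z * (fst z * (D z)\<^sup>2)" for z by (cases "z \<in> Q") (auto simp: Q_def)
  show i: "integrable lborel (\<lambda>z. indicator Q z * (fst z * (D z)\<^sup>2))"
  proof (rule integrableI_nonneg)
    show "(\<integral>\<^sup>+z. ennreal (indicator Q z * (fst z * (D z)\<^sup>2)) \<partial>lborel) < \<infinity>"
      using nn by (rule le_less_trans) simp
  qed (measurable, intro always_eventually allI qn)
  have "ennreal (LBINT z. indicator Q z * (fst z * (D z)\<^sup>2)) \<le> ennreal V"
    using nn by (subst nn_integral_eq_integral[OF i, symmetric]) (auto intro!: always_eventually qn)
  then have "(LBINT z. indicator Q z * (fst z * (D z)\<^sup>2)) \<le> V" using V0 by (simp add: ennreal_le_iff)
  then show "\<nu> / 2 * (LBINT z. indicator Q z * (fst z * (D z)\<^sup>2)) \<le> energy 0 - energy T"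
    using \<nu> by (simp add: V_def field_simps)
qed

end

section \<open>Positivity, vacuum and flux along trajectories\<close>

lemma interval_below:
  fixes f :: "real => real"
  assumes c: "continuous_on UNIV f" and x: "x \<in> {0..A}" "f x < c" and A: "0 < A"
  shows "\<exists>p q. 0 < p \<and> p < q \<and> q < A \<and> (\<forall>r\<in>{p..q}. f r < c)"
proof -
  have "open (f -` {..<c})" by (rule open_vimage[OF _ c]) simp
  then obtain d where d: "d > 0" "ball x d \<subseteq> f -` {..<c}" using x(2) openE[of "f -` {..<c}" x] by auto
  obtain p q where pq: "max 0 (x - d) < p" "p < q" "q < min A (x + d)"
  proof -
    have lt: "max 0 (x - d) < min A (x + d)" using x(1) A d(1) by auto
    obtain p where p: "max 0 (x - d) < p" "p < min A (x + d)" using dense[OF lt] by blast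
    obtain q where "p < q" "q < min A (x + d)" using dense[OF p(2)] by blast
    then show thesis using that p by blast
  qed
  have "f r < c" if "r \<in> {p..q}" for r
  proof -
    have "r \<in> ball x d" using that pq by (auto simp: dist_real_def)
    then show ?thesis using d(2) by auto
  qed
  then show ?thesis using pq by (intro exI[of _ p] exI[of _ q]) auto
qed

context mhd_flow
begin

definition trajectory :: "real => (real => real) => bool" where
  "trajectory \<tau> R \<longleftrightarrow> (\<exists>R'. (\<forall>t. (R has_real_derivative R' t) (at t)) \<and> continuous_on UNIV R' \<and>
     (\<forall>t\<in>{0..\<tau>}. 0 \<le> R t \<and> R t \<le> a t \<and> R' t = u (R t, t)))"

lemma trajectory_range: "trajectory \<tau> R ==> t \<in> {0..\<tau>} ==> 0 \<le> R t \<and> R t \<le> a t"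
  unfolding trajectory_def by blast

lemma trajectory_subset: "trajectory \<tau> R ==> \<tau>' \<le> \<tau> ==> trajectory \<tau>' R"
  unfolding trajectory_def by (elim exE conjE, intro exI conjI, assumption+) auto

lemma trajectory_zero: "\<tau> \<le> T ==> trajectory \<tau> (\<lambda>_. 0)"
  unfolding trajectory_def using u0 a_pos
  by (intro exI[of _ "\<lambda>_. 0"] conjI ballI allI) (auto intro: less_imp_le)

lemma a_within: "\<tau> \<le> T ==> t \<in> {0..\<tau>} ==> (a has_real_derivative u (a t, t)) (at t within {0..\<tau>})"
  using has_field_derivative_at_within[OF a(1)[of t]] a_traj[of t] by simp

lemma forward_trajectory:
  assumes "0 \<le> r" "r \<le> a 0"
  shows "\<exists>R. trajectory T R \<and> R 0 = r"
proof -
  have "\<exists>y y'. y 0 = r \<and> (\<forall>t. (y has_real_derivative y' t) (at t)) \<and> continuous_on UNIV y' \<and>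
    (\<forall>t\<in>{0..T}. 0 \<le> y t \<and> y t \<le> a t \<and> y' t = u (y t, t))"
    by (rule trajectory_exists[OF cont(2) bounded(2)]) (use T a_within[of T] a_pos u0 assms in \<open>auto intro: less_imp_le\<close>)
  then show ?thesis unfolding trajectory_def by blast
qed

lemma backward_trajectory:
  assumes "0 \<le> r" "r \<le> a \<tau>" "0 \<le> \<tau>" "\<tau> \<le> T"
  shows "\<exists>R. trajectory \<tau> R \<and> R \<tau> = r"
proof -
  have "\<exists>y y'. y \<tau> = r \<and> (\<forall>t. (y has_real_derivative y' t) (at t)) \<and> continuous_on UNIV y' \<and>
    (\<forall>t\<in>{0..\<tau>}. 0 \<le> y t \<and> y t \<le> a t \<and> y' t = u (y t, t))"
    by (rule backward_trajectory_exists[OF cont(2) bounded(2)]) (use assms a_within[of \<tau>] a_pos u0 in \<open>auto intro: less_imp_le\<close>)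
  then show ?thesis unfolding trajectory_def by blast
qed

text \<open>The first curve may be the centre and the second one any trajectory, since both stay inside the
  closed fluid region.\<close>

lemma transport:
  assumes R: "trajectory \<tau> R1" "trajectory \<tau> R2" and \<tau>: "0 < \<tau>" "\<tau> \<le> T"
    and F: "continuous_on UNIV F" "wdt Q F Ft" "wdr Q (\<lambda>z. u z * F z) G"
    and src: "AE z in lborel. z \<in> Q --> \<bar>Ft z + G z\<bar> \<le> h z" and h: "integrable lborel (\<lambda>z. indicator Q z * h z)"
  shows "\<bar>(LBINT r:{R1 \<tau>..R2 \<tau>}. F (r, \<tau>)) - (LBINT r:{R1 0..R2 0}. F (r, 0))\<bar> \<le> (LBINT z. indicator Q z * h z)"
proof -
  obtain R1' where R1: "\<And>t. (R1 has_real_derivative R1' t) (at t)" "continuous_on UNIV R1'"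
    "\<And>t. t \<in> {0..\<tau>} ==> 0 \<le> R1 t \<and> R1 t \<le> a t \<and> R1' t = u (R1 t, t)"
    using R(1) unfolding trajectory_def by blast
  obtain R2' where R2: "\<And>t. (R2 has_real_derivative R2' t) (at t)" "continuous_on UNIV R2'"
    "\<And>t. t \<in> {0..\<tau>} ==> 0 \<le> R2 t \<and> R2 t \<le> a t \<and> R2' t = u (R2 t, t)"
    using R(2) unfolding trajectory_def by blast
  show ?thesis
  proof (rule transport_between_trajectories[OF \<tau>(1) R1(1,2) R2(1,2) cont(2) F(1) _ _ _ F(2,3) src h])
    show "R1' t = u (R1 t, t)" "R2' t = u (R2 t, t)" if "t \<in> {0..\<tau>}" for t using R1(3)[OF that] R2(3)[OF that] by auto
    fix r t assume t: "0 < t" "t < \<tau>" "R1 t < r" "r < R2 t"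
    then have "0 \<le> R1 t" "R2 t \<le> a t" using R1(3)[of t] R2(3)[of t] by auto
    then show "(r, t) \<in> Q" using t \<tau> by (auto simp: Q_def)
  qed
qed

text \<open>Two nearby trajectories traced back to time \<open>0\<close> carry the sign of the initial data. The profile
  \<open>\<beta>\<close> serves the pressure, of which only powers are conserved; up to an error \<open>e\<close>, and with
  slope at least \<open>d\<close> at zero whatever \<open>e\<close> is.\<close>

definition sign_profile :: "(real \<times> real => real) => real => real => (real => real) => bool" where
  "sign_profile g d e \<beta> \<longleftrightarrow> continuous_on UNIV \<beta> \<and>
     (\<forall>z. (0 \<le> g z --> d * g z \<le> \<beta> (g z)) \<and> (g z \<le> 0 --> \<beta> (g z) \<le> d * g z)) \<and>
     (\<forall>\<tau> R1 R2. 0 < \<tau> --> \<tau> \<le> T --> trajectory \<tau> R1 --> trajectory \<tau> R2 -->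
        \<bar>(LBINT r:{R1 \<tau>..R2 \<tau>}. r * \<beta> (g (r, \<tau>))) - (LBINT r:{R1 0..R2 0}. r * \<beta> (g (r, 0)))\<bar> \<le> e)"

definition sign_transported :: "(real \<times> real => real) => bool" where
  "sign_transported g \<longleftrightarrow> continuous_on UNIV g \<and> (\<exists>d>0. \<forall>e>0. \<exists>\<beta>. sign_profile g d e \<beta>)"

lemma set_integrable_profile:
  fixes \<beta> :: "real => real" and g :: "real \<times> real => real"
  assumes "continuous_on UNIV \<beta>" "continuous_on UNIV g"
  shows "set_integrable lborel {x..y} (\<lambda>r. r * \<beta> (g (r, t)))"
proof -
  have "continuous_on UNIV (\<lambda>r. \<beta> (g (r, t)))"
    by (rule continuous_on_compose2[OF assms(1) continuous_on_slice[OF assms(2)]]) auto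
  then have "continuous_on {x..y} (\<lambda>r. r * \<beta> (g (r, t)))"
    by (auto intro!: continuous_on_mult continuous_on_id intro: continuous_on_subset)
  then show ?thesis unfolding set_integrable_def by (rule borel_integrable_compact[OF compact_Icc])
qed

text \<open>A negative value would occur on a whole interval. The trajectories ending at its endpoints enclose a
  nonnegative initial mass, up to an error smaller than the negative mass at the end.\<close>

lemma sign_transported_nonneg:
  assumes g: "sign_transported g" and g0: "\<And>r. r \<in> {0..a 0} ==> 0 \<le> g (r, 0)"
    and \<tau>: "\<tau> \<in> {0..T}" and r: "r \<in> {0..a \<tau>}"
  shows "0 \<le> g (r, \<tau>)"
proof (rule ccontr)
  assume "\<not> 0 \<le> g (r, \<tau>)"
  then have neg: "g (r, \<tau>) < g (r, \<tau>) / 2" "g (r, \<tau>) < 0" by auto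
  then have "\<tau> \<noteq> 0" using g0 r by force
  then have \<tau>0: "0 < \<tau>" "\<tau> \<le> T" using \<tau> by auto
  have gc: "continuous_on UNIV g" using g by (simp add: sign_transported_def)
  define c where "c = - g (r, \<tau>) / 2"
  have c: "0 < c" using neg by (simp add: c_def)
  obtain p q where pq: "0 < p" "p < q" "q < a \<tau>" "\<forall>x\<in>{p..q}. g (x, \<tau>) < - c"
    using interval_below[OF continuous_on_slice[OF gc] r, of \<tau> "- c"] neg a_pos[OF \<tau>] by (auto simp: c_def)
  obtain d where d: "0 < d" and dd: "\<forall>e>0. \<exists>\<beta>. sign_profile g d e \<beta>"
    using g unfolding sign_transported_def by blast
  define \<eta> where "\<eta> = (q - p) * (p * (d * c))"
  have \<eta>: "0 < \<eta>" using pq c d by (simp add: \<eta>_def)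
  then obtain \<beta> where \<beta>: "continuous_on UNIV \<beta>"
     "\<And>z. 0 \<le> g z ==> d * g z \<le> \<beta> (g z)" "\<And>z. g z \<le> 0 ==> \<beta> (g z) \<le> d * g z"
     "\<And>\<tau> R1 R2. 0 < \<tau> ==> \<tau> \<le> T ==> trajectory \<tau> R1 ==> trajectory \<tau> R2 ==>
        \<bar>(LBINT r:{R1 \<tau>..R2 \<tau>}. r * \<beta> (g (r, \<tau>))) - (LBINT r:{R1 0..R2 0}. r * \<beta> (g (r, 0)))\<bar> \<le> \<eta> / 2"
    using dd[rule_format, of "\<eta> / 2"] unfolding sign_profile_def by (auto 0 3)
  obtain R1 where R1: "trajectory \<tau> R1" "R1 \<tau> = p" using backward_trajectory[of p \<tau>] pq \<tau>0 by auto
  obtain R2 where R2: "trajectory \<tau> R2" "R2 \<tau> = q" using backward_trajectory[of q \<tau>] pq \<tau>0 by auto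
  have i0: "0 \<le> (LBINT r:{R1 0..R2 0}. r * \<beta> (g (r, 0)))"
    unfolding set_lebesgue_integral_def
  proof (intro integral_nonneg_AE always_eventually allI)
    fix x
    show "0 \<le> indicat_real {R1 0..R2 0} x *\<^sub>R (x * \<beta> (g (x, 0)))"
    proof (cases "x \<in> {R1 0..R2 0}")
      case True
      then have x: "x \<in> {0..a 0}" using trajectory_range[OF R1(1), of 0] trajectory_range[OF R2(1), of 0] \<tau>0 by auto
      then have "0 \<le> d * g (x, 0)" "d * g (x, 0) \<le> \<beta> (g (x, 0))" using g0[of x] \<beta>(2)[of "(x, 0)"] d by auto
      then have "0 \<le> \<beta> (g (x, 0))" by linarith
      then show ?thesis using True x by simp
    qed simp
  qed
  have "(LBINT r:{p..q}. r * \<beta> (g (r, \<tau>))) \<le> (LBINT r:{p..q}. - (p * (d * c)))"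
  proof (rule set_integral_mono[OF set_integrable_profile[OF \<beta>(1) gc]])
    show "set_integrable lborel {p..q} (\<lambda>r. - (p * (d * c)))" by (rule set_integrable_const_Icc)
    fix x assume x: "x \<in> {p..q}"
    have gx: "g (x, \<tau>) < - c" using pq(4) x by blast
    then have "\<beta> (g (x, \<tau>)) \<le> d * g (x, \<tau>)" using \<beta>(3)[of "(x, \<tau>)"] c by simp
    also have "\<dots> \<le> d * (- c)" using gx d by (intro mult_left_mono) auto
    finally have b: "d * c \<le> - \<beta> (g (x, \<tau>))" by simp
    have "p * (d * c) \<le> x * (- \<beta> (g (x, \<tau>)))" using x pq d c b by (intro mult_mono) auto
    then show "x * \<beta> (g (x, \<tau>)) \<le> - (p * (d * c))" by simp
  qed
  also have "\<dots> = - \<eta>" using pq by (simp add: \<eta>_def set_integral_const measure_lborel_Icc)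
  finally show False using \<beta>(4)[OF \<tau>0 R1(1) R2(1)] i0 \<eta> unfolding R1(2) R2(2) by linarith
qed

text \<open>The mass enclosed by the trajectory is initially zero and remains so; being nonnegative, the
  quantity vanishes.\<close>

lemma sign_transported_vacuum:
  assumes g: "sign_transported g" and gn: "\<And>r. r \<in> {0..a \<tau>} ==> 0 \<le> g (r, \<tau>)"
    and R: "trajectory \<tau> R" and g0: "\<And>r. r \<in> {0..R 0} ==> g (r, 0) = 0"
    and \<tau>: "0 < \<tau>" "\<tau> \<le> T" and r: "r \<in> {0..R \<tau>}" and Rp: "0 < R \<tau>"
  shows "g (r, \<tau>) = 0"
proof (rule ccontr)
  assume ne: "g (r, \<tau>) \<noteq> 0"
  have Ra: "R \<tau> \<le> a \<tau>" using trajectory_range[OF R, of \<tau>] \<tau> by auto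
  then have pos: "0 < g (r, \<tau>)" using gn[of r] r ne by auto
  have gc: "continuous_on UNIV g" using g by (simp add: sign_transported_def)
  define c where "c = g (r, \<tau>) / 2"
  have c: "0 < c" using pos by (simp add: c_def)
  have mc: "continuous_on UNIV (\<lambda>x. - g (x, \<tau>))" by (intro continuous_intros continuous_on_slice gc)
  obtain p q where pq: "0 < p" "p < q" "q < R \<tau>" "\<forall>x\<in>{p..q}. - g (x, \<tau>) < - c"
    using interval_below[OF mc r, of "- c"] pos Rp by (auto simp: c_def)
  obtain d where d: "0 < d" and dd: "\<forall>e>0. \<exists>\<beta>. sign_profile g d e \<beta>"
    using g unfolding sign_transported_def by blast
  define \<eta> where "\<eta> = (q - p) * (p * (d * c))"
  have \<eta>: "0 < \<eta>" using pq c d by (simp add: \<eta>_def)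
  then obtain \<beta> where \<beta>: "continuous_on UNIV \<beta>"
     "\<And>z. 0 \<le> g z ==> d * g z \<le> \<beta> (g z)" "\<And>z. g z \<le> 0 ==> \<beta> (g z) \<le> d * g z"
     "\<And>\<tau> R1 R2. 0 < \<tau> ==> \<tau> \<le> T ==> trajectory \<tau> R1 ==> trajectory \<tau> R2 ==>
        \<bar>(LBINT r:{R1 \<tau>..R2 \<tau>}. r * \<beta> (g (r, \<tau>))) - (LBINT r:{R1 0..R2 0}. r * \<beta> (g (r, 0)))\<bar> \<le> \<eta> / 2"
    using dd[rule_format, of "\<eta> / 2"] unfolding sign_profile_def by (auto 0 3)
  have bn: "0 \<le> x * \<beta> (g (x, \<tau>))" if "x \<in> {0..R \<tau>}" for x
  proof -
    have "0 \<le> g (x, \<tau>)" using gn[of x] that Ra by auto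
    then have "0 \<le> d * g (x, \<tau>)" "d * g (x, \<tau>) \<le> \<beta> (g (x, \<tau>))" using \<beta>(2)[of "(x, \<tau>)"] d by auto
    then have "0 \<le> \<beta> (g (x, \<tau>))" by linarith
    then show ?thesis using that by simp
  qed
  have i0: "(LBINT r:{0..R 0}. r * \<beta> (g (r, 0))) = 0"
    unfolding set_lebesgue_integral_def
  proof (intro integral_eq_zero_AE always_eventually allI)
    fix x
    show "indicat_real {0..R 0} x *\<^sub>R (x * \<beta> (g (x, 0))) = 0"
    proof (cases "x \<in> {0..R 0}")
      case True
      then have "\<beta> (g (x, 0)) = 0" using \<beta>(2,3)[of "(x, 0)"] g0[of x] by simp
      then show ?thesis by simp
    qed simp
  qed
  have "\<eta> = (LBINT r:{p..q}. p * (d * c))" using pq by (simp add: \<eta>_def set_integral_const measure_lborel_Icc)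
  also have "\<dots> \<le> (LBINT r:{p..q}. r * \<beta> (g (r, \<tau>)))"
  proof (rule set_integral_mono[OF _ set_integrable_profile[OF \<beta>(1) gc]])
    show "set_integrable lborel {p..q} (\<lambda>r. p * (d * c))" by (rule set_integrable_const_Icc)
    fix x assume x: "x \<in> {p..q}"
    have gx: "c < g (x, \<tau>)" using pq(4) x by force
    have "d * c \<le> d * g (x, \<tau>)" using gx d by (intro mult_left_mono) auto
    also have "\<dots> \<le> \<beta> (g (x, \<tau>))" using \<beta>(2)[of "(x, \<tau>)"] gx c by simp
    finally show "p * (d * c) \<le> x * \<beta> (g (x, \<tau>))" using x pq d c by (intro mult_mono) auto
  qed
  also have "\<dots> \<le> (LBINT r:{0..R \<tau>}. r * \<beta> (g (r, \<tau>)))"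
    unfolding set_lebesgue_integral_def
  proof (rule integral_mono)
    show "integrable lborel (\<lambda>x. indicat_real {p..q} x *\<^sub>R (x * \<beta> (g (x, \<tau>))))"
      "integrable lborel (\<lambda>x. indicat_real {0..R \<tau>} x *\<^sub>R (x * \<beta> (g (x, \<tau>))))"
      using set_integrable_profile[OF \<beta>(1) gc] unfolding set_integrable_def by auto
    show "indicat_real {p..q} x *\<^sub>R (x * \<beta> (g (x, \<tau>))) \<le> indicat_real {0..R \<tau>} x *\<^sub>R (x * \<beta> (g (x, \<tau>)))" for x
      using bn[of x] pq by (auto simp: indicator_def)
  qed
  finally show False using \<beta>(4)[OF \<tau> trajectory_zero[OF \<tau>(2)] R] i0 \<eta> by linarith
qed

lemma density_transported: "sign_transported \<rho>"
proof -
  define F where "F z = fst z * \<rho> z" for z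
  have Fc: "continuous_on UNIV F" unfolding F_def[abs_def] by (intro continuous_intros cont)
  have 1: "wdt Q F (\<lambda>z. \<rho> z * 0 + fst z * \<rho>t z)" unfolding F_def[abs_def]
    by (rule wdt_mult[OF open_Q wdt_fst[OF open_Q] wt(1) fst_continuous cont(1)])
  have "wdr Q (\<lambda>z. fst z * (\<rho> z * u z)) (\<lambda>z. (\<rho> z * u z) * 1 + fst z * \<rho>ur z)"
    by (rule wdr_mult[OF open_Q wdr_fst[OF open_Q] wr(1) fst_continuous]) (intro continuous_intros cont)
  moreover have "(\<lambda>z. fst z * (\<rho> z * u z)) = (\<lambda>z. u z * F z)" by (simp add: F_def fun_eq_iff)
  ultimately have 2: "wdr Q (\<lambda>z. u z * F z) (\<lambda>z. (\<rho> z * u z) * 1 + fst z * \<rho>ur z)" by simp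
  have src: "AE z in lborel. z \<in> Q --> \<bar>(\<rho> z * 0 + fst z * \<rho>t z) + ((\<rho> z * u z) * 1 + fst z * \<rho>ur z)\<bar> \<le> 0"
    using eqs
  proof (rule AE_mp, intro always_eventually allI impI, elim impE)
    fix z assume z: "z \<in> Q" and "\<rho>t z + \<rho>ur z + \<rho> z * u z / fst z = 0 \<and>
        \<rho> z * (ut z + u z * ur z) + Pr z = \<nu> * divr z - B z * (Br z + B z / fst z) \<and>
        Pt z + u z * Pr z + \<gamma> * P z * (ur z + u z / fst z) = 0 \<and> Bt z + uBr z = 0"
    then have "\<rho>t z + \<rho>ur z + \<rho> z * u z / fst z = 0" by blast
    moreover have "fst z \<noteq> 0" using z by (auto simp: Q_def)
    ultimately show "\<bar>(\<rho> z * 0 + fst z * \<rho>t z) + ((\<rho> z * u z) * 1 + fst z * \<rho>ur z)\<bar> \<le> 0" by (simp add: field_simps)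
  qed
  have tr: "\<bar>(LBINT r:{R1 \<tau>..R2 \<tau>}. r * \<rho> (r, \<tau>)) - (LBINT r:{R1 0..R2 0}. r * \<rho> (r, 0))\<bar> \<le> 0"
    if "0 < \<tau>" "\<tau> \<le> T" "trajectory \<tau> R1" "trajectory \<tau> R2" for \<tau> R1 R2
    using transport[OF that(3,4,1,2) Fc 1 2 src] by (simp add: F_def)
  show ?thesis unfolding sign_transported_def
  proof (intro conjI cont exI[of _ 1] allI impI)
    fix e :: real assume "0 < e"
    then show "\<exists>\<beta>. sign_profile \<rho> 1 e \<beta>"
      unfolding sign_profile_def using order_trans[OF tr]
      by (intro exI[of _ "\<lambda>p. p"] conjI allI impI continuous_on_id) simp_all
  qed simp
qed

text \<open>Cauchy--Schwarz with the finite area of \<open>Q\<close>, in the form \<open>\<bar>D\<bar> \<le> 1 + D\<^sup>2\<close>.\<close>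

lemma rD_integrable: "integrable lborel (\<lambda>z. indicator Q z * (fst z * \<bar>D z\<bar>))"
proof -
  obtain A where A: "A > 0" "\<forall>t\<in>{0..T}. a t \<le> A" using a_max by blast
  show ?thesis
  proof (rule Bochner_Integration.integrable_bound)
    show "integrable lborel (\<lambda>z. A * indicat_real Q z + indicator Q z * (fst z * (D z)\<^sup>2))"
      by (intro Bochner_Integration.integrable_add integrable_mult_right Q_finite dissipation_bound(1))
    show "(\<lambda>z. indicator Q z * (fst z * \<bar>D z\<bar>)) \<in> borel_measurable lborel" by measurable
    show "AE z in lborel. norm (indicator Q z * (fst z * \<bar>D z\<bar>)) \<le> norm (A * indicat_real Q z + indicator Q z * (fst z * (D z)\<^sup>2))"
    proof (intro always_eventually allI)
      fix z
      show "norm (indicator Q z * (fst z * \<bar>D z\<bar>)) \<le> norm (A * indicat_real Q z + indicator Q z * (fst z * (D z)\<^sup>2))"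
      proof (cases "z \<in> Q")
        case True
        then have t: "snd z \<in> {0..T}" "0 < fst z" "fst z < a (snd z)" by (auto simp: Q_def)
        then have r: "0 < fst z" "fst z \<le> A" using A(2)[rule_format, OF t(1)] by auto
        have "0 \<le> (\<bar>D z\<bar> - 1)\<^sup>2" by simp
        then have "\<bar>D z\<bar> \<le> 1 + (D z)\<^sup>2" by (simp add: power2_diff)
        then have "fst z * \<bar>D z\<bar> \<le> fst z * (1 + (D z)\<^sup>2)" using r by (intro mult_left_mono) auto
        also have "\<dots> \<le> A + fst z * (D z)\<^sup>2" using r by (simp add: distrib_left)
        finally show ?thesis using True r A by simp
      qed simp
    qed
  qed
qed

text \<open>The power \<open>P\<^bsup>1/\<gamma>\<^esup>\<close> is a conserved density. Its regularisation \<open>p (p\<^sup>2 + \<eta>)\<^bsup>(1/\<gamma> - 1)/2\<^esup>\<close> is smooth and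
  conserved up to a source of size \<open>\<eta>\<^bsup>1/(2\<gamma>)\<^esup> \<bar>D\<bar>\<close>.\<close>

lemma pressure_transported: "sign_transported P"
proof -
  define k where "k = (1 / \<gamma> - 1) / 2"
  have k: "k \<le> 0" "2 * \<gamma> * k = 1 - \<gamma>" using \<gamma> by (auto simp: k_def field_simps)
  define CD where "CD = (LBINT z. indicator Q z * (fst z * \<bar>D z\<bar>))"
  have CD: "0 \<le> CD" unfolding CD_def by (intro integral_nonneg_AE always_eventually allI) (auto simp: indicator_def Q_def)
  (* a lower bound for the slope that is uniform in the regularisation, as |P| is at most M *)
  define d where "d = (M\<^sup>2 + 1) powr k"
  have s0: "0 < M\<^sup>2 + 1" by (smt (verit) zero_le_power2)
  have d: "0 < d" using s0 by (simp add: d_def)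
  have ex: "\<exists>\<beta>. sign_profile P d e \<beta>" if e: "0 < e" for e
  proof -
    define e' where "e' = e / ((\<gamma> - 1) * CD + 1)"
    have den: "0 < (\<gamma> - 1) * CD + 1" using \<gamma> CD by (smt (verit) mult_nonneg_nonneg)
    have e': "0 < e'" using e den by (simp add: e'_def)
    (* the defect below is at most a multiple of this power of the regularisation *)
    define \<eta> where "\<eta> = min 1 (e' powr (2 * \<gamma>))"
    have \<eta>: "0 < \<eta>" "\<eta> \<le> 1" using e' by (auto simp: \<eta>_def)
    have "\<eta> powr (1 / (2 * \<gamma>)) \<le> (e' powr (2 * \<gamma>)) powr (1 / (2 * \<gamma>))"
      using \<eta> \<gamma> by (intro powr_mono2) (auto simp: \<eta>_def)
    also have "\<dots> = e'" using e' \<gamma> by (simp add: powr_powr)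
    finally have \<eta>e: "\<eta> powr (1 / (2 * \<gamma>)) \<le> e'" .
    define \<beta> where "\<beta> p = p * (p\<^sup>2 + \<eta>) powr k" for p
    define \<beta>' where "\<beta>' p = (p\<^sup>2 + \<eta>) powr k + p * (k * (p\<^sup>2 + \<eta>) powr (k - 1) * (2 * p))" for p
    have sp: "0 < p\<^sup>2 + \<eta>" for p using \<eta> by (smt (verit) zero_le_power2)
    have \<beta>d: "(\<beta> has_real_derivative \<beta>' p) (at p)" for p
    proof -
      have "((\<lambda>p. p\<^sup>2 + \<eta>) has_real_derivative 2 * p) (at p)" by (auto intro!: derivative_eq_intros)
      from DERIV_fun_powr[OF this sp, of k]
      have "((\<lambda>p. (p\<^sup>2 + \<eta>) powr k) has_real_derivative k * (p\<^sup>2 + \<eta>) powr (k - 1) * (2 * p)) (at p)" by simp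
      from DERIV_mult[OF DERIV_ident this] show ?thesis
        unfolding \<beta>_def[abs_def] \<beta>'_def by (simp add: add.commute mult.commute)
    qed
    have nz: "p\<^sup>2 + \<eta> \<noteq> 0" for p using sp[of p] by simp
    have \<beta>c: "continuous_on UNIV \<beta>" "continuous_on UNIV \<beta>'"
      unfolding \<beta>_def[abs_def] \<beta>'_def[abs_def] using nz by (auto intro!: continuous_intros)
    have defect: "\<bar>\<beta> p - \<gamma> * p * \<beta>' p\<bar> \<le> (\<gamma> - 1) * e'" for p
    proof -
      define s where "s = p\<^sup>2 + \<eta>"
      have s: "0 < s" "\<eta> \<le> s" "p\<^sup>2 \<le> s" using sp[of p] \<eta> by (auto simp: s_def)
      have sk: "s powr k = s * s powr (k - 1)" using s powr_mult_base[of s "k - 1"] by simp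
      have "\<beta> p - \<gamma> * p * \<beta>' p = p * s powr k - \<gamma> * p * s powr k - (2 * \<gamma> * k) * p * p\<^sup>2 * s powr (k - 1)"
        unfolding \<beta>_def \<beta>'_def s_def[symmetric] by (simp add: algebra_simps power2_eq_square)
      also have "\<dots> = (1 - \<gamma>) * (p * (s powr (k - 1) * (s - p\<^sup>2)))" unfolding k(2) sk by (simp add: algebra_simps)
      also have "s - p\<^sup>2 = \<eta>" by (simp add: s_def)
      finally have eq: "\<bar>\<beta> p - \<gamma> * p * \<beta>' p\<bar> = (\<gamma> - 1) * (\<bar>p\<bar> * (s powr (k - 1) * \<eta>))"
        using \<gamma> \<eta> by (simp add: abs_mult)
      have "\<bar>p\<bar> \<le> s powr (1/2)" using s(3) s(1) by (simp add: powr_half_sqrt real_le_rsqrt)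
      then have "\<bar>p\<bar> * (s powr (k - 1) * \<eta>) \<le> s powr (1/2) * (s powr (k - 1) * \<eta>)"
        using \<eta> by (intro mult_right_mono) auto
      also have "\<dots> = s powr (1 / (2 * \<gamma>) - 1) * \<eta>"
      proof -
        have "1/2 + (k - 1) = 1 / (2 * \<gamma>) - 1" using \<gamma> by (simp add: k_def field_simps)
        then show ?thesis using powr_add[of s "1/2" "k - 1"] by simp
      qed
      also have "\<dots> \<le> \<eta> powr (1 / (2 * \<gamma>) - 1) * \<eta>"
        using s \<eta> \<gamma> by (intro mult_right_mono powr_mono2') (auto simp: field_simps)
      also have "\<dots> = \<eta> powr (1 / (2 * \<gamma>))" using \<eta> powr_mult_base[of \<eta> "1 / (2 * \<gamma>) - 1"] by (simp add: mult.commute)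
      also have "\<dots> \<le> e'" by (rule \<eta>e)
      finally show ?thesis unfolding eq using \<gamma> by (intro mult_left_mono) auto
    qed
    have sign: "(0 \<le> P z --> d * P z \<le> \<beta> (P z)) \<and> (P z \<le> 0 --> \<beta> (P z) \<le> d * P z)" for z
    proof -
      have "(P z)\<^sup>2 \<le> M\<^sup>2" using bounded(3)[of z] by (rule abs_le_square_iff[THEN iffD1, OF order_trans[OF _ abs_ge_self]])
      then have "d \<le> ((P z)\<^sup>2 + \<eta>) powr k" unfolding d_def using sp[of "P z"] k(1) \<eta> by (intro powr_mono2') auto
      then show ?thesis unfolding \<beta>_def mult.commute[of d]
        using mult_left_mono[of d "((P z)\<^sup>2 + \<eta>) powr k" "P z"] mult_left_mono_neg[of d "((P z)\<^sup>2 + \<eta>) powr k" "P z"] by blast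
    qed
    define F where "F z = fst z * \<beta> (P z)" for z
    have bPc: "continuous_on UNIV (\<lambda>z. \<beta> (P z))" by (rule continuous_on_compose2[OF \<beta>c(1) cont(3)]) auto
    have Fc: "continuous_on UNIV F" unfolding F_def[abs_def] by (intro continuous_intros bPc)
    have 1: "wdt Q F (\<lambda>z. \<beta> (P z) * 0 + fst z * (\<beta>' (P z) * Pt z))" unfolding F_def[abs_def]
      by (rule wdt_mult[OF open_Q wdt_fst[OF open_Q] wdt_chain[OF open_Q wt(3) cont(3) \<beta>d \<beta>c(2)] fst_continuous bPc])
    have ub: "wdr Q (\<lambda>z. u z * \<beta> (P z)) (\<lambda>z. \<beta> (P z) * ur z + u z * (\<beta>' (P z) * Pr z))"
      by (rule wdr_mult[OF open_Q wr(2) wdr_chain[OF open_Q wr(4) cont(3) \<beta>d \<beta>c(2)] cont(2) bPc])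
    have "wdr Q (\<lambda>z. fst z * (u z * \<beta> (P z))) (\<lambda>z. (u z * \<beta> (P z)) * 1 + fst z * (\<beta> (P z) * ur z + u z * (\<beta>' (P z) * Pr z)))"
      by (rule wdr_mult[OF open_Q wdr_fst[OF open_Q] ub fst_continuous]) (intro continuous_intros cont bPc)
    moreover have "(\<lambda>z. fst z * (u z * \<beta> (P z))) = (\<lambda>z. u z * F z)" by (simp add: F_def fun_eq_iff)
    ultimately have 2: "wdr Q (\<lambda>z. u z * F z) (\<lambda>z. (u z * \<beta> (P z)) * 1 + fst z * (\<beta> (P z) * ur z + u z * (\<beta>' (P z) * Pr z)))" by simp
    have src: "AE z in lborel. z \<in> Q --> \<bar>(\<beta> (P z) * 0 + fst z * (\<beta>' (P z) * Pt z)) +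
        ((u z * \<beta> (P z)) * 1 + fst z * (\<beta> (P z) * ur z + u z * (\<beta>' (P z) * Pr z)))\<bar> \<le> (\<gamma> - 1) * e' * (fst z * \<bar>D z\<bar>)"
      using eqs
    proof (rule AE_mp, intro always_eventually allI impI, elim impE)
      fix z assume z: "z \<in> Q" and "\<rho>t z + \<rho>ur z + \<rho> z * u z / fst z = 0 \<and>
          \<rho> z * (ut z + u z * ur z) + Pr z = \<nu> * divr z - B z * (Br z + B z / fst z) \<and>
          Pt z + u z * Pr z + \<gamma> * P z * (ur z + u z / fst z) = 0 \<and> Bt z + uBr z = 0"
      then have "Pt z + u z * Pr z + \<gamma> * P z * (ur z + u z / fst z) = 0" by blast
      then have pt: "Pt z = - (u z * Pr z) - \<gamma> * P z * D z" by (simp add: D_def)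
      have r: "0 < fst z" using z by (auto simp: Q_def)
      have rD: "fst z * D z = fst z * ur z + u z" using r by (simp add: D_def field_simps)
      have "(\<beta> (P z) * 0 + fst z * (\<beta>' (P z) * Pt z)) + ((u z * \<beta> (P z)) * 1 + fst z * (\<beta> (P z) * ur z + u z * (\<beta>' (P z) * Pr z)))
          = \<beta> (P z) * (fst z * ur z + u z) - \<gamma> * P z * \<beta>' (P z) * (fst z * D z)"
        unfolding pt by (simp add: algebra_simps)
      also have "\<dots> = (\<beta> (P z) - \<gamma> * P z * \<beta>' (P z)) * (fst z * D z)" unfolding rD by (simp add: algebra_simps)
      finally have eq: "(\<beta> (P z) * 0 + fst z * (\<beta>' (P z) * Pt z)) + ((u z * \<beta> (P z)) * 1 + fst z * (\<beta> (P z) * ur z + u z * (\<beta>' (P z) * Pr z)))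
          = (\<beta> (P z) - \<gamma> * P z * \<beta>' (P z)) * (fst z * D z)" .
      show "\<bar>(\<beta> (P z) * 0 + fst z * (\<beta>' (P z) * Pt z)) +
        ((u z * \<beta> (P z)) * 1 + fst z * (\<beta> (P z) * ur z + u z * (\<beta>' (P z) * Pr z)))\<bar> \<le> (\<gamma> - 1) * e' * (fst z * \<bar>D z\<bar>)"
        unfolding eq abs_mult using defect[of "P z"] r by (intro mult_mono) auto
    qed
    have hi: "integrable lborel (\<lambda>z. indicator Q z * ((\<gamma> - 1) * e' * (fst z * \<bar>D z\<bar>)))"
      using integrable_mult_right[OF rD_integrable, of "(\<gamma> - 1) * e'"] by (simp add: mult_ac)
    have hI: "(LBINT z. indicator Q z * ((\<gamma> - 1) * e' * (fst z * \<bar>D z\<bar>))) = (\<gamma> - 1) * e' * CD"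
      unfolding CD_def by (subst integral_mult_right_zero[symmetric]) (simp add: mult_ac)
    have "(\<gamma> - 1) * CD * e' \<le> ((\<gamma> - 1) * CD + 1) * e'" using e' by (intro mult_right_mono) auto
    also have "\<dots> = e" using den by (simp add: e'_def)
    finally have le: "(\<gamma> - 1) * e' * CD \<le> e" by (simp add: mult_ac)
    have "\<bar>(LBINT r:{R1 \<tau>..R2 \<tau>}. r * \<beta> (P (r, \<tau>))) - (LBINT r:{R1 0..R2 0}. r * \<beta> (P (r, 0)))\<bar> \<le> e"
      if "0 < \<tau>" "\<tau> \<le> T" "trajectory \<tau> R1" "trajectory \<tau> R2" for \<tau> R1 R2
      using transport[OF that(3,4,1,2) Fc 1 2 src hi] le unfolding hI by (simp add: F_def)
    then show ?thesis unfolding sign_profile_def using \<beta>c(1) sign by (intro exI[of _ \<beta>] conjI allI impI) blast+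
  qed
  show ?thesis unfolding sign_transported_def using cont(3) d ex by blast
qed

lemma nonneg_fields:
  assumes "t \<in> {0..T}" "r \<in> {0..a t}"
  shows "0 \<le> \<rho> (r, t)" "0 \<le> P (r, t)"
  using sign_transported_nonneg[OF density_transported _ assms] sign_transported_nonneg[OF pressure_transported _ assms] init by auto

lemma energy_nonneg: "t \<in> {0..T} ==> 0 \<le> energy t"
  unfolding energy_def set_lebesgue_integral_def
proof (intro integral_nonneg_AE always_eventually allI)
  fix r assume t: "t \<in> {0..T}"
  show "0 \<le> indicat_real {0..a t} r *\<^sub>R energy_density (r, t)"
  proof (cases "r \<in> {0..a t}")
    case True
    then show ?thesis using nonneg_fields[OF t True] \<gamma> by (simp add: energy_density_def)
  qed simp
qed

lemma total_dissipation: "\<nu> / 2 * (LBINT z. indicator Q z * (fst z * (D z)\<^sup>2)) \<le> energy 0"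
  using dissipation_bound(2) energy_nonneg[of T] T by simp

text \<open>The left curve is the centre, where \<open>u = 0\<close>.\<close>

lemma flux_conserved:
  assumes R: "trajectory \<tau> R" and \<tau>: "0 \<le> \<tau>" "\<tau> \<le> T"
  shows "(LBINT r:{0..R \<tau>}. B (r, \<tau>)) = (LBINT r:{0..R 0}. B (r, 0))"
proof (cases "\<tau> = 0")
  case False
  have src: "AE z in lborel. z \<in> Q --> \<bar>Bt z + uBr z\<bar> \<le> 0"
    using eqs by (rule AE_mp) (intro always_eventually allI impI, simp)
  show ?thesis
    using transport[OF trajectory_zero[OF \<tau>(2)] R _ \<tau>(2) cont(4) wt(4) wr(6) src] \<tau> False by simp
qed simp

end

section \<open>The vacuum core forces dissipation\<close>

lemma set_integral_Cauchy_Schwarz: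
  fixes f g :: "'a => real"
  assumes "set_integrable N S (\<lambda>x. (f x)\<^sup>2)" "set_integrable N S (\<lambda>x. (g x)\<^sup>2)" "set_integrable N S (\<lambda>x. f x * g x)"
  shows "(LINT x:S|N. f x * g x)\<^sup>2 \<le> (LINT x:S|N. (f x)\<^sup>2) * (LINT x:S|N. (g x)\<^sup>2)"
proof -
  define F G X where "F = (LINT x:S|N. (f x)\<^sup>2)" and "G = (LINT x:S|N. (g x)\<^sup>2)" and "X = (LINT x:S|N. f x * g x)"
  have q: "0 \<le> F + l\<^sup>2 * G - 2 * l * X" for l
  proof -
    have "0 \<le> (LINT x:S|N. (f x - l * g x)\<^sup>2)"
      unfolding set_lebesgue_integral_def by (intro integral_nonneg_AE always_eventually allI) simp
    also have "\<dots> = (LINT x:S|N. ((f x)\<^sup>2 + l\<^sup>2 * (g x)\<^sup>2) - (2 * l) * (f x * g x))"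
      by (simp add: power2_diff power_mult_distrib algebra_simps)
    also have "\<dots> = (LINT x:S|N. (f x)\<^sup>2 + l\<^sup>2 * (g x)\<^sup>2) - (LINT x:S|N. (2 * l) * (f x * g x))"
      using assms by (intro set_integral_diff(2) set_integral_add(1) set_integrable_mult_right)
    also have "\<dots> = F + l\<^sup>2 * G - 2 * l * X"
      using assms by (subst set_integral_add(2)) (auto simp: F_def G_def X_def intro: set_integrable_mult_right)
    finally show ?thesis .
  qed
  have G0: "0 \<le> G" unfolding G_def set_lebesgue_integral_def by (intro integral_nonneg_AE always_eventually allI) simp
  have "X\<^sup>2 \<le> F * G"
  proof (cases "G = 0")
    case True
    have "X = 0"
    proof (rule ccontr)
      assume X: "X \<noteq> 0"
      have "0 \<le> F - 2 * ((F + 1) / (2 * X)) * X" using q[of "(F + 1) / (2 * X)"] True by simp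
      then show False using X by simp
    qed
    then show ?thesis using True by simp
  next
    case False
    then have G: "0 < G" using G0 by simp
    have "0 \<le> F + (X / G)\<^sup>2 * G - 2 * (X / G) * X" by (rule q)
    also have "\<dots> = F - X\<^sup>2 / G" using G by (simp add: field_simps power2_eq_square)
    finally show ?thesis using G by (simp add: field_simps)
  qed
  then show ?thesis by (simp add: F_def G_def X_def)
qed

lemma powr_continuous: "0 < x ==> continuous_on {x..y::real} (\<lambda>r. r powr e)"
  by (intro continuous_intros) auto

lemma powr_integral_le:
  fixes x y e :: real
  assumes "0 < x" "x \<le> y" "-1 < e"
  shows "(LBINT r:{x..y}. r powr e) \<le> y powr (e + 1) / (e + 1)"
proof -
  have "ac x y (\<lambda>r. r powr (e + 1) / (e + 1)) (\<lambda>r. r powr e)"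
  proof (rule ac_C1[OF _ powr_continuous[OF assms(1)]])
    fix r assume "x \<le> r"
    then have "((\<lambda>r. r powr (e + 1)) has_real_derivative (e + 1) * r powr (e + 1 - 1)) (at r)"
      using assms by (intro has_real_derivative_powr) auto
    from DERIV_cdivide[OF this, of "e + 1"]
    show "((\<lambda>r. r powr (e + 1) / (e + 1)) has_real_derivative r powr e) (at r)" using assms by simp
  qed
  from ac_diff[OF this, of x y] have "(LBINT r:{x..y}. r powr e) = y powr (e + 1) / (e + 1) - x powr (e + 1) / (e + 1)"
    using assms by simp
  moreover have "0 \<le> x powr (e + 1) / (e + 1)" using assms by simp
  ultimately show ?thesis by linarith
qed

context mhd_flow
begin

text \<open>The dissipation rate at time \<open>t\<close>, up to the factor \<open>\<nu>\<close>.\<close>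

definition diss :: "real => real" where
  "diss t = (LBINT r. indicator Q (r, t) * (r * (D (r, t))\<^sup>2))"

text \<open>Good times at which the dissipation rate is a genuine integral.\<close>

definition dissipative :: "real => bool" where
  "dissipative t \<longleftrightarrow> good t \<and> integrable lborel (\<lambda>r. indicator Q (r, t) * (r * (D (r, t))\<^sup>2))"

lemma AE_dissipative: "AE t in lborel. t \<in> {0<..<T} --> dissipative t"
  using AE_good plane_Fubini(1)[OF dissipation_bound(1)]
  by eventually_elim (simp add: dissipative_def)

lemma diss_integrable: "integrable lborel diss"
  using plane_Fubini(2)[OF dissipation_bound(1)] unfolding diss_def[abs_def] by simp

lemma diss_integral: "\<nu> / 2 * (LBINT t. diss t) \<le> energy 0"
  using plane_Fubini(3)[OF dissipation_bound(1)] total_dissipation unfolding diss_def by simp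

lemma diss_nonneg: "0 \<le> diss t"
  unfolding diss_def by (intro integral_nonneg_AE always_eventually allI) (auto simp: indicator_def Q_def)

lemma D_slice:
  assumes "dissipative t" "0 < x" "y < a t"
  shows "set_integrable lborel {x..y} (\<lambda>r. (sqrt r * \<bar>D (r, t)\<bar>)\<^sup>2)"
    and "(LBINT r:{x..y}. (sqrt r * \<bar>D (r, t)\<bar>)\<^sup>2) \<le> diss t"
proof -
  have i: "integrable lborel (\<lambda>r. indicator Q (r, t) * (r * (D (r, t))\<^sup>2))" and t: "t \<in> {0<..<T}"
    using assms(1) goodD(1) by (auto simp: dissipative_def)
  have Q: "(r, t) \<in> Q" if "r \<in> {x..y}" for r using that assms t by (auto simp: Q_def)
  have le: "indicator {x..y} r *\<^sub>R (sqrt r * \<bar>D (r, t)\<bar>)\<^sup>2 \<le> indicator Q (r, t) * (r * (D (r, t))\<^sup>2)" for r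
  proof (cases "r \<in> {x..y}")
    case True then show ?thesis using Q[OF True] assms by (simp add: power_mult_distrib)
  qed (auto simp: indicator_def Q_def)
  have [measurable]: "(\<lambda>r. D (r, t)) \<in> borel_measurable borel" by (rule measurable_slice[OF measurable_D])
  show s: "set_integrable lborel {x..y} (\<lambda>r. (sqrt r * \<bar>D (r, t)\<bar>)\<^sup>2)"
    unfolding set_integrable_def
  proof (rule Bochner_Integration.integrable_bound[OF i])
    show "AE r in lborel. norm (indicat_real {x..y} r *\<^sub>R (sqrt r * \<bar>D (r, t)\<bar>)\<^sup>2) \<le> norm (indicat_real Q (r, t) * (r * (D (r, t))\<^sup>2))"
    proof (intro always_eventually allI)
      fix r
      show "norm (indicat_real {x..y} r *\<^sub>R (sqrt r * \<bar>D (r, t)\<bar>)\<^sup>2) \<le> norm (indicat_real Q (r, t) * (r * (D (r, t))\<^sup>2))"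
        using order_trans[OF le[of r] abs_ge_self] by simp
    qed
  qed measurable
  show "(LBINT r:{x..y}. (sqrt r * \<bar>D (r, t)\<bar>)\<^sup>2) \<le> diss t"
    unfolding set_lebesgue_integral_def diss_def
    by (rule integral_mono[OF s[unfolded set_integrable_def] i le])
qed

lemma D_integrable:
  assumes "dissipative t" "0 < x" "x \<le> y" "y < a t"
  shows "set_integrable lborel {x..y} (\<lambda>r. r powr b * \<bar>D (r, t)\<bar>)"
proof (cases "x = y")
  case True
  have [measurable]: "(\<lambda>r. D (r, t)) \<in> borel_measurable borel" by (rule measurable_slice[OF measurable_D])
  have "AE r in lborel. indicator {y..y} r *\<^sub>R (r powr b * \<bar>D (r, t)\<bar>) = 0"
    using AE_lborel_singleton[of y] by eventually_elim (auto simp: indicator_def)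
  then have "integrable lborel (\<lambda>r. indicator {y..y} r *\<^sub>R (r powr b * \<bar>D (r, t)\<bar>)) = integrable lborel (\<lambda>_::real. 0::real)"
    by (intro integrable_cong_AE) auto
  then show ?thesis unfolding set_integrable_def True by simp
next
  case False
  then have lt: "x < y" using assms by simp
  have g: "good t" using assms(1) by (simp add: dissipative_def)
  obtain F where F: "ac x y F (\<lambda>r. divr (r, t))" and FD: "AE r in lborel. r \<in> {x..y} --> D (r, t) = F r"
    using good_D[OF g assms(2) lt assms(4)] by (elim exE conjE)
  have [measurable]: "(\<lambda>r. D (r, t)) \<in> borel_measurable borel" by (rule measurable_slice[OF measurable_D])
  have c: "set_integrable lborel {x..y} (\<lambda>r. r powr b * \<bar>F r\<bar>)" unfolding set_integrable_def
    by (intro borel_integrable_compact compact_Icc continuous_on_mult powr_continuous assms continuous_on_rabs ac_continuous[OF F])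
  show ?thesis unfolding set_integrable_def
  proof (rule integrable_cong_AE_imp[OF c[unfolded set_integrable_def]])
    show "AE r in lborel. indicat_real {x..y} r *\<^sub>R (r powr b * \<bar>F r\<bar>) = indicat_real {x..y} r *\<^sub>R (r powr b * \<bar>D (r, t)\<bar>)"
      using FD by (rule AE_mp) (intro always_eventually allI impI, simp add: indicator_def)
  qed measurable
qed

text \<open>Cauchy--Schwarz with the factors \<open>r\<^bsup>1/2\<^esup> \<bar>D\<bar>\<close> and \<open>r\<^bsup>b - 1/2\<^esup>\<close>. The constants \<open>1/\<surd>(2\<alpha> - 2)\<close> and
  \<open>1/\<surd>(2\<alpha>)\<close> of the final bound are the cases \<open>b = \<alpha> - 1\<close> and \<open>b = \<alpha>\<close>.\<close>

lemma D_weighted: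
  assumes t: "dissipative t" and xy: "0 < x" "x \<le> y" "y < a t" and b: "0 < b"
  shows "(LBINT r:{x..y}. r powr b * \<bar>D (r, t)\<bar>) \<le> sqrt (diss t) * y powr b / sqrt (2 * b)"
proof -
  have sq: "r powr (b - 1 / 2) * (sqrt r * \<bar>D (r, t)\<bar>) = r powr b * \<bar>D (r, t)\<bar>" "(r powr (b - 1 / 2))\<^sup>2 = r powr (2 * b - 1)" if "r \<in> {x..y}" for r
  proof -
    have r: "0 < r" using that xy by simp
    have "r powr (b - 1 / 2) * sqrt r = r powr b" using r powr_add[of r "b - 1/2" "1/2"] by (simp add: powr_half_sqrt)
    then show "r powr (b - 1 / 2) * (sqrt r * \<bar>D (r, t)\<bar>) = r powr b * \<bar>D (r, t)\<bar>" by (simp add: mult.assoc[symmetric])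
    show "(r powr (b - 1 / 2))\<^sup>2 = r powr (2 * b - 1)"
      using r powr_add[of r "b - 1/2" "b - 1/2"] by (simp add: power2_eq_square)
  qed
  have p: "set_integrable lborel {x..y} (\<lambda>r. (r powr (b - 1 / 2))\<^sup>2)"
    unfolding set_integrable_def using xy(1)
    by (intro borel_integrable_compact compact_Icc continuous_on_power powr_continuous)
  have "(LBINT r:{x..y}. r powr b * \<bar>D (r, t)\<bar>)\<^sup>2 = (LBINT r:{x..y}. r powr (b - 1 / 2) * (sqrt r * \<bar>D (r, t)\<bar>))\<^sup>2"
    by (intro arg_cong[where f = "\<lambda>x. x\<^sup>2"] set_lebesgue_integral_cong allI impI sq(1)[symmetric]) simp_all
  also have "\<dots> \<le> (LBINT r:{x..y}. (r powr (b - 1 / 2))\<^sup>2) * (LBINT r:{x..y}. (sqrt r * \<bar>D (r, t)\<bar>)\<^sup>2)"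
  proof (rule set_integral_Cauchy_Schwarz[OF p D_slice(1)[OF t xy(1,3)]])
    show "set_integrable lborel {x..y} (\<lambda>r. r powr (b - 1 / 2) * (sqrt r * \<bar>D (r, t)\<bar>))"
      using D_integrable[OF t xy, of b] by (subst set_integrable_cong[OF refl refl sq(1)]) auto
  qed
  also have "(LBINT r:{x..y}. (r powr (b - 1 / 2))\<^sup>2) = (LBINT r:{x..y}. r powr (2 * b - 1))"
    using sq by (intro set_lebesgue_integral_cong) auto
  also have "(LBINT r:{x..y}. r powr (2 * b - 1)) * (LBINT r:{x..y}. (sqrt r * \<bar>D (r, t)\<bar>)\<^sup>2) \<le> y powr (2 * b) / (2 * b) * diss t"
  proof (intro mult_mono D_slice(2)[OF t xy(1,3)])
    show "(LBINT r:{x..y}. r powr (2 * b - 1)) \<le> y powr (2 * b) / (2 * b)" using powr_integral_le[OF xy(1,2), of "2 * b - 1"] b by simp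
    show "0 \<le> (LBINT r:{x..y}. (sqrt r * \<bar>D (r, t)\<bar>)\<^sup>2)"
      unfolding set_lebesgue_integral_def by (intro integral_nonneg_AE always_eventually allI) simp
  qed (use b in simp)
  also have "y powr (2 * b) / (2 * b) * diss t = (sqrt (diss t) * y powr b / sqrt (2 * b))\<^sup>2"
    using b xy diss_nonneg[of t] powr_add[of y b b] by (simp add: power_divide power_mult_distrib power2_eq_square)
  finally show ?thesis
    by (rule power2_le_imp_le) (use diss_nonneg[of t] b in simp)
qed

text \<open>As \<open>(r u)\<^sub>r = r D\<close>, the product \<open>q u(q)\<close> is an integral of \<open>r D\<close>, which is at most \<open>q\<close> times the square root
  of the dissipation rate.\<close>

lemma velocity_le_diss:
  assumes t: "dissipative t" and q: "0 \<le> q" "q \<le> a t"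
  shows "\<bar>u (q, t)\<bar> \<le> sqrt (diss t)"
proof -
  have g: "good t" using t by (simp add: dissipative_def)
  have inner: "\<bar>u (q, t)\<bar> \<le> sqrt (diss t)" if q: "0 < q" "q < a t" for q
  proof -
    have est: "q * \<bar>u (q, t)\<bar> \<le> q * sqrt (diss t) + s * M" if s: "0 < s" "s < q" for s
    proof -
      have "ac s q (\<lambda>r. r * u (r, t)) (\<lambda>r. 1 * u (r, t) + r * ur (r, t))"
        by (rule ac_mult[OF ac_C1 goodD(4)[OF g s q(2)]]) (auto intro!: derivative_eq_intros continuous_intros)
      from ac_diff[OF this, of s q] have "q * u (q, t) - s * u (s, t) = (LBINT r:{s..q}. 1 * u (r, t) + r * ur (r, t))"
        using s by simp
      also have "\<dots> = (LBINT r:{s..q}. r * D (r, t))"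
        using s by (intro set_lebesgue_integral_cong) (auto simp: D_def field_simps)
      finally have eq: "q * u (q, t) - s * u (s, t) = (LBINT r:{s..q}. r * D (r, t))" .
      have "\<bar>LBINT r:{s..q}. r * D (r, t)\<bar> \<le> (LBINT r:{s..q}. \<bar>r * D (r, t)\<bar>)"
        unfolding set_lebesgue_integral_def by (rule order_trans[OF integral_abs_bound]) (simp add: abs_mult)
      also have "\<dots> = (LBINT r:{s..q}. r powr 1 * \<bar>D (r, t)\<bar>)"
        using s by (intro set_lebesgue_integral_cong) (auto simp: abs_mult)
      also have "\<dots> \<le> sqrt (diss t) * q powr 1 / sqrt (2 * 1)" using s q by (intro D_weighted[OF t]) auto
      also have "\<dots> = q * (sqrt (diss t) / sqrt 2)" using q by simp
      also have "\<dots> \<le> q * sqrt (diss t)"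
      proof -
        have "sqrt (diss t) / sqrt 2 \<le> sqrt (diss t) / 1" using diss_nonneg[of t] by (intro divide_left_mono) auto
        then show ?thesis using q by (intro mult_left_mono) auto
      qed
      finally have "\<bar>q * u (q, t) - s * u (s, t)\<bar> \<le> q * sqrt (diss t)" unfolding eq .
      moreover have "\<bar>s * u (s, t)\<bar> \<le> s * M" using bounded(2)[of "(s, t)"] s by (simp add: abs_mult)
      moreover have "\<bar>q * u (q, t)\<bar> = q * \<bar>u (q, t)\<bar>" using q by (simp add: abs_mult)
      ultimately show ?thesis by linarith
    qed
    have "q * \<bar>u (q, t)\<bar> \<le> q * sqrt (diss t)"
    proof (rule field_le_epsilon)
      fix e :: real assume e: "0 < e"
      define s where "s = min (q / 2) (e / (M + 1))"
      have M: "0 < M + 1" using M_nonneg by simp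
      have s: "0 < s" "s < q" using q e M by (auto simp: s_def)
      have "s * M \<le> e / (M + 1) * (M + 1)" using M_nonneg e by (intro mult_mono) (auto simp: s_def)
      then have "s * M \<le> e" using M by simp
      then show "q * \<bar>u (q, t)\<bar> \<le> q * sqrt (diss t) + e" using est[OF s] by simp
    qed
    then show ?thesis using q by simp
  qed
  show ?thesis
  proof (cases "0 < q")
    case True
    have c: "continuous_on {0..a t} (\<lambda>q. \<bar>u (q, t)\<bar>)" by (intro continuous_intros continuous_on_slice cont)
    have "closed ({0..a t} \<inter> (\<lambda>q. \<bar>u (q, t)\<bar>) -` {..sqrt (diss t)})"
      by (rule continuous_closed_preimage[OF c]) auto
    moreover have "{0<..<a t} \<subseteq> {0..a t} \<inter> (\<lambda>q. \<bar>u (q, t)\<bar>) -` {..sqrt (diss t)}" using inner by auto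
    ultimately have "closure {0<..<a t} \<subseteq> {0..a t} \<inter> (\<lambda>q. \<bar>u (q, t)\<bar>) -` {..sqrt (diss t)}" by (rule closure_minimal[rotated])
    moreover have "closure {0<..<a t} = {0..a t}" using goodD(3)[OF g] by simp
    ultimately show ?thesis using q by auto
  next
    case False
    then have "q = 0" using q by simp
    then show ?thesis using u0[OF goodD(2)[OF g]] diss_nonneg[of t] by simp
  qed
qed

lemma vacuum_stress_decreasing:
  assumes s: "stress_rep t s" and vac: "\<And>r. r \<in> {0..R} ==> \<rho> (r, t) = 0" and R: "R \<le> a t"
    and xy: "0 < x" "x \<le> y" "y < R"
  shows "s y \<le> s x"
proof (cases "x = y")
  case False
  then have "ac x y s (\<lambda>r. - force (r, t))" using s xy R unfolding stress_rep_def by simp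
  from ac_diff[OF this, of x y] have "s y - s x = (LBINT r:{x..y}. - force (r, t))" using xy by simp
  moreover have "0 \<le> (LBINT r:{x..y}. force (r, t))"
    unfolding set_lebesgue_integral_def
    by (intro integral_nonneg_AE always_eventually allI) (use xy vac in \<open>auto simp: indicator_def force_def\<close>)
  moreover have "(LBINT r:{x..y}. - force (r, t)) = - (LBINT r:{x..y}. force (r, t))"
    by (simp add: set_lebesgue_integral_def)
  ultimately show ?thesis by linarith
qed simp

text \<open>In vacuum the stress decreases in \<open>r\<close>, so its value at \<open>x\<close> is at most its mean over \<open>[x/2, x]\<close>, which
  the dissipation controls. The stress can therefore grow at most like \<open>1/x\<close> at the centre.\<close>

lemma vacuum_stress_bound:
  assumes t: "dissipative t" and s: "stress_rep t s" and R: "R \<le> a t"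
    and vac: "\<And>r. r \<in> {0..R} ==> \<rho> (r, t) = 0 \<and> P (r, t) = 0" and x: "0 < x" "x < R"
  shows "s x * x \<le> M\<^sup>2 * x + 4 * \<nu> * sqrt (diss t)"
proof -
  note Mi = B_square_le
  (* the mean over [x/2, x] is used only for a positive stress *)
  define y where "y = x / 2"
  have y: "0 < y" "y \<le> x" "y < x" "x < a t" using x R by (auto simp: y_def)
  have Di: "set_integrable lborel {y..x} (\<lambda>r. r powr 1 * \<bar>D (r, t)\<bar>)" by (rule D_integrable[OF t y(1,2,4)])
  have sc: "continuous_on {y..x} s" using s y unfolding stress_rep_def by (intro ac_continuous[of y x]) blast
  have si: "set_integrable lborel {y..x} (\<lambda>r. r * s r)" unfolding set_integrable_def
    by (intro borel_integrable_compact compact_Icc continuous_on_mult continuous_on_id sc)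
  note ci = set_integrable_const_Icc[of y x]
  have len: "(LBINT r:{y..x}. c) = y * c" for c :: real using y by (simp add: set_integral_const measure_lborel_Icc y_def)
  have "y * (y * s x) \<le> x * M\<^sup>2 / 2 * y + \<nu> * (sqrt (diss t) * x)"
  proof (cases "0 \<le> s x")
    case True
    have "y * (y * s x) = (LBINT r:{y..x}. y * s x)" by (simp add: len)
    also have "\<dots> \<le> (LBINT r:{y..x}. r * s r)"
    proof (rule set_integral_mono[OF ci si])
      fix r assume r: "r \<in> {y..x}"
      have "s x \<le> s r" using r y x R vac by (intro vacuum_stress_decreasing[OF s, of R]) auto
      then show "y * s x \<le> r * s r" using r y True by (intro mult_mono) auto
    qed
    also have "\<dots> \<le> (LBINT r:{y..x}. x * M\<^sup>2 / 2 + \<nu> * (r powr 1 * \<bar>D (r, t)\<bar>))"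
    proof (rule set_integral_mono_AE[OF si])
      show "set_integrable lborel {y..x} (\<lambda>r. x * M\<^sup>2 / 2 + \<nu> * (r powr 1 * \<bar>D (r, t)\<bar>))"
        by (intro set_integral_add(1) ci set_integrable_mult_right Di)
      have "AE r in lborel. r \<in> {0<..<a t} --> stress (r, t) = s r" using s unfolding stress_rep_def by (rule conjunct2)
      then show "AE r\<in>{y..x} in lborel. r * s r \<le> x * M\<^sup>2 / 2 + \<nu> * (r powr 1 * \<bar>D (r, t)\<bar>)"
      proof (rule AE_mp, intro always_eventually allI impI)
        fix r assume e: "r \<in> {0<..<a t} --> stress (r, t) = s r" and r: "r \<in> {y..x}"
        have "s r = stress (r, t)" using e r y by auto
        also have "\<dots> = (B (r, t))\<^sup>2 / 2 - \<nu> * D (r, t)" using vac[of r] r y x by (simp add: stress_def)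
        finally have sr: "r * s r = r * ((B (r, t))\<^sup>2 / 2) - \<nu> * (r * D (r, t))" by (simp only: right_diff_distrib mult.left_commute)
        have "r * ((B (r, t))\<^sup>2 / 2) \<le> x * (M\<^sup>2 / 2)" using Mi[of "(r, t)"] r y by (intro mult_mono) auto
        moreover have "\<nu> * (r * - D (r, t)) \<le> \<nu> * (r * \<bar>D (r, t)\<bar>)" using \<nu> r y by (intro mult_left_mono) auto
        moreover have "r powr 1 = r" using r y by simp
        ultimately show "r * s r \<le> x * M\<^sup>2 / 2 + \<nu> * (r powr 1 * \<bar>D (r, t)\<bar>)" unfolding sr by simp
      qed
    qed
    also have "\<dots> = (LBINT r:{y..x}. x * M\<^sup>2 / 2) + (LBINT r:{y..x}. \<nu> * (r powr 1 * \<bar>D (r, t)\<bar>))"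
      by (rule set_integral_add(2)[OF ci set_integrable_mult_right[OF Di]])
    also have "\<dots> = y * (x * M\<^sup>2 / 2) + \<nu> * (LBINT r:{y..x}. r powr 1 * \<bar>D (r, t)\<bar>)" unfolding len by simp
    also have "\<dots> \<le> y * (x * M\<^sup>2 / 2) + \<nu> * (sqrt (diss t) * x)"
    proof -
      have "(LBINT r:{y..x}. r powr 1 * \<bar>D (r, t)\<bar>) \<le> sqrt (diss t) * x powr 1 / sqrt (2 * 1)"
        by (rule D_weighted[OF t y(1,2,4)]) simp
      also have "\<dots> \<le> sqrt (diss t) * x / 1" using x diss_nonneg[of t] by (intro frac_le) auto
      finally show ?thesis using \<nu> by simp
    qed
    finally show ?thesis by (simp add: mult_ac)
  next
    case False
    then have "y * (y * s x) \<le> 0" using y by (simp add: mult_le_0_iff)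
    moreover have "0 \<le> x * M\<^sup>2 / 2 * y + \<nu> * (sqrt (diss t) * x)" using x y \<nu> diss_nonneg[of t] by simp
    ultimately show ?thesis by linarith
  qed
  then have "x * (s x * x) \<le> x * (M\<^sup>2 * x + 4 * \<nu> * sqrt (diss t))" by (simp add: y_def field_simps)
  then show ?thesis using x by simp
qed

text \<open>The weight \<open>w = r\<^sup>\<alpha> (q - r)\<close> vanishes at \<open>q\<close>, and since \<open>\<alpha> > 1\<close> it beats the growth of the stress at the
  centre. Integration by parts of \<open>s w\<close> with \<open>s\<^sub>r = - B\<^sup>2/r\<close> and \<open>s = B\<^sup>2/2 - \<nu> D\<close> leaves the
  coefficient \<open>w/r - w'/2 \<ge> (1 - \<alpha>/2) q r\<^bsup>\<alpha> - 1\<^esup>\<close> of \<open>B\<^sup>2\<close>. A Cauchy--Schwarz inequality with the weight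
  \<open>r\<^bsup>\<alpha> - 1\<^esup>\<close> passes from \<open>B\<^sup>2\<close> to the flux; it needs \<open>\<alpha> < 2\<close> for \<open>r\<^bsup>1 - \<alpha>\<^esup>\<close> to be integrable.\<close>

lemma vacuum_truncated_inequality:
  assumes t: "dissipative t" and s: "stress_rep t s" and R: "R \<le> a t"
    and vac: "\<And>r. r \<in> {0..R} ==> \<rho> (r, t) = 0 \<and> P (r, t) = 0"
    and xq: "0 < x" "x < q" "q < R" and \<alpha>: "1 < \<alpha>" "\<alpha> < 2"
  shows "(2 - \<alpha>)\<^sup>2 / 2 * (LBINT r:{x..q}. B (r, t))\<^sup>2 \<le>
    q powr (2 - \<alpha>) * ((M\<^sup>2 * x + 4 * \<nu> * sqrt (diss t)) * x powr (\<alpha> - 1))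
    + \<nu> * sqrt (diss t) * q * (\<alpha> / sqrt (2 * \<alpha> - 2) + (\<alpha> + 1) / sqrt (2 * \<alpha>))"
proof -
  define K where "K = \<alpha> / sqrt (2 * \<alpha> - 2) + (\<alpha> + 1) / sqrt (2 * \<alpha>)"
  (* the weight and its derivative *)
  define w w' where "w r = r powr \<alpha> * (q - r)" and "w' r = \<alpha> * q * r powr (\<alpha> - 1) - (\<alpha> + 1) * r powr \<alpha>" for r
  define Y where "Y = (LBINT r:{x..q}. (B (r, t))\<^sup>2 * r powr (\<alpha> - 1))"
  have q: "0 < q" "q < a t" using xq R by auto
  have Bc: "continuous_on S (\<lambda>r. B (r, t))" for S by (intro continuous_on_slice cont)
  have pc: "continuous_on {x..q} (\<lambda>r. r powr e)" for e by (rule powr_continuous[OF xq(1)])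
  have ci: "continuous_on {x..q} f ==> set_integrable lborel {x..q} f" for f :: "real => real"
    unfolding set_integrable_def by (rule borel_integrable_compact[OF compact_Icc])
  have split: "r powr \<alpha> = r * r powr (\<alpha> - 1)" if "0 < r" for r
    using that powr_mult_base[of r "\<alpha> - 1"] by simp
  have wd: "(w has_real_derivative w' r) (at r)" if "0 < r" for r
  proof -
    have "((\<lambda>r. r powr \<alpha>) has_real_derivative \<alpha> * r powr (\<alpha> - 1)) (at r)" by (rule has_real_derivative_powr[OF that])
    moreover have "((\<lambda>r. q - r) has_real_derivative - 1) (at r)" by (auto intro!: derivative_eq_intros)
    ultimately have "((\<lambda>r. r powr \<alpha> * (q - r)) has_real_derivative \<alpha> * r powr (\<alpha> - 1) * (q - r) + (- 1) * r powr \<alpha>) (at r)"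
      by (rule DERIV_mult)
    moreover have "\<alpha> * r powr (\<alpha> - 1) * (q - r) + (- 1) * r powr \<alpha> = w' r"
      unfolding w'_def split[OF that] by (simp add: algebra_simps)
    ultimately show ?thesis unfolding w_def[abs_def] by simp
  qed
  have w'c: "continuous_on {x..q} w'" unfolding w'_def[abs_def] by (intro continuous_intros pc)
  have wc: "continuous_on {x..q} w" unfolding w_def[abs_def] by (intro continuous_intros pc)
  have acs: "ac x q s (\<lambda>r. - force (r, t))" using s xq(1,2) q(2) unfolding stress_rep_def by blast
  have sw: "ac x q (\<lambda>r. s r * w r) (\<lambda>r. - force (r, t) * w r + s r * w' r)"
    by (rule ac_mult[OF acs ac_C1]) (use wd xq w'c in auto)
  have Bw: "(B (r, t))\<^sup>2 * r powr (\<alpha> - 1) * (q * (1 - \<alpha> / 2)) \<le> (B (r, t))\<^sup>2 / r * w r - (B (r, t))\<^sup>2 / 2 * w' r" if "r \<in> {x..q}" for r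
  proof -
    have r: "0 < r" using that xq by simp
    have "(B (r, t))\<^sup>2 / r * w r - (B (r, t))\<^sup>2 / 2 * w' r = (B (r, t))\<^sup>2 * r powr (\<alpha> - 1) * (q * (1 - \<alpha> / 2) + r * ((\<alpha> - 1) / 2))"
      unfolding w_def w'_def split[OF r] using r by (simp add: field_simps)
    moreover have "(B (r, t))\<^sup>2 * r powr (\<alpha> - 1) * (q * (1 - \<alpha> / 2)) \<le> (B (r, t))\<^sup>2 * r powr (\<alpha> - 1) * (q * (1 - \<alpha> / 2) + r * ((\<alpha> - 1) / 2))"
      using r \<alpha> by (intro mult_left_mono) auto
    ultimately show ?thesis by linarith
  qed
  have i1: "set_integrable lborel {x..q} (\<lambda>r. (B (r, t))\<^sup>2 * r powr (\<alpha> - 1))" by (intro ci continuous_intros Bc pc)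
  have i2: "set_integrable lborel {x..q} (\<lambda>r. force (r, t) * w r - s r * w' r)"
    using set_integrable_mult_right[OF ac_integrable[OF sw], of "- 1"] by (simp add: algebra_simps)
  have Di: "set_integrable lborel {x..q} (\<lambda>r. r powr b * \<bar>D (r, t)\<bar>)" for b
    using xq q by (intro D_integrable[OF t]) auto
  have i3: "set_integrable lborel {x..q} (\<lambda>r. \<alpha> * q * (r powr (\<alpha> - 1) * \<bar>D (r, t)\<bar>) + (\<alpha> + 1) * (r powr \<alpha> * \<bar>D (r, t)\<bar>))"
    by (intro set_integral_add(1) set_integrable_mult_right Di)
  have "q * (1 - \<alpha> / 2) * Y = (LBINT r:{x..q}. q * (1 - \<alpha> / 2) * ((B (r, t))\<^sup>2 * r powr (\<alpha> - 1)))"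
    unfolding Y_def by simp
  also have "\<dots> \<le> (LBINT r:{x..q}. (force (r, t) * w r - s r * w' r)
      + \<nu> * (\<alpha> * q * (r powr (\<alpha> - 1) * \<bar>D (r, t)\<bar>) + (\<alpha> + 1) * (r powr \<alpha> * \<bar>D (r, t)\<bar>)))"
  proof (rule set_integral_mono_AE[OF set_integrable_mult_right[OF i1] set_integral_add(1)[OF i2 set_integrable_mult_right[OF i3]]])
    have "AE r in lborel. r \<in> {0<..<a t} --> stress (r, t) = s r" using s unfolding stress_rep_def by (rule conjunct2)
    then show "AE r\<in>{x..q} in lborel. q * (1 - \<alpha> / 2) * ((B (r, t))\<^sup>2 * r powr (\<alpha> - 1)) \<le>
       (force (r, t) * w r - s r * w' r) + \<nu> * (\<alpha> * q * (r powr (\<alpha> - 1) * \<bar>D (r, t)\<bar>) + (\<alpha> + 1) * (r powr \<alpha> * \<bar>D (r, t)\<bar>))"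
    proof (rule AE_mp, intro always_eventually allI impI)
      fix r assume e: "r \<in> {0<..<a t} --> stress (r, t) = s r" and r: "r \<in> {x..q}"
      have v: "\<rho> (r, t) = 0" "P (r, t) = 0" using vac[of r] r xq by auto
      have f: "force (r, t) = (B (r, t))\<^sup>2 / r" using v by (simp add: force_def)
      have "s r = stress (r, t)" using e r xq q by auto
      then have sr: "s r = (B (r, t))\<^sup>2 / 2 - \<nu> * D (r, t)" using v by (simp add: stress_def)
      have w': "\<bar>w' r\<bar> \<le> \<alpha> * q * r powr (\<alpha> - 1) + (\<alpha> + 1) * r powr \<alpha>"
        unfolding w'_def by (rule order_trans[OF abs_triangle_ineq4]) (use \<alpha> q r xq in \<open>simp add: abs_mult\<close>)
      have "- (D (r, t) * w' r) \<le> \<bar>D (r, t)\<bar> * \<bar>w' r\<bar>" by (metis abs_ge_minus_self abs_mult)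
      also have "\<dots> \<le> \<bar>D (r, t)\<bar> * (\<alpha> * q * r powr (\<alpha> - 1) + (\<alpha> + 1) * r powr \<alpha>)" by (rule mult_left_mono[OF w']) simp
      also have "\<dots> = \<alpha> * q * (r powr (\<alpha> - 1) * \<bar>D (r, t)\<bar>) + (\<alpha> + 1) * (r powr \<alpha> * \<bar>D (r, t)\<bar>)" by (simp add: algebra_simps)
      finally have "\<nu> * - (D (r, t) * w' r) \<le> \<nu> * (\<alpha> * q * (r powr (\<alpha> - 1) * \<bar>D (r, t)\<bar>) + (\<alpha> + 1) * (r powr \<alpha> * \<bar>D (r, t)\<bar>))"
        using \<nu> by (intro mult_left_mono) auto
      moreover have "s r * w' r = (B (r, t))\<^sup>2 / 2 * w' r + \<nu> * - (D (r, t) * w' r)" unfolding sr by (simp add: algebra_simps)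
      moreover have "q * (1 - \<alpha> / 2) * ((B (r, t))\<^sup>2 * r powr (\<alpha> - 1)) = (B (r, t))\<^sup>2 * r powr (\<alpha> - 1) * (q * (1 - \<alpha> / 2))" by (simp only: mult_ac)
      ultimately show "q * (1 - \<alpha> / 2) * ((B (r, t))\<^sup>2 * r powr (\<alpha> - 1)) \<le>
         (force (r, t) * w r - s r * w' r) + \<nu> * (\<alpha> * q * (r powr (\<alpha> - 1) * \<bar>D (r, t)\<bar>) + (\<alpha> + 1) * (r powr \<alpha> * \<bar>D (r, t)\<bar>))"
        using Bw[OF r] unfolding f by linarith
    qed
  qed
  also have "\<dots> = (LBINT r:{x..q}. force (r, t) * w r - s r * w' r)
      + \<nu> * (LBINT r:{x..q}. \<alpha> * q * (r powr (\<alpha> - 1) * \<bar>D (r, t)\<bar>) + (\<alpha> + 1) * (r powr \<alpha> * \<bar>D (r, t)\<bar>))"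
    by (subst set_integral_add(2)[OF i2 set_integrable_mult_right[OF i3]]) simp
  also have "(LBINT r:{x..q}. force (r, t) * w r - s r * w' r) = s x * w x"
  proof -
    have "s q * w q - s x * w x = (LBINT r:{x..q}. - force (r, t) * w r + s r * w' r)" using ac_diff[OF sw, of x q] xq by simp
    also have "\<dots> = (LBINT r:{x..q}. - (force (r, t) * w r - s r * w' r))" by (simp add: algebra_simps)
    also have "\<dots> = - (LBINT r:{x..q}. force (r, t) * w r - s r * w' r)" unfolding set_lebesgue_integral_def scaleR_minus_right by (rule integral_minus)
    finally show ?thesis by (simp add: w_def)
  qed
  also have "(LBINT r:{x..q}. \<alpha> * q * (r powr (\<alpha> - 1) * \<bar>D (r, t)\<bar>) + (\<alpha> + 1) * (r powr \<alpha> * \<bar>D (r, t)\<bar>))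
      = \<alpha> * q * (LBINT r:{x..q}. r powr (\<alpha> - 1) * \<bar>D (r, t)\<bar>) + (\<alpha> + 1) * (LBINT r:{x..q}. r powr \<alpha> * \<bar>D (r, t)\<bar>)"
    by (subst set_integral_add(2)[OF set_integrable_mult_right[OF Di] set_integrable_mult_right[OF Di]]) simp
  finally have main: "q * (1 - \<alpha> / 2) * Y \<le> s x * w x + \<nu> * (\<alpha> * q * (LBINT r:{x..q}. r powr (\<alpha> - 1) * \<bar>D (r, t)\<bar>)
      + (\<alpha> + 1) * (LBINT r:{x..q}. r powr \<alpha> * \<bar>D (r, t)\<bar>))" .
  have "\<alpha> * q * (LBINT r:{x..q}. r powr (\<alpha> - 1) * \<bar>D (r, t)\<bar>) \<le> \<alpha> * q * (sqrt (diss t) * q powr (\<alpha> - 1) / sqrt (2 * (\<alpha> - 1)))"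
    using xq q \<alpha> by (intro mult_left_mono D_weighted[OF t]) auto
  moreover have "(\<alpha> + 1) * (LBINT r:{x..q}. r powr \<alpha> * \<bar>D (r, t)\<bar>) \<le> (\<alpha> + 1) * (sqrt (diss t) * q powr \<alpha> / sqrt (2 * \<alpha>))"
    using xq q \<alpha> by (intro mult_left_mono D_weighted[OF t]) auto
  moreover have "\<alpha> * q * (sqrt (diss t) * q powr (\<alpha> - 1) / sqrt (2 * (\<alpha> - 1))) + (\<alpha> + 1) * (sqrt (diss t) * q powr \<alpha> / sqrt (2 * \<alpha>))
      = sqrt (diss t) * q powr \<alpha> * K"
    unfolding split[OF q(1)] K_def by (simp add: algebra_simps)
  ultimately have "\<alpha> * q * (LBINT r:{x..q}. r powr (\<alpha> - 1) * \<bar>D (r, t)\<bar>) + (\<alpha> + 1) * (LBINT r:{x..q}. r powr \<alpha> * \<bar>D (r, t)\<bar>)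
      \<le> sqrt (diss t) * q powr \<alpha> * K" by linarith
  then have "\<nu> * (\<alpha> * q * (LBINT r:{x..q}. r powr (\<alpha> - 1) * \<bar>D (r, t)\<bar>) + (\<alpha> + 1) * (LBINT r:{x..q}. r powr \<alpha> * \<bar>D (r, t)\<bar>))
      \<le> \<nu> * (sqrt (diss t) * q powr \<alpha> * K)" using \<nu> by (intro mult_left_mono) auto
  moreover have "s x * w x \<le> (M\<^sup>2 * x + 4 * \<nu> * sqrt (diss t)) * x powr (\<alpha> - 1) * q"
  proof -
    have S: "0 \<le> M\<^sup>2 * x + 4 * \<nu> * sqrt (diss t)" using xq \<nu> diss_nonneg[of t] by simp
    have "s x * w x = s x * x * (x powr (\<alpha> - 1) * (q - x))" unfolding w_def split[OF xq(1)] by (simp only: mult_ac)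
    also have "\<dots> \<le> (M\<^sup>2 * x + 4 * \<nu> * sqrt (diss t)) * (x powr (\<alpha> - 1) * (q - x))"
      using xq by (intro mult_right_mono vacuum_stress_bound[OF t s R vac]) auto
    also have "\<dots> \<le> (M\<^sup>2 * x + 4 * \<nu> * sqrt (diss t)) * (x powr (\<alpha> - 1) * q)"
      using xq S by (intro mult_left_mono) auto
    finally show ?thesis by (simp only: mult_ac)
  qed
  ultimately have Y: "q * (1 - \<alpha> / 2) * Y \<le> (M\<^sup>2 * x + 4 * \<nu> * sqrt (diss t)) * x powr (\<alpha> - 1) * q + \<nu> * (sqrt (diss t) * q powr \<alpha> * K)"
    using main by linarith
  have Y': "(1 - \<alpha> / 2) * Y \<le> (M\<^sup>2 * x + 4 * \<nu> * sqrt (diss t)) * x powr (\<alpha> - 1) + \<nu> * (sqrt (diss t) * q powr (\<alpha> - 1) * K)"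
  proof -
    have "q * ((1 - \<alpha> / 2) * Y) \<le> q * ((M\<^sup>2 * x + 4 * \<nu> * sqrt (diss t)) * x powr (\<alpha> - 1) + \<nu> * (sqrt (diss t) * q powr (\<alpha> - 1) * K))"
      using Y unfolding split[OF q(1)] by (simp add: algebra_simps)
    then show ?thesis using q by simp
  qed
  have cs: "(LBINT r:{x..q}. B (r, t))\<^sup>2 \<le> Y * (q powr (2 - \<alpha>) / (2 - \<alpha>))"
  proof -
    (* the two factors of B *)
    define f g where "f r = B (r, t) * r powr ((\<alpha> - 1) / 2)" and "g r = r powr ((1 - \<alpha>) / 2)" for r
    have fg: "f r * g r = B (r, t)" "(f r)\<^sup>2 = (B (r, t))\<^sup>2 * r powr (\<alpha> - 1)" "(g r)\<^sup>2 = r powr (1 - \<alpha>)" if "r \<in> {x..q}" for r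
    proof -
      have r: "0 < r" using that xq by simp
      have "r powr ((\<alpha> - 1) / 2) * r powr ((1 - \<alpha>) / 2) = 1"
        using r powr_add[of r "(\<alpha> - 1) / 2" "(1 - \<alpha>) / 2"] by (simp add: add_divide_distrib[symmetric])
      then show "f r * g r = B (r, t)" by (simp add: f_def g_def mult.assoc)
      show "(f r)\<^sup>2 = (B (r, t))\<^sup>2 * r powr (\<alpha> - 1)" "(g r)\<^sup>2 = r powr (1 - \<alpha>)"
        by (simp_all add: f_def g_def power2_eq_square powr_add[symmetric] mult_ac)
    qed
    have fc: "continuous_on {x..q} f" "continuous_on {x..q} g"
      unfolding f_def[abs_def] g_def[abs_def] by (intro continuous_intros Bc pc)+
    have eq: "(LBINT r:{x..q}. B (r, t)) = (LBINT r:{x..q}. f r * g r)" by (intro set_lebesgue_integral_cong) (auto simp: fg)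
    have csi: "(LBINT r:{x..q}. f r * g r)\<^sup>2 \<le> (LBINT r:{x..q}. (f r)\<^sup>2) * (LBINT r:{x..q}. (g r)\<^sup>2)"
      by (intro set_integral_Cauchy_Schwarz ci continuous_on_power continuous_on_mult fc)
    have fY: "(LBINT r:{x..q}. (f r)\<^sup>2) = Y" unfolding Y_def by (intro set_lebesgue_integral_cong) (auto simp: fg)
    have gq: "(LBINT r:{x..q}. (g r)\<^sup>2) \<le> q powr (2 - \<alpha>) / (2 - \<alpha>)"
    proof -
      have "(LBINT r:{x..q}. (g r)\<^sup>2) = (LBINT r:{x..q}. r powr (1 - \<alpha>))" by (intro set_lebesgue_integral_cong) (auto simp: fg)
      also have "\<dots> \<le> q powr (1 - \<alpha> + 1) / (1 - \<alpha> + 1)" using xq \<alpha> by (intro powr_integral_le) auto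
      finally show ?thesis by simp
    qed
    have Y0: "0 \<le> Y" unfolding Y_def set_lebesgue_integral_def by (intro integral_nonneg_AE always_eventually allI) simp
    show ?thesis using order_trans[OF csi[unfolded fY] mult_left_mono[OF gq Y0]] unfolding eq .
  qed
  have "(2 - \<alpha>)\<^sup>2 / 2 * (LBINT r:{x..q}. B (r, t))\<^sup>2 \<le> (2 - \<alpha>)\<^sup>2 / 2 * (Y * (q powr (2 - \<alpha>) / (2 - \<alpha>)))"
    by (intro mult_left_mono cs) simp
  also have "\<dots> = q powr (2 - \<alpha>) * ((1 - \<alpha> / 2) * Y)" using \<alpha> by (simp add: field_simps power2_eq_square)
  also have "\<dots> \<le> q powr (2 - \<alpha>) * ((M\<^sup>2 * x + 4 * \<nu> * sqrt (diss t)) * x powr (\<alpha> - 1) + \<nu> * (sqrt (diss t) * q powr (\<alpha> - 1) * K))"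
    by (intro mult_left_mono Y') simp
  also have "\<dots> = q powr (2 - \<alpha>) * ((M\<^sup>2 * x + 4 * \<nu> * sqrt (diss t)) * x powr (\<alpha> - 1)) + \<nu> * sqrt (diss t) * (q powr (2 - \<alpha>) * q powr (\<alpha> - 1)) * K"
    by (simp add: algebra_simps)
  also have "q powr (2 - \<alpha>) * q powr (\<alpha> - 1) = q" using q powr_add[of q "2 - \<alpha>" "\<alpha> - 1"] by simp
  finally show ?thesis unfolding K_def .
qed

text \<open>First \<open>x\<close> tends to \<open>0\<close>, then \<open>q\<close> to \<open>R\<close>.\<close>

lemma vacuum_inequality:
  assumes t: "dissipative t" and R: "0 < R" "R \<le> a t"
    and vac: "\<And>r. r \<in> {0..R} ==> \<rho> (r, t) = 0 \<and> P (r, t) = 0" and \<alpha>: "1 < \<alpha>" "\<alpha> < 2"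
  shows "(2 - \<alpha>)\<^sup>2 / 2 * (LBINT r:{0..R}. B (r, t))\<^sup>2 \<le>
    \<nu> * sqrt (diss t) * R * (\<alpha> / sqrt (2 * \<alpha> - 2) + (\<alpha> + 1) / sqrt (2 * \<alpha>))"
proof -
  define K where "K = \<alpha> / sqrt (2 * \<alpha> - 2) + (\<alpha> + 1) / sqrt (2 * \<alpha>)"
  have K: "0 \<le> K" using \<alpha> by (auto simp: K_def)
  obtain s where s: "stress_rep t s" using stress_rep_exists t unfolding dissipative_def by blast
  have Bi: "set_integrable lborel {0..R} (\<lambda>r. B (r, t))"
    unfolding set_integrable_def by (intro borel_integrable_compact compact_Icc continuous_on_slice cont)
  define G where "G x = 0 + (LBINT r:{0..x}. B (r, t))" for x
  have G: "ac 0 R G (\<lambda>r. B (r, t))" unfolding G_def[abs_def] by (rule ac_primitive[OF Bi])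
  have Gc: "continuous_on {0..R} G" by (rule ac_continuous[OF G])
  have G0: "G 0 = 0"
  proof -
    have "AE r in lborel. indicator {0..0} r *\<^sub>R B (r, t) = 0"
      using AE_lborel_singleton[of 0] by eventually_elim (auto simp: indicator_def)
    then have "(LBINT r:{0..0}. B (r, t)) = 0" unfolding set_lebesgue_integral_def by (rule integral_eq_zero_AE)
    then show ?thesis by (simp add: G_def)
  qed
  have inner: "(2 - \<alpha>)\<^sup>2 / 2 * (G q)\<^sup>2 \<le> \<nu> * sqrt (diss t) * R * K" if q: "0 < q" "q < R" for q
  proof -
    have "(2 - \<alpha>)\<^sup>2 / 2 * (G q)\<^sup>2 \<le> \<nu> * sqrt (diss t) * q * K"
    proof (rule tendsto_le)
      show "at_right (0::real) \<noteq> bot" by simp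
      have "(G \<longlongrightarrow> G 0) (at 0 within {0..R})" using Gc R by (auto simp: continuous_on_def)
      then have "(G \<longlongrightarrow> 0) (at_right 0)" unfolding G0 using R(1) by (simp add: at_within_Icc_at_right)
      then have "((\<lambda>x. (2 - \<alpha>)\<^sup>2 / 2 * (G q - G x)\<^sup>2) \<longlongrightarrow> (2 - \<alpha>)\<^sup>2 / 2 * (G q - 0)\<^sup>2) (at_right 0)"
        by (intro tendsto_intros)
      then show "((\<lambda>x. (2 - \<alpha>)\<^sup>2 / 2 * (G q - G x)\<^sup>2) \<longlongrightarrow> (2 - \<alpha>)\<^sup>2 / 2 * (G q)\<^sup>2) (at_right 0)" by simp
      have p: "((\<lambda>x::real. x powr (\<alpha> - 1)) \<longlongrightarrow> 0) (at_right 0)"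
      proof (rule tendsto_zero_powrI[where b = "\<alpha> - 1"])
        show "eventually (\<lambda>x::real. 0 \<le> x) (at_right 0)" by (auto simp: eventually_at_filter)
      qed (use \<alpha> in \<open>auto intro: tendsto_ident_at\<close>)
      have "((\<lambda>x. q powr (2 - \<alpha>) * ((M\<^sup>2 * x + 4 * \<nu> * sqrt (diss t)) * x powr (\<alpha> - 1)) + \<nu> * sqrt (diss t) * q * K) \<longlongrightarrow>
        q powr (2 - \<alpha>) * ((M\<^sup>2 * 0 + 4 * \<nu> * sqrt (diss t)) * 0) + \<nu> * sqrt (diss t) * q * K) (at_right 0)"
        by (intro tendsto_add tendsto_mult tendsto_const tendsto_ident_at p)
      then show "((\<lambda>x. q powr (2 - \<alpha>) * ((M\<^sup>2 * x + 4 * \<nu> * sqrt (diss t)) * x powr (\<alpha> - 1)) + \<nu> * sqrt (diss t) * q * K) \<longlongrightarrow>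
        \<nu> * sqrt (diss t) * q * K) (at_right 0)" by simp
      show "\<forall>\<^sub>F x in at_right 0. (2 - \<alpha>)\<^sup>2 / 2 * (G q - G x)\<^sup>2 \<le>
        q powr (2 - \<alpha>) * ((M\<^sup>2 * x + 4 * \<nu> * sqrt (diss t)) * x powr (\<alpha> - 1)) + \<nu> * sqrt (diss t) * q * K"
        using eventually_at_right_less[of 0] eventually_at_right_real[OF q(1)]
      proof eventually_elim
        case (elim x)
        then have x: "0 < x" "x < q" by auto
        have "G q - G x = (LBINT r:{x..q}. B (r, t))" using ac_diff[OF G, of x q] x q by simp
        then show ?case using vacuum_truncated_inequality[OF t s R(2) vac x q(2) \<alpha>] by (simp add: K_def)
      qed
    qed
    also have "\<dots> \<le> \<nu> * sqrt (diss t) * R * K"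
      using q \<nu> K diss_nonneg[of t] by (intro mult_right_mono mult_left_mono) auto
    finally show ?thesis .
  qed
  have "closed ({0..R} \<inter> (\<lambda>q. (2 - \<alpha>)\<^sup>2 / 2 * (G q)\<^sup>2) -` {..\<nu> * sqrt (diss t) * R * K})"
    by (rule continuous_closed_preimage) (auto intro!: continuous_intros Gc)
  moreover have "{0<..<R} \<subseteq> {0..R} \<inter> (\<lambda>q. (2 - \<alpha>)\<^sup>2 / 2 * (G q)\<^sup>2) -` {..\<nu> * sqrt (diss t) * R * K}" using inner by auto
  ultimately have "closure {0<..<R} \<subseteq> {0..R} \<inter> (\<lambda>q. (2 - \<alpha>)\<^sup>2 / 2 * (G q)\<^sup>2) -` {..\<nu> * sqrt (diss t) * R * K}" by (rule closure_minimal[rotated])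
  moreover have "R \<in> closure {0<..<R}" using R by simp
  ultimately have "(2 - \<alpha>)\<^sup>2 / 2 * (G R)\<^sup>2 \<le> \<nu> * sqrt (diss t) * R * K" by blast
  then show ?thesis by (simp add: G_def K_def)
qed

end

section \<open>The time of existence\<close>

context mhd_flow
begin

lemma sqrt_diss_integrable: "set_integrable lborel {x..y} (\<lambda>t. sqrt (diss t))"
  unfolding set_integrable_def
proof (rule Bochner_Integration.integrable_bound)
  have "integrable lborel (indicat_real {x..y})" by (simp add: integrable_indicator_iff emeasure_lborel_Icc_eq)
  then show "integrable lborel (\<lambda>t. indicat_real {x..y} t + diss t)"
    by (rule Bochner_Integration.integrable_add[OF _ diss_integrable])
  have "diss \<in> borel_measurable lborel" using diss_integrable by simp
  then show "(\<lambda>t. indicat_real {x..y} t *\<^sub>R sqrt (diss t)) \<in> borel_measurable lborel" by measurable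
  show "AE t in lborel. norm (indicat_real {x..y} t *\<^sub>R sqrt (diss t)) \<le> norm (indicat_real {x..y} t + diss t)"
  proof (intro always_eventually allI)
    fix t
    have "0 \<le> (sqrt (diss t) - 1)\<^sup>2" by simp
    then have "2 * sqrt (diss t) \<le> 1 + diss t" using diss_nonneg[of t] by (simp add: power2_diff)
    moreover have "0 \<le> sqrt (diss t)" using diss_nonneg[of t] by simp
    ultimately show "norm (indicat_real {x..y} t *\<^sub>R sqrt (diss t)) \<le> norm (indicat_real {x..y} t + diss t)"
      using diss_nonneg[of t] by (auto simp: indicator_def)
  qed
qed

text \<open>The displacement is at most the time integral of the square root of the dissipation rate, to which
  Cauchy--Schwarz in time applies.\<close>

lemma trajectory_growth:
  assumes R: "trajectory T R" and t: "t \<in> {0..T}"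
  shows "(R t)\<^sup>2 \<le> ((a 0)\<^sup>2 + 2 * energy 0 / \<nu>) * (1 + t)"
proof -
  define Y where "Y = 2 * energy 0 / \<nu>"
  have Y: "0 \<le> Y" using \<nu> energy_nonneg[of 0] T by (simp add: Y_def)
  obtain R' where R': "\<And>t. (R has_real_derivative R' t) (at t)" "continuous_on UNIV R'"
    "\<And>t. t \<in> {0..T} ==> 0 \<le> R t \<and> R t \<le> a t \<and> R' t = u (R t, t)"
    using R unfolding trajectory_def by blast
  have ac: "ac 0 t R R'" using R' by (intro ac_C1) (auto intro: continuous_on_subset)
  have "R t - R 0 = (LBINT s:{0..t}. R' s)" using ac_diff[OF ac, of 0 t] t by simp
  also have "\<dots> \<le> (LBINT s:{0..t}. sqrt (diss s))"
  proof (rule set_integral_mono_AE[OF ac_integrable[OF ac] sqrt_diss_integrable])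
    show "AE s\<in>{0..t} in lborel. R' s \<le> sqrt (diss s)"
      using AE_dissipative AE_lborel_singleton[of 0] AE_lborel_singleton[of T]
    proof eventually_elim
      case (elim s)
      show ?case
      proof
        assume s: "s \<in> {0..t}"
        then have sT: "s \<in> {0..T}" "s \<in> {0<..<T}" using t elim by auto
        have "R' s \<le> \<bar>u (R s, s)\<bar>" using R'(3)[OF sT(1)] by simp
        also have "\<dots> \<le> sqrt (diss s)" using velocity_le_diss[of s "R s"] elim(1) sT R'(3)[OF sT(1)] by simp
        finally show "R' s \<le> sqrt (diss s)" .
      qed
    qed
  qed
  also have "\<dots> \<le> sqrt (t * Y)"
  proof (rule real_le_rsqrt)
    have c: "set_integrable lborel {0..t} (\<lambda>s. (1::real)\<^sup>2)" by (rule set_integrable_const_Icc)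
    have sq: "(sqrt (diss s))\<^sup>2 = diss s" for s using diss_nonneg[of s] by simp
    have d: "set_integrable lborel {0..t} diss" unfolding set_integrable_def using integrable_mult_indicator[OF _ diss_integrable] by simp
    have "(LBINT s:{0..t}. 1 * sqrt (diss s))\<^sup>2 \<le> (LBINT s:{0..t}. 1\<^sup>2) * (LBINT s:{0..t}. (sqrt (diss s))\<^sup>2)"
      by (rule set_integral_Cauchy_Schwarz[OF c]) (use d sqrt_diss_integrable sq in simp_all)
    also have "(LBINT s:{0..t}. (1::real)\<^sup>2) = t" using t by (simp add: set_integral_const measure_lborel_Icc)
    also have "(LBINT s:{0..t}. (sqrt (diss s))\<^sup>2) \<le> Y"
    proof -
      have "(LBINT s:{0..t}. diss s) \<le> (LBINT s. diss s)"
        unfolding set_lebesgue_integral_def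
        by (rule integral_mono[OF d[unfolded set_integrable_def] diss_integrable]) (use diss_nonneg in \<open>auto simp: indicator_def\<close>)
      also have "\<dots> \<le> Y" using diss_integral \<nu> by (simp add: Y_def field_simps)
      finally show ?thesis unfolding sq .
    qed
    finally show "(LBINT s:{0..t}. sqrt (diss s))\<^sup>2 \<le> t * Y" using t by (simp add: mult_left_mono)
  qed
  finally have le: "R t \<le> a 0 + sqrt (t * Y)" using R'(3)[of 0] T by simp
  have tY: "0 \<le> t * Y" using t Y by simp
  have "(R t)\<^sup>2 \<le> (a 0 + sqrt t * sqrt Y)\<^sup>2" using le R'(3)[OF t] by (intro power_mono) (auto simp: real_sqrt_mult)
  also have "\<dots> = (a 0)\<^sup>2 + t * Y + 2 * ((a 0 * sqrt t) * sqrt Y)"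
    using t Y by (simp add: power2_sum power_mult_distrib mult_ac)
  also have "\<dots> \<le> (a 0)\<^sup>2 + t * Y + ((a 0 * sqrt t)\<^sup>2 + (sqrt Y)\<^sup>2)"
    using sum_squares_bound[of "a 0 * sqrt t" "sqrt Y"] by simp
  also have "\<dots> = ((a 0)\<^sup>2 + Y) * (1 + t)" using t Y by (simp add: power_mult_distrib algebra_simps)
  finally show ?thesis unfolding Y_def .
qed

text \<open>A trajectory enclosing a nonzero flux cannot reach the centre, so the vacuum inequality holds at
  almost every time, with \<open>R(t)\<^sup>2\<close> replaced by its bound. The constant \<open>Z\<close> collects what remains.\<close>

theorem existence_time_bound:
  assumes r0: "0 < r0" "r0 < a 0" and vac: "\<And>r. r \<in> {0..r0} ==> \<rho> (r, 0) = 0 \<and> P (r, 0) = 0"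
    and flux: "I = (LBINT r:{0..r0}. B (r, 0))" "I \<noteq> 0"
    and \<alpha>: "1 < \<alpha>" "\<alpha> < 2" and C: "0 < C" "2 * ((a 0)\<^sup>2 + 2 * energy 0 / \<nu>) \<le> C\<^sup>2"
  shows "T \<le> exp (energy 0 * (I\<^sup>2 * (2 - \<alpha>)\<^sup>2 /
    (2 * sqrt \<nu> * C * (\<alpha> / sqrt (2 * \<alpha> - 2) + (\<alpha> + 1) / sqrt (2 * \<alpha>)))) powi (- 2)) - 1"
proof -
  define K where "K = \<alpha> / sqrt (2 * \<alpha> - 2) + (\<alpha> + 1) / sqrt (2 * \<alpha>)"
  define V where "V = (2 - \<alpha>)\<^sup>2 * I\<^sup>2"
  define N where "N = (a 0)\<^sup>2 + 2 * energy 0 / \<nu>"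
  define Z where "Z = (V / 2)\<^sup>2 / (\<nu>\<^sup>2 * N * K\<^sup>2)"
  have E: "0 \<le> energy 0" using energy_nonneg[of 0] T by simp
  have K: "0 < K" unfolding K_def using \<alpha> by (intro add_pos_pos) auto
  have V: "0 < V" using \<alpha> flux by (simp add: V_def)
  have N: "0 < N" unfolding N_def using r0 E \<nu> by (intro add_pos_nonneg) auto
  have Z: "0 < Z" using V N K \<nu> by (simp add: Z_def)
  obtain R where R: "trajectory T R" "R 0 = r0" using forward_trajectory[of r0] r0 by auto
  have lower: "Z / (1 + t) \<le> diss t" if t: "t \<in> {0<..<T}" and d: "dissipative t" for t
  proof -
    have tT: "t \<in> {0..T}" "0 < t" "t \<le> T" using t by auto
    have Rt: "trajectory t R" using R(1) tT by (auto intro: trajectory_subset)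
    have fl: "(LBINT r:{0..R t}. B (r, t)) = I" using flux_conserved[OF Rt] tT R(2) flux(1) by simp
    have Ra: "0 \<le> R t" "R t \<le> a t" using trajectory_range[OF R(1) tT(1)] by auto
    have "R t \<noteq> 0"
    proof
      assume "R t = 0"
      have "AE r in lborel. indicator {0..0} r *\<^sub>R B (r, t) = 0"
        using AE_lborel_singleton[of 0] by eventually_elim (auto simp: indicator_def)
      then have "(LBINT r:{0..0}. B (r, t)) = 0" unfolding set_lebesgue_integral_def by (rule integral_eq_zero_AE)
      then show False using fl flux(2) \<open>R t = 0\<close> by simp
    qed
    then have Rp: "0 < R t" using Ra by simp
    have "\<rho> (r, t) = 0 \<and> P (r, t) = 0" if r: "r \<in> {0..R t}" for r
      using sign_transported_vacuum[OF density_transported nonneg_fields(1)[OF tT(1)] Rt _ tT(2,3) r Rp]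
        sign_transported_vacuum[OF pressure_transported nonneg_fields(2)[OF tT(1)] Rt _ tT(2,3) r Rp] vac R(2) by simp
    from vacuum_inequality[OF d Rp Ra(2) this \<alpha>]
    have "V / 2 \<le> \<nu> * sqrt (diss t) * R t * K" unfolding fl K_def V_def by simp
    then have "(V / 2)\<^sup>2 \<le> (\<nu> * sqrt (diss t) * R t * K)\<^sup>2" using V by (intro power_mono) auto
    also have "\<dots> = \<nu>\<^sup>2 * K\<^sup>2 * diss t * (R t)\<^sup>2" using diss_nonneg[of t] by (simp add: power_mult_distrib)
    also have "\<dots> \<le> \<nu>\<^sup>2 * K\<^sup>2 * diss t * (N * (1 + t))"
      using trajectory_growth[OF R(1) tT(1)] diss_nonneg[of t] unfolding N_def by (intro mult_left_mono) auto
    finally have "(V / 2)\<^sup>2 \<le> (\<nu>\<^sup>2 * N * K\<^sup>2) * (diss t * (1 + t))" by (simp only: mult_ac)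
    then have "Z \<le> diss t * (1 + t)" unfolding Z_def using \<nu> N K by (simp add: pos_divide_le_eq mult_ac)
    then show ?thesis using tT by (simp add: pos_divide_le_eq)
  qed
  have "ac 0 T (\<lambda>t. Z * ln (1 + t)) (\<lambda>t. Z / (1 + t))"
    by (rule ac_C1) (auto intro!: derivative_eq_intros continuous_intros)
  note acZ = this
  have "Z * ln (1 + T) = (LBINT t:{0..T}. Z / (1 + t))" using ac_diff[OF acZ, of 0 T] T by simp
  also have "\<dots> \<le> (LBINT t. diss t)"
    unfolding set_lebesgue_integral_def
  proof (rule integral_mono_AE[OF ac_integrable[OF acZ, unfolded set_integrable_def] diss_integrable])
    show "AE t in lborel. indicat_real {0..T} t *\<^sub>R (Z / (1 + t)) \<le> diss t"
      using AE_dissipative AE_lborel_singleton[of 0] AE_lborel_singleton[of T]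
    proof eventually_elim
      case (elim t)
      show ?case
      proof (cases "t \<in> {0..T}")
        case True
        then have "t \<in> {0<..<T}" using elim by auto
        then show ?thesis using lower[of t] elim(1) True by simp
      qed (use diss_nonneg in simp)
    qed
  qed
  also have "\<dots> \<le> 2 * energy 0 / \<nu>" using diss_integral \<nu> by (simp add: field_simps)
  finally have "ln (1 + T) \<le> 2 * energy 0 / \<nu> / Z" using Z by (simp add: pos_le_divide_eq mult.commute del: divide_divide_eq_left)
  also have "\<dots> = energy 0 * (4 * \<nu> * (2 * N) * K\<^sup>2 / V\<^sup>2)"
    unfolding Z_def using \<nu> V N K by (simp add: field_simps power2_eq_square)
  also have "\<dots> \<le> energy 0 * (4 * \<nu> * C\<^sup>2 * K\<^sup>2 / V\<^sup>2)"
    using E \<nu> C(2) by (intro mult_left_mono divide_right_mono mult_right_mono) (auto simp: N_def)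
  also have "4 * \<nu> * C\<^sup>2 * K\<^sup>2 / V\<^sup>2 = (I\<^sup>2 * (2 - \<alpha>)\<^sup>2 / (2 * sqrt \<nu> * C * K)) powi (- 2)"
    using \<nu> by (simp add: V_def power_int_minus power_divide power_mult_distrib mult_ac)
  finally have "exp (ln (1 + T)) \<le> exp (energy 0 * (I\<^sup>2 * (2 - \<alpha>)\<^sup>2 / (2 * sqrt \<nu> * C * K)) powi (- 2))" by simp
  then show ?thesis unfolding K_def using T by simp
qed

end

section \<open>Weak derivatives with Borel representatives\<close>

text \<open>An exhaustion by compact sets, on each of which the function is integrable.\<close>

lemma locally_integrable_measurable:
  fixes g :: "'a::euclidean_space => real"
  assumes "open U" and g: "locally_integrable U g"
  shows "(\<lambda>z. indicator U z * g z) \<in> borel_measurable lebesgue"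
proof -
  obtain C :: "nat => 'a set" where C: "\<And>n. compact (C n)" "\<And>n. C n \<subseteq> U"
    "\<And>K. compact K ==> K \<subseteq> U ==> \<exists>N. \<forall>n\<ge>N. K \<subseteq> C n"
  proof (rule open_Union_compact_subsets[OF assms(1)])
    fix C :: "nat => 'a set"
    assume "\<And>n. compact (C n)" "\<And>n. C n \<subseteq> U" "\<And>K. compact K ==> K \<subseteq> U ==> \<exists>N. \<forall>n\<ge>N. K \<subseteq> C n"
    then show thesis by (rule that)
  qed
  show ?thesis
  proof (rule borel_measurable_LIMSEQ_real)
    fix z :: 'a
    show "(\<lambda>n. indicator (C n) z * g z) \<longlonglongrightarrow> indicator U z * g z"
    proof (cases "z \<in> U")
      case True
      then obtain N where N: "\<forall>n\<ge>N. {z} \<subseteq> C n" using C(3)[of "{z}"] by auto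
      show ?thesis
        by (rule tendsto_eventually) (use N True in \<open>auto simp: eventually_sequentially intro!: exI[of _ N]\<close>)
    next
      case False
      then have "indicator (C n) z * g z = indicator U z * g z" for n using C(2)[of n] by (auto simp: indicator_def)
      then show ?thesis by (simp only: tendsto_const)
    qed
    show "(\<lambda>z. indicator (C n) z * g z) \<in> borel_measurable lebesgue" for n
      using g C(1,2)[of n] unfolding locally_integrable_def set_integrable_def by auto
  qed
qed

lemma borel_version_exists:
  fixes g :: "'a::euclidean_space => real"
  assumes "open U" "locally_integrable U g"
  shows "\<exists>g'. g' \<in> borel_measurable borel \<and> (AE z in lborel. z \<in> U --> g z = g' z)"
proof -
  obtain g' where "g' \<in> borel_measurable lborel" and e: "AE z in lborel. indicator U z * g z = g' z"
    using completion_ex_borel_measurable_real[OF locally_integrable_measurable[OF assms]] by blast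
  moreover have "AE z in lborel. z \<in> U --> g z = g' z" using e by (rule AE_mp) (intro always_eventually allI impI, simp)
  ultimately show ?thesis by auto
qed

lemma locally_integrable_loc_int:
  assumes "locally_integrable Q g" and g': "g' \<in> borel_measurable borel" "AE z in lborel. z \<in> Q --> g z = g' z"
  shows "loc_int Q g'"
  unfolding loc_int_def
proof (intro conjI allI impI g')
  fix K assume K: "compact K" "K \<subseteq> Q"
  then have [measurable]: "K \<in> sets borel" by (auto intro: borel_closed compact_imp_closed)
  have i: "integrable lebesgue (\<lambda>z. indicator K z *\<^sub>R g z)"
    using assms(1) K unfolding locally_integrable_def set_integrable_def by blast
  have m: "(\<lambda>z. indicator K z *\<^sub>R g' z) \<in> borel_measurable lborel" using g'(1) by measurable
  have "integrable lebesgue (\<lambda>z. indicator K z *\<^sub>R g' z)"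
  proof (rule integrable_cong_AE_imp[OF i])
    show "(\<lambda>z. indicator K z *\<^sub>R g' z) \<in> borel_measurable lebesgue" using m by (rule measurable_completion)
    show "AE z in lebesgue. indicator K z *\<^sub>R g z = indicator K z *\<^sub>R g' z"
      using AE_completion[OF g'(2)] by (rule AE_mp) (intro always_eventually allI impI, use K in \<open>auto simp: indicator_def\<close>)
  qed
  then show "set_integrable lborel K g'" unfolding set_integrable_def integrable_completion[OF m] .
qed

lemma test_on_test_function:
  assumes "test_on Q \<phi> \<phi>r \<phi>t"
  shows "test_function Q \<phi>" and "frechet_derivative \<phi> (at z) (x, y) = \<phi>r z * x + \<phi>t z * y"
proof -
  have d: "\<And>z. (\<phi> has_derivative (\<lambda>(x, y). \<phi>r z * x + \<phi>t z * y)) (at z)"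
    and c: "continuous_on UNIV \<phi>r" "continuous_on UNIV \<phi>t"
    and K: "\<exists>K. compact K \<and> K \<subseteq> Q \<and> (\<forall>z. z \<notin> K --> \<phi> z = 0 \<and> \<phi>r z = 0 \<and> \<phi>t z = 0)"
    using assms unfolding test_on_def by auto
  have f: "frechet_derivative \<phi> (at z) = (\<lambda>(x, y). \<phi>r z * x + \<phi>t z * y)" for z
    using frechet_derivative_at[OF d] by simp
  show "frechet_derivative \<phi> (at z) (x, y) = \<phi>r z * x + \<phi>t z * y" by (simp add: f)
  show "test_function Q \<phi>" unfolding test_function_def f
  proof (intro conjI allI)
    show "\<phi> differentiable at z" for z using d[of z] by (rule differentiableI)
    fix v :: "real \<times> real"
    obtain x y where v: "v = (x, y)" by (cases v)
    show "continuous_on UNIV (\<lambda>z. (case v of (x, y) => \<phi>r z * x + \<phi>t z * y))" unfolding v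
      by (auto intro!: continuous_intros c)
  qed (use K in blast)
qed

lemma lebesgue_integral_borel_version:
  fixes h :: "real \<times> real => real"
  assumes f: "f \<in> borel_measurable lebesgue" and h: "h \<in> borel_measurable borel" and e: "AE z in lborel. f z = h z"
  shows "(\<integral>z. f z \<partial>lebesgue) = (LBINT z. h z)"
proof -
  have m: "h \<in> borel_measurable lborel" using h by simp
  have "(\<integral>z. f z \<partial>lebesgue) = (\<integral>z. h z \<partial>lebesgue)"
    by (rule integral_cong_AE[OF f measurable_completion[OF m] AE_completion[OF e]])
  then show ?thesis by (simp add: integral_completion[OF m])
qed

lemma weak_deriv_borel_version:
  assumes Q: "open Q" and w: "weak_deriv Q (x, y) f g"
    and f': "f' \<in> borel_measurable borel" "AE z in lborel. z \<in> Q --> f z = f' z"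
    and g': "g' \<in> borel_measurable borel" "AE z in lborel. z \<in> Q --> g z = g' z"
  shows "loc_int Q f'" "loc_int Q g'"
    and "test_on Q \<phi> \<phi>r \<phi>t ==> (LBINT z. (\<phi>r z * x + \<phi>t z * y) * f' z) = - (LBINT z. \<phi> z * g' z)"
proof -
  have l: "locally_integrable Q f" "locally_integrable Q g" using w unfolding weak_deriv_def by auto
  show "loc_int Q f'" "loc_int Q g'" using locally_integrable_loc_int l f' g' by blast+
  assume t: "test_on Q \<phi> \<phi>r \<phi>t"
  then have c: "continuous_on UNIV \<phi>r" "continuous_on UNIV \<phi>t" and out: "\<And>z. z \<notin> Q ==> \<phi> z = 0 \<and> \<phi>r z = 0 \<and> \<phi>t z = 0"
    unfolding test_on_def by blast+
  have d: "(\<phi> has_derivative (\<lambda>(x, y). \<phi>r z * x + \<phi>t z * y)) (at z)" for z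
    using t[unfolded test_on_def] by blast
  have "continuous_on UNIV \<phi>"
    by (rule has_derivative_continuous_on[OF has_derivative_at_withinI[OF d]])
  then have cphi: "\<phi> \<in> borel_measurable borel" by (rule borel_measurable_continuous_onI)
  have cw: "(\<lambda>z. \<phi>r z * x + \<phi>t z * y) \<in> borel_measurable borel"
    by (intro borel_measurable_continuous_onI continuous_intros c)
  have int: "(LINT z:Q|lebesgue. k z *\<^sub>R h z) = (LBINT z. k z * h' z)"
    if k: "k \<in> borel_measurable borel" "\<And>z. z \<notin> Q ==> k z = 0" and h: "locally_integrable Q h"
      and h': "h' \<in> borel_measurable borel" "AE z in lborel. z \<in> Q --> h z = h' z" for k h h' :: "real \<times> real => real"
    unfolding set_lebesgue_integral_def
  proof (rule lebesgue_integral_borel_version)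
    have "(\<lambda>z. k z * (indicator Q z * h z)) \<in> borel_measurable lebesgue"
      using k(1) by (intro borel_measurable_times locally_integrable_measurable[OF Q h] measurable_completion) simp
    then show "(\<lambda>z. indicat_real Q z *\<^sub>R k z *\<^sub>R h z) \<in> borel_measurable lebesgue" by (simp add: mult_ac)
    show "(\<lambda>z. k z * h' z) \<in> borel_measurable borel" using k(1) h'(1) by simp
    show "AE z in lborel. indicat_real Q z *\<^sub>R k z *\<^sub>R h z = k z * h' z"
      using h'(2) by (rule AE_mp) (intro always_eventually allI impI, use k(2) in \<open>auto simp: indicator_def\<close>)
  qed
  have "(LINT z:Q|lebesgue. frechet_derivative \<phi> (at z) (x, y) *\<^sub>R f z) = - (LINT z:Q|lebesgue. \<phi> z *\<^sub>R g z)"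
    using w test_on_test_function(1)[OF t] unfolding weak_deriv_def by blast
  then show "(LBINT z. (\<phi>r z * x + \<phi>t z * y) * f' z) = - (LBINT z. \<phi> z * g' z)"
    unfolding test_on_test_function(2)[OF t] using int[OF cw _ l(1) f'] int[OF cphi _ l(2) g'] out by simp
qed

lemma weak_dr_wdr:
  assumes "open Q" "weak_dr Q f g"
    and "f' \<in> borel_measurable borel" "AE z in lborel. z \<in> Q --> (case z of (r, t) => f r t) = f' z"
    and "g' \<in> borel_measurable borel" "AE z in lborel. z \<in> Q --> (case z of (r, t) => g r t) = g' z"
  shows "wdr Q f' g'"
  using weak_deriv_borel_version[OF assms(1) assms(2)[unfolded weak_dr_def] assms(3-6)] unfolding wdr_def by simp

lemma weak_dt_wdt:
  assumes "open Q" "weak_dt Q f g"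
    and "f' \<in> borel_measurable borel" "AE z in lborel. z \<in> Q --> (case z of (r, t) => f r t) = f' z"
    and "g' \<in> borel_measurable borel" "AE z in lborel. z \<in> Q --> (case z of (r, t) => g r t) = g' z"
  shows "wdt Q f' g'"
  using weak_deriv_borel_version[OF assms(1) assms(2)[unfolded weak_dt_def] assms(3-6)] unfolding wdt_def by simp

lemma weak_version_exists:
  assumes "open Q" "weak_deriv Q v f g"
  shows "\<exists>g'::real\<times>real=>real. g' \<in> borel_measurable borel \<and> (AE z in lborel. z \<in> Q --> g z = g' z)"
  using assms(2) unfolding weak_deriv_def by (intro borel_version_exists[OF assms(1)]) blast

section \<open>Polar coordinates\<close>

text \<open>The discs have area \<open>\<pi> x\<^sup>2\<close>, the primitive of \<open>2 \<pi> r\<close>, and half-lines generate the Borel sets.\<close>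

lemma distr_norm_plane:
  "distr lborel borel (norm :: real ^ 2 => real) = density lborel (\<lambda>r. ennreal (2 * pi * r * indicator {0..} r))" (is "?M = ?N")
proof (rule measure_eqI_generator_eq[where E = "range atMost" and \<Omega> = UNIV and A = "\<lambda>n. {..real n}"])
  show "Int_stable (range (atMost :: real => _))" by (auto simp: Int_stable_def)
  have b: "sets (borel :: real measure) = sigma_sets UNIV (range atMost)" unfolding borel_eq_atMost by simp
  show "sets ?M = sigma_sets UNIV (range atMost)" "sets ?N = sigma_sets UNIV (range atMost)" using b by simp_all
  have m: "emeasure ?M {..x} = ennreal (pi * (max 0 x)\<^sup>2)" for x
  proof -
    have "emeasure ?M {..x} = emeasure lborel (cball (0 :: real ^ 2) x)"
      by (subst emeasure_distr) (auto intro!: arg_cong[where f = "emeasure lborel"])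
    also have "\<dots> = ennreal (pi * (max 0 x)\<^sup>2)"
    proof (cases "0 \<le> x")
      case True then show ?thesis by (simp add: emeasure_cball unit_ball_vol_2)
    next
      case False
      then have "cball (0 :: real ^ 2) x = {}" by simp
      then show ?thesis using False by simp
    qed
    finally show ?thesis .
  qed
  have n: "emeasure ?N {..x} = ennreal (pi * (max 0 x)\<^sup>2)" for x
  proof -
    have "emeasure ?N {..x} = (\<integral>\<^sup>+r. ennreal (2 * pi * r * indicator {0..} r) * indicator {..x} r \<partial>lborel)"
      by (rule emeasure_density) auto
    also have "\<dots> = (\<integral>\<^sup>+r. ennreal (2 * pi * max 0 r) * indicator {0..max 0 x} r \<partial>lborel)"
      by (rule nn_integral_cong) (auto simp: indicator_def)
    also have "\<dots> = (\<integral>\<^sup>+r. ennreal (2 * pi * r) * indicator {0..max 0 x} r \<partial>lborel)"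
      by (rule nn_integral_cong) (auto simp: indicator_def)
    also have "\<dots> = ennreal (pi * (max 0 x)\<^sup>2 - pi * 0\<^sup>2)"
      by (rule nn_integral_FTC_Icc[where F = "\<lambda>r. pi * r\<^sup>2"]) (auto intro!: derivative_eq_intros)
    finally show ?thesis by simp
  qed
  show "emeasure ?M X = emeasure ?N X" if "X \<in> range atMost" for X using that m n by auto
  show "emeasure ?M {..real i} \<noteq> \<infinity>" for i using m by simp
  show "(\<Union>i. {..real i}) = (UNIV::real set)" using real_arch_simple by auto
qed auto

lemma nn_integral_polar:
  assumes [measurable]: "g \<in> borel_measurable borel"
  shows "(\<integral>\<^sup>+x. g (norm x) \<partial>(lborel :: (real ^ 2) measure)) = (\<integral>\<^sup>+r. ennreal (2 * pi * r * indicator {0..} r) * g r \<partial>lborel)"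
proof -
  have "(\<integral>\<^sup>+x. g (norm x) \<partial>(lborel :: (real ^ 2) measure)) = (\<integral>\<^sup>+r. g r \<partial>distr lborel borel (norm :: real ^ 2 => real))"
    by (subst nn_integral_distr) auto
  also have "\<dots> = (\<integral>\<^sup>+r. ennreal (2 * pi * r * indicator {0..} r) * g r \<partial>lborel)"
    unfolding distr_norm_plane by (subst nn_integral_density) auto
  finally show ?thesis .
qed

text \<open>Radial extensions of null sets are null sets.\<close>

lemma AE_radial:
  assumes "AE r in lborel. 0 < r --> P r"
  shows "AE x in (lborel :: (real ^ 2) measure). x \<noteq> 0 --> P (norm x)"
proof -
  have "AE r in distr lborel borel (norm :: real ^ 2 => real). 0 < r --> P r"
    unfolding distr_norm_plane using assms by (subst AE_density) (auto elim: AE_mp)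
  then have "AE x in (lborel :: (real ^ 2) measure). 0 < norm x --> P (norm x)"
    by (rule AE_distrD[rotated]) simp
  then show ?thesis by simp
qed

text \<open>The bound is computed in polar coordinates on almost every time slice and assembled by Tonelli, for
  which the Borel representative of \<open>f\<close> is used.\<close>

lemma radial_L2:
  assumes Q: "Q = radial_region T a" "open Q"
    and L: "L_Lp 2 2 T (fluid_domain a) (radial_vector f)"
    and f': "f' \<in> borel_measurable borel" "AE z in lborel. z \<in> Q --> (case z of (r, t) => f r t) = f' z"
  shows "integrable lborel (\<lambda>z. indicator Q z * ((f' z)\<^sup>2 * fst z))"
proof -
  note f'(1)[measurable]
  have [measurable]: "Q \<in> sets borel" using Q(2) by simp
  have [measurable]: "(fst :: real \<times> real => real) \<in> borel_measurable borel"
    by (intro borel_measurable_continuous_onI continuous_intros)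
  define G where "G z = indicator Q z * ((f' z)\<^sup>2 * fst z)" for z
  have Gm [measurable]: "G \<in> borel_measurable borel" unfolding G_def[abs_def] by measurable
  have G0: "0 \<le> G z" for z by (auto simp: G_def Q(1) radial_region_def space_time_def indicator_def)
  define N where "N t = (LINT x|lebesgue_on (fluid_domain a t). norm (radial_vector f t x) powr 2)" for t
  have N0: "0 \<le> N t" for t unfolding N_def by (intro integral_nonneg_AE always_eventually allI) simp
  have Lp: "norm (Lp_norm 2 (fluid_domain a t) (radial_vector f t)) powr 2 = N t" for t
    unfolding Lp_norm_def N_def[symmetric] using N0[of t] by (simp add: powr_powr)
  have Ni: "integrable (lebesgue_on {0..T}) N"
    using L unfolding L_Lp_def in_Lp_def Lp by blast
  have in2: "AE t in lborel. t \<in> {0..T} --> in_Lp 2 (fluid_domain a t) (radial_vector f t)"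
  proof -
    have "AE t in lebesgue_on {0..T}. in_Lp 2 (fluid_domain a t) (radial_vector f t)" using L unfolding L_Lp_def by blast
    then show ?thesis by (simp add: AE_restrict_space_iff AE_completion_iff)
  qed
  have slice: "AE t in lborel. (\<integral>\<^sup>+r. ennreal (G (r, t)) \<partial>lborel) \<le> ennreal (N t) * indicator {0..T} t"
    using in2 plane_AE_slices[OF f'(2)]
  proof eventually_elim
    case (elim t)
    show ?case
    proof (cases "t \<in> {0<..<T}")
      case False
      then have "G (r, t) = 0" for r by (auto simp: G_def Q(1) radial_region_def space_time_def)
      then show ?thesis by simp
    next
      case True
      have Qi: "(r, t) \<in> Q \<longleftrightarrow> 0 < r \<and> r < a t" for r using True by (auto simp: Q(1) radial_region_def space_time_def)
      have inn: "in_Lp 2 (fluid_domain a t) (radial_vector f t)" using elim(1) True by simp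
      have i: "integrable (lebesgue_on (fluid_domain a t)) (\<lambda>x. norm (radial_vector f t x) powr 2)"
        using inn unfolding in_Lp_def by blast
      have dom: "fluid_domain a t \<inter> space lebesgue \<in> sets lebesgue" by (simp add: fluid_domain_def)
      have [measurable]: "(\<lambda>r. f' (r, t)) \<in> borel_measurable borel"
      proof -
        have "(\<lambda>r::real. (r, t)) \<in> borel \<rightarrow>\<^sub>M borel" by (intro borel_measurable_continuous_onI continuous_intros)
        from measurable_compose[OF this f'(1)] show ?thesis .
      qed
      define g where "g r = indicator {0<..<a t} r * ennreal ((f' (r, t))\<^sup>2)" for r
      have gm: "g \<in> borel_measurable borel" unfolding g_def[abs_def] by measurable
      have "ennreal (N t) = (\<integral>\<^sup>+x. ennreal (norm (radial_vector f t x) powr 2) \<partial>lebesgue_on (fluid_domain a t))"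
        unfolding N_def by (subst nn_integral_eq_integral[OF i]) auto
      also have "\<dots> = (\<integral>\<^sup>+x. ennreal (norm (radial_vector f t x) powr 2) * indicator (fluid_domain a t) x \<partial>lborel)"
        by (simp only: nn_integral_restrict_space[OF dom] nn_integral_completion)
      also have "\<dots> = (\<integral>\<^sup>+x. g (norm x) \<partial>(lborel :: (real ^ 2) measure))"
      proof (rule nn_integral_cong_AE)
        have "AE r in lborel. 0 < r --> ((r, t) \<in> Q --> f r t = f' (r, t))" using elim(2) by (rule AE_mp) (intro always_eventually allI impI, simp)
        from AE_radial[OF this]
        have "AE x in (lborel :: (real ^ 2) measure). x \<noteq> 0 --> ((norm x, t) \<in> Q --> f (norm x) t = f' (norm x, t))" .
        then show "AE x in lborel. ennreal (norm (radial_vector f t x) powr 2) * indicator (fluid_domain a t) x = g (norm x)"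
          using AE_lborel_singleton[of "0 :: real ^ 2"]
        proof eventually_elim
          case (elim x)
          have "norm (radial_vector f t x) = \<bar>f (norm x) t\<bar>" using elim by (simp add: radial_vector_def)
          then have n2: "norm (radial_vector f t x) powr 2 = (f (norm x) t)\<^sup>2" by simp
          show ?case using elim unfolding n2 g_def Qi by (auto simp: fluid_domain_def indicator_def)
        qed
      qed
      also have "\<dots> = (\<integral>\<^sup>+r. ennreal (2 * pi * r * indicator {0..} r) * g r \<partial>lborel)" by (rule nn_integral_polar[OF gm])
      also have "\<dots> \<ge> (\<integral>\<^sup>+r. ennreal (G (r, t)) \<partial>lborel)"
      proof (rule nn_integral_mono)
        fix r
        show "ennreal (G (r, t)) \<le> ennreal (2 * pi * r * indicator {0..} r) * g r"
        proof (cases "0 < r \<and> r < a t")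
          case True
          have "(1::real) \<le> 2 * pi" using pi_gt3 by linarith
          then have "1 * (r * (f' (r, t))\<^sup>2) \<le> 2 * pi * (r * (f' (r, t))\<^sup>2)" using True by (intro mult_right_mono) auto
          then show ?thesis using True Qi[of r] unfolding G_def g_def
            by (simp add: ennreal_mult'[symmetric] mult_ac ennreal_leI)
        next
          case False
          then have "(r, t) \<notin> Q" using Qi by simp
          then show ?thesis by (simp add: G_def)
        qed
      qed
      finally show ?thesis using True by simp
    qed
  qed
  have "(\<integral>\<^sup>+z. ennreal (G z) \<partial>lborel) = (\<integral>\<^sup>+t. (\<integral>\<^sup>+r. ennreal (G (r, t)) \<partial>lborel) \<partial>lborel)"
    by (rule plane_nn_Fubini) measurable
  also have "\<dots> \<le> (\<integral>\<^sup>+t. ennreal (N t) * indicator {0..T} t \<partial>lborel)" by (rule nn_integral_mono_AE[OF slice])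
  also have "\<dots> = (\<integral>\<^sup>+t. ennreal (N t) \<partial>lebesgue_on {0..T})"
    by (subst nn_integral_restrict_space) (simp_all add: nn_integral_completion)
  also have "\<dots> < \<infinity>" using Ni N0 by (subst nn_integral_eq_integral[OF Ni]) auto
  finally have "(\<integral>\<^sup>+z. ennreal (G z) \<partial>lborel) < \<infinity>" .
  then have "integrable lborel G" using G0 by (intro integrableI_nonneg) auto
  then show ?thesis unfolding G_def[abs_def] .
qed

section \<open>Strong solutions as flows\<close>

lemma bounded_continuous_extension:
  fixes f :: "real \<times> real => real"
  assumes S: "compact S" and f: "continuous_on S f"
  shows "\<exists>F b. continuous_on UNIV F \<and> (\<forall>z\<in>S. F z = f z) \<and> (\<forall>z. \<bar>F z\<bar> \<le> b)"
proof -
  have "bounded (f ` S)" by (rule compact_imp_bounded[OF compact_continuous_image[OF f S]])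
  then obtain b where b: "0 < b" "\<forall>y\<in>f ` S. norm y \<le> b" unfolding bounded_pos by blast
  have cl: "closedin (top_of_set UNIV) S" using compact_imp_closed[OF S] by simp
  obtain F where "continuous_on UNIV F" "\<And>z. z \<in> S ==> F z = f z" "\<And>z. z \<in> UNIV ==> norm (F z) \<le> b"
    by (rule Tietze[OF f cl, of b]) (use b in auto)
  then show ?thesis by (intro exI[of _ F] exI[of _ b]) simp
qed

text \<open>The derivative is extended by its boundary values, and the extension is its antiderivative.\<close>

lemma C1_extension:
  fixes a w :: "real => real"
  assumes T: "0 < T" and a: "\<And>t. t \<in> {0..T} ==> (a has_real_derivative w t) (at t within {0..T})"
    and w: "continuous_on {0..T} w"
  shows "\<exists>A A'. (\<forall>t. (A has_real_derivative A' t) (at t)) \<and> continuous_on UNIV A' \<and> (\<forall>t\<in>{0..T}. A t = a t \<and> A' t = w t)"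
proof -
  define A' where "A' t = w (max 0 (min T t))" for t
  have A': "continuous_on UNIV A'" unfolding A'_def
    by (rule continuous_on_compose2[OF w]) (use T in \<open>auto intro!: continuous_intros\<close>)
  obtain A where A: "A 0 = a 0" "\<And>t. (A has_real_derivative A' t) (at t)" using antiderivative_exists[OF A'] by blast
  have eq: "A' t = w t" if "t \<in> {0..T}" for t using that by (simp add: A'_def)
  have "\<exists>c. \<forall>t\<in>{0..T}. A t - a t = c"
  proof (rule has_field_derivative_zero_constant)
    fix t assume t: "t \<in> {0..T}"
    have "((\<lambda>t. A t - a t) has_real_derivative (A' t - w t)) (at t within {0..T})"
      by (rule DERIV_diff[OF has_field_derivative_at_within[OF A(2)] a[OF t]])
    then show "((\<lambda>t. A t - a t) has_real_derivative 0) (at t within {0..T})" using eq[OF t] by simp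
  qed simp
  then obtain c where c: "\<forall>t\<in>{0..T}. A t - a t = c" by blast
  then have "c = 0" using A(1) T by force
  then show ?thesis using A(2) A' eq c by (intro exI[of _ A] exI[of _ A']) auto
qed

text \<open>The region is the image of a rectangle under \<open>(s, t) \<mapsto> (s a(t), t)\<close>.\<close>

lemma compact_under_graph:
  fixes a :: "real => real"
  assumes a: "continuous_on {0..T} a" "\<And>t. t \<in> {0..T} ==> 0 < a t"
  shows "compact {(r, t). 0 \<le> t \<and> t \<le> T \<and> 0 \<le> r \<and> r \<le> a t}"
proof -
  have "{(r, t). 0 \<le> t \<and> t \<le> T \<and> 0 \<le> r \<and> r \<le> a t} = (\<lambda>z. (fst z * a (snd z), snd z)) ` ({0..1} \<times> {0..T})"
  proof (intro equalityI subsetI)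
    fix z assume "z \<in> {(r, t). 0 \<le> t \<and> t \<le> T \<and> 0 \<le> r \<and> r \<le> a t}"
    then obtain r t where z: "z = (r, t)" "0 \<le> t" "t \<le> T" "0 \<le> r" "r \<le> a t" by auto
    then have at: "0 < a t" using a(2) by simp
    have "(r / a t, t) \<in> {0..1} \<times> {0..T}" "z = (r / a t * a t, t)" using z at by auto
    then show "z \<in> (\<lambda>z. (fst z * a (snd z), snd z)) ` ({0..1} \<times> {0..T})" by (intro image_eqI[of _ _ "(r / a t, t)"]) auto
  next
    fix z assume "z \<in> (\<lambda>z. (fst z * a (snd z), snd z)) ` ({0..1} \<times> {0..T})"
    then obtain p where p: "z = (fst p * a (snd p), snd p)" "p \<in> {0..1} \<times> {0..T}" by blast
    define s t where "s = fst p" and "t = snd p"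
    have z: "z = (s * a t, t)" "0 \<le> s" "s \<le> 1" "t \<in> {0..T}" using p by (auto simp: s_def t_def)
    then have "0 < a t" using a(2) by simp
    then have "0 \<le> s * a t" "s * a t \<le> 1 * a t" using z by (auto intro: mult_right_mono)
    then show "z \<in> {(r, t). 0 \<le> t \<and> t \<le> T \<and> 0 \<le> r \<and> r \<le> a t}" using z by auto
  qed
  moreover have "continuous_on ({0..1} \<times> {0..T}) (\<lambda>z::real\<times>real. a (snd z))"
    by (rule continuous_on_compose2[OF a(1)]) (auto intro!: continuous_intros)
  then have "continuous_on ({0..1} \<times> {0..T}) (\<lambda>z. (fst z * a (snd z), snd z))"
    by (intro continuous_on_Pair continuous_on_mult continuous_on_fst continuous_on_snd continuous_on_id)
  ultimately show ?thesis by (simp add: compact_continuous_image compact_Times)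
qed

lemma weak_dr_version:
  assumes "open Q" "weak_dr Q f g"
  shows "\<exists>g'. g' \<in> borel_measurable borel \<and> (AE z in lborel. z \<in> Q --> (case z of (r, t) => g r t) = g' z)"
  by (rule weak_version_exists[OF assms(1) assms(2)[unfolded weak_dr_def]])

lemma weak_dt_version:
  assumes "open Q" "weak_dt Q f g"
  shows "\<exists>g'. g' \<in> borel_measurable borel \<and> (AE z in lborel. z \<in> Q --> (case z of (r, t) => g r t) = g' z)"
  by (rule weak_version_exists[OF assms(1) assms(2)[unfolded weak_dt_def]])

text \<open>The fields are extended from the compact closed region by Tietze's theorem, and the free boundary as a
  \<open>C\<^sup>1\<close> function of time. The weak derivatives are replaced by Borel functions equal to them almost
  everywhere.\<close>

theorem strong_solution_flow:
  assumes par: "0 < \<mu>" "0 \<le> \<mu> + lam" "1 < \<gamma>"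
    and sol: "strong_solution \<mu> lam \<gamma> T a \<rho> u P B"
    and init: "\<forall>r\<in>{0..a 0}. 0 \<le> \<rho> r 0 \<and> 0 \<le> P r 0"
  shows "\<exists>M A A' \<rho>' u' P' B' \<rho>t ut Pt Bt \<rho>ur ur divr Pr Br uBr.
    mhd_flow (2 * \<mu> + lam) \<gamma> T M A A' \<rho>' u' P' B' \<rho>t ut Pt Bt \<rho>ur ur divr Pr Br uBr (radial_region T a) \<and>
    A 0 = a 0 \<and> (\<forall>r\<in>{0..a 0}. \<rho>' (r, 0) = \<rho> r 0 \<and> u' (r, 0) = u r 0 \<and> P' (r, 0) = P r 0 \<and> B' (r, 0) = B r 0)"
proof -
  define \<nu> where "\<nu> = 2 * \<mu> + lam"
  have \<nu>: "0 < \<nu>" using par by (simp add: \<nu>_def)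
  define Q where "Q = radial_region T a"
  (* the closed region on which the profiles are continuous *)
  define S where "S = {(r, t). 0 \<le> t \<and> t \<le> T \<and> 0 \<le> r \<and> r \<le> a t}"
  have T: "0 < T" and a_pos: "\<And>t. t \<in> {0..T} ==> 0 < a t"
    and c: "continuous_on S (\<lambda>(r, t). \<rho> r t)" "continuous_on S (\<lambda>(r, t). u r t)"
      "continuous_on S (\<lambda>(r, t). P r t)" "continuous_on S (\<lambda>(r, t). B r t)"
    and bcs: "boundary_conditions \<mu> lam T a u P B"
    using sol unfolding strong_solution_def continuous_profile_def S_def by simp_all
  obtain q \<rho>t0 ut0 Pt0 Bt0 where mhd: "mhd_equations \<mu> lam \<gamma> T a \<rho> u P B \<rho>t0 ut0 Pt0 Bt0"
    and reg: "strong_regularity q T a \<rho> u P B \<rho>t0 ut0 Pt0 Bt0"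
    using sol[unfolded strong_solution_def] by (elim exE conjE) (rule that)
  have L2: "L_Lp 2 2 T (fluid_domain a) (radial_vector ut0)"
    using reg unfolding strong_regularity_def Let_def One_nat_def L_Sobolev.simps by (elim conjE)
  note m = mhd[unfolded mhd_equations_def Let_def, folded Q_def \<nu>_def]
  obtain \<rho>ur0 ur0 divr0 Pr0 Br0 uBr0 where wt0: "weak_dt Q \<rho> \<rho>t0" "weak_dt Q u ut0" "weak_dt Q P Pt0" "weak_dt Q B Bt0"
    and wr0: "weak_dr Q (\<lambda>r t. \<rho> r t * u r t) \<rho>ur0" "weak_dr Q u ur0" "weak_dr Q (\<lambda>r t. ur0 r t + u r t / r) divr0"
      "weak_dr Q P Pr0" "weak_dr Q B Br0" "weak_dr Q (\<lambda>r t. u r t * B r t) uBr0"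
    and eq0: "AE (r, t) in lebesgue_on Q.
            \<rho>t0 r t + \<rho>ur0 r t + \<rho> r t * u r t / r = 0 \<and>
            \<rho> r t * (ut0 r t + u r t * ur0 r t) + Pr0 r t =
              \<nu> * divr0 r t - B r t * (Br0 r t + B r t / r) \<and>
            Pt0 r t + u r t * Pr0 r t + \<gamma> * P r t * (ur0 r t + u r t / r) = 0 \<and>
            Bt0 r t + uBr0 r t = 0"
    using m by (elim exE conjE) (rule that)
  have bc0: "u 0 t = 0" "B 0 t = 0" "(a has_real_derivative u (a t) t) (at t within {0..T})"
    "\<exists>d. ((\<lambda>r. u r t) has_real_derivative d) (at (a t) within {0..a t}) \<and>
       (B (a t) t)\<^sup>2 / 2 + P (a t) t - \<nu> * (d + u (a t) t / a t) = 0" if "t \<in> {0..T}" for t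
    using bcs[unfolded boundary_conditions_def, rule_format, OF that] unfolding \<nu>_def by simp_all
  have ac: "continuous_on {0..T} a" by (rule DERIV_continuous_on[OF bc0(3)])
  have cS: "compact S" unfolding S_def by (rule compact_under_graph[OF ac a_pos])
  obtain \<rho>' b1 where r': "continuous_on UNIV \<rho>'" "\<forall>z\<in>S. \<rho>' z = (case z of (r, t) => \<rho> r t)" "\<forall>z. \<bar>\<rho>' z\<bar> \<le> b1"
    using bounded_continuous_extension[OF cS c(1)] by blast
  obtain u' b2 where u': "continuous_on UNIV u'" "\<forall>z\<in>S. u' z = (case z of (r, t) => u r t)" "\<forall>z. \<bar>u' z\<bar> \<le> b2"
    using bounded_continuous_extension[OF cS c(2)] by blast
  obtain P' b3 where P': "continuous_on UNIV P'" "\<forall>z\<in>S. P' z = (case z of (r, t) => P r t)" "\<forall>z. \<bar>P' z\<bar> \<le> b3"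
    using bounded_continuous_extension[OF cS c(3)] by blast
  obtain B' b4 where B': "continuous_on UNIV B'" "\<forall>z\<in>S. B' z = (case z of (r, t) => B r t)" "\<forall>z. \<bar>B' z\<bar> \<le> b4"
    using bounded_continuous_extension[OF cS c(4)] by blast
  have S_iff: "(r, t) \<in> S \<longleftrightarrow> t \<in> {0..T} \<and> r \<in> {0..a t}" for r t by (auto simp: S_def)
  have onS: "\<rho>' (r, t) = \<rho> r t" "u' (r, t) = u r t" "P' (r, t) = P r t" "B' (r, t) = B r t"
    if "t \<in> {0..T}" "r \<in> {0..a t}" for r t
    using r'(2)[rule_format, of "(r, t)"] u'(2)[rule_format, of "(r, t)"] P'(2)[rule_format, of "(r, t)"]
      B'(2)[rule_format, of "(r, t)"] that S_iff by simp_all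
  define M where "M = b1 + b2 + b3 + b4"
  have b: "0 \<le> b1" "0 \<le> b2" "0 \<le> b3" "0 \<le> b4"
    using r'(3)[rule_format, of 0] u'(3)[rule_format, of 0] P'(3)[rule_format, of 0] B'(3)[rule_format, of 0] by linarith+
  have bd: "\<bar>\<rho>' z\<bar> \<le> M" "\<bar>u' z\<bar> \<le> M" "\<bar>P' z\<bar> \<le> M" "\<bar>B' z\<bar> \<le> M" for z
    using r'(3)[rule_format, of z] u'(3)[rule_format, of z] P'(3)[rule_format, of z] B'(3)[rule_format, of z] b
    unfolding M_def by linarith+
  have wc: "continuous_on {0..T} (\<lambda>t. u' (a t, t))"
    by (rule continuous_on_compose2[OF u'(1)]) (auto intro!: continuous_intros ac)
  have "\<exists>A A'. (\<forall>t. (A has_real_derivative A' t) (at t)) \<and> continuous_on UNIV A' \<and> (\<forall>t\<in>{0..T}. A t = a t \<and> A' t = u' (a t, t))"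
  proof (rule C1_extension[OF T _ wc])
    fix t assume t: "t \<in> {0..T}"
    then show "(a has_real_derivative u' (a t, t)) (at t within {0..T})" using bc0(3)[OF t] onS(2)[OF t, of "a t"] a_pos[OF t] by simp
  qed
  then obtain A A' where A: "\<And>t. (A has_real_derivative A' t) (at t)" "continuous_on UNIV A'"
    "\<And>t. t \<in> {0..T} ==> A t = a t" "\<And>t. t \<in> {0..T} ==> A' t = u' (a t, t)" by blast
  have Q: "Q = {(r, t). 0 < t \<and> t < T \<and> 0 < r \<and> r < A t}"
    using A(3) by (auto simp: Q_def radial_region_def space_time_def)
  have A_cont: "continuous_on UNIV A" by (rule DERIV_continuous_on[OF has_field_derivative_at_within[OF A(1)]])
  have open_Q: "open Q"
  proof -
    have "Q = {z. 0 < snd z} \<inter> {z. snd z < T} \<inter> {z. 0 < fst z} \<inter> {z. fst z < A (snd z)}"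
      by (auto simp: Q)
    moreover have "open \<dots>"
      by (intro open_Int open_Collect_less continuous_intros continuous_snd_comp[OF A_cont])
    ultimately show ?thesis by simp
  qed
  have QS: "z \<in> S" if "z \<in> Q" for z using that A(3) by (auto simp: Q S_def)
  have ext: "AE z in lborel. z \<in> Q --> (case z of (r, t) => \<rho> r t) = \<rho>' z" "AE z in lborel. z \<in> Q --> (case z of (r, t) => u r t) = u' z"
    "AE z in lborel. z \<in> Q --> (case z of (r, t) => P r t) = P' z" "AE z in lborel. z \<in> Q --> (case z of (r, t) => B r t) = B' z"
    "AE z in lborel. z \<in> Q --> (case z of (r, t) => \<rho> r t * u r t) = \<rho>' z * u' z"
    "AE z in lborel. z \<in> Q --> (case z of (r, t) => u r t * B r t) = u' z * B' z"
    using QS r'(2) u'(2) P'(2) B'(2) by (auto intro!: AE_I2)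
  have [measurable]: "(fst :: real \<times> real => real) \<in> borel_measurable borel"
    by (intro borel_measurable_continuous_onI continuous_intros)
  have mf [measurable]: "\<rho>' \<in> borel_measurable borel" "u' \<in> borel_measurable borel" "P' \<in> borel_measurable borel" "B' \<in> borel_measurable borel"
    by (intro borel_measurable_continuous_onI r' u' P' B')+
  obtain \<rho>t where \<rho>t: "\<rho>t \<in> borel_measurable borel" "AE z in lborel. z \<in> Q --> (case z of (r, t) => \<rho>t0 r t) = \<rho>t z"
    using weak_dt_version[OF open_Q wt0(1)] by (elim exE conjE) (rule that)
  obtain ut where ut: "ut \<in> borel_measurable borel" "AE z in lborel. z \<in> Q --> (case z of (r, t) => ut0 r t) = ut z"
    using weak_dt_version[OF open_Q wt0(2)] by (elim exE conjE) (rule that)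
  obtain Pt where Pt: "Pt \<in> borel_measurable borel" "AE z in lborel. z \<in> Q --> (case z of (r, t) => Pt0 r t) = Pt z"
    using weak_dt_version[OF open_Q wt0(3)] by (elim exE conjE) (rule that)
  obtain Bt where Bt: "Bt \<in> borel_measurable borel" "AE z in lborel. z \<in> Q --> (case z of (r, t) => Bt0 r t) = Bt z"
    using weak_dt_version[OF open_Q wt0(4)] by (elim exE conjE) (rule that)
  obtain \<rho>ur where \<rho>ur: "\<rho>ur \<in> borel_measurable borel" "AE z in lborel. z \<in> Q --> (case z of (r, t) => \<rho>ur0 r t) = \<rho>ur z"
    using weak_dr_version[OF open_Q wr0(1)] by (elim exE conjE) (rule that)
  obtain ur where ur[measurable]: "ur \<in> borel_measurable borel" and ur_ae: "AE z in lborel. z \<in> Q --> (case z of (r, t) => ur0 r t) = ur z"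
    using weak_dr_version[OF open_Q wr0(2)] by (elim exE conjE) (rule that)
  obtain divr where divr: "divr \<in> borel_measurable borel" "AE z in lborel. z \<in> Q --> (case z of (r, t) => divr0 r t) = divr z"
    using weak_dr_version[OF open_Q wr0(3)] by (elim exE conjE) (rule that)
  obtain Pr where Pr: "Pr \<in> borel_measurable borel" "AE z in lborel. z \<in> Q --> (case z of (r, t) => Pr0 r t) = Pr z"
    using weak_dr_version[OF open_Q wr0(4)] by (elim exE conjE) (rule that)
  obtain Br where Br: "Br \<in> borel_measurable borel" "AE z in lborel. z \<in> Q --> (case z of (r, t) => Br0 r t) = Br z"
    using weak_dr_version[OF open_Q wr0(5)] by (elim exE conjE) (rule that)
  obtain uBr where uBr: "uBr \<in> borel_measurable borel" "AE z in lborel. z \<in> Q --> (case z of (r, t) => uBr0 r t) = uBr z"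
    using weak_dr_version[OF open_Q wr0(6)] by (elim exE conjE) (rule that)
  have div_ae: "AE z in lborel. z \<in> Q --> (case z of (r, t) => ur0 r t + u r t / r) = ur z + u' z / fst z"
    using ur_ae ext(2) by eventually_elim (auto split: prod.splits)
  have wt: "wdt Q \<rho>' \<rho>t" "wdt Q u' ut" "wdt Q P' Pt" "wdt Q B' Bt"
    by (rule weak_dt_wdt[OF open_Q wt0(1) mf(1) ext(1) \<rho>t] weak_dt_wdt[OF open_Q wt0(2) mf(2) ext(2) ut]
        weak_dt_wdt[OF open_Q wt0(3) mf(3) ext(3) Pt] weak_dt_wdt[OF open_Q wt0(4) mf(4) ext(4) Bt])+
  have pm: "(\<lambda>z. \<rho>' z * u' z) \<in> borel_measurable borel" "(\<lambda>z. u' z * B' z) \<in> borel_measurable borel"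
    "(\<lambda>z. ur z + u' z / fst z) \<in> borel_measurable borel" by measurable
  have wr: "wdr Q (\<lambda>z. \<rho>' z * u' z) \<rho>ur" "wdr Q u' ur" "wdr Q (\<lambda>z. ur z + u' z / fst z) divr"
      "wdr Q P' Pr" "wdr Q B' Br" "wdr Q (\<lambda>z. u' z * B' z) uBr"
    by (rule weak_dr_wdr[OF open_Q wr0(1) pm(1) ext(5) \<rho>ur] weak_dr_wdr[OF open_Q wr0(2) mf(2) ext(2) ur ur_ae]
        weak_dr_wdr[OF open_Q wr0(3) pm(3) div_ae divr] weak_dr_wdr[OF open_Q wr0(4) mf(3) ext(3) Pr]
        weak_dr_wdr[OF open_Q wr0(5) mf(4) ext(4) Br] weak_dr_wdr[OF open_Q wr0(6) pm(2) ext(6) uBr])+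
  have "Q \<inter> space lebesgue \<in> sets lebesgue" using open_Q by simp
  note eq1 = eq0[unfolded AE_restrict_space_iff[OF this] AE_completion_iff]
  have eqs: "AE z in lborel. z \<in> Q -->
        \<rho>t z + \<rho>ur z + \<rho>' z * u' z / fst z = 0 \<and>
        \<rho>' z * (ut z + u' z * ur z) + Pr z = \<nu> * divr z - B' z * (Br z + B' z / fst z) \<and>
        Pt z + u' z * Pr z + \<gamma> * P' z * (ur z + u' z / fst z) = 0 \<and>
        Bt z + uBr z = 0"
    using eq1 \<rho>t(2) ut(2) Pt(2) Bt(2) \<rho>ur(2) ur_ae divr(2) Pr(2) Br(2) uBr(2)
  proof eventually_elim
    case (elim z)
    obtain r t where z: "z = (r, t)" by (cases z)
    show ?case
    proof
      assume zQ: "z \<in> Q"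
      then have "t \<in> {0..T}" "r \<in> {0..a t}" using QS S_iff z by auto
      from onS[OF this] elim zQ show "\<rho>t z + \<rho>ur z + \<rho>' z * u' z / fst z = 0 \<and>
        \<rho>' z * (ut z + u' z * ur z) + Pr z = \<nu> * divr z - B' z * (Br z + B' z / fst z) \<and>
        Pt z + u' z * Pr z + \<gamma> * P' z * (ur z + u' z / fst z) = 0 \<and>
        Bt z + uBr z = 0" unfolding z by simp
    qed
  qed
  have A_pos: "\<And>t. t \<in> {0..T} ==> 0 < A t" using a_pos A(3) by simp
  have A_traj: "\<And>t. t \<in> {0..T} ==> A' t = u' (A t, t)" using A(3,4) by simp
  have axis: "\<And>t. t \<in> {0..T} ==> u' (0, t) = 0" "\<And>t. t \<in> {0..T} ==> B' (0, t) = 0"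
    using onS[of _ 0] bc0(1,2) a_pos by (simp_all add: less_imp_le)
  have bc: "\<exists>d. ((\<lambda>r. u' (r, t)) has_real_derivative d) (at (A t) within {0..A t}) \<and>
        (B' (A t, t))\<^sup>2 / 2 + P' (A t, t) - \<nu> * (d + u' (A t, t) / A t) = 0" if t: "t \<in> {0..T}" for t
  proof -
    obtain d where d: "((\<lambda>r. u r t) has_real_derivative d) (at (a t) within {0..a t})"
       "(B (a t) t)\<^sup>2 / 2 + P (a t) t - \<nu> * (d + u (a t) t / a t) = 0" using bc0(4)[OF t] by blast
    have at: "a t \<in> {0..a t}" using a_pos[OF t] by simp
    have "((\<lambda>r. u' (r, t)) has_real_derivative d) (at (a t) within {0..a t})"
      by (rule has_field_derivative_transform_within[OF d(1) zero_less_one at]) (simp add: onS(2)[OF t])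
    then show ?thesis using d(2) onS[OF t at] unfolding A(3)[OF t] by auto
  qed
  have ut_L2: "integrable lborel (\<lambda>z. indicator Q z * ((ut z)\<^sup>2 * fst z))"
    by (rule radial_L2[OF Q_def open_Q L2 ut])
  have T0: "0 \<in> {0..T}" using T by simp
  have A0: "A 0 = a 0" by (rule A(3)[OF T0])
  have init': "0 \<le> \<rho>' (r, 0) \<and> 0 \<le> P' (r, 0)" if "r \<in> {0..A 0}" for r
    using onS[OF T0, of r] init that unfolding A0 by simp
  have "mhd_flow \<nu> \<gamma> T M A A' \<rho>' u' P' B' \<rho>t ut Pt Bt \<rho>ur ur divr Pr Br uBr Q"
    by (intro mhd_flow.intro \<nu> par(3) T Q A(1,2) A_pos A_traj r'(1) u'(1) P'(1) B'(1) bd axis wt wr eqs bc ut_L2 init')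
  then show ?thesis unfolding \<nu>_def Q_def
    by (intro exI conjI) (assumption, rule A0, use onS[OF T0] in blast)
qed

text \<open>Initial data and energy are expressed by the extended fields, and Lebesgue integrals of continuous
  functions by gauge integrals.\<close>

lemma existence_time_le:
  assumes par: "0 < \<mu>" "0 \<le> \<mu> + lam" "1 < \<gamma>"
    and sol: "strong_solution \<mu> lam \<gamma> T a \<rho> u P B"
    and ini: "initial_condition a0 \<rho>0 u0 P0 B0 a \<rho> u P B"
    and nonneg: "\<forall>r\<in>{0..a0}. 0 \<le> \<rho>0 r \<and> 0 \<le> P0 r"
    and r0: "0 < r0" "r0 < a0" and vac: "\<forall>r\<in>{0..r0}. \<rho>0 r = 0 \<and> P0 r = 0"
    and flux: "integral {0..r0} B0 \<noteq> 0" and \<alpha>: "1 < \<alpha>" "\<alpha> < 2"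
    and E: "E = initial_energy \<gamma> a0 \<rho>0 u0 P0 B0" and C: "0 < C" "2 * (a0\<^sup>2 + 2 * E / (2 * \<mu> + lam)) \<le> C\<^sup>2"
  shows "T \<le> exp (E * (\<bar>integral {0..r0} B0\<bar>\<^sup>2 * (2 - \<alpha>)\<^sup>2 /
    (2 * sqrt (2 * \<mu> + lam) * C * (\<alpha> / sqrt (2 * \<alpha> - 2) + (\<alpha> + 1) / sqrt (2 * \<alpha>)))) powi (- 2)) - 1"
proof -
  have a0: "a 0 = a0" and i: "\<And>r. r \<in> {0..a0} ==> \<rho> r 0 = \<rho>0 r \<and> u r 0 = u0 r \<and> P r 0 = P0 r \<and> B r 0 = B0 r"
    using ini unfolding initial_condition_def by auto
  have "\<forall>r\<in>{0..a 0}. 0 \<le> \<rho> r 0 \<and> 0 \<le> P r 0" using nonneg i a0 by simp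
  from strong_solution_flow[OF par sol this]
  obtain M A A' \<rho>' u' P' B' \<rho>t ut Pt Bt \<rho>ur ur divr Pr Br uBr where
    flow: "mhd_flow (2 * \<mu> + lam) \<gamma> T M A A' \<rho>' u' P' B' \<rho>t ut Pt Bt \<rho>ur ur divr Pr Br uBr (radial_region T a)"
    and A0: "A 0 = a 0" and d: "\<forall>r\<in>{0..a 0}. \<rho>' (r, 0) = \<rho> r 0 \<and> u' (r, 0) = u r 0 \<and> P' (r, 0) = P r 0 \<and> B' (r, 0) = B r 0"
    by (elim exE conjE) (rule that)
  interpret F: mhd_flow "2 * \<mu> + lam" \<gamma> T M A A' \<rho>' u' P' B' \<rho>t ut Pt Bt \<rho>ur ur divr Pr Br uBr "radial_region T a"
    by (rule flow)
  have data: "\<rho>' (r, 0) = \<rho>0 r" "u' (r, 0) = u0 r" "P' (r, 0) = P0 r" "B' (r, 0) = B0 r" if "r \<in> {0..a0}" for r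
    using d[rule_format, of r] i[OF that] that a0 by simp_all
  have ci: "continuous_on UNIV f ==> (LBINT r:{0..x}. f (r, 0)) = integral {0..x} (\<lambda>r. f (r, 0))" for f :: "real \<times> real => real" and x
    by (rule set_borel_integral_eq_integral(2)) (unfold set_integrable_def, intro borel_integrable_compact compact_Icc continuous_on_slice)
  have en: "F.energy 0 = E"
  proof -
    have "F.energy 0 = integral {0..a0} (\<lambda>r. F.energy_density (r, 0))"
      unfolding F.energy_def A0 a0 by (rule ci[OF F.energy_density_continuous])
    also have "\<dots> = E" unfolding E initial_energy_def
      by (rule Henstock_Kurzweil_Integration.integral_cong) (simp add: F.energy_density_def data algebra_simps)
    finally show ?thesis .
  qed
  have fl: "integral {0..r0} B0 = (LBINT r:{0..r0}. B' (r, 0))"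
    unfolding ci[OF F.cont(4)] by (rule Henstock_Kurzweil_Integration.integral_cong) (use data r0 in auto)
  have v: "\<rho>' (r, 0) = 0 \<and> P' (r, 0) = 0" if "r \<in> {0..r0}" for r using data[of r] vac that r0 by auto
  have C': "2 * ((A 0)\<^sup>2 + 2 * F.energy 0 / (2 * \<mu> + lam)) \<le> C\<^sup>2" using C(2) unfolding en A0 a0 .
  have r0A: "r0 < A 0" using r0 by (simp add: A0 a0)
  show ?thesis
    using F.existence_time_bound[OF r0(1) r0A v fl flux \<alpha> C(1) C'] unfolding en by simp
qed

text \<open>Every continuation has the same initial data, so the bound on its time of existence is that of the
  given solution. The absolute values keep the constant positive for arguments that do not come from
  a flow. Finiteness follows from the bound at one value of the exponent, \<open>\<alpha> = 3/2\<close>.\<close>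

theorem theorem2p4:
  shows "\<exists>C :: real \<Rightarrow> real \<Rightarrow> real \<Rightarrow> real \<Rightarrow> real.
    (\<forall>a0 E0 \<mu> lam. 0 < C a0 E0 \<mu> lam) \<and>
    (\<forall>\<mu> lam \<gamma> T0 a0 r0 :: real. \<forall>a \<rho>0 u0 P0 B0 :: real \<Rightarrow> real. \<forall>\<rho> u P B :: real \<Rightarrow> real \<Rightarrow> real.
       0 < \<mu> \<longrightarrow> 0 \<le> \<mu> + lam \<longrightarrow> 1 < \<gamma> \<longrightarrow> 0 < a0 \<longrightarrow>
       (\<forall>r\<in>{0..a0}. 0 \<le> \<rho>0 r \<and> 0 \<le> P0 r) \<longrightarrow>
       strong_solution \<mu> lam \<gamma> T0 a \<rho> u P B \<longrightarrow>
       initial_condition a0 \<rho>0 u0 P0 B0 a \<rho> u P B \<longrightarrow>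
       0 < r0 \<longrightarrow> r0 < a 0 \<longrightarrow>
       (\<forall>r\<in>{0..r0}. \<rho>0 r = 0 \<and> P0 r = 0) \<longrightarrow>
       integral {0..r0} B0 \<noteq> 0 \<longrightarrow>
       (let E0 = initial_energy \<gamma> a0 \<rho>0 u0 P0 B0;
            L = lifespan \<mu> lam \<gamma> T0 a \<rho> u P B
        in L < \<infinity> \<and>
           (\<forall>\<alpha>\<in>{1<..<2}.
              L \<le> ereal (exp (E0 *
                    ((\<bar>integral {0..r0} B0\<bar>\<^sup>2 * (2 - \<alpha>)\<^sup>2) /
                     (2 * sqrt (2 * \<mu> + lam) * C a0 E0 \<mu> lam *
                        (\<alpha> / sqrt (2 * \<alpha> - 2) + (\<alpha> + 1) / sqrt (2 * \<alpha>)))) powi (- 2)) - 1))))"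
proof (rule exI[of _ "\<lambda>a0 E0 \<mu> lam. sqrt (1 + 2 * (a0\<^sup>2 + 2 * \<bar>E0\<bar> / \<bar>2 * \<mu> + lam\<bar>))"], intro conjI allI impI)
  fix a0 E0 \<mu> lam :: real
  show "0 < sqrt (1 + 2 * (a0\<^sup>2 + 2 * \<bar>E0\<bar> / \<bar>2 * \<mu> + lam\<bar>))"
    by (simp add: add_pos_nonneg)
next
  fix \<mu> lam \<gamma> T0 a0 r0 :: real and a \<rho>0 u0 P0 B0 :: "real => real" and \<rho> u P B :: "real => real => real"
  assume par: "0 < \<mu>" "0 \<le> \<mu> + lam" "1 < \<gamma>" and "0 < a0"
    and nonneg: "\<forall>r\<in>{0..a0}. 0 \<le> \<rho>0 r \<and> 0 \<le> P0 r"
    and sol: "strong_solution \<mu> lam \<gamma> T0 a \<rho> u P B"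
    and ini: "initial_condition a0 \<rho>0 u0 P0 B0 a \<rho> u P B"
    and r0: "0 < r0" "r0 < a 0" and vac: "\<forall>r\<in>{0..r0}. \<rho>0 r = 0 \<and> P0 r = 0"
    and flux: "integral {0..r0} B0 \<noteq> 0"
  define E where "E = initial_energy \<gamma> a0 \<rho>0 u0 P0 B0"
  define C where "C = sqrt (1 + 2 * (a0\<^sup>2 + 2 * \<bar>E\<bar> / \<bar>2 * \<mu> + lam\<bar>))"
  define bound where "bound \<alpha> = exp (E * (\<bar>integral {0..r0} B0\<bar>\<^sup>2 * (2 - \<alpha>)\<^sup>2 /
    (2 * sqrt (2 * \<mu> + lam) * C * (\<alpha> / sqrt (2 * \<alpha> - 2) + (\<alpha> + 1) / sqrt (2 * \<alpha>)))) powi (- 2)) - 1" for \<alpha>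
  have \<nu>: "0 < 2 * \<mu> + lam" using par by simp
  have "0 < 1 + 2 * (a0\<^sup>2 + 2 * \<bar>E\<bar> / \<bar>2 * \<mu> + lam\<bar>)"
    by (intro add_pos_nonneg mult_nonneg_nonneg add_nonneg_nonneg divide_nonneg_nonneg) auto
  then have Csq: "C\<^sup>2 = 1 + 2 * (a0\<^sup>2 + 2 * \<bar>E\<bar> / \<bar>2 * \<mu> + lam\<bar>)" and C0: "0 < C"
    unfolding C_def by (simp_all only: real_sqrt_pow2 less_imp_le real_sqrt_gt_zero)
  have "2 * E / (2 * \<mu> + lam) \<le> 2 * \<bar>E\<bar> / \<bar>2 * \<mu> + lam\<bar>" using \<nu> by (simp add: divide_right_mono)
  then have "2 * (a0\<^sup>2 + 2 * E / (2 * \<mu> + lam)) \<le> 2 * (a0\<^sup>2 + 2 * \<bar>E\<bar> / \<bar>2 * \<mu> + lam\<bar>)"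
    by (intro mult_left_mono add_left_mono) simp_all
  then have C: "2 * (a0\<^sup>2 + 2 * E / (2 * \<mu> + lam)) \<le> C\<^sup>2" unfolding Csq by (rule order_trans) simp
  have T0: "0 < T0" using sol by (simp add: strong_solution_def)
  have a0: "a 0 = a0" using ini by (simp add: initial_condition_def)
  have L: "lifespan \<mu> lam \<gamma> T0 a \<rho> u P B \<le> ereal (bound \<alpha>)" if \<alpha>: "\<alpha> \<in> {1<..<2}" for \<alpha>
    unfolding lifespan_def
  proof (rule Sup_least)
    fix y assume "y \<in> {ereal T | T. T0 \<le> T \<and>
       (\<exists>a' \<rho>' u' P' B'. strong_solution \<mu> lam \<gamma> T a' \<rho>' u' P' B' \<and>
          (\<forall>t\<in>{0..T0}. a' t = a t \<and>
             (\<forall>r\<in>{0..a t}. \<rho>' r t = \<rho> r t \<and> u' r t = u r t \<and> P' r t = P r t \<and> B' r t = B r t)))}"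
    then obtain T a' \<rho>' u' P' B' where y: "y = ereal T" and sol': "strong_solution \<mu> lam \<gamma> T a' \<rho>' u' P' B'"
      and agree: "\<forall>t\<in>{0..T0}. a' t = a t \<and>
             (\<forall>r\<in>{0..a t}. \<rho>' r t = \<rho> r t \<and> u' r t = u r t \<and> P' r t = P r t \<and> B' r t = B r t)"
      by blast
    have "initial_condition a0 \<rho>0 u0 P0 B0 a' \<rho>' u' P' B'"
      using ini agree[rule_format, of 0] T0 unfolding initial_condition_def by simp
    from existence_time_le[OF par sol' this nonneg r0(1) _ vac flux _ _ E_def C0 C, of \<alpha>]
    have "T \<le> bound \<alpha>" using r0(2) a0 \<alpha> unfolding bound_def by simp
    then show "y \<le> ereal (bound \<alpha>)" unfolding y by simp
  qed
  have "lifespan \<mu> lam \<gamma> T0 a \<rho> u P B < \<infinity>" by (rule order.strict_trans1[OF L[of "3 / 2"]]) simp_all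
  then show "let E0 = initial_energy \<gamma> a0 \<rho>0 u0 P0 B0;
            L = lifespan \<mu> lam \<gamma> T0 a \<rho> u P B
        in L < \<infinity> \<and>
           (\<forall>\<alpha>\<in>{1<..<2}.
              L \<le> ereal (exp (E0 *
                    ((\<bar>integral {0..r0} B0\<bar>\<^sup>2 * (2 - \<alpha>)\<^sup>2) /
                     (2 * sqrt (2 * \<mu> + lam) * sqrt (1 + 2 * (a0\<^sup>2 + 2 * \<bar>E0\<bar> / \<bar>2 * \<mu> + lam\<bar>)) *
                        (\<alpha> / sqrt (2 * \<alpha> - 2) + (\<alpha> + 1) / sqrt (2 * \<alpha>)))) powi (- 2)) - 1))"
    using L unfolding bound_def C_def E_def Let_def by blast
qed

end
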